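(* (Rigidity of super vector bundles) Let $\mathcal{P}$ be a small algebra, $\mathcal{M}$ a $\mathcal{P}$-supermanifold and $\mathcal{E}$ a $\mathcal{P}$-super vector bundle on $\mathcal{M}$. Then there exists an isomorphism $\varphi:\mathcal{E}^{\#'}\to\mathcal{E}$ of $\mathcal{P}$-super vector bundles with $\varphi^{\#'}=\mathrm{id}_{\mathcal{E}^{\#'}}$.
   Context: A small algebra is a finite-dimensional real unital $\mathbb{Z}_2$-graded commutative algebra $\mathcal{P}$ with a unital algebra projection ${}^{\#'}:\mathcal{P}\to\mathbb{R}$ whose kernel is the largest ideal of $\mathcal{P}$ and is nilpotent. $\boxtimes$ is the graded tensor product. A $\mathcal{P}$-supermanifold of super dimension $(m,n)$ is a ringed space $\mathcal{M}=(M,\mathcal{C}^\infty_{\mathcal{M}})$, where $M$ is a smooth $m$-manifold and $\mathcal{C}^\infty_{\mathcal{M}}$ is a sheaf of unital graded $\mathcal{P}$-algebras locally isomorphic to $\mathcal{P}\boxtimes(\mathcal{C}^\infty_M\otimes\bigwedge\mathbb{R}^n)$. Its relative body is the ordinary supermanifold $\mathcal{M}^{\#'}:=(M,\mathbb{R}\boxtimes_{\mathcal{P}}\mathcal{C}^\infty_{\mathcal{M}})$ ($\mathbb{R}$ a $\mathcal{P}$-module via ${}^{\#'}$). Every $\mathcal{P}$-supermanifold $\mathcal M$ is $\mathcal{P}$-superdiffeomorphic, by a $\mathcal{P}$-superdiffeomorphism with relative body the identity, to $(M,\mathcal{P}\boxtimes\mathcal{C}^\infty_{\mathcal{M}^{\#'}})$,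 and $\mathcal{M}$ is identified with the latter. A $\mathcal{P}$-super vector bundle on $\mathcal{M}$ of super rank $(p,q)$ is a sheaf $\mathcal{E}$ of graded $\mathcal{C}^\infty_{\mathcal{M}}$-modules locally isomorphic to $(\mathcal{C}^\infty_{\mathcal{M}})^{p|q}$ (the free module with $p$ even and $q$ odd generators). $\mathcal{E}^{\#'}:=\mathcal{C}^\infty_{\mathcal{M}^{\#'}}\boxtimes_{\mathcal{C}^\infty_{\mathcal{M}}}\mathcal{E}$ is a super vector bundle on $\mathcal{M}^{\#'}$, and $\varphi^{\#'}$ is the induced homomorphism for an (even) homomorphism $\varphi$. In the theorem $\mathcal{E}^{\#'}$ is regarded as a $\mathcal{P}$-super vector bundle on $\mathcal{M}$ by extension of scalars to $\mathcal{P}$ (i.e. as $\mathcal{P}\boxtimes\mathcal{E}^{\#'}$). *)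

theory Defs
  imports
    "HOL-Analysis.Abstract_Euclidean_Space"
    "HOL-Analysis.Abstract_Topological_Spaces"
    "HOL-Algebra.Module"
    "HOL-Algebra.RingHom"
    "HOL-Algebra.Generated_Groups"
    "HOL-Algebra.Free_Abelian_Groups"
    "HOL-Library.Z2"
begin

section \<open>Graded rings, modules and algebras\<close>

text \<open>
  A \<^typ>\<open>('r, 'a) module\<close> record together with its even part (\<open>grade M 0\<close>) and its odd part
  (\<open>grade M 1\<close>). As in \<^theory>\<open>HOL-Algebra.Module\<close>, the fields \<open>mult\<close> and \<open>one\<close> are
  meaningless when the record is used as a module only, and \<open>smult\<close> is meaningless when it is
  used as a ring only.
\<close>

record ('r, 'a) gmodule = "('r, 'a) module" +
  grade :: "bit \<Rightarrow> 'a set"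

definition graded :: "('r, 'a) gmodule \<Rightarrow> bool" where
  "graded M \<longleftrightarrow>
     (\<forall>i. additive_subgroup (grade M i) M) \<and>
     (\<forall>x\<in>carrier M. \<exists>!y. fst y \<in> grade M 0 \<and> snd y \<in> grade M 1 \<and> x = fst y \<oplus>\<^bsub>M\<^esub> snd y)"

definition hcomp :: "('r, 'a) gmodule \<Rightarrow> bit \<Rightarrow> 'a \<Rightarrow> 'a" where
  "hcomp M i x = (THE y. y \<in> grade M i \<and> (\<exists>z\<in>grade M (i + 1). x = y \<oplus>\<^bsub>M\<^esub> z))"

text \<open>The Koszul sign \<open>(-1)\<^sup>i\<^sup>j\<close>, acting on a module and as an integer.\<close>

definition koszul :: "('r, 'a) gmodule \<Rightarrow> bit \<Rightarrow> bit \<Rightarrow> 'a \<Rightarrow> 'a" where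
  "koszul M i j x = (if i = 1 \<and> j = 1 then \<ominus>\<^bsub>M\<^esub> x else x)"

definition koszul_int :: "bit \<Rightarrow> bit \<Rightarrow> int" where
  "koszul_int i j = (if i = 1 \<and> j = 1 then -1 else 1)"

locale superring = ring R for R :: "('k, 'r) gmodule" (structure) +
  assumes graded: "graded R"
    and one_even: "\<one> \<in> grade R 0"
    and grade_mult: "\<lbrakk>x \<in> grade R i; y \<in> grade R j\<rbrakk> \<Longrightarrow> x \<otimes> y \<in> grade R (i + j)"
    and supercommutative:
      "\<lbrakk>x \<in> grade R i; y \<in> grade R j\<rbrakk> \<Longrightarrow> x \<otimes> y = koszul R i j (y \<otimes> x)"

text \<open>
  Modules over a superring \<open>R\<close> are left modules; the corresponding right action is
  \<open>x r = (-1)\<^bsup>|x||r|\<^esup> r x\<close>.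
\<close>

locale supermodule = R?: superring R + M?: abelian_group M
  for R :: "('k, 'r) gmodule" and M :: "('r, 'a) gmodule" (structure) +
  assumes module_graded: "graded M"
    and smult_closed: "\<lbrakk>r \<in> carrier R; x \<in> carrier M\<rbrakk> \<Longrightarrow> r \<odot> x \<in> carrier M"
    and smult_l_distr: "\<lbrakk>r \<in> carrier R; s \<in> carrier R; x \<in> carrier M\<rbrakk> \<Longrightarrow>
          (r \<oplus>\<^bsub>R\<^esub> s) \<odot> x = r \<odot> x \<oplus> s \<odot> x"
    and smult_r_distr: "\<lbrakk>r \<in> carrier R; x \<in> carrier M; y \<in> carrier M\<rbrakk> \<Longrightarrow>
          r \<odot> (x \<oplus> y) = r \<odot> x \<oplus> r \<odot> y"
    and smult_assoc: "\<lbrakk>r \<in> carrier R; s \<in> carrier R; x \<in> carrier M\<rbrakk> \<Longrightarrow>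
          (r \<otimes>\<^bsub>R\<^esub> s) \<odot> x = r \<odot> (s \<odot> x)"
    and smult_one: "x \<in> carrier M \<Longrightarrow> \<one>\<^bsub>R\<^esub> \<odot> x = x"
    and grade_smult: "\<lbrakk>r \<in> grade R i; x \<in> grade M j\<rbrakk> \<Longrightarrow> r \<odot> x \<in> grade M (i + j)"

locale superalgebra = supermodule P A + A?: superring A
  for P :: "('k, 'p) gmodule" and A :: "('p, 'a) gmodule" (structure) +
  assumes smult_mult_l: "\<lbrakk>p \<in> carrier P; x \<in> carrier A; y \<in> carrier A\<rbrakk> \<Longrightarrow>
          (p \<odot> x) \<otimes> y = p \<odot> (x \<otimes> y)"
    and smult_mult_r: "\<lbrakk>p \<in> grade P i; x \<in> grade A j; y \<in> carrier A\<rbrakk> \<Longrightarrow>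
          x \<otimes> (p \<odot> y) = koszul A i j (p \<odot> (x \<otimes> y))"

definition module_hom :: "('k, 'r) gmodule \<Rightarrow> ('r, 'a) gmodule \<Rightarrow> ('r, 'b) gmodule \<Rightarrow>
    ('a \<Rightarrow> 'b) \<Rightarrow> bool" where
  "module_hom R M N h \<longleftrightarrow>
     h \<in> carrier M \<rightarrow> carrier N \<and>
     (\<forall>x\<in>carrier M. \<forall>y\<in>carrier M. h (x \<oplus>\<^bsub>M\<^esub> y) = h x \<oplus>\<^bsub>N\<^esub> h y) \<and>
     (\<forall>r\<in>carrier R. \<forall>x\<in>carrier M. h (r \<odot>\<^bsub>M\<^esub> x) = r \<odot>\<^bsub>N\<^esub> h x) \<and>
     (\<forall>i. h ` grade M i \<subseteq> grade N i)"

definition algebra_hom :: "('k, 'r) gmodule \<Rightarrow> ('r, 'a) gmodule \<Rightarrow> ('r, 'b) gmodule \<Rightarrow>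
    ('a \<Rightarrow> 'b) \<Rightarrow> bool" where
  "algebra_hom R A B h \<longleftrightarrow> module_hom R A B h \<and> h \<in> ring_hom A B"

definition real_alg :: "(real, real) gmodule" where
  "real_alg = \<lparr>carrier = UNIV, monoid.mult = (*), one = 1, ring.zero = 0, add = (+), smult = (*),
     grade = (\<lambda>i. if i = 0 then UNIV else {0})\<rparr>"

text \<open>\<open>pr\<close> is the projection onto the reals.\<close>

definition small_algebra :: "(real, 'p) gmodule \<Rightarrow> ('p \<Rightarrow> real) \<Rightarrow> bool" where
  "small_algebra P pr \<longleftrightarrow>
     superalgebra real_alg P \<and>
     (\<exists>B. finite B \<and> B \<subseteq> carrier P \<and>
        (\<forall>x\<in>carrier P. \<exists>c. x = (\<Oplus>\<^bsub>P\<^esub>b\<in>B. c b \<odot>\<^bsub>P\<^esub> b))) \<and>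
     pr \<in> ring_hom P real_alg \<and>
     (\<forall>c. \<forall>x\<in>carrier P. pr (c \<odot>\<^bsub>P\<^esub> x) = c * pr x) \<and>
     (\<forall>J. ideal J P \<and> J \<noteq> carrier P \<longrightarrow> J \<subseteq> a_kernel P real_alg pr) \<and>
     (\<exists>k. \<forall>xs. length xs = k \<and> set xs \<subseteq> a_kernel P real_alg pr \<longrightarrow>
        foldr (\<otimes>\<^bsub>P\<^esub>) xs \<one>\<^bsub>P\<^esub> = \<zero>\<^bsub>P\<^esub>)"


section \<open>Graded tensor products\<close>

text \<open>
  The tensor product of two modules over a superring \<open>R\<close> is the free abelian group on
  \<open>A \<times> B\<close> modulo biadditivity and \<open>a r \<otimes> b = a \<otimes> r b\<close>, where \<open>a r = (-1)\<^bsup>|a||r|\<^esup> r a\<close>.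
\<close>

type_synonym ('a, 'b) tensor = "('a \<times> 'b \<Rightarrow>\<^sub>0 int) set"

definition tensor_free ::
    "('r, 'a) gmodule \<Rightarrow> ('r, 'b) gmodule \<Rightarrow> ('a \<times> 'b \<Rightarrow>\<^sub>0 int) monoid" where
  "tensor_free A B = free_Abelian_group (carrier A \<times> carrier B)"

definition tensor_rels ::
    "('k, 'r) gmodule \<Rightarrow> ('r, 'a) gmodule \<Rightarrow> ('r, 'b) gmodule \<Rightarrow> ('a \<times> 'b \<Rightarrow>\<^sub>0 int) set" where
  "tensor_rels R A B =
     {frag_of (a \<oplus>\<^bsub>A\<^esub> a', b) - frag_of (a, b) - frag_of (a', b) | a a' b.
        a \<in> carrier A \<and> a' \<in> carrier A \<and> b \<in> carrier B} \<union>
     {frag_of (a, b \<oplus>\<^bsub>B\<^esub> b') - frag_of (a, b) - frag_of (a, b') | a b b'.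
        a \<in> carrier A \<and> b \<in> carrier B \<and> b' \<in> carrier B} \<union>
     {frag_of (koszul A i j (r \<odot>\<^bsub>A\<^esub> a), b) - frag_of (a, r \<odot>\<^bsub>B\<^esub> b) | i j a r b.
        a \<in> grade A i \<and> r \<in> grade R j \<and> b \<in> carrier B}"

definition tensor_null ::
    "('k, 'r) gmodule \<Rightarrow> ('r, 'a) gmodule \<Rightarrow> ('r, 'b) gmodule \<Rightarrow> ('a \<times> 'b \<Rightarrow>\<^sub>0 int) set" where
  "tensor_null R A B = generate (tensor_free A B) (tensor_rels R A B)"

definition tensor_class ::
    "('k, 'r) gmodule \<Rightarrow> ('r, 'a) gmodule \<Rightarrow> ('r, 'b) gmodule \<Rightarrow>
     ('a \<times> 'b \<Rightarrow>\<^sub>0 int) \<Rightarrow> ('a, 'b) tensor" where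
  "tensor_class R A B f = tensor_null R A B #>\<^bsub>tensor_free A B\<^esub> f"

definition pure_tensor ::
    "('k, 'r) gmodule \<Rightarrow> ('r, 'a) gmodule \<Rightarrow> ('r, 'b) gmodule \<Rightarrow> 'a \<Rightarrow> 'b \<Rightarrow> ('a, 'b) tensor" where
  "pure_tensor R A B a b = tensor_class R A B (frag_of (a, b))"

text \<open>
  The map \<open>g \<otimes> h\<close> into the tensor product of \<open>A\<close> and \<open>B\<close>, for even \<open>g\<close> and \<open>h\<close>. It is computed on
  all representatives of a class; when \<open>g \<otimes> h\<close> is well defined the union is a single class.
\<close>

definition tensor_map ::
    "('k, 'r) gmodule \<Rightarrow> ('r, 'a) gmodule \<Rightarrow> ('r, 'b) gmodule \<Rightarrow>
     ('c \<Rightarrow> 'a) \<Rightarrow> ('d \<Rightarrow> 'b) \<Rightarrow> ('c, 'd) tensor \<Rightarrow> ('a, 'b) tensor" where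
  "tensor_map R A B g h X =
     (\<Union>f\<in>X. tensor_class R A B (frag_extend (\<lambda>(c, d). frag_of (g c, h d)) f))"

text \<open>
  The product \<open>(c \<otimes> d) (a \<otimes> b) = (-1)\<^bsup>|d||a|\<^esup> \<mu> c a \<otimes> \<nu> d b\<close> with values in the tensor product
  of \<open>A\<close> and \<open>B\<close>, where \<open>c \<otimes> d\<close> lies in a tensor product with second factor \<open>D\<close>, and \<open>\<mu>\<close> and \<open>\<nu>\<close>
  are multiplications or module actions. Again it is computed on representatives.
\<close>

definition tensor_prod ::
    "('k, 'r) gmodule \<Rightarrow> ('r, 'a) gmodule \<Rightarrow> ('r, 'b) gmodule \<Rightarrow> ('s, 'd) gmodule \<Rightarrow>
     ('c \<Rightarrow> 'a \<Rightarrow> 'a) \<Rightarrow> ('d \<Rightarrow> 'b \<Rightarrow> 'b) \<Rightarrow> ('c, 'd) tensor \<Rightarrow> ('a, 'b) tensor \<Rightarrow> ('a, 'b) tensor"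
  where
  "tensor_prod R A B D \<mu> \<nu> X Y =
     (\<Union>f\<in>X. \<Union>g\<in>Y. tensor_class R A B
        (frag_extend (\<lambda>(c, d). frag_extend (\<lambda>(a, b).
            \<Sum>i\<in>UNIV. \<Sum>j\<in>UNIV. frag_cmul (koszul_int j i)
              (frag_of (\<mu> c (hcomp A i a), \<nu> (hcomp D j d) b))) g) f))"

text \<open>
  The scalar action on a tensor product depends on the situation and is a parameter. The
  multiplication and the unit are meaningful if both \<open>A\<close> and \<open>B\<close> are superalgebras.
\<close>

definition tensor ::
    "('k, 'r) gmodule \<Rightarrow> ('r, 'a) gmodule \<Rightarrow> ('r, 'b) gmodule \<Rightarrow>
     ('s \<Rightarrow> ('a, 'b) tensor \<Rightarrow> ('a, 'b) tensor) \<Rightarrow> ('s, ('a, 'b) tensor) gmodule" where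
  "tensor R A B act =
     \<lparr>carrier = carrier (tensor_free A B Mod tensor_null R A B),
      monoid.mult = tensor_prod R A B B (\<otimes>\<^bsub>A\<^esub>) (\<otimes>\<^bsub>B\<^esub>),
      one = pure_tensor R A B \<one>\<^bsub>A\<^esub> \<one>\<^bsub>B\<^esub>,
      ring.zero = \<one>\<^bsub>tensor_free A B Mod tensor_null R A B\<^esub>,
      add = monoid.mult (tensor_free A B Mod tensor_null R A B),
      smult = act,
      grade = (\<lambda>k. tensor_class R A B ` generate (tensor_free A B)
                 {frag_of (a, b) | a b i j. a \<in> grade A i \<and> b \<in> grade B j \<and> i + j = k})\<rparr>"

text \<open>The tensor product with scalars acting on the left factor by \<open>act\<close>.\<close>

definition left_tensor ::
    "('k, 'r) gmodule \<Rightarrow> ('r, 'a) gmodule \<Rightarrow> ('r, 'b) gmodule \<Rightarrow> ('s \<Rightarrow> 'a \<Rightarrow> 'a) \<Rightarrow>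
     ('s, ('a, 'b) tensor) gmodule" where
  "left_tensor R A B act = tensor R A B (\<lambda>s. tensor_map R A B (act s) id)"


section \<open>Sheaves of graded modules and algebras\<close>

record ('x, 'r, 'a) gsheaf =
  sec :: "'x set \<Rightarrow> ('r, 'a) gmodule"
  res :: "'x set \<Rightarrow> 'x set \<Rightarrow> 'a \<Rightarrow> 'a"

text \<open>\<open>res F U V\<close> restricts sections over \<open>U\<close> to \<open>V \<subseteq> U\<close>.\<close>

definition sheaf :: "'x topology \<Rightarrow> ('x, 'r, 'a) gsheaf \<Rightarrow> bool" where
  "sheaf T F \<longleftrightarrow>
     (\<forall>U V. openin T U \<and> openin T V \<and> V \<subseteq> U \<longrightarrow>
        res F U V \<in> carrier (sec F U) \<rightarrow> carrier (sec F V)) \<and>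
     (\<forall>U. openin T U \<longrightarrow> (\<forall>x\<in>carrier (sec F U). res F U U x = x)) \<and>
     (\<forall>U V W. openin T U \<and> openin T V \<and> openin T W \<and> W \<subseteq> V \<and> V \<subseteq> U \<longrightarrow>
        (\<forall>x\<in>carrier (sec F U). res F V W (res F U V x) = res F U W x)) \<and>
     (\<forall>\<U>. (\<forall>V\<in>\<U>. openin T V) \<longrightarrow>
        (\<forall>s. (\<forall>V\<in>\<U>. s V \<in> carrier (sec F V)) \<and>
             (\<forall>V\<in>\<U>. \<forall>W\<in>\<U>. res F V (V \<inter> W) (s V) = res F W (V \<inter> W) (s W)) \<longrightarrow>
             (\<exists>!x. x \<in> carrier (sec F (\<Union>\<U>)) \<and> (\<forall>V\<in>\<U>. res F (\<Union>\<U>) V x = s V))))"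

definition algebra_sheaf ::
    "'x topology \<Rightarrow> ('k, 'p) gmodule \<Rightarrow> ('x, 'p, 'a) gsheaf \<Rightarrow> bool" where
  "algebra_sheaf T P F \<longleftrightarrow>
     sheaf T F \<and>
     (\<forall>U. openin T U \<longrightarrow> superalgebra P (sec F U)) \<and>
     (\<forall>U V. openin T U \<and> openin T V \<and> V \<subseteq> U \<longrightarrow> algebra_hom P (sec F U) (sec F V) (res F U V))"

definition module_sheaf ::
    "'x topology \<Rightarrow> ('x, 'p, 'a) gsheaf \<Rightarrow> ('x, 'a, 'e) gsheaf \<Rightarrow> bool" where
  "module_sheaf T \<O> E \<longleftrightarrow>
     sheaf T E \<and>
     (\<forall>U. openin T U \<longrightarrow> supermodule (sec \<O> U) (sec E U)) \<and>
     (\<forall>U V. openin T U \<and> openin T V \<and> V \<subseteq> U \<longrightarrow>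
        (\<forall>x\<in>carrier (sec E U). \<forall>y\<in>carrier (sec E U).
           res E U V (x \<oplus>\<^bsub>sec E U\<^esub> y) = res E U V x \<oplus>\<^bsub>sec E V\<^esub> res E U V y) \<and>
        (\<forall>f\<in>carrier (sec \<O> U). \<forall>x\<in>carrier (sec E U).
           res E U V (f \<odot>\<^bsub>sec E U\<^esub> x) = res \<O> U V f \<odot>\<^bsub>sec E V\<^esub> res E U V x) \<and>
        (\<forall>i. res E U V ` grade (sec E U) i \<subseteq> grade (sec E V) i))"

text \<open>Isomorphisms of the restrictions of two sheaves to an open set \<open>U\<close>.\<close>

definition commutes_with_res :: "'x topology \<Rightarrow> 'x set \<Rightarrow> ('x, 'r, 'a) gsheaf \<Rightarrow>
    ('x, 's, 'b) gsheaf \<Rightarrow> ('x set \<Rightarrow> 'a \<Rightarrow> 'b) \<Rightarrow> bool" where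
  "commutes_with_res T U F G \<psi> \<longleftrightarrow>
     (\<forall>V W. openin T V \<and> openin T W \<and> W \<subseteq> V \<and> V \<subseteq> U \<longrightarrow>
        (\<forall>x\<in>carrier (sec F V). \<psi> W (res F V W x) = res G V W (\<psi> V x)))"

definition algebra_sheaf_iso :: "'x topology \<Rightarrow> 'x set \<Rightarrow> ('k, 'p) gmodule \<Rightarrow>
    ('x, 'p, 'a) gsheaf \<Rightarrow> ('x, 'p, 'b) gsheaf \<Rightarrow> ('x set \<Rightarrow> 'a \<Rightarrow> 'b) \<Rightarrow> bool" where
  "algebra_sheaf_iso T U P F G \<psi> \<longleftrightarrow>
     commutes_with_res T U F G \<psi> \<and>
     (\<forall>V. openin T V \<and> V \<subseteq> U \<longrightarrow>
        algebra_hom P (sec F V) (sec G V) (\<psi> V) \<and>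
        bij_betw (\<psi> V) (carrier (sec F V)) (carrier (sec G V)))"

definition module_sheaf_iso :: "'x topology \<Rightarrow> 'x set \<Rightarrow> ('x, 'p, 'r) gsheaf \<Rightarrow>
    ('x, 'r, 'a) gsheaf \<Rightarrow> ('x, 'r, 'b) gsheaf \<Rightarrow> ('x set \<Rightarrow> 'a \<Rightarrow> 'b) \<Rightarrow> bool" where
  "module_sheaf_iso T U \<O> F G \<psi> \<longleftrightarrow>
     commutes_with_res T U F G \<psi> \<and>
     (\<forall>V. openin T V \<and> V \<subseteq> U \<longrightarrow>
        module_hom (sec \<O> V) (sec F V) (sec G V) (\<psi> V) \<and>
        bij_betw (\<psi> V) (carrier (sec F V)) (carrier (sec G V)))"


section \<open>Smooth manifolds\<close>

text \<open>
  \<open>C_k m k S f\<close>: on the open subset \<open>S\<close> of \<^term>\<open>Euclidean_space m\<close> (that is,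
  \<open>m\<close>-dimensional Euclidean space, with \<open>m = 0\<close> allowed) all iterated partial derivatives of \<open>f\<close> of
  order at most \<open>k\<close> exist and are continuous.
\<close>

primrec C_k :: "nat \<Rightarrow> nat \<Rightarrow> (nat \<Rightarrow> real) set \<Rightarrow> ((nat \<Rightarrow> real) \<Rightarrow> real) \<Rightarrow> bool" where
  "C_k m 0 S f \<longleftrightarrow> continuous_map (subtopology (Euclidean_space m) S) euclideanreal f"
| "C_k m (Suc k) S f \<longleftrightarrow>
     continuous_map (subtopology (Euclidean_space m) S) euclideanreal f \<and>
     (\<forall>i<m. \<exists>g. (\<forall>x\<in>S. ((\<lambda>t. f (x(i := t))) has_real_derivative g x) (at (x i))) \<and> C_k m k S g)"

definition smooth :: "nat \<Rightarrow> (nat \<Rightarrow> real) set \<Rightarrow> ((nat \<Rightarrow> real) \<Rightarrow> real) \<Rightarrow> bool" where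
  "smooth m S f \<longleftrightarrow> (\<forall>k. C_k m k S f)"

type_synonym 'x chart = "'x set \<times> ('x \<Rightarrow> nat \<Rightarrow> real)"

definition smooth_manifold :: "nat \<Rightarrow> 'x topology \<Rightarrow> 'x chart set \<Rightarrow> bool" where
  "smooth_manifold m T \<A> \<longleftrightarrow>
     Hausdorff_space T \<and> second_countable T \<and>
     (\<forall>(U, c)\<in>\<A>. openin T U \<and> openin (Euclidean_space m) (c ` U) \<and>
        homeomorphic_map (subtopology T U) (subtopology (Euclidean_space m) (c ` U)) c) \<and>
     (\<Union>(U, c)\<in>\<A>. U) = topspace T \<and>
     (\<forall>(U, c)\<in>\<A>. \<forall>(V, d)\<in>\<A>. \<forall>i<m. smooth m (c ` (U \<inter> V)) (\<lambda>y. d (inv_into U c y) i))"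

definition smooth_function :: "nat \<Rightarrow> 'x chart set \<Rightarrow> 'x set \<Rightarrow> ('x \<Rightarrow> real) \<Rightarrow> bool" where
  "smooth_function m \<A> U f \<longleftrightarrow>
     (\<forall>(V, c)\<in>\<A>. smooth m (c ` (U \<inter> V)) (\<lambda>y. f (inv_into V c y)))"

definition smooth_sheaf ::
    "nat \<Rightarrow> 'x chart set \<Rightarrow> ('x, real, 'x \<Rightarrow> real) gsheaf" where
  "smooth_sheaf m \<A> =
     \<lparr>sec = (\<lambda>U.
        \<lparr>carrier = {f \<in> extensional U. smooth_function m \<A> U f},
         monoid.mult = (\<lambda>f g. \<lambda>x\<in>U. f x * g x), one = (\<lambda>x\<in>U. 1),
         ring.zero = (\<lambda>x\<in>U. 0), add = (\<lambda>f g. \<lambda>x\<in>U. f x + g x),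
         smult = (\<lambda>r f. \<lambda>x\<in>U. r * f x),
         grade = (\<lambda>i. if i = 0 then {f \<in> extensional U. smooth_function m \<A> U f}
                      else {\<lambda>x\<in>U. 0})\<rparr>),
      res = (\<lambda>U V f. restrict f V)\<rparr>"


section \<open>Supermanifolds over a small algebra\<close>

text \<open>
  The exterior algebra of \<open>n\<close>-dimensional real space in the standard basis: \<open>f I\<close> is the coefficient
  of \<open>e\<^sub>I = e\<^bsub>i\<^sub>1\<^esub> \<and> \<dots> \<and> e\<^bsub>i\<^sub>k\<^esub>\<close> for \<open>I = {i\<^sub>1 < \<dots> < i\<^sub>k}\<close>, and \<open>e\<^sub>I \<and> e\<^sub>J = (-1)\<^sup>\<nu> e\<^bsub>I \<union> J\<^esub>\<close> for disjoint
  \<open>I\<close> and \<open>J\<close>, where \<open>\<nu>\<close> is the number of pairs \<open>(i, j) \<in> I \<times> J\<close> with \<open>j < i\<close>.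
\<close>

definition exterior_alg :: "nat \<Rightarrow> (real, nat set \<Rightarrow> real) gmodule" where
  "exterior_alg n =
     \<lparr>carrier = {f. \<forall>I. \<not> I \<subseteq> {..<n} \<longrightarrow> f I = 0},
      monoid.mult = (\<lambda>f g K. \<Sum>I\<in>Pow K.
         (-1) ^ card {(i, j). i \<in> I \<and> j \<in> K - I \<and> j < i} * f I * g (K - I)),
      one = (\<lambda>I. if I = {} then 1 else 0),
      ring.zero = (\<lambda>I. 0), add = (\<lambda>f g I. f I + g I), smult = (\<lambda>r f I. r * f I),
      grade = (\<lambda>k. {f. \<forall>I. \<not> (I \<subseteq> {..<n} \<and> of_nat (card I) = k) \<longrightarrow> f I = 0})\<rparr>"

text \<open>The extension of scalars from the reals to \<open>P\<close> of a sheaf of real superalgebras.\<close>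

definition extend_alg ::
    "(real, 'p) gmodule \<Rightarrow> ('x, real, 'a) gsheaf \<Rightarrow> ('x, 'p, ('p, 'a) tensor) gsheaf" where
  "extend_alg P F =
     \<lparr>sec = (\<lambda>U. left_tensor real_alg P (sec F U) (\<otimes>\<^bsub>P\<^esub>)),
      res = (\<lambda>U V. tensor_map real_alg P (sec F V) id (res F U V))\<rparr>"

definition split_sheaf ::
    "nat \<Rightarrow> nat \<Rightarrow> 'x chart set \<Rightarrow> ('x, real, ('x \<Rightarrow> real, nat set \<Rightarrow> real) tensor) gsheaf" where
  "split_sheaf m n \<A> =
     \<lparr>sec = (\<lambda>U. left_tensor real_alg (sec (smooth_sheaf m \<A>) U) (exterior_alg n)
               (smult (sec (smooth_sheaf m \<A>) U))),
      res = (\<lambda>U V. tensor_map real_alg (sec (smooth_sheaf m \<A>) V) (exterior_alg n)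
               (res (smooth_sheaf m \<A>) U V) id)\<rparr>"

definition supermanifold :: "(real, 'p) gmodule \<Rightarrow> nat \<Rightarrow> nat \<Rightarrow> 'x topology \<Rightarrow>
    'x chart set \<Rightarrow> ('x, 'p, 'o) gsheaf \<Rightarrow> bool" where
  "supermanifold P m n T \<A> \<O> \<longleftrightarrow>
     smooth_manifold m T \<A> \<and>
     algebra_sheaf T P \<O> \<and>
     (\<forall>x\<in>topspace T. \<exists>U. openin T U \<and> x \<in> U \<and>
        (\<exists>\<psi>. algebra_sheaf_iso T U P \<O> (extend_alg P (split_sheaf m n \<A>)) \<psi>))"

text \<open>The reals as a \<open>P\<close>-module.\<close>

definition real_over :: "('p \<Rightarrow> real) \<Rightarrow> ('p, real) gmodule" where
  "real_over pr = \<lparr>carrier = UNIV, monoid.mult = (*), one = 1, ring.zero = 0, add = (+),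
     smult = (\<lambda>p x. pr p * x), grade = grade real_alg\<rparr>"

text \<open>The structure sheaf of the relative body; the tensor products are taken section by section.\<close>

definition body :: "(real, 'p) gmodule \<Rightarrow> ('p \<Rightarrow> real) \<Rightarrow> ('x, 'p, 'o) gsheaf \<Rightarrow>
    ('x, real, (real, 'o) tensor) gsheaf" where
  "body P pr \<O> =
     \<lparr>sec = (\<lambda>U. left_tensor P (real_over pr) (sec \<O> U) (*)),
      res = (\<lambda>U V. tensor_map P (real_over pr) (sec \<O> V) id (res \<O> U V))\<rparr>"

definition body_map :: "(real, 'p) gmodule \<Rightarrow> ('p \<Rightarrow> real) \<Rightarrow> ('x, 'p, 'b) gsheaf \<Rightarrow>
    ('x set \<Rightarrow> 'a \<Rightarrow> 'b) \<Rightarrow> 'x set \<Rightarrow> (real, 'a) tensor \<Rightarrow> (real, 'b) tensor" where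
  "body_map P pr G \<psi> U = tensor_map P (real_over pr) (sec G U) id (\<psi> U)"

text \<open>
  An identification of \<open>\<M> = (M, \<O>)\<close> with the extension of scalars of its relative body: a
  \<open>P\<close>-superdiffeomorphism over the identity of \<open>M\<close> whose relative body is the identity. For the
  latter, the relative body of the extension of scalars of the sheaf \<open>body P pr \<O>\<close> is identified
  with that sheaf by \<open>f \<mapsto> 1 \<otimes> (1 \<otimes> f)\<close>.
\<close>

definition body_identification :: "(real, 'p) gmodule \<Rightarrow> ('p \<Rightarrow> real) \<Rightarrow> 'x topology \<Rightarrow>
    ('x, 'p, 'o) gsheaf \<Rightarrow> ('x set \<Rightarrow> 'o \<Rightarrow> ('p, (real, 'o) tensor) tensor) \<Rightarrow> bool" where
  "body_identification P pr T \<O> \<kappa> \<longleftrightarrow>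
     algebra_sheaf_iso T (topspace T) P \<O> (extend_alg P (body P pr \<O>)) \<kappa> \<and>
     (\<forall>U. openin T U \<longrightarrow> (\<forall>f\<in>carrier (sec (body P pr \<O>) U).
        body_map P pr (extend_alg P (body P pr \<O>)) \<kappa> U f =
        pure_tensor P (real_over pr) (sec (extend_alg P (body P pr \<O>)) U) 1
          (pure_tensor real_alg P (sec (body P pr \<O>) U) \<one>\<^bsub>P\<^esub> f)))"


section \<open>Super vector bundles\<close>

text \<open>
  The free module with \<open>p\<close> even and \<open>q\<close> odd generators \<open>e\<^sub>0, \<dots>, e\<^bsub>p+q-1\<^esub>\<close>; the function \<open>v\<close> stands
  for \<open>v\<^sub>0 e\<^sub>0 + \<dots>\<close>, with left coefficients. Multiplication and unit are irrelevant.
\<close>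

definition free_module :: "nat \<Rightarrow> nat \<Rightarrow> ('r, 'a) gmodule \<Rightarrow> ('a, nat \<Rightarrow> 'a) gmodule" where
  "free_module p q R =
     \<lparr>carrier = {..<p + q} \<rightarrow>\<^sub>E carrier R, monoid.mult = undefined, one = undefined,
      ring.zero = (\<lambda>k\<in>{..<p + q}. \<zero>\<^bsub>R\<^esub>),
      add = (\<lambda>v w. \<lambda>k\<in>{..<p + q}. v k \<oplus>\<^bsub>R\<^esub> w k),
      smult = (\<lambda>r v. \<lambda>k\<in>{..<p + q}. r \<otimes>\<^bsub>R\<^esub> v k),
      grade = (\<lambda>i. \<Pi>\<^sub>E k\<in>{..<p + q}. grade R (if k < p then i else i + 1))\<rparr>"

definition free_sheaf ::
    "nat \<Rightarrow> nat \<Rightarrow> ('x, 'r, 'a) gsheaf \<Rightarrow> ('x, 'a, nat \<Rightarrow> 'a) gsheaf" where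
  "free_sheaf p q \<O> =
     \<lparr>sec = (\<lambda>U. free_module p q (sec \<O> U)),
      res = (\<lambda>U V v. \<lambda>k\<in>{..<p + q}. res \<O> U V (v k))\<rparr>"

definition super_vector_bundle :: "nat \<Rightarrow> nat \<Rightarrow> 'x topology \<Rightarrow> ('x, 'p, 'o) gsheaf \<Rightarrow>
    ('x, 'o, 'e) gsheaf \<Rightarrow> bool" where
  "super_vector_bundle p q T \<O> E \<longleftrightarrow>
     module_sheaf T \<O> E \<and>
     (\<forall>x\<in>topspace T. \<exists>U. openin T U \<and> x \<in> U \<and>
        (\<exists>\<psi>. module_sheaf_iso T U \<O> E (free_sheaf p q \<O>) \<psi>))"

definition svb_iso :: "nat \<Rightarrow> nat \<Rightarrow> 'x topology \<Rightarrow> ('x, 'p, 'o) gsheaf \<Rightarrow>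
    ('x, 'o, 'e) gsheaf \<Rightarrow> ('x, 'o, 'f) gsheaf \<Rightarrow> ('x set \<Rightarrow> 'e \<Rightarrow> 'f) \<Rightarrow> bool" where
  "svb_iso p q T \<O> E F \<phi> \<longleftrightarrow>
     super_vector_bundle p q T \<O> E \<and> super_vector_bundle p q T \<O> F \<and>
     module_sheaf_iso T (topspace T) \<O> E F \<phi>"

text \<open>The algebra of sections of the body as a module over the algebra of sections of \<open>\<O>\<close>.\<close>

definition body_over :: "(real, 'p) gmodule \<Rightarrow> ('p \<Rightarrow> real) \<Rightarrow> ('x, 'p, 'o) gsheaf \<Rightarrow> 'x set \<Rightarrow>
    ('o, (real, 'o) tensor) gmodule" where
  "body_over P pr \<O> U = (let B = sec (body P pr \<O>) U in
     \<lparr>carrier = carrier B, monoid.mult = monoid.mult B, one = one B, ring.zero = ring.zero B, add = add B,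
      smult = (\<lambda>f b. pure_tensor P (real_over pr) (sec \<O> U) 1 f \<otimes>\<^bsub>B\<^esub> b), grade = grade B\<rparr>)"

definition bundle_body :: "(real, 'p) gmodule \<Rightarrow> ('p \<Rightarrow> real) \<Rightarrow> ('x, 'p, 'o) gsheaf \<Rightarrow>
    ('x, 'o, 'e) gsheaf \<Rightarrow> ('x, (real, 'o) tensor, ((real, 'o) tensor, 'e) tensor) gsheaf" where
  "bundle_body P pr \<O> E =
     \<lparr>sec = (\<lambda>U. left_tensor (sec \<O> U) (body_over P pr \<O> U) (sec E U)
                (monoid.mult (sec (body P pr \<O>) U))),
      res = (\<lambda>U V. tensor_map (sec \<O> V) (body_over P pr \<O> V) (sec E V)
                (res (body P pr \<O>) U V) (res E U V))\<rparr>"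

definition bundle_body_map :: "(real, 'p) gmodule \<Rightarrow> ('p \<Rightarrow> real) \<Rightarrow> ('x, 'p, 'o) gsheaf \<Rightarrow>
    ('x, 'o, 'f) gsheaf \<Rightarrow> ('x set \<Rightarrow> 'e \<Rightarrow> 'f) \<Rightarrow> 'x set \<Rightarrow>
    ((real, 'o) tensor, 'e) tensor \<Rightarrow> ((real, 'o) tensor, 'f) tensor" where
  "bundle_body_map P pr \<O> F \<phi> U =
     tensor_map (sec \<O> U) (body_over P pr \<O> U) (sec F U) id (\<phi> U)"

definition restrict_to_real :: "(real, 'a) gmodule \<Rightarrow> ('a, 'e) gmodule \<Rightarrow> (real, 'e) gmodule" where
  "restrict_to_real A M =
     \<lparr>carrier = carrier M, monoid.mult = monoid.mult M, one = one M, ring.zero = ring.zero M, add = add M,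
      smult = (\<lambda>r. smult M (r \<odot>\<^bsub>A\<^esub> \<one>\<^bsub>A\<^esub>)), grade = grade M\<rparr>"

text \<open>
  The extension of scalars to \<open>P\<close> of a module \<open>F\<close> over the sheaf \<open>\<B>\<close> of real superalgebras, a module
  over \<open>extend_alg P \<B>\<close> by \<open>(p \<otimes> f) (p' \<otimes> e) = (-1)\<^bsup>|f||p'|\<^esup> p p' \<otimes> f e\<close>.
\<close>

definition extend_bundle :: "(real, 'p) gmodule \<Rightarrow> ('x, real, 'b) gsheaf \<Rightarrow>
    ('x, 'b, 'e) gsheaf \<Rightarrow> ('x, ('p, 'b) tensor, ('p, 'e) tensor) gsheaf" where
  "extend_bundle P \<B> F =
     \<lparr>sec = (\<lambda>U. tensor real_alg P (restrict_to_real (sec \<B> U) (sec F U))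
                (tensor_prod real_alg P (restrict_to_real (sec \<B> U) (sec F U)) (sec \<B> U)
                   (\<otimes>\<^bsub>P\<^esub>) (smult (sec F U)))),
      res = (\<lambda>U V. tensor_map real_alg P (restrict_to_real (sec \<B> V) (sec F V)) id (res F U V))\<rparr>"

text \<open>A module over the target of the morphism of sheaves of rings \<open>\<kappa>\<close> as a module over its source.\<close>

definition pull_scalars :: "('x set \<Rightarrow> 'a \<Rightarrow> 'b) \<Rightarrow> ('x, 'b, 'e) gsheaf \<Rightarrow> ('x, 'a, 'e) gsheaf" where
  "pull_scalars \<kappa> F =
     \<lparr>sec = (\<lambda>U. let M = sec F U in
        \<lparr>carrier = carrier M, monoid.mult = monoid.mult M, one = one M, ring.zero = ring.zero M, add = add M,
         smult = (\<lambda>a. smult M (\<kappa> U a)), grade = grade M\<rparr>),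
      res = res F\<rparr>"

text \<open>The body of \<open>E\<close>, regarded as a super vector bundle on \<open>\<M>\<close> by means of \<open>\<kappa>\<close>.\<close>

definition extended_body :: "(real, 'p) gmodule \<Rightarrow> ('p \<Rightarrow> real) \<Rightarrow> ('x, 'p, 'o) gsheaf \<Rightarrow>
    ('x set \<Rightarrow> 'o \<Rightarrow> ('p, (real, 'o) tensor) tensor) \<Rightarrow> ('x, 'o, 'e) gsheaf \<Rightarrow>
    ('x, 'o, ('p, ((real, 'o) tensor, 'e) tensor) tensor) gsheaf" where
  "extended_body P pr \<O> \<kappa> E =
     pull_scalars \<kappa> (extend_bundle P (body P pr \<O>) (bundle_body P pr \<O> E))"

text \<open>The canonical identification \<open>e \<mapsto> 1 \<otimes> (1 \<otimes> e)\<close> of the body of \<open>E\<close> with the body of its extension.\<close>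

definition body_embed :: "(real, 'p) gmodule \<Rightarrow> ('p \<Rightarrow> real) \<Rightarrow> ('x, 'p, 'o) gsheaf \<Rightarrow>
    ('x set \<Rightarrow> 'o \<Rightarrow> ('p, (real, 'o) tensor) tensor) \<Rightarrow> ('x, 'o, 'e) gsheaf \<Rightarrow> 'x set \<Rightarrow>
    ((real, 'o) tensor, 'e) tensor \<Rightarrow>
    ((real, 'o) tensor, ('p, ((real, 'o) tensor, 'e) tensor) tensor) tensor" where
  "body_embed P pr \<O> \<kappa> E U e =
     pure_tensor (sec \<O> U) (body_over P pr \<O> U) (sec (extended_body P pr \<O> \<kappa> E) U)
       \<one>\<^bsub>sec (body P pr \<O>) U\<^esub>
       (pure_tensor real_alg P
          (restrict_to_real (sec (body P pr \<O>) U) (sec (bundle_body P pr \<O> E) U)) \<one>\<^bsub>P\<^esub> e)"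

end

theory Submission
  imports Defs
begin

text \<open>
  The identification \<open>\<kappa>\<close> splits the projection of \<open>\<O>\<close> onto its body by an algebra homomorphism and so
  yields an idempotent even ring endomorphism \<open>\<tau>\<close> of \<open>\<O>\<close> which is the identity modulo the nilpotent
  kernel \<open>nil\<close> of \<open>pr\<close>. An isomorphism from the extended body of \<open>E\<close> to \<open>E\<close> over the identity amounts to
  an even additive operator \<open>S\<close> on \<open>E\<close> with \<open>S (f e) = \<tau> f S e\<close> and \<open>S e - e\<close> in \<open>nil E\<close>: it sends
  \<open>p \<otimes> (1 \<otimes> e)\<close> to \<open>p S e\<close>. As \<open>nil\<close> is nilpotent, every section is a combination
  \<open>\<Sum> p\<^sub>j S y\<^sub>j\<close> over a basis \<open>p\<^sub>j\<close> of \<open>P\<close>; that the terms are unique is checked in a local frame, where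
  any such \<open>S\<close> differs from \<open>S\<^sub>0\<close>, the application of \<open>\<tau>\<close> to the coordinates, by a unipotent linear map.

  Locally \<open>S\<^sub>0\<close> is such an operator. No partition of unity is needed to glue: for even bump sections
  \<open>g\<^sub>n\<close> supported in charts and equal to 1 on the members \<open>V\<^sub>n\<close> of a countable cover, and with
  \<open>L\<^sub>n e\<close> the extension by zero of \<open>g\<^sub>n S\<^sub>0 e\<close>, the sums of \<open>(1 - g\<^sub>0) \<cdots> (1 - g\<^bsub>n-1\<^esub>) L\<^sub>n e\<close> are
  stationary on each \<open>V\<^sub>k\<close>.
\<close>

section \<open>Additive maps\<close>

text \<open>The extended body is a tensor product taken section by section, so nothing says at the
  outset that it is a sheaf or that its sections are graded modules. Both facts are carried over
  from \<open>E\<close> along \<open>\<phi>\<close>, which therefore has to be bijective over every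
  open set, including those without a frame. Hence \<open>S\<close> must satisfy its conditions over
  all open sets at once. Uniqueness of coefficients passes from frames to arbitrary open sets, since
  vanishing is local. The condition that \<open>S e - e\<close> lies in \<open>nil E\<close> does
  not: it asks for a finite sum, and local finite sums need not patch to a finite one. It is
  recovered by gluing the unique coefficients of \<open>e\<close> over one fixed finite basis of
  \<open>P\<close> that contains 1 and otherwise lies in \<open>nil\<close>; the coefficient at 1 is
  then \<open>S e\<close>. A second obstacle is that maps and products on tensor products are unions
  over representatives. Each is compared with a map obtained from the universal property before it
  can be evaluated on pure tensors.\<close>

definition addmap :: "('a, 'm) ring_scheme \<Rightarrow> ('b, 'n) ring_scheme \<Rightarrow> ('a \<Rightarrow> 'b) \<Rightarrow> bool" where
 "addmap G H h \<longleftrightarrow> h : carrier G \<rightarrow> carrier H \<and>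
  (\<forall>x\<in>carrier G. \<forall>y\<in>carrier G. h (x \<oplus>\<^bsub>G\<^esub> y) = h x \<oplus>\<^bsub>H\<^esub> h y)"

lemma addmapI:
 assumes "\<And>x. x : carrier G ==> h x : carrier H"
  and "\<And>x y. [|x : carrier G; y : carrier G|] ==> h (x \<oplus>\<^bsub>G\<^esub> y) = h x \<oplus>\<^bsub>H\<^esub> h y"
 shows "addmap G H h"
 using assms by (auto simp: addmap_def)

lemma addmap_closed: "[|addmap G H h; x : carrier G|] ==> h x : carrier H"
 by (auto simp: addmap_def)

lemma addmap_add:
 "[|addmap G H h; x : carrier G; y : carrier G|] ==> h (x \<oplus>\<^bsub>G\<^esub> y) = h x \<oplus>\<^bsub>H\<^esub> h y"
 by (auto simp: addmap_def)

lemma addmap_zero: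
 assumes "addmap G H h" "abelian_group G" "abelian_group H"
 shows "h \<zero>\<^bsub>G\<^esub> = \<zero>\<^bsub>H\<^esub>"
proof -
 interpret G: abelian_group G by fact
 interpret H: abelian_group H by fact
 have "h \<zero>\<^bsub>G\<^esub> \<oplus>\<^bsub>H\<^esub> h \<zero>\<^bsub>G\<^esub> = h \<zero>\<^bsub>G\<^esub>"
  using addmap_add[OF assms(1), of "\<zero>\<^bsub>G\<^esub>" "\<zero>\<^bsub>G\<^esub>"] by simp
 moreover have "h \<zero>\<^bsub>G\<^esub> : carrier H" using addmap_closed[OF assms(1)] by simp
 ultimately show ?thesis by (metis H.add.l_cancel_one)
qed

lemma addmap_neg:
 assumes "addmap G H h" "abelian_group G" "abelian_group H" "x : carrier G"
 shows "h (\<ominus>\<^bsub>G\<^esub> x) = \<ominus>\<^bsub>H\<^esub> h x"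
proof -
 interpret G: abelian_group G by fact
 interpret H: abelian_group H by fact
 have "h (\<ominus>\<^bsub>G\<^esub> x) \<oplus>\<^bsub>H\<^esub> h x = \<zero>\<^bsub>H\<^esub>"
  using addmap_add[OF assms(1), of "\<ominus>\<^bsub>G\<^esub> x" x] assms
  by (simp add: G.l_neg addmap_zero)
 then show ?thesis
  using assms by (metis G.a_inv_closed H.minus_equality addmap_closed)
qed

lemma addmap_minus:
 assumes "addmap G H h" "abelian_group G" "abelian_group H" "x : carrier G" "y : carrier G"
 shows "h (x \<ominus>\<^bsub>G\<^esub> y) = h x \<ominus>\<^bsub>H\<^esub> h y"
 using assms addmap_neg[OF assms(1-3)]
 by (simp add: a_minus_def addmap_add abelian_group.a_inv_closed)

lemma addmap_finsum:
 assumes "addmap G H h" "abelian_group G" "abelian_group H" "f : I \<rightarrow> carrier G"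
 shows "h (\<Oplus>\<^bsub>G\<^esub>i\<in>I. f i) = (\<Oplus>\<^bsub>H\<^esub>i\<in>I. h (f i))"
proof -
 interpret G: abelian_group G by fact
 interpret H: abelian_group H by fact
 show ?thesis
  using assms(4)
 proof (induction I rule: infinite_finite_induct)
  case (insert i I)
  then have "f : I \<rightarrow> carrier G" "f i : carrier G" by auto
  moreover have "(\<lambda>i. h (f i)) : I \<rightarrow> carrier H"
   using \<open>f : I \<rightarrow> carrier G\<close> addmap_closed[OF assms(1)] by auto
  ultimately show ?case
   using insert addmap_closed[OF assms(1)]
   by (simp add: addmap_add[OF assms(1)])
 qed (simp_all add: addmap_zero[OF assms(1-3)])
qed

lemma addmap_comp:
 "[|addmap G H h; addmap H K k|] ==> addmap G K (\<lambda>x. k (h x))"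
 by (auto simp: addmap_def Pi_iff)

lemma addmap_id: "addmap G G (\<lambda>x. x)"
 by (auto simp: addmap_def)

lemma addmap_pointwise_add:
 assumes "addmap G H h" "addmap G H k" "abelian_group H"
 shows "addmap G H (\<lambda>x. h x \<oplus>\<^bsub>H\<^esub> k x)"
proof -
 interpret H: abelian_group H by fact
 show ?thesis
  using assms by (auto simp: addmap_def Pi_iff H.a_ac)
qed


section \<open>Tensor products\<close>

text \<open>The clauses answer the three families in \<open>tensor_rels\<close> one by one, so that
  the map induced on the free abelian group kills \<open>tensor_null\<close>.\<close>

definition balanced :: "('k, 'r) gmodule \<Rightarrow> ('r, 'a) gmodule \<Rightarrow> ('r, 'b) gmodule \<Rightarrow>
  ('g, 'm) ring_scheme \<Rightarrow> ('a \<Rightarrow> 'b \<Rightarrow> 'g) \<Rightarrow> bool" where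
 "balanced R A B G \<beta> \<longleftrightarrow>
  (\<forall>b\<in>carrier B. addmap A G (\<lambda>a. \<beta> a b)) \<and>
  (\<forall>a\<in>carrier A. addmap B G (\<beta> a)) \<and>
  (\<forall>i j a r b. a : grade A i \<and> r : grade R j \<and> b : carrier B \<longrightarrow>
    \<beta> (koszul A i j (r \<odot>\<^bsub>A\<^esub> a)) b = \<beta> a (r \<odot>\<^bsub>B\<^esub> b))"

text \<open>The assumptions are weak on purpose: the locale is applied to objects such as
  \<open>BO\<close>, \<open>RE\<close> and \<open>exterior_alg n\<close>, which are only shown to be
  abelian groups with a closed scalar action.\<close>

locale tensor_pair =
 fixes R :: "('k, 'r) gmodule" and A :: "('r, 'a) gmodule" and B :: "('r, 'b) gmodule"
 assumes abelian_left: "abelian_group A" and abelian_right: "abelian_group B"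
  and grade_left: "grade A i \<subseteq> carrier A"
  and smult_left: "[|r : grade R j; a : carrier A|] ==> r \<odot>\<^bsub>A\<^esub> a : carrier A"
  and smult_right: "[|r : grade R j; b : carrier B|] ==> r \<odot>\<^bsub>B\<^esub> b : carrier B"
begin

abbreviation free where "free \<equiv> carrier (tensor_free A B)"
abbreviation cls where "cls \<equiv> tensor_class R A B"
abbreviation pure where "pure \<equiv> pure_tensor R A B"
abbreviation tp where "tp act \<equiv> tensor R A B act"


sublocale A: abelian_group A by (rule abelian_left)
sublocale B: abelian_group B by (rule abelian_right)

lemma koszul_closed: "x : carrier A ==> koszul A i j x : carrier A"
 by (simp add: koszul_def)

lemma group_tensor_free: "group (tensor_free A B)"
 by (simp add: tensor_free_def)

lemma tensor_rels_subset: "tensor_rels R A B \<subseteq> free"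
proof
 fix f assume "f : tensor_rels R A B"
 then consider
   (left) a a' b where "f = frag_of (a \<oplus>\<^bsub>A\<^esub> a', b) - frag_of (a, b) - frag_of (a', b)"
    "a : carrier A" "a' : carrier A" "b : carrier B"
  | (right) a b b' where "f = frag_of (a, b \<oplus>\<^bsub>B\<^esub> b') - frag_of (a, b) - frag_of (a, b')"
    "a : carrier A" "b : carrier B" "b' : carrier B"
  | (smult) i j a r b where "f = frag_of (koszul A i j (r \<odot>\<^bsub>A\<^esub> a), b) - frag_of (a, r \<odot>\<^bsub>B\<^esub> b)"
    "a : grade A i" "r : grade R j" "b : carrier B"
  unfolding tensor_rels_def by blast
 then show "f : free"
 proof cases
  case smult
  then have "a : carrier A" using grade_left by blast
  then show ?thesis
   using smult smult_left smult_right koszul_closed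
   by (auto simp: tensor_free_def dest!: subsetD[OF keys_diff])
 qed (auto simp: tensor_free_def dest!: subsetD[OF keys_diff])
qed

lemma subgroup_tensor_null: "subgroup (tensor_null R A B) (tensor_free A B)"
 unfolding tensor_null_def
 by (rule group.generate_is_subgroup[OF group_tensor_free tensor_rels_subset])

lemma normal_tensor_null: "tensor_null R A B \<lhd> tensor_free A B"
 by (simp add: abelian_free_Abelian_group comm_group.normal_iff_subgroup subgroup_tensor_null
   tensor_free_def subgroup_tensor_null[unfolded tensor_free_def])

lemma tensor_class_altdef: "cls f = (\<lambda>k. k + f) ` tensor_null R A B"
 by (auto simp: tensor_class_def r_coset_def tensor_free_def)

lemma tensor_class_eqI:
 assumes "f - g : tensor_null R A B" "f : free" "g : free"
 shows "cls f = cls g"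
proof -
 interpret group "tensor_free A B" by (rule group_tensor_free)
 have "f : cls g"
  unfolding tensor_class_altdef using assms(1) by force
 then show ?thesis
  using assms subgroup_tensor_null repr_independence unfolding tensor_class_def by metis
qed

lemma tensor_class_memD:
 assumes "f : cls g" "g : free"
 shows "f : free" "cls f = cls g"
proof -
 interpret group "tensor_free A B" by (rule group_tensor_free)
 show "f : free"
  using assms subgroup_tensor_null r_coset_subset_G subgroup.subset unfolding tensor_class_def by blast
 show "cls f = cls g"
  using assms subgroup_tensor_null repr_independence unfolding tensor_class_def by metis
qed

lemma tensor_class_self: "f : free ==> f : cls f"
 unfolding tensor_class_altdef using subgroup.one_closed[OF subgroup_tensor_null]
 by (force simp: tensor_free_def)

lemma carrier_tensor: "carrier (tp act) = cls ` free"
 by (auto simp: tensor_def FactGroup_def RCOSETS_def tensor_class_def)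

lemma tensor_class_closed:
 "f : free ==> cls f : carrier (tp act)"
 by (simp add: carrier_tensor)

lemma tensor_classE:
 assumes "X : carrier (tp act)"
 obtains f where "f : free" "X = cls f"
 using assms unfolding carrier_tensor by blast

lemma add_tensor_class:
 assumes "f : free" "g : free"
 shows "cls f \<oplus>\<^bsub>tp act\<^esub> cls g = cls (f + g)"
 using normal.rcos_sum[OF normal_tensor_null assms]
 by (simp add: tensor_def tensor_class_def FactGroup_def) (simp add: tensor_free_def)

lemma abelian_group_tensor: "abelian_group (tp act)"
proof -
 interpret comm_group "tensor_free A B"
  by (simp add: abelian_free_Abelian_group tensor_free_def)
 interpret Q: comm_group "tensor_free A B Mod tensor_null R A B"
  by (rule abelian_FactGroup[OF subgroup_tensor_null])
 show ?thesis
 proof (rule abelian_groupI)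
  fix X assume "X : carrier (tp act)"
  then show "\<exists>Y\<in>carrier (tp act). Y \<oplus>\<^bsub>tp act\<^esub> X = \<zero>\<^bsub>tp act\<^esub>"
   by (intro bexI[of _ "inv\<^bsub>tensor_free A B Mod tensor_null R A B\<^esub> X"])
    (simp_all add: tensor_def del: mult_FactGroup one_FactGroup)
 qed (simp_all add: tensor_def Q.m_ac del: mult_FactGroup one_FactGroup)
qed

lemma pure_closed:
 "[|a : carrier A; b : carrier B|] ==> pure a b : carrier (tp act)"
 unfolding pure_tensor_def by (rule tensor_class_closed) (simp add: tensor_free_def)

lemma pure_add_left:
 assumes "a : carrier A" "a' : carrier A" "b : carrier B"
 shows "pure (a \<oplus>\<^bsub>A\<^esub> a') b = pure a b \<oplus>\<^bsub>tp act\<^esub> pure a' b"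
proof -
 have "cls (frag_of (a \<oplus>\<^bsub>A\<^esub> a', b)) =
   cls (frag_of (a, b) + frag_of (a', b))"
 proof (rule tensor_class_eqI)
  show "frag_of (a \<oplus>\<^bsub>A\<^esub> a', b) - (frag_of (a, b) + frag_of (a', b)) : tensor_null R A B"
   unfolding tensor_null_def
   by (rule generate.incl, unfold tensor_rels_def, rule UnI1, rule UnI1) (use assms in force)
 qed (use assms in \<open>auto simp: tensor_free_def dest!: subsetD[OF keys_add]\<close>)
 then show ?thesis
  using assms by (simp add: pure_tensor_def add_tensor_class tensor_free_def)
qed

lemma pure_add_right:
 assumes "a : carrier A" "b : carrier B" "b' : carrier B"
 shows "pure a (b \<oplus>\<^bsub>B\<^esub> b') = pure a b \<oplus>\<^bsub>tp act\<^esub> pure a b'"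
proof -
 have "cls (frag_of (a, b \<oplus>\<^bsub>B\<^esub> b')) =
   cls (frag_of (a, b) + frag_of (a, b'))"
 proof (rule tensor_class_eqI)
  show "frag_of (a, b \<oplus>\<^bsub>B\<^esub> b') - (frag_of (a, b) + frag_of (a, b')) : tensor_null R A B"
   unfolding tensor_null_def
   by (rule generate.incl, unfold tensor_rels_def, rule UnI1, rule UnI2) (use assms in force)
 qed (use assms in \<open>auto simp: tensor_free_def dest!: subsetD[OF keys_add]\<close>)
 then show ?thesis
  using assms by (simp add: pure_tensor_def add_tensor_class tensor_free_def)
qed

lemma pure_smult:
 assumes "a : grade A i" "r : grade R j" "b : carrier B"
 shows "pure (koszul A i j (r \<odot>\<^bsub>A\<^esub> a)) b = pure a (r \<odot>\<^bsub>B\<^esub> b)"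
 unfolding pure_tensor_def
proof (rule tensor_class_eqI)
 show "frag_of (koszul A i j (r \<odot>\<^bsub>A\<^esub> a), b) - frag_of (a, r \<odot>\<^bsub>B\<^esub> b) : tensor_null R A B"
  unfolding tensor_null_def
  by (rule generate.incl, unfold tensor_rels_def, rule UnI2) (use assms in blast)
qed (use assms subsetD[OF grade_left assms(1)] smult_left smult_right koszul_closed in \<open>auto simp: tensor_free_def\<close>)

lemma balanced_pure: "balanced R A B (tp act) (pure)"
 unfolding balanced_def
 by (intro conjI ballI allI impI addmapI) (simp_all add: pure_closed pure_add_left pure_add_right pure_smult)

lemma additive_pure_left: "b : carrier B ==> addmap A (tp act) (\<lambda>a. pure a b)"
 using balanced_pure[of act] by (auto simp: balanced_def)

lemma additive_pure_right: "a : carrier A ==> addmap B (tp act) (pure a)"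
 using balanced_pure[of act] by (auto simp: balanced_def)

lemma pure_zero_left: "b : carrier B ==> pure \<zero>\<^bsub>A\<^esub> b = \<zero>\<^bsub>tp act\<^esub>"
 using addmap_zero[OF additive_pure_left abelian_left abelian_group_tensor] .

lemma pure_zero_right: "a : carrier A ==> pure a \<zero>\<^bsub>B\<^esub> = \<zero>\<^bsub>tp act\<^esub>"
 using addmap_zero[OF additive_pure_right abelian_right abelian_group_tensor] .

lemma tensor_class_zero: "cls 0 = \<zero>\<^bsub>tp act\<^esub>"
proof -
 interpret abelian_group "tp act" by (rule abelian_group_tensor)
 have 0: "(0 :: 'a \<times> 'b \<Rightarrow>\<^sub>0 int) : free" by (simp add: tensor_free_def)
 then have "cls 0 \<oplus>\<^bsub>tp act\<^esub> cls 0 = cls 0"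
  using add_tensor_class[OF 0 0] by simp
 then show ?thesis
  using tensor_class_closed[OF 0, of act] by (metis add.l_cancel_one)
qed

lemma tensor_class_minus:
 assumes "f : free" "g : free"
 shows "cls (f - g) =
  cls f \<ominus>\<^bsub>tp act\<^esub> cls g"
proof -
 interpret abelian_group "tp act" by (rule abelian_group_tensor)
 have d: "f - g : free"
  using assms by (auto simp: tensor_free_def dest!: subsetD[OF keys_diff])
 have "cls (f - g) \<oplus>\<^bsub>tp act\<^esub> cls g = cls f"
  using add_tensor_class[OF d assms(2)] by simp
 then show ?thesis
  using tensor_class_closed[OF d, of act] tensor_class_closed[OF assms(1), of act]
   tensor_class_closed[OF assms(2), of act]
  by (metis a_minus_def add.inv_solve_right')
qed

text \<open>No case for negation arises, since the negative of \<open>pure a b\<close> is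
  \<open>pure (\<ominus> a) b\<close>.\<close>

lemma tensor_induct [consumes 1, case_names pure add]:
 assumes X: "X : carrier (tp act)"
  and pure: "\<And>a b. [|a : carrier A; b : carrier B|] ==> P (pure a b)"
  and add: "\<And>X Y. [|X : carrier (tp act); Y : carrier (tp act); P X; P Y|] ==>
   P (X \<oplus>\<^bsub>tp act\<^esub> Y)"
 shows "P X"
proof -
 interpret T: abelian_group "tp act" by (rule abelian_group_tensor)
 have zero: "P \<zero>\<^bsub>tp act\<^esub>"
  using pure[of "\<zero>\<^bsub>A\<^esub>" "\<zero>\<^bsub>B\<^esub>"] pure_zero_left[of "\<zero>\<^bsub>B\<^esub>" act] by simp
 have minus_zero: "\<ominus>\<^bsub>tp act\<^esub> \<zero>\<^bsub>tp act\<^esub> = \<zero>\<^bsub>tp act\<^esub>"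
  by (rule T.minus_equality) simp_all
 obtain f where f: "Poly_Mapping.keys f \<subseteq> carrier A \<times> carrier B" "X = cls f"
  using X by (auto simp: carrier_tensor tensor_free_def)
 \<comment> \<open>\<open>free_Abelian_group_induct\<close> proceeds through differences, so the
   claim is strengthened by the negative of the class.\<close>
 have "P (cls f) \<and> P (\<ominus>\<^bsub>tp act\<^esub> cls f)"
  using f(1)
 proof (rule free_Abelian_group_induct)
  show "P (cls 0) \<and> P (\<ominus>\<^bsub>tp act\<^esub> cls 0)"
   using zero by (simp add: tensor_class_zero[of act] minus_zero)
 next
  fix x y
  assume 2: "Poly_Mapping.keys x \<subseteq> carrier A \<times> carrier B" "Poly_Mapping.keys y \<subseteq> carrier A \<times> carrier B"
   "P (cls x) \<and> P (\<ominus>\<^bsub>tp act\<^esub> cls x)"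
   "P (cls y) \<and> P (\<ominus>\<^bsub>tp act\<^esub> cls y)"
  then have xy: "x : free" "y : free"
   by (auto simp: tensor_free_def)
  note c = tensor_class_closed[OF xy(1), of act] tensor_class_closed[OF xy(2), of act]
  have "P (cls (x - y))"
   unfolding tensor_class_minus[OF xy, of act] a_minus_def using 2 c by (auto intro!: add)
  moreover have "\<ominus>\<^bsub>tp act\<^esub> cls (x - y) =
    \<ominus>\<^bsub>tp act\<^esub> cls x \<oplus>\<^bsub>tp act\<^esub> cls y"
   unfolding tensor_class_minus[OF xy, of act] a_minus_def using c by (simp add: T.minus_add)
  then have "P (\<ominus>\<^bsub>tp act\<^esub> cls (x - y))"
   using 2 c by (auto intro!: add)
  ultimately show "P (cls (x - y)) \<and> P (\<ominus>\<^bsub>tp act\<^esub> cls (x - y))" ..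
 next
  fix ab assume "ab : carrier A \<times> carrier B"
  then obtain a b where ab: "ab = (a, b)" "a : carrier A" "b : carrier B" by auto
  then have "\<ominus>\<^bsub>tp act\<^esub> cls (frag_of ab) = pure (\<ominus>\<^bsub>A\<^esub> a) b"
   using addmap_neg[OF additive_pure_left abelian_left abelian_group_tensor, of b a act]
   by (simp add: pure_tensor_def)
  then show "P (cls (frag_of ab)) \<and>
    P (\<ominus>\<^bsub>tp act\<^esub> cls (frag_of ab))"
   using pure[of a b] pure[of "\<ominus>\<^bsub>A\<^esub> a" b] ab by (simp add: pure_tensor_def)
 qed
 then show ?thesis using f by simp
qed

lemma addmaps_eq:
 assumes "addmap (tp act) G h" "addmap (tp act) G k"
  and "\<And>a b. [|a : carrier A; b : carrier B|] ==> h (pure a b) = k (pure a b)"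
  and "X : carrier (tp act)"
 shows "h X = k X"
 using assms(4)
 by (induction rule: tensor_induct) (auto simp: assms(3) addmap_add[OF assms(1)] addmap_add[OF assms(2)])

text \<open>The universal property. The parameter \<open>act\<close> enters only the scalar
  multiplication of the tensor product, so that a single \<open>\<theta>\<close> serves every choice
  of it.\<close>

lemma tensor_lift:
 assumes G: "abelian_group G" and \<beta>: "balanced R A B G \<beta>"
 obtains \<theta> where "\<And>act. addmap (tp act) G \<theta>"
  "\<And>a b. [|a : carrier A; b : carrier B|] ==> \<theta> (pure a b) = \<beta> a b"
proof -
 interpret G: abelian_group G by fact
 let ?F = "tensor_free A B"
 have closed: "\<And>a b. [|a : carrier A; b : carrier B|] ==> \<beta> a b : carrier G"
  using \<beta> by (auto simp: balanced_def addmap_def)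
 have sub: "case_prod \<beta> ` (carrier A \<times> carrier B) \<subseteq> carrier (add_monoid G)"
  by (auto simp: closed)
 obtain h where h: "h : hom (free_Abelian_group (carrier A \<times> carrier B)) (add_monoid G)"
   "\<And>x. x : carrier A \<times> carrier B ==> h (frag_of x) = case_prod \<beta> x"
  by (rule comm_group.free_Abelian_group_universal[OF G.a_comm_group sub]) (rule that)
 have "group_hom ?F (add_monoid G) h"
  using h(1) group_tensor_free G.a_group
  by (simp add: group_hom_def group_hom_axioms_def tensor_free_def)
 then interpret h: group_hom ?F "add_monoid G" h .
 have h_closed: "h f : carrier G" if "f : carrier ?F" for f
  using h.hom_closed that by simp
 have h_add: "h (f + g) = h f \<oplus>\<^bsub>G\<^esub> h g" if "f : carrier ?F" "g : carrier ?F" for f g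
  using h.hom_mult[OF that] by (simp add: tensor_free_def)
 have h_minus: "h (f - g) = h f \<ominus>\<^bsub>G\<^esub> h g" if "f : carrier ?F" "g : carrier ?F" for f g
 proof -
  have "- g : carrier ?F" using that by (simp add: tensor_free_def)
  moreover have "h (- g) = \<ominus>\<^bsub>G\<^esub> h g"
   using h.hom_inv[OF that(2)] that(2) by (simp add: tensor_free_def a_inv_def)
  ultimately show ?thesis
   using h_add[of f "- g"] that by (simp add: a_minus_def)
 qed
 have pure: "frag_of (a, b) : carrier ?F" if "a : carrier A" "b : carrier B" for a b
  using that by (simp add: tensor_free_def)
 have diff: "f - g : carrier ?F" if "f : carrier ?F" "g : carrier ?F" for f g
  using that by (auto simp: tensor_free_def dest!: subsetD[OF keys_diff])
 have cancel: "x \<oplus>\<^bsub>G\<^esub> y \<ominus>\<^bsub>G\<^esub> x \<ominus>\<^bsub>G\<^esub> y = \<zero>\<^bsub>G\<^esub>" if "x : carrier G" "y : carrier G" for x y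
  using that by (simp add: a_minus_def G.a_comm[of x y] G.a_assoc G.r_neg)
 have "h f = \<zero>\<^bsub>G\<^esub>" if "f : tensor_rels R A B" for f
 proof -
  from that consider
    (left) a a' b where "f = frag_of (a \<oplus>\<^bsub>A\<^esub> a', b) - frag_of (a, b) - frag_of (a', b)"
     "a : carrier A" "a' : carrier A" "b : carrier B"
   | (right) a b b' where "f = frag_of (a, b \<oplus>\<^bsub>B\<^esub> b') - frag_of (a, b) - frag_of (a, b')"
     "a : carrier A" "b : carrier B" "b' : carrier B"
   | (smult) i j a r b where "f = frag_of (koszul A i j (r \<odot>\<^bsub>A\<^esub> a), b) - frag_of (a, r \<odot>\<^bsub>B\<^esub> b)"
     "a : grade A i" "r : grade R j" "b : carrier B"
   unfolding tensor_rels_def by blast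
  then show ?thesis
  proof cases
   case left
   then have "\<beta> (a \<oplus>\<^bsub>A\<^esub> a') b = \<beta> a b \<oplus>\<^bsub>G\<^esub> \<beta> a' b"
    using \<beta> by (auto simp: balanced_def addmap_def)
   then show ?thesis
    using left closed cancel[of "\<beta> a b" "\<beta> a' b"] by (simp add: h_minus diff pure h(2))
  next
   case right
   then have "\<beta> a (b \<oplus>\<^bsub>B\<^esub> b') = \<beta> a b \<oplus>\<^bsub>G\<^esub> \<beta> a b'"
    using \<beta> by (auto simp: balanced_def addmap_def)
   then show ?thesis
    using right closed cancel[of "\<beta> a b" "\<beta> a b'"] by (simp add: h_minus diff pure h(2))
  next
   case smult
   then have "a : carrier A" using grade_left by blast
   moreover have "\<beta> (koszul A i j (r \<odot>\<^bsub>A\<^esub> a)) b = \<beta> a (r \<odot>\<^bsub>B\<^esub> b)"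
    using smult \<beta> by (auto simp: balanced_def)
   ultimately show ?thesis
    using smult closed smult_left smult_right koszul_closed
    by (simp add: h_minus diff pure h(2) a_minus_def G.r_neg)
  qed
 qed
 then have "tensor_rels R A B \<subseteq> kernel ?F (add_monoid G) h"
  using tensor_rels_subset by (auto simp: kernel_def)
 then have null: "tensor_null R A B \<subseteq> kernel ?F (add_monoid G) h"
  unfolding tensor_null_def
  by (rule group.generate_subgroup_incl[OF group_tensor_free]) (rule h.subgroup_kernel)
 have h_cong: "h f = h g"
  if "f : carrier ?F" "g : carrier ?F" "cls f = cls g" for f g
 proof -
  have "f : cls g"
   using tensor_class_self[OF that(1)] that(3) by simp
  then obtain k where "k : tensor_null R A B" "f = k + g"
   by (auto simp: tensor_class_altdef)
  then show ?thesis
   using subsetD[OF null] h_add[of k g] h_closed[OF that(2)] that(2) by (simp add: kernel_def)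
 qed
 \<comment> \<open>The representative is chosen arbitrarily; \<open>h_cong\<close> makes the value
   independent of the choice.\<close>
 define \<theta> where "\<theta> X = h (SOME f. f : carrier ?F \<and> cls f = X)" for X
 have \<theta>: "\<theta> (cls f) = h f" if "f : carrier ?F" for f
  unfolding \<theta>_def
 proof (rule someI2)
  show "f : carrier ?F \<and> cls f = cls f" using that by simp
  show "h g = h f" if "g : carrier ?F \<and> cls g = cls f" for g
   by (rule h_cong) (use that \<open>f : carrier ?F\<close> in simp_all)
 qed
 show ?thesis
 proof (rule that)
  show "addmap (tp act) G \<theta>" for act
  proof (rule addmapI)
   fix X Y assume "X : carrier (tp act)" "Y : carrier (tp act)"
   then obtain f g where fg: "f : carrier ?F" "g : carrier ?F"
    "X = cls f" "Y = cls g"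
    by (auto simp only: carrier_tensor image_iff)
   then have "f + g : carrier ?F"
    by (auto simp: tensor_free_def dest!: subsetD[OF keys_add])
   then show "\<theta> (X \<oplus>\<^bsub>tp act\<^esub> Y) = \<theta> X \<oplus>\<^bsub>G\<^esub> \<theta> Y"
    unfolding fg(3,4) add_tensor_class[OF fg(1,2)] using fg(1,2) by (simp add: \<theta> h_add)
  next
   fix X assume "X : carrier (tp act)"
   then obtain f where "f : carrier ?F" "X = cls f"
    by (auto simp only: carrier_tensor image_iff)
   then show "\<theta> X : carrier G" by (simp add: \<theta> h_closed)
  qed
  show "\<theta> (pure a b) = \<beta> a b" if "a : carrier A" "b : carrier B" for a b
   using that by (simp add: pure_tensor_def \<theta> pure h(2))
 qed
qed

end

lemma addmap_cong:
 assumes "addmap G H k" "abelian_group G" "\<And>x. x : carrier G ==> h x = k x"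
 shows "addmap G H h"
 using assms abelian_groupE(1)[OF assms(2)] by (simp add: addmap_def Pi_iff)

section \<open>Maps and products that are computed on representatives\<close>

context tensor_pair begin

lemma balanced_cong:
 assumes "balanced R A B G \<beta>" "\<And>a b. [|a : carrier A; b : carrier B|] ==> \<beta>' a b = \<beta> a b"
 shows "balanced R A B G \<beta>'"
 unfolding balanced_def
proof (intro conjI ballI allI impI)
 fix i j a r b assume *: "a : grade A i \<and> r : grade R j \<and> b : carrier B"
 then have "a : carrier A" using grade_left by blast
 then show "\<beta>' (koszul A i j (r \<odot>\<^bsub>A\<^esub> a)) b = \<beta>' a (r \<odot>\<^bsub>B\<^esub> b)"
  using * assms smult_left smult_right koszul_closed unfolding balanced_def by metis
qed (use assms in \<open>simp_all add: balanced_def addmap_def Pi_iff\<close>)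

lemma frag_extend_closed:
 assumes "\<And>x. x : S ==> k x : free" "Poly_Mapping.keys f \<subseteq> S"
 shows "frag_extend k f : free"
 using assms keys_frag_extend[of k f] unfolding tensor_free_def by fastforce

text \<open>Both sides are additive in \<open>f\<close>, so agreement on the generators
  \<open>(c, d)\<close> is enough. In this way a computation on representatives is matched with a
  map that is already known to be well defined.\<close>

lemma tensor_class_frag_extend:
 assumes \<theta>: "addmap (tensor R' C D act') (tp act) \<theta>"
  and CD: "tensor_pair R' C D"
  and k: "\<And>c d. [|c : carrier C; d : carrier D|] ==> k (c, d) : free \<and>
    cls (k (c, d)) = \<theta> (pure_tensor R' C D c d)"
  and f: "f : carrier (tensor_free C D)"
 shows "cls (frag_extend k f) = \<theta> (tensor_class R' C D f)"
proof -
 interpret CD: tensor_pair R' C D by (rule CD)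
 note ab = CD.abelian_group_tensor[of act'] abelian_group_tensor[of act]
 have "Poly_Mapping.keys f \<subseteq> carrier C \<times> carrier D" using f by (simp add: tensor_free_def)
 then show ?thesis
 proof (rule free_Abelian_group_induct)
  show "cls (frag_extend k 0) = \<theta> (tensor_class R' C D 0)"
   using addmap_zero[OF \<theta> ab] by (simp add: tensor_class_zero[of act] CD.tensor_class_zero[of act'])
 next
  fix f g
  assume keys: "Poly_Mapping.keys f \<subseteq> carrier C \<times> carrier D" "Poly_Mapping.keys g \<subseteq> carrier C \<times> carrier D"
   and IH: "cls (frag_extend k f) = \<theta> (tensor_class R' C D f)"
    "cls (frag_extend k g) = \<theta> (tensor_class R' C D g)"
  have fg: "f : carrier (tensor_free C D)" "g : carrier (tensor_free C D)"
   using keys by (simp_all add: tensor_free_def)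
  have "frag_extend k f : free" "frag_extend k g : free"
   by (rule frag_extend_closed[of "carrier C \<times> carrier D"]; use k keys in auto)+
  then show "cls (frag_extend k (f - g)) = \<theta> (tensor_class R' C D (f - g))"
   using IH addmap_minus[OF \<theta> ab CD.tensor_class_closed[OF fg(1)] CD.tensor_class_closed[OF fg(2)]]
   by (simp add: frag_extend_diff tensor_class_minus[of _ _ act] CD.tensor_class_minus[of _ _ act'] fg)
 next
  fix cd assume "cd : carrier C \<times> carrier D"
  then show "cls (frag_extend k (frag_of cd)) = \<theta> (tensor_class R' C D (frag_of cd))"
   using k by (cases cd) (simp add: pure_tensor_def)
 qed
qed

text \<open>All representatives of a class are sent into one and the same class, the value of the
  lift \<open>\<theta>\<close>; hence \<open>tensor_map\<close> is a nonempty union of equal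
  sets.\<close>

lemma tensor_map_eval:
 fixes C :: "('s, 'c) gmodule" and D :: "('s, 'd) gmodule"
 assumes CD: "tensor_pair R' C D"
  and gh: "\<And>c. c : carrier C ==> g c : carrier A" "\<And>d. d : carrier D ==> h d : carrier B"
  and bal: "balanced R' C D (tp act) (\<lambda>c d. pure (g c) (h d))"
 shows "addmap (tensor R' C D act') (tp act) (tensor_map R A B g h)"
  and "[|c : carrier C; d : carrier D|] ==>
   tensor_map R A B g h (pure_tensor R' C D c d) = pure (g c) (h d)"
proof -
 interpret CD: tensor_pair R' C D by (rule CD)
 obtain \<theta> where \<theta>: "addmap (tensor R' C D act') (tp act) \<theta>"
  "\<And>c d. [|c : carrier C; d : carrier D|] ==> \<theta> (pure_tensor R' C D c d) = pure (g c) (h d)"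
  using CD.tensor_lift[OF abelian_group_tensor bal] by metis
 have "tensor_map R A B g h X = \<theta> X" if X: "X : carrier (tensor R' C D act')" for X
 proof -
  obtain f where f: "f : carrier (tensor_free C D)" "X = tensor_class R' C D f"
   by (rule CD.tensor_classE[OF X])
  have "cls (frag_extend (\<lambda>(c, d). frag_of (g c, h d)) f') = \<theta> X" if "f' : X" for f'
  proof -
   have "f' : carrier (tensor_free C D)" "tensor_class R' C D f' = X"
    using CD.tensor_class_memD[of f' f] f that by simp_all
   then show ?thesis
    using tensor_class_frag_extend[OF \<theta>(1) CD, of "\<lambda>(c, d). frag_of (g c, h d)" f'] gh \<theta>(2)
    by (simp add: tensor_free_def pure_tensor_def)
  qed
  moreover have "f : X" using f CD.tensor_class_self by simp
  ultimately show ?thesis unfolding tensor_map_def by blast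
 qed
 then show "addmap (tensor R' C D act') (tp act) (tensor_map R A B g h)"
  using \<theta>(1) CD.abelian_group_tensor[of act']
  by (simp add: addmap_def abelian_group_def abelian_monoid.a_closed Pi_iff)
 show "tensor_map R A B g h (pure_tensor R' C D c d) = pure (g c) (h d)"
  if "c : carrier C" "d : carrier D"
  using \<open>\<And>X. X : carrier (tensor R' C D act') ==> tensor_map R A B g h X = \<theta> X\<close> that
  by (simp add: \<theta>(2) CD.pure_closed)
qed

text \<open>\<open>K\<close> is the value expected on two pure tensors. The double union is
  controlled one argument at a time: first \<open>c\<close> and \<open>d\<close> are fixed and
  \<open>K c d\<close> is lifted in the second argument, then a class \<open>Y\<close> is fixed and
  the outcome is lifted in the first argument.\<close>

lemma tensor_prod_eval:
 fixes C :: "('s, 'c) gmodule" and D :: "('s, 'd) gmodule"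
 assumes CD: "tensor_pair R' C D"
  and "\<And>c d a b. [|c : carrier C; d : carrier D; a : carrier A; b : carrier B|] ==>
   (\<Sum>i\<in>UNIV. \<Sum>j\<in>UNIV. frag_cmul (koszul_int j i) (frag_of (\<mu> c (hcomp A i a), \<nu> (hcomp D j d) b)))
    : free \<and>
   cls
   (\<Sum>i\<in>UNIV. \<Sum>j\<in>UNIV. frag_cmul (koszul_int j i) (frag_of (\<mu> c (hcomp A i a), \<nu> (hcomp D j d) b)))
   = K c d a b"
  and bal: "\<And>c d. [|c : carrier C; d : carrier D|] ==> balanced R A B (tp act) (K c d)"
   "\<And>a b. [|a : carrier A; b : carrier B|] ==> balanced R' C D (tp act) (\<lambda>c d. K c d a b)"
 shows "Y : carrier (tp act) ==>
   addmap (tensor R' C D act') (tp act) (\<lambda>X. tensor_prod R A B D \<mu> \<nu> X Y)"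
  and "X : carrier (tensor R' C D act') ==>
   addmap (tp act) (tp act) (tensor_prod R A B D \<mu> \<nu> X)"
  and "[|c : carrier C; d : carrier D; a : carrier A; b : carrier B|] ==>
   tensor_prod R A B D \<mu> \<nu> (pure_tensor R' C D c d) (pure a b) = K c d a b"
proof -
 interpret CD: tensor_pair R' C D by (rule CD)
 let ?T = "tp act" and ?S = "tensor R' C D act'"
 define k where "k c d a b = (\<Sum>i\<in>UNIV. \<Sum>j\<in>UNIV. frag_cmul (koszul_int j i)
   (frag_of (\<mu> c (hcomp A i a), \<nu> (hcomp D j d) b)))" for c d a b
 note k = assms(2)[folded k_def]
 let ?F = "\<lambda>f g. cls (frag_extend (\<lambda>(c, d). frag_extend (\<lambda>(a, b). k c d a b) g) f)"
 have k_closed: "k c d a b : free"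
  if "c : carrier C" "d : carrier D" "a : carrier A" "b : carrier B" for c d a b
  using k that by blast
 have inner_closed: "frag_extend (\<lambda>(a, b). k c d a b) g : free"
  if "c : carrier C" "d : carrier D" "g : free" for c d g
 proof (rule frag_extend_closed)
  show "Poly_Mapping.keys g \<subseteq> carrier A \<times> carrier B"
   using that(3) by (simp add: tensor_free_def)
  show "(case x of (a, b) \<Rightarrow> k c d a b) : free" if "x : carrier A \<times> carrier B" for x
   using k_closed[OF \<open>c : carrier C\<close> \<open>d : carrier D\<close>] that by (cases x) simp
 qed
 have inner: "\<exists>\<theta>. addmap ?T ?T \<theta> \<and>
   (\<forall>a\<in>carrier A. \<forall>b\<in>carrier B. \<theta> (pure a b) = K c d a b) \<and>
   (\<forall>g\<in>free.
    cls (frag_extend (\<lambda>(a, b). k c d a b) g) = \<theta> (cls g))"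
  if cd: "c : carrier C" "d : carrier D" for c d
 proof -
  obtain \<theta> where \<theta>: "addmap ?T ?T \<theta>"
   "\<And>a b. [|a : carrier A; b : carrier B|] ==> \<theta> (pure a b) = K c d a b"
   using tensor_lift[OF abelian_group_tensor bal(1)[OF cd]] by metis
  have "cls (frag_extend (\<lambda>(a, b). k c d a b) g) = \<theta> (cls g)"
   if "g : free" for g
   by (rule tensor_class_frag_extend[OF \<theta>(1) tensor_pair_axioms _ that]) (use k \<theta>(2) cd in simp)
  then show ?thesis using \<theta> by blast
 qed
 \<comment> \<open>For fixed \<open>Y\<close> the class that belongs to \<open>(c, d)\<close> may be
   computed from any representative of \<open>Y\<close>, because by \<open>inner\<close> it is a
   function of \<open>Y\<close> alone.\<close>
 have outer: "\<exists>\<theta>. addmap ?S ?T \<theta> \<and>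
   (\<forall>f\<in>carrier (tensor_free C D). \<forall>g\<in>Y. ?F f g = \<theta> (tensor_class R' C D f)) \<and>
   (\<forall>c\<in>carrier C. \<forall>d\<in>carrier D. \<forall>g\<in>Y. \<theta> (pure_tensor R' C D c d) =
    cls (frag_extend (\<lambda>(a, b). k c d a b) g))"
  if Y: "Y : carrier ?T" for Y
 proof -
  obtain g0 where g0: "g0 : free" "Y = cls g0"
   using Y by (rule tensor_classE)
  have mem: "g : free \<and> cls g = Y" if "g : Y" for g
   using tensor_class_memD[of g g0] g0 that by simp
  define \<beta> where "\<beta> c d = cls (frag_extend (\<lambda>(a, b). k c d a b) g0)" for c d
  have \<beta>: "cls (frag_extend (\<lambda>(a, b). k c d a b) g) = \<beta> c d"
   if "c : carrier C" "d : carrier D" "g : Y" for c d g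
   using inner[OF that(1,2)] mem[OF that(3)] g0 unfolding \<beta>_def by metis
  \<comment> \<open>Balancedness in \<open>c\<close> and \<open>d\<close> is given only against a
    single pair \<open>(a, b)\<close>. Since \<open>free_Abelian_group_induct\<close> builds
    \<open>g\<close> from such pairs by differences, it is enough that balancedness survives a
    difference.\<close>
  have "balanced R' C D ?T (\<lambda>c d. cls (frag_extend (\<lambda>(a, b). k c d a b) g))"
   if "g : free" for g
  proof -
   let ?B = "\<lambda>g c d. cls (frag_extend (\<lambda>(a, b). k c d a b) g)"
   interpret T: abelian_group ?T by (rule abelian_group_tensor)
   have B_closed: "?B g c d : carrier ?T" if "g : free" "c : carrier C" "d : carrier D" for g c d
    by (rule tensor_class_closed) (rule inner_closed[OF that(2,3,1)])
   have B_minus: "?B (g - g') c d = ?B g c d \<ominus>\<^bsub>?T\<^esub> ?B g' c d"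
    if "g : free" "g' : free" "c : carrier C" "d : carrier D" for g g' c d
    using inner_closed[OF that(3,4,1)] inner_closed[OF that(3,4,2)]
    by (simp only: frag_extend_diff tensor_class_minus[of _ _ act])
   have B_pure: "?B (frag_of (a, b)) c d = K c d a b"
    if "a : carrier A" "b : carrier B" "c : carrier C" "d : carrier D" for a b c d
    using k[OF that(3,4,1,2)] by simp
   have K_closed: "K c d a b : carrier ?T"
    if "a : carrier A" "b : carrier B" "c : carrier C" "d : carrier D" for a b c d
    using k[OF that(3,4,1,2)] tensor_class_closed by metis
   have swap: "(x \<oplus>\<^bsub>?T\<^esub> y) \<ominus>\<^bsub>?T\<^esub> (x' \<oplus>\<^bsub>?T\<^esub> y') = (x \<ominus>\<^bsub>?T\<^esub> x') \<oplus>\<^bsub>?T\<^esub> (y \<ominus>\<^bsub>?T\<^esub> y')"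
    if "x : carrier ?T" "y : carrier ?T" "x' : carrier ?T" "y' : carrier ?T" for x y x' y'
    using that by (simp add: a_minus_def T.minus_add T.a_ac)
   have "Poly_Mapping.keys g \<subseteq> carrier A \<times> carrier B" using that by (simp add: tensor_free_def)
   then show "balanced R' C D ?T (?B g)"
   proof (rule free_Abelian_group_induct)
    show "balanced R' C D ?T (?B 0)"
     by (auto simp: balanced_def addmap_def tensor_class_zero[of act])
   next
    fix g g'
    assume "Poly_Mapping.keys g \<subseteq> carrier A \<times> carrier B" "Poly_Mapping.keys g' \<subseteq> carrier A \<times> carrier B"
     and IH: "balanced R' C D ?T (?B g)" "balanced R' C D ?T (?B g')"
    then have gg: "g : free" "g' : free"
     by (simp_all add: tensor_free_def)
    show "balanced R' C D ?T (?B (g - g'))"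
     unfolding balanced_def
    proof (intro conjI ballI allI impI addmapI)
     fix d c c' assume cd: "d : carrier D" "c : carrier C" "c' : carrier C"
     then have "?B g (c \<oplus>\<^bsub>C\<^esub> c') d = ?B g c d \<oplus>\<^bsub>?T\<^esub> ?B g c' d"
      "?B g' (c \<oplus>\<^bsub>C\<^esub> c') d = ?B g' c d \<oplus>\<^bsub>?T\<^esub> ?B g' c' d"
      using IH by (simp_all add: balanced_def addmap_def)
     then show "?B (g - g') (c \<oplus>\<^bsub>C\<^esub> c') d = ?B (g - g') c d \<oplus>\<^bsub>?T\<^esub> ?B (g - g') c' d"
      using cd gg by (simp only: B_minus CD.A.a_closed swap B_closed)
    next
     fix c d d' assume cd: "c : carrier C" "d : carrier D" "d' : carrier D"
     then have "?B g c (d \<oplus>\<^bsub>D\<^esub> d') = ?B g c d \<oplus>\<^bsub>?T\<^esub> ?B g c d'"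
      "?B g' c (d \<oplus>\<^bsub>D\<^esub> d') = ?B g' c d \<oplus>\<^bsub>?T\<^esub> ?B g' c d'"
      using IH by (simp_all add: balanced_def addmap_def)
     then show "?B (g - g') c (d \<oplus>\<^bsub>D\<^esub> d') = ?B (g - g') c d \<oplus>\<^bsub>?T\<^esub> ?B (g - g') c d'"
      using cd gg by (simp only: B_minus CD.B.a_closed swap B_closed)
    next
     fix i j c r d assume crd: "c : grade C i \<and> r : grade R' j \<and> d : carrier D"
     then have c: "c : carrier C" using CD.grade_left by blast
     have "?B g (koszul C i j (r \<odot>\<^bsub>C\<^esub> c)) d = ?B g c (r \<odot>\<^bsub>D\<^esub> d)"
      "?B g' (koszul C i j (r \<odot>\<^bsub>C\<^esub> c)) d = ?B g' c (r \<odot>\<^bsub>D\<^esub> d)"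
      using IH crd unfolding balanced_def by blast+
     moreover have "koszul C i j (r \<odot>\<^bsub>C\<^esub> c) : carrier C" "r \<odot>\<^bsub>D\<^esub> d : carrier D"
      using crd c CD.koszul_closed CD.smult_left CD.smult_right by blast+
     ultimately show "?B (g - g') (koszul C i j (r \<odot>\<^bsub>C\<^esub> c)) d = ?B (g - g') c (r \<odot>\<^bsub>D\<^esub> d)"
      using crd c gg by (simp only: B_minus)
    next
     fix c d assume "d : carrier D" "c : carrier C"
     then show "?B (g - g') c d : carrier ?T"
      using gg B_closed by (simp only: B_minus T.minus_closed)
    next
     fix c d assume "c : carrier C" "d : carrier D"
     then show "?B (g - g') c d : carrier ?T"
      using gg B_closed by (simp only: B_minus T.minus_closed)
    qed
   next
    fix ab assume "ab : carrier A \<times> carrier B"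
    then obtain a b where ab: "ab = (a, b)" "a : carrier A" "b : carrier B" by auto
    have "balanced R' C D ?T (\<lambda>c d. K c d a b)" by (rule bal(2)[OF ab(2,3)])
    then show "balanced R' C D ?T (?B (frag_of ab))"
     unfolding ab(1) by (rule CD.balanced_cong) (rule B_pure[OF ab(2,3)])
   qed
  qed
  then have "balanced R' C D ?T \<beta>" unfolding \<beta>_def using g0 by blast
  then obtain \<theta> where \<theta>: "addmap ?S ?T \<theta>"
   "\<And>c d. [|c : carrier C; d : carrier D|] ==> \<theta> (pure_tensor R' C D c d) = \<beta> c d"
   using CD.tensor_lift[OF abelian_group_tensor] by metis
  have "?F f g = \<theta> (tensor_class R' C D f)" if "f : carrier (tensor_free C D)" "g : Y" for f g
   by (rule tensor_class_frag_extend[OF \<theta>(1) CD _ that(1)])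
    (use inner_closed mem[OF that(2)] \<beta>[OF _ _ that(2)] \<theta>(2) in simp)
  then show ?thesis using \<theta> \<beta> by (intro exI[of _ \<theta>]) simp
 qed
 have prod: "\<exists>\<theta>. addmap ?S ?T \<theta> \<and> (\<forall>X\<in>carrier ?S. tensor_prod R A B D \<mu> \<nu> X Y = \<theta> X) \<and>
   (\<forall>c\<in>carrier C. \<forall>d\<in>carrier D. \<forall>g\<in>Y. \<theta> (pure_tensor R' C D c d) =
    cls (frag_extend (\<lambda>(a, b). k c d a b) g))"
  if Y: "Y : carrier ?T" for Y
 proof -
  obtain \<theta> where \<theta>: "addmap ?S ?T \<theta>"
   "\<And>f g. [|f : carrier (tensor_free C D); g : Y|] ==> ?F f g = \<theta> (tensor_class R' C D f)"
   "\<And>c d g. [|c : carrier C; d : carrier D; g : Y|] ==> \<theta> (pure_tensor R' C D c d) =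
    cls (frag_extend (\<lambda>(a, b). k c d a b) g)"
   using outer[OF Y] by blast
  obtain g0 where g0: "g0 : Y"
   using Y tensor_class_self by (metis tensor_classE)
  have "tensor_prod R A B D \<mu> \<nu> X Y = \<theta> X" if X: "X : carrier ?S" for X
  proof -
   obtain f0 where f0: "f0 : carrier (tensor_free C D)" "X = tensor_class R' C D f0"
    by (rule CD.tensor_classE[OF X])
   have "?F f g = \<theta> X" if "f : X" "g : Y" for f g
    using CD.tensor_class_memD[of f f0] f0 that \<theta>(2)[of f g] by simp
   moreover have "f0 : X" using f0 CD.tensor_class_self by simp
   ultimately show ?thesis unfolding tensor_prod_def k_def[symmetric] using g0 by blast
  qed
  then show ?thesis using \<theta> by blast
 qed
 show left: "addmap ?S ?T (\<lambda>X. tensor_prod R A B D \<mu> \<nu> X Y)" if "Y : carrier ?T" for Y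
 proof -
  interpret S: abelian_group ?S by (rule CD.abelian_group_tensor)
  show ?thesis using prod[OF that] by (auto simp: addmap_def Pi_iff simp del: Union_iff)
 qed
 have pure_left: "\<exists>\<theta>. addmap ?T ?T \<theta> \<and> (\<forall>Y\<in>carrier ?T. tensor_prod R A B D \<mu> \<nu> (pure_tensor R' C D c d) Y = \<theta> Y)
   \<and> (\<forall>a\<in>carrier A. \<forall>b\<in>carrier B. \<theta> (pure a b) = K c d a b)"
  if cd: "c : carrier C" "d : carrier D" for c d
 proof -
  obtain \<theta> where \<theta>: "addmap ?T ?T \<theta>"
   "\<forall>a\<in>carrier A. \<forall>b\<in>carrier B. \<theta> (pure a b) = K c d a b"
   "\<forall>g\<in>free.
    cls (frag_extend (\<lambda>(a, b). k c d a b) g) = \<theta> (cls g)"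
   using inner[OF cd] by blast
  have "tensor_prod R A B D \<mu> \<nu> (pure_tensor R' C D c d) Y = \<theta> Y" if Y: "Y : carrier ?T" for Y
  proof -
   obtain g where g: "g : free" "Y = cls g"
    using Y by (rule tensor_classE)
   then have "g : Y" using tensor_class_self by simp
   then show ?thesis using prod[OF Y] cd \<theta>(3) g CD.pure_closed[OF cd, of act'] by metis
  qed
  then show ?thesis using \<theta> by blast
 qed
 show "tensor_prod R A B D \<mu> \<nu> (pure_tensor R' C D c d) (pure a b) = K c d a b"
  if "c : carrier C" "d : carrier D" "a : carrier A" "b : carrier B" for c d a b
  using pure_left[OF that(1,2)] that pure_closed by metis
 \<comment> \<open>Additivity in the second argument is known for pure \<open>X\<close> by
   \<open>pure_left\<close>. It survives sums of such \<open>X\<close> because the product is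
   already additive in the first argument.\<close>
 show "addmap ?T ?T (tensor_prod R A B D \<mu> \<nu> X)" if "X : carrier ?S" for X
  using that
 proof (induction rule: CD.tensor_induct)
  case (pure c d)
  interpret T: abelian_group ?T by (rule abelian_group_tensor)
  show ?case using pure_left[OF pure] by (auto simp: addmap_def Pi_iff)
 next
  case (add X X')
  show ?case
   by (rule addmap_cong[OF _ abelian_group_tensor])
    (use add addmap_add[OF left add(1,2)] in
     \<open>auto intro!: addmap_pointwise_add abelian_group_tensor simp del: Union_iff\<close>)
 qed
qed

end

lemma tensor_free_add:
 "[|f : carrier (tensor_free A B); g : carrier (tensor_free A B)|] ==> f + g : carrier (tensor_free A B)"
 unfolding tensor_free_def using keys_add[of f g] by auto

lemma tensor_free_diff:
 "[|f : carrier (tensor_free A B); g : carrier (tensor_free A B)|] ==> f - g : carrier (tensor_free A B)"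
 unfolding tensor_free_def using keys_diff[of f g] by auto

section \<open>Graded groups\<close>

lemma bit_cases: "i = (0 :: bit) \<or> i = 1"
 by (cases i) auto

lemma UNIV_bit: "(UNIV :: bit set) = {0, 1}"
 using bit_cases by auto

text \<open>The additive part of a grading alone, shared by rings, modules and tensor products
  before any multiplication on them is available.\<close>

locale graded_group = M: abelian_group M for M :: "('r, 'a) gmodule" +
 assumes graded_group: "graded M"
begin

lemmas abg = M.abelian_group_axioms


lemma additive_subgroup_grade: "additive_subgroup (grade M i) M"
 using graded_group by (simp add: graded_def)

lemma grade_subset: "grade M i \<subseteq> carrier M"
 using additive_subgroup.a_subset[OF additive_subgroup_grade] .

lemma grade_carrier: "x : grade M i ==> x : carrier M"
 using grade_subset by blast

lemma grade_add: "[|x : grade M i; y : grade M i|] ==> x \<oplus>\<^bsub>M\<^esub> y : grade M i"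
 using additive_subgroup.a_closed[OF additive_subgroup_grade] .

lemma grade_zero: "\<zero>\<^bsub>M\<^esub> : grade M i"
 using additive_subgroup.zero_closed[OF additive_subgroup_grade] .

lemma grade_neg: "x : grade M i ==> \<ominus>\<^bsub>M\<^esub> x : grade M i"
 using subgroup.m_inv_closed[OF additive_subgroup.a_subgroup[OF additive_subgroup_grade]]
 by (simp add: a_inv_def)

lemma grade_decomp_unique:
 assumes "y : grade M i" "z : grade M (i + 1)" "y' : grade M i" "z' : grade M (i + 1)"
  and eq: "y \<oplus>\<^bsub>M\<^esub> z = y' \<oplus>\<^bsub>M\<^esub> z'"
 shows "y = y' \<and> z = z'"
proof -
 have *: "y = y' \<and> z = z'" if "y : grade M 0" "z : grade M 1" "y' : grade M 0" "z' : grade M 1"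
  "y \<oplus>\<^bsub>M\<^esub> z = y' \<oplus>\<^bsub>M\<^esub> z'" for y z y' z'
 proof -
  have "y \<oplus>\<^bsub>M\<^esub> z : carrier M" using that grade_carrier by blast
  then have "\<exists>!w. fst w : grade M 0 \<and> snd w : grade M 1 \<and> y \<oplus>\<^bsub>M\<^esub> z = fst w \<oplus>\<^bsub>M\<^esub> snd w"
   using graded_group by (simp add: graded_def)
  then have "(y, z) = (y', z')"
   by (rule ex1E) (use that in \<open>metis fst_conv snd_conv\<close>)
  then show ?thesis by simp
 qed
 show ?thesis
 proof (cases "i = 0")
  case True
  then show ?thesis using * assms by simp
 next
  case False
  then have "i = 1" using bit_cases by blast
  then show ?thesis using *[of z y z' y'] assms grade_carrier M.a_comm by simp
 qed
qed

lemma grade_decomp_exists: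
 assumes "x : carrier M"
 shows "\<exists>y\<in>grade M i. \<exists>z\<in>grade M (i + 1). x = y \<oplus>\<^bsub>M\<^esub> z"
proof -
 have "\<exists>!w. fst w : grade M 0 \<and> snd w : grade M 1 \<and> x = fst w \<oplus>\<^bsub>M\<^esub> snd w"
  using graded_group assms by (simp add: graded_def)
 then obtain y z where yz: "y : grade M 0" "z : grade M 1" "x = y \<oplus>\<^bsub>M\<^esub> z" by auto
 show ?thesis
 proof (cases "i = 0")
  case True
  then show ?thesis using yz by auto
 next
  case False
  then have "i = 1" using bit_cases by blast
  moreover have "x = z \<oplus>\<^bsub>M\<^esub> y" using yz grade_carrier M.a_comm by simp
  ultimately show ?thesis using yz by auto
 qed
qed

lemma hcomp_eqI:
 assumes "y : grade M i" "z : grade M (i + 1)" "x = y \<oplus>\<^bsub>M\<^esub> z"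
 shows "hcomp M i x = y"
 unfolding hcomp_def using assms grade_decomp_unique by (intro the_equality) blast+

lemma hcomp_props:
 assumes "x : carrier M"
 shows "hcomp M i x : grade M i" "x = hcomp M i x \<oplus>\<^bsub>M\<^esub> hcomp M (i + 1) x"
proof -
 obtain y z where yz: "y : grade M i" "z : grade M (i + 1)" "x = y \<oplus>\<^bsub>M\<^esub> z"
  using grade_decomp_exists[OF assms] by blast
 then have y: "hcomp M i x = y" by (rule hcomp_eqI)
 have "i + 1 + 1 = i" using bit_cases[of i] by auto
 moreover have "x = z \<oplus>\<^bsub>M\<^esub> y" using yz grade_carrier M.a_comm by simp
 ultimately have z: "hcomp M (i + 1) x = z" using hcomp_eqI[of z "i + 1" y x] yz by simp
 show "hcomp M i x : grade M i" using y yz by simp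
 show "x = hcomp M i x \<oplus>\<^bsub>M\<^esub> hcomp M (i + 1) x" using y z yz by simp
qed

lemma hcomp_closed: "x : carrier M ==> hcomp M i x : carrier M"
 using hcomp_props grade_carrier by blast

lemma hcomp_sum: "x : carrier M ==> hcomp M 0 x \<oplus>\<^bsub>M\<^esub> hcomp M 1 x = x"
 using hcomp_props(2)[of x 0] by simp

lemma hcomp_grade_same: "x : grade M i ==> hcomp M i x = x"
 by (rule hcomp_eqI[of _ _ "\<zero>\<^bsub>M\<^esub>"]) (auto simp: grade_zero grade_carrier)

lemma hcomp_grade_other: "x : grade M (i + 1) ==> hcomp M i x = \<zero>\<^bsub>M\<^esub>"
 by (rule hcomp_eqI[of _ _ x]) (auto simp: grade_zero grade_carrier)

lemma hcomp_add:
 assumes "x : carrier M" "y : carrier M"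
 shows "hcomp M i (x \<oplus>\<^bsub>M\<^esub> y) = hcomp M i x \<oplus>\<^bsub>M\<^esub> hcomp M i y"
proof (rule hcomp_eqI)
 show "x \<oplus>\<^bsub>M\<^esub> y = (hcomp M i x \<oplus>\<^bsub>M\<^esub> hcomp M i y) \<oplus>\<^bsub>M\<^esub> (hcomp M (i + 1) x \<oplus>\<^bsub>M\<^esub> hcomp M (i + 1) y)"
  using hcomp_props(2)[OF assms(1), of i] hcomp_props(2)[OF assms(2), of i] assms hcomp_closed
  by (metis M.a_assoc M.a_closed M.a_lcomm)
qed (use assms in \<open>auto intro: grade_add hcomp_props\<close>)

lemma additive_hcomp: "addmap M M (hcomp M i)"
 by (rule addmapI) (auto simp: hcomp_closed hcomp_add)

text \<open>An even additive map carries a decomposition of \<open>x\<close> to a decomposition of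
  \<open>h x\<close>, and decompositions are unique.\<close>

lemma hcomp_commute:
 assumes "graded_group N" "addmap M N h" "\<And>i x. x : grade M i ==> h x : grade N i" "x : carrier M"
 shows "hcomp N i (h x) = h (hcomp M i x)"
proof -
 interpret N: graded_group N by fact
 show ?thesis
 proof (rule N.hcomp_eqI)
  show "h x = h (hcomp M i x) \<oplus>\<^bsub>N\<^esub> h (hcomp M (i + 1) x)"
   using addmap_add[OF assms(2), of "hcomp M i x" "hcomp M (i + 1) x"] assms(4) hcomp_closed
    hcomp_props(2)[OF assms(4), of i] by simp
 qed (use assms hcomp_props in auto)
qed

end

section \<open>Graded tensor products\<close>

text \<open>Of the four signed terms in \<open>tensor_prod\<close> only the odd-odd one is negative;
  grouped by the parity of the first factor they collapse to two pure tensors.\<close>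

lemma (in tensor_pair) tensor_class_koszul_sum:
 assumes "\<And>i. u i : carrier A" "\<And>j. v j : carrier B"
 shows "(\<Sum>i\<in>UNIV. \<Sum>j\<in>UNIV. frag_cmul (koszul_int j i) (frag_of (u i, v j)))
    : free" (is "?s : _")
  and "cls (\<Sum>i\<in>UNIV. \<Sum>j\<in>UNIV. frag_cmul (koszul_int j i) (frag_of (u i, v j))) =
   pure (u 0) (v 0 \<oplus>\<^bsub>B\<^esub> v 1) \<oplus>\<^bsub>tp act\<^esub> pure (u 1) (v 0 \<ominus>\<^bsub>B\<^esub> v 1)"
proof -
 have s: "?s = (frag_of (u 0, v 0) + frag_of (u 0, v 1)) + (frag_of (u 1, v 0) - frag_of (u 1, v 1))"
  by (simp add: UNIV_bit koszul_int_def)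
 have f: "frag_of (u i, v j) : free" for i j
  using assms by (simp add: tensor_free_def)
 have f1: "frag_of (u 0, v 0) + frag_of (u 0, v 1) : free"
  by (rule tensor_free_add[OF f f])
 have f2: "frag_of (u 1, v 0) - frag_of (u 1, v 1) : free"
  by (rule tensor_free_diff[OF f f])
 show "?s : free"
  unfolding s by (rule tensor_free_add[OF f1 f2])
 show "cls ?s = pure (u 0) (v 0 \<oplus>\<^bsub>B\<^esub> v 1) \<oplus>\<^bsub>tp act\<^esub>
   pure (u 1) (v 0 \<ominus>\<^bsub>B\<^esub> v 1)"
  unfolding s add_tensor_class[OF f1 f2, of act, symmetric] add_tensor_class[OF f f, where act = act, symmetric]
   tensor_class_minus[OF f f, where act = act]
  using assms by (simp add: pure_add_right[of _ _ _ act]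
    addmap_minus[OF additive_pure_right[of _ act] abelian_right abelian_group_tensor])
   (simp add: pure_tensor_def)
qed

locale graded_pair = tensor_pair R A B + A: graded_group A + B: graded_group B for R A B +
 assumes grade_smult_left: "[|r : grade R j; a : grade A i|] ==> r \<odot>\<^bsub>A\<^esub> a : grade A (i + j)"
  and grade_smult_right: "[|r : grade R j; b : grade B i|] ==> r \<odot>\<^bsub>B\<^esub> b : grade B (i + j)"
  and smult_right_distr: "[|r : grade R j; b : carrier B; b' : carrier B|] ==>
   r \<odot>\<^bsub>B\<^esub> (b \<oplus>\<^bsub>B\<^esub> b') = r \<odot>\<^bsub>B\<^esub> b \<oplus>\<^bsub>B\<^esub> r \<odot>\<^bsub>B\<^esub> b'"

context tensor_pair begin

lemma grade_tensor:
 "grade (tp act) k = cls ` generate (tensor_free A B)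
  {frag_of (a, b) | a b i j. a : grade A i \<and> b : grade B j \<and> i + j = k}"
 by (simp add: tensor_def)

lemma grade_tensor_induct [consumes 2, case_names pure zero add neg]:
 assumes gB: "\<And>i. grade B i \<subseteq> carrier B"
  and X: "X : grade (tp act) k"
  and pure: "\<And>a b i j. [|a : grade A i; b : grade B j; i + j = k|] ==> Q (pure a b)"
  and zero: "Q \<zero>\<^bsub>tp act\<^esub>"
  and add: "\<And>X Y. [|X : carrier (tp act); Y : carrier (tp act); Q X; Q Y|] ==>
   Q (X \<oplus>\<^bsub>tp act\<^esub> Y)"
  and neg: "\<And>X. [|X : carrier (tp act); Q X|] ==> Q (\<ominus>\<^bsub>tp act\<^esub> X)"
 shows "X : carrier (tp act) \<and> Q X"
proof -
 interpret T: abelian_group "tp act" by (rule abelian_group_tensor)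
 let ?H = "{frag_of (a, b) | a b i j. a : grade A i \<and> b : grade B j \<and> i + j = k}"
 have H: "h : free \<and> Q (cls h)" if h: "h : ?H" for h
 proof -
  obtain a b i j where h: "h = frag_of (a, b)" "a : grade A i" "b : grade B j" "i + j = k"
   using h by blast
  then have "a : carrier A" "b : carrier B" using gB grade_left by blast+
  then show ?thesis using pure[OF h(2-4)] h(1) by (simp add: tensor_free_def pure_tensor_def)
 qed
 obtain f where f: "f : generate (tensor_free A B) ?H" "X = cls f"
  using X by (auto simp only: grade_tensor)
 have "f : free \<and> Q (cls f)"
  using f(1)
 proof induction
  case one
  then show ?case using zero by (simp add: tensor_free_def tensor_class_zero[of act])
 next
  case (incl h)
  then show ?case using H by blast
 next
  case (inv h)
  have h: "h : free" using H[OF inv] by blast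
  have 0: "0 : free" by (simp add: tensor_free_def)
  have "inv\<^bsub>tensor_free A B\<^esub> h = - h" using h by (simp add: tensor_free_def)
  moreover have "- h : free" using h by (simp add: tensor_free_def)
  moreover have "cls (- h) = \<ominus>\<^bsub>tp act\<^esub> cls h"
   using tensor_class_minus[OF 0 h, of act] tensor_class_closed[OF h, of act]
   by (simp add: tensor_class_zero[of act] a_minus_def)
  ultimately show ?case using neg[OF tensor_class_closed[OF h]] H[OF inv] by simp
 next
  case (eng h1 h2)
  then have "h1 + h2 : free" by (simp add: tensor_free_add)
  moreover have "h1 \<otimes>\<^bsub>tensor_free A B\<^esub> h2 = h1 + h2" by (simp add: tensor_free_def)
  ultimately show ?case
   using eng add[of "cls h1" "cls h2"]
    tensor_class_closed[of h1 act] tensor_class_closed[of h2 act]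
   by (simp add: add_tensor_class)
 qed
 then show ?thesis using f tensor_class_closed[of f act] by simp
qed

lemma pure_grade:
 "[|a : grade A i; b : grade B j|] ==> pure a b : grade (tp act) (i + j)"
 unfolding grade_tensor pure_tensor_def by (rule imageI, rule generate.incl) blast

lemma additive_subgroup_grade_tensor:
 assumes gB: "\<And>i. grade B i \<subseteq> carrier B"
 shows "additive_subgroup (grade (tp act) k) (tp act)"
proof -
 interpret T: abelian_group "tp act" by (rule abelian_group_tensor)
 let ?H = "{frag_of (a, b) | a b i j. a : grade A i \<and> b : grade B j \<and> i + j = k}"
 have H: "?H \<subseteq> free"
 proof
  fix h assume "h : ?H"
  then obtain a b i j where h: "h = frag_of (a, b)" "a : grade A i" "b : grade B j" by blast
  then have "a : carrier A" "b : carrier B" using gB grade_left by blast+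
  then show "h : free" by (simp add: h(1) tensor_free_def)
 qed
 note gen = group.generate_in_carrier[OF group_tensor_free H]
 have zero: "\<zero>\<^bsub>tp act\<^esub> : grade (tp act) k"
  unfolding grade_tensor tensor_class_zero[of act, symmetric]
  using generate.one[of "tensor_free A B"] by (intro imageI) (simp add: tensor_free_def)
 have minus: "X \<ominus>\<^bsub>tp act\<^esub> Y : grade (tp act) k"
  if XY: "X : grade (tp act) k" "Y : grade (tp act) k" for X Y
 proof -
  obtain f g where fg: "f : generate (tensor_free A B) ?H" "X = cls f"
    "g : generate (tensor_free A B) ?H" "Y = cls g"
   using XY by (auto simp only: grade_tensor)
  have "inv\<^bsub>tensor_free A B\<^esub> g : generate (tensor_free A B) ?H"
   using group.generate_m_inv_closed[OF group_tensor_free H fg(3)] .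
  then have "f \<otimes>\<^bsub>tensor_free A B\<^esub> inv\<^bsub>tensor_free A B\<^esub> g : generate (tensor_free A B) ?H"
   using fg(1) by (rule generate.eng[rotated])
  moreover have "f \<otimes>\<^bsub>tensor_free A B\<^esub> inv\<^bsub>tensor_free A B\<^esub> g = f - g"
   using gen[OF fg(3)] by (simp add: tensor_free_def)
  ultimately show ?thesis
   unfolding fg(2,4) tensor_class_minus[OF gen[OF fg(1)] gen[OF fg(3)], of act, symmetric] grade_tensor
   by (intro imageI) simp
 qed
 have sub: "grade (tp act) k \<subseteq> carrier (tp act)"
  unfolding grade_tensor using gen tensor_class_closed by blast
 have neg: "\<ominus>\<^bsub>tp act\<^esub> X : grade (tp act) k" if "X : grade (tp act) k" for X
  using minus[OF zero that] that sub by (simp add: a_minus_def subset_iff)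
 show ?thesis
 proof (rule additive_subgroupI, rule subgroup.intro)
  show "X \<otimes>\<^bsub>add_monoid (tp act)\<^esub> Y : grade (tp act) k"
   if "X : grade (tp act) k" "Y : grade (tp act) k" for X Y
   using minus[OF that(1) neg[OF that(2)]] that sub by (simp add: a_minus_def subset_iff)
 qed (use sub zero neg in \<open>simp_all add: a_inv_def[symmetric]\<close>)
qed

end

text \<open>The grades of a tensor product are generated subgroups, which does not show that they
  are independent of each other. The projections onto them are therefore built from the universal
  property. That every element has a decomposition is immediate on pure tensors.\<close>

lemma (in graded_pair) graded_group_tensor: "graded_group (tp act)"
proof -
 let ?T = "tp act"
 interpret T: abelian_group ?T by (rule abelian_group_tensor)
 have gB: "grade B i \<subseteq> carrier B" for i by (rule B.grade_subset)
 \<comment> \<open>Of the four products of homogeneous components these are the two of total degree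
   \<open>k\<close>, namely \<open>0 + k\<close> and \<open>1 + (k + 1)\<close>.\<close>
 define \<beta> where "\<beta> k a b = pure (hcomp A 0 a) (hcomp B k b) \<oplus>\<^bsub>?T\<^esub>
   pure (hcomp A 1 a) (hcomp B (k + 1) b)" for k a b
 have \<beta>_hom: "\<beta> k a b = pure a (hcomp B (k + i) b)"
  if a: "a : grade A i" and b: "b : carrier B" for k i a b
 proof (cases "i = 0")
  case True
  then have "hcomp A 0 a = a" "hcomp A 1 a = \<zero>\<^bsub>A\<^esub>"
   using a A.hcomp_grade_same[of a 0] A.hcomp_grade_other[of a 1] by simp_all
  then show ?thesis
   using True a b by (simp add: \<beta>_def pure_zero_left[of _ act] B.hcomp_closed pure_closed A.grade_carrier)
 next
  case False
  then have "i = 1" using bit_cases by blast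
  then have "hcomp A 1 a = a" "hcomp A 0 a = \<zero>\<^bsub>A\<^esub>"
   using a A.hcomp_grade_same[of a 1] A.hcomp_grade_other[of a 0] by simp_all
  then show ?thesis
   using \<open>i = 1\<close> a b by (simp add: \<beta>_def pure_zero_left[of _ act] B.hcomp_closed pure_closed A.grade_carrier)
 qed
 \<comment> \<open>A scalar of degree \<open>j\<close> shifts components by \<open>j\<close>. When
   it is moved from \<open>a\<close> to \<open>b\<close> this offsets the change in the degree of
   \<open>a\<close>: modulo 2, \<open>k + (i + j) + j = k + i\<close>.\<close>
 have smult_hcomp: "hcomp B (l + j) (r \<odot>\<^bsub>B\<^esub> b) = r \<odot>\<^bsub>B\<^esub> hcomp B l b"
  if "r : grade R j" "b : carrier B" for r j b l
 proof (rule B.hcomp_eqI)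
  show "r \<odot>\<^bsub>B\<^esub> b = r \<odot>\<^bsub>B\<^esub> hcomp B l b \<oplus>\<^bsub>B\<^esub> r \<odot>\<^bsub>B\<^esub> hcomp B (l + 1) b"
   using smult_right_distr[OF that(1), of "hcomp B l b" "hcomp B (l + 1) b"] that(2)
    B.hcomp_closed B.hcomp_props(2)[OF that(2), of l] by simp
  show "r \<odot>\<^bsub>B\<^esub> hcomp B (l + 1) b : grade B (l + j + 1)"
   using grade_smult_right[OF that(1) B.hcomp_props(1)[OF that(2), of "l + 1"]] by (simp only: ac_simps)
 qed (use that grade_smult_right B.hcomp_props in blast)
 have "balanced R A B ?T (\<beta> k)" for k
  unfolding balanced_def
 proof (intro conjI ballI allI impI)
  fix b assume "b : carrier B"
  then show "addmap A ?T (\<lambda>a. \<beta> k a b)"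
   unfolding \<beta>_def
   by (intro addmap_pointwise_add abelian_group_tensor
     addmap_comp[OF A.additive_hcomp additive_pure_left] B.hcomp_closed)
 next
  fix a assume "a : carrier A"
  then show "addmap B ?T (\<beta> k a)"
   unfolding \<beta>_def
   by (intro addmap_pointwise_add abelian_group_tensor
     addmap_comp[OF B.additive_hcomp additive_pure_right] A.hcomp_closed)
 next
  fix i j a r b assume *: "a : grade A i \<and> r : grade R j \<and> b : carrier B"
  then have "r \<odot>\<^bsub>A\<^esub> a : grade A (i + j)" using grade_smult_left by blast
  then have ra: "koszul A i j (r \<odot>\<^bsub>A\<^esub> a) : grade A (i + j)"
   using A.grade_neg unfolding koszul_def by presburger
  have "\<beta> k (koszul A i j (r \<odot>\<^bsub>A\<^esub> a)) b = pure (koszul A i j (r \<odot>\<^bsub>A\<^esub> a)) (hcomp B (k + (i + j)) b)"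
   using \<beta>_hom[OF ra] * by blast
  also have "\<dots> = pure a (r \<odot>\<^bsub>B\<^esub> hcomp B (k + (i + j)) b)"
   using pure_smult * B.hcomp_closed by blast
  also have "\<dots> = pure a (hcomp B (k + (i + j) + j) (r \<odot>\<^bsub>B\<^esub> b))"
   using smult_hcomp * by (simp only:)
  also have "k + (i + j) + j = k + i" using bit_cases[of j] by (auto simp: add.assoc)
  also have "pure a (hcomp B (k + i) (r \<odot>\<^bsub>B\<^esub> b)) = \<beta> k a (r \<odot>\<^bsub>B\<^esub> b)"
   using \<beta>_hom * smult_right by auto
  finally show "\<beta> k (koszul A i j (r \<odot>\<^bsub>A\<^esub> a)) b = \<beta> k a (r \<odot>\<^bsub>B\<^esub> b)" .
 qed
 then have "\<exists>\<theta>. addmap ?T ?T \<theta> \<and>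
   (\<forall>a\<in>carrier A. \<forall>b\<in>carrier B. \<theta> (pure a b) = \<beta> k a b)" for k
  using tensor_lift[OF abelian_group_tensor] by metis
 then obtain \<theta> where \<theta>: "\<And>k. addmap ?T ?T (\<theta> k)"
  "\<And>k a b. [|a : carrier A; b : carrier B|] ==> \<theta> k (pure a b) = \<beta> k a b"
  by metis
 have neg_zero: "\<ominus>\<^bsub>?T\<^esub> \<zero>\<^bsub>?T\<^esub> = \<zero>\<^bsub>?T\<^esub>" by (rule T.minus_equality) simp_all
 \<comment> \<open>So \<open>\<theta> l\<close> reads off the component of degree \<open>l\<close>
   from any decomposition, which gives uniqueness below.\<close>
 have \<theta>_grade: "X : carrier ?T \<and> \<theta> l X = (if l = k then X else \<zero>\<^bsub>?T\<^esub>)"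
  if "X : grade ?T k" for X k l
  using gB that
 proof (induction rule: grade_tensor_induct)
  case (pure a b i j)
  have "\<theta> l (pure a b) = pure a (hcomp B (l + i) b)"
   using pure \<theta>(2) \<beta>_hom A.grade_carrier B.grade_carrier by metis
  moreover have "hcomp B (l + i) b = (if l = k then b else \<zero>\<^bsub>B\<^esub>)"
  proof (cases "l = k")
   case True
   then have "l + i = j" using pure(3) bit_cases[of i] bit_cases[of j] by auto
   then show ?thesis using True pure B.hcomp_grade_same by simp
  next
   case False
   then have "j = l + i + 1"
    using pure(3) bit_cases[of i] bit_cases[of j] bit_cases[of l] bit_cases[of k] by auto
   then show ?thesis using False pure B.hcomp_grade_other by simp
  qed
  ultimately show ?case using pure A.grade_carrier pure_zero_right[of a act] by simp
 next
  case (add X Y)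
  then show ?case by (simp add: addmap_add[OF \<theta>(1)])
 next
  case (neg X)
  then show ?case
   by (simp add: addmap_neg[OF \<theta>(1) abelian_group_tensor abelian_group_tensor] neg_zero)
 next
  case zero
  show ?case by (simp add: addmap_zero[OF \<theta>(1) abelian_group_tensor abelian_group_tensor])
 qed
 have sub: "additive_subgroup (grade ?T k) ?T" for k by (rule additive_subgroup_grade_tensor[OF gB])
 have decomp: "\<exists>y z. y : grade ?T 0 \<and> z : grade ?T 1 \<and> X = y \<oplus>\<^bsub>?T\<^esub> z" if "X : carrier ?T" for X
  using that
 proof (induction rule: tensor_induct)
  case (pure a b)
  let ?p = "\<lambda>i j. pure (hcomp A i a) (hcomp B j b)"
  have p: "?p i j : grade ?T (i + j)" for i j
   using pure by (intro pure_grade A.hcomp_props B.hcomp_props)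
  have pc: "?p i j : carrier ?T" for i j
   using pure by (intro pure_closed A.hcomp_closed B.hcomp_closed)
  have "pure x b = pure x (hcomp B 0 b) \<oplus>\<^bsub>?T\<^esub> pure x (hcomp B 1 b)"
   if "x : carrier A" for x
   using pure_add_right[OF that, of "hcomp B 0 b" "hcomp B 1 b" act] pure
   by (simp add: B.hcomp_sum B.hcomp_closed)
  moreover have "pure a b = pure (hcomp A 0 a) b \<oplus>\<^bsub>?T\<^esub> pure (hcomp A 1 a) b"
   using pure_add_left[of "hcomp A 0 a" "hcomp A 1 a" b act] pure
   by (simp add: A.hcomp_sum A.hcomp_closed)
  ultimately have "pure a b = (?p 0 0 \<oplus>\<^bsub>?T\<^esub> ?p 0 1) \<oplus>\<^bsub>?T\<^esub> (?p 1 0 \<oplus>\<^bsub>?T\<^esub> ?p 1 1)"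
   using A.hcomp_closed[OF pure(1)] by metis
  also have "\<dots> = (?p 0 0 \<oplus>\<^bsub>?T\<^esub> ?p 1 1) \<oplus>\<^bsub>?T\<^esub> (?p 0 1 \<oplus>\<^bsub>?T\<^esub> ?p 1 0)"
   using pc[of 0 0] pc[of 0 1] pc[of 1 0] pc[of 1 1] by (simp add: T.a_ac)
  finally have "pure a b = (?p 0 0 \<oplus>\<^bsub>?T\<^esub> ?p 1 1) \<oplus>\<^bsub>?T\<^esub> (?p 0 1 \<oplus>\<^bsub>?T\<^esub> ?p 1 0)" .
  moreover have "?p 0 0 \<oplus>\<^bsub>?T\<^esub> ?p 1 1 : grade ?T 0"
   using p[of 0 0] p[of 1 1] by (intro additive_subgroup.a_closed[OF sub]) simp_all
  moreover have "?p 0 1 \<oplus>\<^bsub>?T\<^esub> ?p 1 0 : grade ?T 1"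
   using p[of 0 1] p[of 1 0] by (intro additive_subgroup.a_closed[OF sub]) simp_all
  ultimately show ?case by blast
 next
  case (add X Y)
  then obtain x0 x1 y0 y1 where xy: "x0 : grade ?T 0" "x1 : grade ?T 1" "X = x0 \<oplus>\<^bsub>?T\<^esub> x1"
   "y0 : grade ?T 0" "y1 : grade ?T 1" "Y = y0 \<oplus>\<^bsub>?T\<^esub> y1"
   by blast
  then have "x0 : carrier ?T" "x1 : carrier ?T" "y0 : carrier ?T" "y1 : carrier ?T"
   using \<theta>_grade by blast+
  then have "X \<oplus>\<^bsub>?T\<^esub> Y = (x0 \<oplus>\<^bsub>?T\<^esub> y0) \<oplus>\<^bsub>?T\<^esub> (x1 \<oplus>\<^bsub>?T\<^esub> y1)"
   using xy(3,6) by (simp add: T.a_ac)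
  then show ?case using xy additive_subgroup.a_closed[OF sub] by blast
 qed
 have "\<exists>!w. fst w : grade ?T 0 \<and> snd w : grade ?T 1 \<and> X = fst w \<oplus>\<^bsub>?T\<^esub> snd w"
  if "X : carrier ?T" for X
 proof -
  have "y = \<theta> 0 X \<and> z = \<theta> 1 X"
   if yz: "y : grade ?T 0" "z : grade ?T 1" "X = y \<oplus>\<^bsub>?T\<^esub> z" for y z
  proof -
   have c: "y : carrier ?T" "z : carrier ?T" using \<theta>_grade yz by blast+
   then show ?thesis
    unfolding yz(3) addmap_add[OF \<theta>(1) c]
    using \<theta>_grade[OF yz(1), of 0] \<theta>_grade[OF yz(1), of 1] \<theta>_grade[OF yz(2), of 0] \<theta>_grade[OF yz(2), of 1]
    by simp
  qed
  then show ?thesis using decomp[OF that] by (metis prod.collapse fst_conv snd_conv)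
 qed
 then show ?thesis
  by (intro graded_group.intro graded_group_axioms.intro abelian_group_tensor)
   (simp add: graded_def sub)
qed

section \<open>Superalgebras over a small algebra\<close>

lemmas (in supermodule) abg = M.abelian_group_axioms

lemma (in superring) graded_group: "graded_group R"
 by (intro graded_group.intro graded_group_axioms.intro graded) (rule is_abelian_group)

lemma (in supermodule) graded_group: "graded_group M"
 by (intro graded_group.intro graded_group_axioms.intro module_graded) (rule M.abelian_group_axioms)

lemma real_alg_simps [simp]:
 "carrier real_alg = UNIV" "x \<otimes>\<^bsub>real_alg\<^esub> y = x * y" "\<one>\<^bsub>real_alg\<^esub> = 1" "\<zero>\<^bsub>real_alg\<^esub> = 0"
 "x \<oplus>\<^bsub>real_alg\<^esub> y = x + y" "grade real_alg i = (if i = 0 then UNIV else {0})"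
 by (simp_all add: real_alg_def)

lemma real_over_simps [simp]:
 "carrier (real_over pr) = UNIV" "x \<otimes>\<^bsub>real_over pr\<^esub> y = x * y" "\<one>\<^bsub>real_over pr\<^esub> = 1"
 "\<zero>\<^bsub>real_over pr\<^esub> = 0" "x \<oplus>\<^bsub>real_over pr\<^esub> y = x + y" "p \<odot>\<^bsub>real_over pr\<^esub> x = pr p * x"
 "grade (real_over pr) i = (if i = 0 then UNIV else {0})"
 by (simp_all add: real_over_def)

lemma abelian_group_real_over: "abelian_group (real_over pr)"
 by (rule abelian_groupI) (auto intro: exI[of _ "- x" for x])

lemma real_over_neg [simp]: "\<ominus>\<^bsub>real_over pr\<^esub> x = - x"
 by (rule abelian_group.minus_equality[OF abelian_group_real_over]) simp_all

lemma additive_subgroup_of_closed: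
 assumes "abelian_group G" "H \<subseteq> carrier G" "\<zero>\<^bsub>G\<^esub> : H"
  "\<And>x y. [|x : H; y : H|] ==> x \<oplus>\<^bsub>G\<^esub> y : H" "\<And>x. x : H ==> \<ominus>\<^bsub>G\<^esub> x : H"
 shows "additive_subgroup H G"
proof (rule additive_subgroupI, rule subgroup.intro)
 show "inv\<^bsub>add_monoid G\<^esub> x : H" if "x : H" for x
  using assms(5)[OF that] by (simp add: a_inv_def)
qed (use assms in simp_all)

lemma graded_group_real_over: "graded_group (real_over pr)"
proof -
 have "additive_subgroup (grade (real_over pr) i) (real_over pr)" for i
  by (rule additive_subgroup_of_closed[OF abelian_group_real_over]) auto
 moreover have "\<exists>!y. fst y : grade (real_over pr) 0 \<and> snd y : grade (real_over pr) 1 \<and> x = fst y + snd y"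
  for x :: real
  by (rule ex1I[of _ "(x, 0)"]) auto
 ultimately show ?thesis
  by (intro graded_group.intro graded_group_axioms.intro abelian_group_real_over)
   (simp add: graded_def)
qed

lemma hcomp_real_over [simp]: "hcomp (real_over pr) i x = (if i = 0 then x else 0)"
 using graded_group.hcomp_grade_same[OF graded_group_real_over, where x = x and i = 0]
  graded_group.hcomp_grade_other[OF graded_group_real_over, where x = x and i = 1] bit_cases[of i] by auto

text \<open>An odd real scalar is zero, so the sign in the last clause of \<open>balanced\<close>
  can only fall on the zero of \<open>A\<close>.\<close>

lemma balanced_realI:
 assumes "abelian_group A" "abelian_group B" "abelian_group G"
  and left: "\<And>b. b : carrier B ==> addmap A G (\<lambda>a. \<beta> a b)"
  and right: "\<And>a. a : carrier A ==> addmap B G (\<beta> a)"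
  and grade: "\<And>i. grade A i \<subseteq> carrier A"
  and zero: "\<And>a. a : carrier A ==> 0 \<odot>\<^bsub>A\<^esub> a = \<zero>\<^bsub>A\<^esub>"
  and smult: "\<And>r a b. [|a : carrier A; b : carrier B|] ==> \<beta> (r \<odot>\<^bsub>A\<^esub> a) b = \<beta> a (r \<odot>\<^bsub>B\<^esub> b)"
 shows "balanced real_alg A B G \<beta>"
 unfolding balanced_def
proof (intro conjI ballI allI impI left right)
 fix i j a b and r :: real
 assume *: "a : grade A i \<and> r : grade real_alg j \<and> b : carrier B"
 then have a: "a : carrier A" using grade by blast
 have "koszul A i j (r \<odot>\<^bsub>A\<^esub> a) = r \<odot>\<^bsub>A\<^esub> a"
 proof (cases "j = 0")
  case False
  then have "r = 0" using * by simp
  moreover have "\<ominus>\<^bsub>A\<^esub> \<zero>\<^bsub>A\<^esub> = \<zero>\<^bsub>A\<^esub>"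
   using abelian_group.minus_equality[OF assms(1), of "\<zero>\<^bsub>A\<^esub>" "\<zero>\<^bsub>A\<^esub>"] abelian_groupE[OF assms(1)] by simp
  ultimately show ?thesis using zero[OF a] by (simp add: koszul_def)
 qed (simp add: koszul_def)
 then show "\<beta> (koszul A i j (r \<odot>\<^bsub>A\<^esub> a)) b = \<beta> a (r \<odot>\<^bsub>B\<^esub> b)"
  using smult[of a b r] a * by simp
qed

text \<open>The axiom speaks of homogeneous \<open>x\<close>; for even \<open>p\<close> it has no
  sign, and the contributions of the two parts of \<open>x\<close> can be added.\<close>

lemma (in superalgebra) smult_mult_r_even:
 assumes "p : grade P 0" "x : carrier A" "y : carrier A"
 shows "x \<otimes> (p \<odot> y) = p \<odot> (x \<otimes> y)"
proof -
 interpret G: graded_group A by (rule A.graded_group)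
 interpret GP: graded_group P by (rule R.graded_group)
 have p: "p : carrier P" using assms(1) by (rule GP.grade_carrier)
 have *: "hcomp A i x \<otimes> (p \<odot> y) = p \<odot> (hcomp A i x \<otimes> y)" for i
  using smult_mult_r[OF assms(1) G.hcomp_props(1)[OF assms(2), of i] assms(3)] by (simp add: koszul_def)
 note c = G.hcomp_closed[OF assms(2)]
 have "x \<otimes> (p \<odot> y) = (hcomp A 0 x \<oplus> hcomp A 1 x) \<otimes> (p \<odot> y)"
  using G.hcomp_sum[OF assms(2)] by simp
 also have "\<dots> = p \<odot> (hcomp A 0 x \<otimes> y) \<oplus> p \<odot> (hcomp A 1 x \<otimes> y)"
  using c assms smult_closed[OF p] by (simp add: A.l_distr *)
 also have "\<dots> = p \<odot> ((hcomp A 0 x \<oplus> hcomp A 1 x) \<otimes> y)"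
  using c assms p by (simp add: A.l_distr smult_r_distr)
 also have "hcomp A 0 x \<oplus> hcomp A 1 x = x" using G.hcomp_sum[OF assms(2)] .
 finally show ?thesis .
qed

lemma (in supermodule) smult_zero_left: "x : carrier M ==> \<zero>\<^bsub>R\<^esub> \<odot> x = \<zero>"
 using smult_l_distr[of "\<zero>\<^bsub>R\<^esub>" "\<zero>\<^bsub>R\<^esub>" x] smult_closed[of "\<zero>\<^bsub>R\<^esub>" x] by simp

lemma (in supermodule) additive_smult: "r : carrier R ==> addmap M M (\<lambda>x. r \<odot> x)"
 by (rule addmapI) (auto simp: smult_closed smult_r_distr)

lemma (in supermodule) additive_smult_left: "x : carrier M ==> addmap R M (\<lambda>r. r \<odot> x)"
 by (rule addmapI) (auto simp: smult_closed smult_l_distr)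

lemma (in supermodule) smult_zero_right: "r : carrier R ==> r \<odot> \<zero> = \<zero>"
 using addmap_zero[OF additive_smult M.abelian_group_axioms M.abelian_group_axioms] .

lemma (in supermodule) smult_neg_left: "[|r : carrier R; x : carrier M|] ==> (\<ominus>\<^bsub>R\<^esub> r) \<odot> x = \<ominus> (r \<odot> x)"
 using addmap_neg[OF additive_smult_left R.is_abelian_group M.abelian_group_axioms] .

lemma (in supermodule) smult_neg_right: "[|r : carrier R; x : carrier M|] ==> r \<odot> (\<ominus> x) = \<ominus> (r \<odot> x)"
 using addmap_neg[OF additive_smult M.abelian_group_axioms M.abelian_group_axioms] .

locale small_alg =
 fixes P :: "(real, 'p) gmodule" and pr :: "'p \<Rightarrow> real"
 assumes small: "small_algebra P pr"
begin

lemma superalgebra_P: "superalgebra real_alg P"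
 using small by (simp add: small_algebra_def)

sublocale P: superalgebra real_alg P by (rule superalgebra_P)

sublocale PG: graded_group P by (rule P.A.graded_group)

lemma pr_hom: "pr : ring_hom P real_alg"
 using small by (simp add: small_algebra_def)

lemma pr_add: "[|x : carrier P; y : carrier P|] ==> pr (x \<oplus>\<^bsub>P\<^esub> y) = pr x + pr y"
 using ring_hom_add[OF pr_hom] by simp

lemma pr_mult: "[|x : carrier P; y : carrier P|] ==> pr (x \<otimes>\<^bsub>P\<^esub> y) = pr x * pr y"
 using ring_hom_mult[OF pr_hom] by simp

lemma pr_one: "pr \<one>\<^bsub>P\<^esub> = 1"
 using ring_hom_one[OF pr_hom] by simp

lemma pr_smult: "x : carrier P ==> pr (c \<odot>\<^bsub>P\<^esub> x) = c * pr x"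
 using small by (simp add: small_algebra_def)

lemma pr_zero: "pr \<zero>\<^bsub>P\<^esub> = 0"
 using pr_add[of "\<zero>\<^bsub>P\<^esub>" "\<zero>\<^bsub>P\<^esub>"] by simp

lemma pr_neg: "x : carrier P ==> pr (\<ominus>\<^bsub>P\<^esub> x) = - pr x"
 using pr_add[of x "\<ominus>\<^bsub>P\<^esub> x"] pr_zero by (simp add: P.M.r_neg)

text \<open>Supercommutativity gives \<open>x x = - x x\<close>, so the square of the real number
  \<open>pr x\<close> is zero.\<close>

lemma pr_odd: assumes "x : grade P 1" shows "pr x = 0"
proof -
 have x: "x : carrier P" using assms by (rule PG.grade_carrier)
 have "x \<otimes>\<^bsub>P\<^esub> x = \<ominus>\<^bsub>P\<^esub> (x \<otimes>\<^bsub>P\<^esub> x)"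
  using P.A.supercommutative[OF assms assms] by (simp add: koszul_def)
 then have "pr (x \<otimes>\<^bsub>P\<^esub> x) = - pr (x \<otimes>\<^bsub>P\<^esub> x)" using pr_neg[of "x \<otimes>\<^bsub>P\<^esub> x"] x by simp
 then show ?thesis using pr_mult[OF x x] by simp
qed

text \<open>The unit map of the real algebra \<open>P\<close>; it splits the projection
  \<open>pr\<close>.\<close>

definition sc :: "real \<Rightarrow> 'p" where "sc c = c \<odot>\<^bsub>P\<^esub> \<one>\<^bsub>P\<^esub>"

lemma sc_even: "sc c : grade P 0"
 using P.grade_smult[of c 0 "\<one>\<^bsub>P\<^esub>" 0] P.A.one_even by (simp add: sc_def)

lemma sc_closed [simp]: "sc c : carrier P"
 using sc_even by (rule PG.grade_carrier)

lemma pr_sc [simp]: "pr (sc c) = c"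
 by (simp add: sc_def pr_smult pr_one)

lemma sc_add: "sc (c + d) = sc c \<oplus>\<^bsub>P\<^esub> sc d"
 using P.smult_l_distr[of c d "\<one>\<^bsub>P\<^esub>"] by (simp add: sc_def)

lemma sc_one [simp]: "sc 1 = \<one>\<^bsub>P\<^esub>"
 using P.smult_one[of "\<one>\<^bsub>P\<^esub>"] by (simp add: sc_def)

lemma smult_sc: "x : carrier P ==> c \<odot>\<^bsub>P\<^esub> x = sc c \<otimes>\<^bsub>P\<^esub> x"
 using P.smult_mult_l[of c "\<one>\<^bsub>P\<^esub>" x] by (simp add: sc_def)

lemma sc_mult: "sc (c * d) = sc c \<otimes>\<^bsub>P\<^esub> sc d"
 using P.smult_assoc[of c d "\<one>\<^bsub>P\<^esub>"] smult_sc[of "sc d" c] sc_closed[of d] by (simp add: sc_def)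

lemma sc_zero [simp]: "sc 0 = \<zero>\<^bsub>P\<^esub>"
 using P.smult_zero_left[of "\<one>\<^bsub>P\<^esub>"] by (simp add: sc_def)

definition nil :: "'p set" where "nil = {x : carrier P. pr x = 0}"

lemma nil_carrier: "x : nil ==> x : carrier P"
 by (simp add: nil_def)

text \<open>By \<open>pr_odd\<close> the odd component has value zero, so the even one carries the
  whole value of \<open>pr x\<close>.\<close>

lemma nil_hcomp: "x : nil ==> hcomp P i x : nil"
 using pr_odd[of "hcomp P 1 x"] PG.hcomp_props(1)[of x 1] PG.hcomp_closed[of x]
  pr_add[of "hcomp P 0 x" "hcomp P 1 x"] PG.hcomp_sum[of x] bit_cases[of i]
 by (auto simp: nil_def)

lemma split_nil:
 assumes "p : carrier P"
 obtains n where "n : nil" "p = sc (pr p) \<oplus>\<^bsub>P\<^esub> n"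
proof (rule that)
 show "p \<ominus>\<^bsub>P\<^esub> sc (pr p) : nil"
  using assms by (simp add: nil_def a_minus_def pr_add pr_neg)
 show "p = sc (pr p) \<oplus>\<^bsub>P\<^esub> (p \<ominus>\<^bsub>P\<^esub> sc (pr p))"
  using assms by (simp add: a_minus_def P.M.a_lcomm P.M.r_neg)
qed

lemma nilpotent: "\<exists>k. \<forall>xs. length xs = k \<and> set xs \<subseteq> nil \<longrightarrow> foldr (\<otimes>\<^bsub>P\<^esub>) xs \<one>\<^bsub>P\<^esub> = \<zero>\<^bsub>P\<^esub>"
proof -
 have "nil = a_kernel P real_alg pr" by (auto simp: nil_def a_kernel_def')
 then show ?thesis using small by (simp add: small_algebra_def)
qed

end

text \<open>The algebra of sections over a single open set. \<open>B\<close> is its relative body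
  and \<open>br f = 1 \<otimes> f\<close> the projection onto it.\<close>

locale algebra_over = small_alg P pr + A: superalgebra P A
 for P :: "(real, 'p) gmodule" and pr and A :: "('p, 'a) gmodule"
begin

sublocale AG: graded_group A by (rule A.A.graded_group)

lemma smult_conv_mult: "[|p : carrier P; f : carrier A|] ==> p \<odot>\<^bsub>A\<^esub> f = (p \<odot>\<^bsub>A\<^esub> \<one>\<^bsub>A\<^esub>) \<otimes>\<^bsub>A\<^esub> f"
 using A.smult_mult_l[of p "\<one>\<^bsub>A\<^esub>" f] by simp

abbreviation B where "B \<equiv> left_tensor P (real_over pr) A (*)"
abbreviation br where "br \<equiv> pure_tensor P (real_over pr) A 1"

sublocale body: graded_pair P "real_over pr" A
proof (intro graded_pair.intro tensor_pair.intro graded_pair_axioms.intro abelian_group_real_over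
  graded_group_real_over AG.graded_group_axioms A.abg)
 show "grade (real_over pr) i \<subseteq> carrier (real_over pr)" for i by simp
 show "r \<odot>\<^bsub>A\<^esub> b : carrier A" if "r : grade P j" "b : carrier A" for r j b
  using that PG.grade_carrier A.smult_closed by blast
 \<comment> \<open>An odd \<open>r\<close> acts by \<open>pr r = 0\<close>, so the result does lie
   in the other degree.\<close>
 show "r \<odot>\<^bsub>real_over pr\<^esub> a : grade (real_over pr) (i + j)"
  if "r : grade P j" "a : grade (real_over pr) i" for r j a i
  using that pr_odd bit_cases[of i] bit_cases[of j] by (auto split: if_splits)
 show "r \<odot>\<^bsub>A\<^esub> b : grade A (i + j)" if "r : grade P j" "b : grade A i" for r j b i
  unfolding add.commute[of i j] by (rule A.grade_smult[OF that])
 show "r \<odot>\<^bsub>A\<^esub> (b \<oplus>\<^bsub>A\<^esub> b') = r \<odot>\<^bsub>A\<^esub> b \<oplus>\<^bsub>A\<^esub> r \<odot>\<^bsub>A\<^esub> b'"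
  if "r : grade P j" "b : carrier A" "b' : carrier A" for r j b b'
  using that PG.grade_carrier A.smult_r_distr by blast
qed simp_all

sublocale BG: graded_group B
 unfolding left_tensor_def by (rule body.graded_group_tensor)

lemma br_additive: "addmap A B br"
 unfolding left_tensor_def by (rule body.additive_pure_right) simp

lemma br_closed: "f : carrier A ==> br f : carrier B"
 by (rule addmap_closed[OF br_additive])

text \<open>For homogeneous \<open>p\<close> this is a defining relation, without sign because the
  left factor is even; both sides are additive in \<open>p\<close>.\<close>

lemma pure_smult_P:
 assumes "p : carrier P" "f : carrier A"
 shows "pure_tensor P (real_over pr) A x (p \<odot>\<^bsub>A\<^esub> f) = pure_tensor P (real_over pr) A (pr p * x) f"
proof -
 have *: "pure_tensor P (real_over pr) A x (q \<odot>\<^bsub>A\<^esub> f) = pure_tensor P (real_over pr) A (pr q * x) f"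
  if "q : grade P j" for q j
  using body.pure_smult[of x 0 q j f] that assms by (simp add: koszul_def)
 have "addmap P B (\<lambda>p. pure_tensor P (real_over pr) A x (p \<odot>\<^bsub>A\<^esub> f))"
  unfolding left_tensor_def
  by (rule addmap_comp[OF A.additive_smult_left body.additive_pure_right]) (use assms in simp_all)
 moreover have "addmap P B (\<lambda>p. pure_tensor P (real_over pr) A (pr p * x) f)"
  unfolding left_tensor_def
  by (rule addmap_comp[of _ "real_over pr" "\<lambda>p. pr p * x", OF _ body.additive_pure_left])
   (use assms in \<open>auto simp: addmap_def pr_add distrib_right\<close>)
 ultimately have "addmap P B (\<lambda>p. pure_tensor P (real_over pr) A x (p \<odot>\<^bsub>A\<^esub> f))"
  "addmap P B (\<lambda>p. pure_tensor P (real_over pr) A (pr p * x) f)" by blast+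
 note add = this[THEN addmap_add, OF PG.hcomp_closed[OF assms(1), of 0] PG.hcomp_closed[OF assms(1), of 1],
   unfolded PG.hcomp_sum[OF assms(1)]]
 show ?thesis
  unfolding add using *[OF PG.hcomp_props(1)[OF assms(1)]] by simp
qed

lemma pure_conv_br: "f : carrier A ==> pure_tensor P (real_over pr) A x f = br (sc x \<odot>\<^bsub>A\<^esub> f)"
 using pure_smult_P[of "sc x" f 1] by simp

lemma br_smult: "[|p : carrier P; f : carrier A|] ==> br (p \<odot>\<^bsub>A\<^esub> f) = br (sc (pr p) \<odot>\<^bsub>A\<^esub> f)"
 using pure_smult_P[of p f 1] pure_conv_br[of f "pr p"] by simp

text \<open>The left factor can be absorbed, \<open>x \<otimes> f = 1 \<otimes> sc x f\<close>.
  Identities in \<open>B\<close> are from here on reduced to identities in \<open>A\<close>.\<close>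

lemma br_surj:
 assumes "X : carrier B"
 obtains f where "f : carrier A" "X = br f"
proof -
 have "\<exists>f\<in>carrier A. X = br f"
  using assms unfolding left_tensor_def
 proof (induction rule: body.tensor_induct)
  case (pure x f)
  show ?case
   by (rule bexI, rule pure_conv_br[OF pure(2)], rule A.smult_closed[OF sc_closed pure(2)])
 next
  case (add X Y)
  from add(3) obtain f where f: "f : carrier A" "X = br f" by (rule bexE)
  from add(4) obtain g where g: "g : carrier A" "Y = br g" by (rule bexE)
  show ?case
   by (rule bexI[of _ "f \<oplus>\<^bsub>A\<^esub> g"])
    (use f g addmap_add[OF br_additive, of f g] in \<open>simp_all add: left_tensor_def\<close>)
 qed
 then show ?thesis using that by blast
qed

lemma br_nil: "[|p : nil; f : carrier A|] ==> br (p \<odot>\<^bsub>A\<^esub> f) = \<zero>\<^bsub>B\<^esub>"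
 using br_smult[of p f] addmap_zero[OF br_additive A.abg BG.abg]
 by (simp add: nil_def A.smult_zero_left)

lemma br_grade: "f : grade A k ==> br f : grade B k"
 unfolding left_tensor_def using body.pure_grade[of 1 0 f k] by (simp only: add_0_left) simp

lemma hcomp_br: "f : carrier A ==> hcomp B k (br f) = br (hcomp A k f)"
 by (rule AG.hcomp_commute[OF BG.graded_group_axioms br_additive br_grade])

lemma grade_B_lift:
 assumes "X : grade B k"
 obtains f where "f : grade A k" "X = br f"
proof -
 obtain f where f: "f : carrier A" "X = br f"
  using assms BG.grade_carrier br_surj by metis
 then have "X = br (hcomp A k f)"
  using BG.hcomp_grade_same[OF assms] hcomp_br by simp
 then show ?thesis using that f AG.hcomp_props(1) by blast
qed

lemma smult_B: "f : carrier A ==> c \<odot>\<^bsub>B\<^esub> br f = br (sc c \<odot>\<^bsub>A\<^esub> f)"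
proof -
 assume f: "f : carrier A"
 have "balanced P (real_over pr) A (tensor P (real_over pr) A (\<lambda>s. tensor_map P (real_over pr) A ((*) s) id))
  (\<lambda>x f. pure_tensor P (real_over pr) A (c * x) (id f))"
  unfolding balanced_def
 proof (intro conjI ballI allI impI)
  fix f assume "f : carrier A"
  then show "addmap (real_over pr) (tensor P (real_over pr) A (\<lambda>s. tensor_map P (real_over pr) A ((*) s) id))
    (\<lambda>x. pure_tensor P (real_over pr) A (c * x) (id f))"
   by (intro addmap_comp[of _ "real_over pr" "(*) c", OF _ body.additive_pure_left])
    (auto simp: addmap_def distrib_left)
 next
  fix i j x p f assume *: "x : grade (real_over pr) i \<and> p : grade P j \<and> f : carrier A"
  then show "pure_tensor P (real_over pr) A (c * koszul (real_over pr) i j (p \<odot>\<^bsub>real_over pr\<^esub> x)) (id f) =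
    pure_tensor P (real_over pr) A (c * x) (id (p \<odot>\<^bsub>A\<^esub> f))"
   using pure_smult_P[of p f "c * x"] PG.grade_carrier
   by (auto simp: koszul_def ac_simps split: if_splits)
 qed (use body.additive_pure_right in simp)
 then have "tensor_map P (real_over pr) A ((*) c) id (br f) = pure_tensor P (real_over pr) A (c * 1) (id f)"
  by (rule body.tensor_map_eval(2)[OF body.tensor_pair_axioms, rotated 2]) (use f in simp_all)
 then show "c \<odot>\<^bsub>B\<^esub> br f = br (sc c \<odot>\<^bsub>A\<^esub> f)"
  using pure_conv_br[OF f, of c] by (simp add: left_tensor_def tensor_def)
qed

lemma hcomp_mult_smult:
 assumes "p : grade P j" "d : carrier A" "b : carrier A"
 shows "pr p = 0 \<or> d \<otimes>\<^bsub>A\<^esub> (p \<odot>\<^bsub>A\<^esub> b) = p \<odot>\<^bsub>A\<^esub> (d \<otimes>\<^bsub>A\<^esub> b)"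
 using A.smult_mult_r_even[of p d b] assms pr_odd[of p] bit_cases[of j] by auto

text \<open>The homogeneous parts of \<open>p\<close> can be moved past those of \<open>d\<close> up
  to sign. Once in front, each is replaced by its value under \<open>pr\<close>, which is
  zero.\<close>

lemma br_mult_nil:
 assumes "p : nil" "d : carrier A" "b : carrier A"
 shows "pure_tensor P (real_over pr) A x (d \<otimes>\<^bsub>A\<^esub> (p \<odot>\<^bsub>A\<^esub> b)) = \<zero>\<^bsub>B\<^esub>"
proof -
 have zero: "pure_tensor P (real_over pr) A x (q \<odot>\<^bsub>A\<^esub> f) = \<zero>\<^bsub>B\<^esub>" if "q : nil" "f : carrier A" for q f
  using pure_smult_P[of q f x] body.pure_zero_left[OF that(2)] that by (simp add: nil_def left_tensor_def)
 have *: "pure_tensor P (real_over pr) A x (d' \<otimes>\<^bsub>A\<^esub> (q \<odot>\<^bsub>A\<^esub> b)) = \<zero>\<^bsub>B\<^esub>"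
  if "q : grade P j" "q : nil" "d' : grade A i" for q j d' i
 proof -
  have d: "d' : carrier A" and q: "q : carrier P" using that AG.grade_carrier nil_carrier by blast+
  have "d' \<otimes>\<^bsub>A\<^esub> (q \<odot>\<^bsub>A\<^esub> b) = q \<odot>\<^bsub>A\<^esub> (d' \<otimes>\<^bsub>A\<^esub> b) \<or> d' \<otimes>\<^bsub>A\<^esub> (q \<odot>\<^bsub>A\<^esub> b) = q \<odot>\<^bsub>A\<^esub> (\<ominus>\<^bsub>A\<^esub> (d' \<otimes>\<^bsub>A\<^esub> b))"
   using A.smult_mult_r[OF that(1,3) assms(3)] d q assms by (auto simp: koszul_def A.smult_neg_right)
  then show ?thesis using zero[OF that(2)] d assms by auto
 qed
 note c = AG.hcomp_closed[OF assms(2)] PG.hcomp_closed[OF nil_carrier[OF assms(1)]]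
 have "d \<otimes>\<^bsub>A\<^esub> (p \<odot>\<^bsub>A\<^esub> b) = (hcomp A 0 d \<oplus>\<^bsub>A\<^esub> hcomp A 1 d) \<otimes>\<^bsub>A\<^esub> ((hcomp P 0 p \<oplus>\<^bsub>P\<^esub> hcomp P 1 p) \<odot>\<^bsub>A\<^esub> b)"
  using assms AG.hcomp_sum PG.hcomp_sum nil_carrier by simp
 also have "\<dots> = (hcomp A 0 d \<otimes>\<^bsub>A\<^esub> (hcomp P 0 p \<odot>\<^bsub>A\<^esub> b) \<oplus>\<^bsub>A\<^esub> hcomp A 1 d \<otimes>\<^bsub>A\<^esub> (hcomp P 0 p \<odot>\<^bsub>A\<^esub> b)) \<oplus>\<^bsub>A\<^esub>
   (hcomp A 0 d \<otimes>\<^bsub>A\<^esub> (hcomp P 1 p \<odot>\<^bsub>A\<^esub> b) \<oplus>\<^bsub>A\<^esub> hcomp A 1 d \<otimes>\<^bsub>A\<^esub> (hcomp P 1 p \<odot>\<^bsub>A\<^esub> b))"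
  using c assms(3) by (simp add: A.smult_l_distr A.A.l_distr A.A.r_distr A.smult_closed)
 finally have d: "d \<otimes>\<^bsub>A\<^esub> (p \<odot>\<^bsub>A\<^esub> b) = \<dots>" .
 have add: "pure_tensor P (real_over pr) A x (u \<oplus>\<^bsub>A\<^esub> v) =
   pure_tensor P (real_over pr) A x u \<oplus>\<^bsub>B\<^esub> pure_tensor P (real_over pr) A x v"
  if "u : carrier A" "v : carrier A" for u v
  unfolding left_tensor_def by (rule body.pure_add_right) (use that in simp_all)
 have t: "hcomp A i d \<otimes>\<^bsub>A\<^esub> (hcomp P j p \<odot>\<^bsub>A\<^esub> b) : carrier A" for i j
  using c assms(3) A.smult_closed by simp
 show ?thesis
  unfolding d
  using *[OF PG.hcomp_props(1)[OF nil_carrier[OF assms(1)]] nil_hcomp[OF assms(1)] AG.hcomp_props(1)[OF assms(2)]]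
  by (simp only: add t A.M.a_closed BG.M.l_zero BG.M.zero_closed)
qed

lemma tensor_prod_body:
 assumes "f : carrier A" "g : carrier A"
 shows "br f \<otimes>\<^bsub>B\<^esub> br g = br (f \<otimes>\<^bsub>A\<^esub> g)"
proof -
 let ?pt = "pure_tensor P (real_over pr) A"
 define act where "act = (\<lambda>s. tensor_map P (real_over pr) A ((*) s) id)"
 let ?T = "tensor P (real_over pr) A act"
 have B: "B = ?T" by (simp add: left_tensor_def act_def)
 interpret T: abelian_group ?T by (rule body.abelian_group_tensor)
 \<comment> \<open>The product on \<open>B\<close> carries no sign: the odd part of
   \<open>real_over pr\<close> is zero, so only the terms with \<open>i = 0\<close> survive.\<close>
 let ?K = "\<lambda>c d a b. ?pt (c * a) (d \<otimes>\<^bsub>A\<^esub> b)"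
 have k: "(\<Sum>i\<in>UNIV. \<Sum>j\<in>UNIV. frag_cmul (koszul_int j i)
    (frag_of (c * hcomp (real_over pr) i a, hcomp A j d \<otimes>\<^bsub>A\<^esub> b))) : carrier (tensor_free (real_over pr) A) \<and>
   tensor_class P (real_over pr) A (\<Sum>i\<in>UNIV. \<Sum>j\<in>UNIV. frag_cmul (koszul_int j i)
    (frag_of (c * hcomp (real_over pr) i a, hcomp A j d \<otimes>\<^bsub>A\<^esub> b))) = ?K c d a b"
  if "d : carrier A" "b : carrier A" for c d a b
 proof -
  have "hcomp A j d \<otimes>\<^bsub>A\<^esub> b : carrier A" for j using that AG.hcomp_closed by simp
  note ks = body.tensor_class_koszul_sum[of "\<lambda>i. c * hcomp (real_over pr) i a", OF _ this]
  have "hcomp A 0 d \<otimes>\<^bsub>A\<^esub> b \<oplus>\<^bsub>A\<^esub> hcomp A 1 d \<otimes>\<^bsub>A\<^esub> b = d \<otimes>\<^bsub>A\<^esub> b"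
   using that AG.hcomp_closed AG.hcomp_sum A.A.l_distr[of "hcomp A 0 d" "hcomp A 1 d" b] by simp
  moreover have "?pt 0 y = \<zero>\<^bsub>?T\<^esub>" if "y : carrier A" for y
   using body.pure_zero_left[OF that] by simp
  ultimately show ?thesis
   using ks(1) ks(2)[where act = act] that AG.hcomp_closed body.pure_closed[of "c * a" "d \<otimes>\<^bsub>A\<^esub> b" act]
   by simp
 qed
 have add_l: "addmap (real_over pr) ?T (\<lambda>x. ?pt (h x) y)"
  if "y : carrier A" "\<And>x x'. h (x + x') = h x + h x'" for h y
  by (rule addmap_comp[OF _ body.additive_pure_left[OF that(1)]])
   (use that(2) in \<open>simp add: addmap_def\<close>)
 have add_r: "addmap A ?T (\<lambda>y. ?pt x (h y))" if "addmap A A h" for h x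
  by (rule addmap_comp[OF that body.additive_pure_right]) simp
 have add_mult_l: "addmap A A (\<lambda>d. d \<otimes>\<^bsub>A\<^esub> b)" if "b : carrier A" for b
  using that by (intro addmapI) (simp_all add: A.A.l_distr)
 have add_mult_r: "addmap A A (\<lambda>b. d \<otimes>\<^bsub>A\<^esub> b)" if "d : carrier A" for d
  using that by (intro addmapI) (simp_all add: A.A.r_distr)
 have kz: "koszul (real_over pr) i j (p \<odot>\<^bsub>real_over pr\<^esub> x) = pr p * x" if "x : grade (real_over pr) i" for i j p x
  using that by (auto simp: koszul_def split: if_splits)
 have bal1: "balanced P (real_over pr) A ?T (?K c d)" if d: "d : carrier A" for c d
  unfolding balanced_def
 proof (intro conjI ballI allI impI)
  fix i j a p b assume *: "a : grade (real_over pr) i \<and> p : grade P j \<and> b : carrier A"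
  then have p: "p : carrier P" using PG.grade_carrier by blast
  show "?K c d (koszul (real_over pr) i j (p \<odot>\<^bsub>real_over pr\<^esub> a)) b = ?K c d a (p \<odot>\<^bsub>A\<^esub> b)"
  \<comment> \<open>An even \<open>p\<close> passes \<open>d\<close> freely. An odd \<open>p\<close>
    may pick up a sign, but then \<open>pr p = 0\<close> and both sides vanish.\<close>
  proof (cases "pr p = 0")
   case True
   then have "p : nil" using p by (simp add: nil_def)
   then have "?K c d a (p \<odot>\<^bsub>A\<^esub> b) = \<zero>\<^bsub>?T\<^esub>" using br_mult_nil d * B by simp
   then show ?thesis
    using True * kz[of a i j p] body.pure_zero_left[of "d \<otimes>\<^bsub>A\<^esub> b" act] d by simp
  next
   case False
   then have "d \<otimes>\<^bsub>A\<^esub> (p \<odot>\<^bsub>A\<^esub> b) = p \<odot>\<^bsub>A\<^esub> (d \<otimes>\<^bsub>A\<^esub> b)"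
    using hcomp_mult_smult[of p j d b] * d by blast
   then show ?thesis
    using pure_smult_P[of p "d \<otimes>\<^bsub>A\<^esub> b" "c * a"] p d * kz[of a i j p] by (simp add: ac_simps)
  qed
 qed (use d in \<open>auto intro!: add_l add_r add_mult_r simp: distrib_left\<close>)
 have bal2: "balanced P (real_over pr) A ?T (\<lambda>c d. ?K c d a b)" if b: "b : carrier A" for a b
  unfolding balanced_def
 proof (intro conjI ballI allI impI)
  fix i j c p d assume *: "c : grade (real_over pr) i \<and> p : grade P j \<and> d : carrier A"
  then have p: "p : carrier P" using PG.grade_carrier by blast
  show "?K (koszul (real_over pr) i j (p \<odot>\<^bsub>real_over pr\<^esub> c)) d a b = ?K c (p \<odot>\<^bsub>A\<^esub> d) a b"
   using pure_smult_P[of p "d \<otimes>\<^bsub>A\<^esub> b" "c * a"] p * b kz[of c i j p]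
   by (simp add: A.smult_mult_l ac_simps)
 qed (use b in \<open>auto intro!: add_l add_r add_mult_l simp: distrib_right\<close>)
 have "tensor_prod P (real_over pr) A A (*) (\<otimes>\<^bsub>A\<^esub>) (br f) (br g) = ?K 1 f 1 g"
  by (rule body.tensor_prod_eval(3)[OF body.tensor_pair_axioms _ bal1 bal2]) (use k assms in simp_all)
 moreover have "monoid.mult (real_over pr) = (*)" by (simp add: real_over_def)
 ultimately show ?thesis by (simp add: left_tensor_def tensor_def)
qed

lemma one_B: "\<one>\<^bsub>B\<^esub> = br \<one>\<^bsub>A\<^esub>"
 by (simp add: left_tensor_def tensor_def)

end

section \<open>A basis of a small algebra\<close>

context small_alg begin

definition functional :: "('p \<Rightarrow> real) \<Rightarrow> bool" where
 "functional c \<longleftrightarrow> (\<forall>x\<in>carrier P. \<forall>y\<in>carrier P. c (x \<oplus>\<^bsub>P\<^esub> y) = c x + c y) \<and>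
  (\<forall>r. \<forall>x\<in>carrier P. c (r \<odot>\<^bsub>P\<^esub> x) = r * c x)"

lemma functional_pr: "functional pr"
 by (simp add: functional_def pr_add pr_smult)

lemma real_smult_closed: "x : carrier P ==> r \<odot>\<^bsub>P\<^esub> x : carrier P"
 using P.smult_closed by simp

lemma real_smult_finsum:
 "f : J \<rightarrow> carrier P ==> r \<odot>\<^bsub>P\<^esub> (\<Oplus>\<^bsub>P\<^esub>j\<in>J. f j) = (\<Oplus>\<^bsub>P\<^esub>j\<in>J. r \<odot>\<^bsub>P\<^esub> f j)"
 using addmap_finsum[OF P.additive_smult P.abg P.abg, of r f J] by simp

definition lin :: "('p \<Rightarrow> real) \<Rightarrow> 'p set \<Rightarrow> 'p" where "lin a J = (\<Oplus>\<^bsub>P\<^esub>j\<in>J. a j \<odot>\<^bsub>P\<^esub> j)"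

lemma lin_closed: "J \<subseteq> carrier P ==> lin a J : carrier P"
 unfolding lin_def by (intro P.M.finsum_closed) (auto simp: real_smult_closed)

lemma lin_add:
 "J \<subseteq> carrier P ==> lin (\<lambda>j. a j + b j) J = lin a J \<oplus>\<^bsub>P\<^esub> lin b J"
 unfolding lin_def
 by (subst P.M.finsum_addf[symmetric])
  (auto simp: real_smult_closed P.smult_l_distr[simplified] intro!: P.M.finsum_cong')

lemma lin_smult:
 "J \<subseteq> carrier P ==> lin (\<lambda>j. r * a j) J = r \<odot>\<^bsub>P\<^esub> lin a J"
 unfolding lin_def
 by (subst real_smult_finsum)
  (auto simp: real_smult_closed P.smult_assoc[simplified] intro!: P.M.finsum_cong')

lemma lin_insert:
 "[|J \<subseteq> carrier P; x : carrier P; finite J; x \<notin> J|] ==> lin a (insert x J) = a x \<odot>\<^bsub>P\<^esub> x \<oplus>\<^bsub>P\<^esub> lin a J"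
 unfolding lin_def by (subst P.M.finsum_insert) (auto simp: real_smult_closed)

text \<open>A real basis with its dual functionals, adapted to the splitting of \<open>P\<close>
  into the reals and \<open>nil\<close>. A finite spanning set is moved into \<open>nil\<close> by
  subtracting \<open>sc (pr s)\<close> from each \<open>s\<close>. Among the finite subsets of
  \<open>nil\<close> that span together with 1, one of least cardinality is then linearly
  independent together with 1. The special shape matters in \<open>S_near\<close>, where all terms
  of an expansion except that of 1 must lie in \<open>nil E\<close>.\<close>

lemma basis:
 obtains J c where "finite J" "J \<subseteq> carrier P" "\<one>\<^bsub>P\<^esub> : J" "J - {\<one>\<^bsub>P\<^esub>} \<subseteq> nil"
  "\<And>j. j : J ==> functional (c j)" "\<And>i j. [|i : J; j : J|] ==> c i j = (if i = j then 1 else 0)"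
  "\<And>x. x : carrier P ==> x = (\<Oplus>\<^bsub>P\<^esub>j\<in>J. c j x \<odot>\<^bsub>P\<^esub> j)"
proof -
 define spans where "spans J \<longleftrightarrow> (\<forall>x\<in>carrier P. \<exists>a. x = lin a J)" for J
 obtain S where S: "finite S" "S \<subseteq> carrier P" "spans S"
  using small unfolding small_algebra_def spans_def lin_def by metis
 have one_notin: "\<one>\<^bsub>P\<^esub> \<notin> nil" by (simp add: nil_def pr_one)
 have lin_cong: "lin a J = lin b J" if "J \<subseteq> carrier P" "\<And>j. j : J ==> a j = b j" for a b J
  unfolding lin_def by (rule P.M.finsum_cong') (use that in \<open>auto simp: real_smult_closed\<close>)
 let ?Q = "\<lambda>N. finite N \<and> N \<subseteq> nil \<and> spans (insert \<one>\<^bsub>P\<^esub> N)"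
 have span_mem: "spans J" if J: "finite J" "J \<subseteq> carrier P" and mem: "\<And>s. s : S' ==> \<exists>a. s = lin a J"
  and S': "finite S'" "S' \<subseteq> carrier P" "spans S'" for J S'
 proof -
  have "\<exists>b. lin a S'' = lin b J" if "finite S''" "S'' \<subseteq> S'" for a S''
   using that
  proof (induction S'')
   case empty
   have "lin (\<lambda>_. 0) J = \<zero>\<^bsub>P\<^esub>"
    using lin_smult[OF J(2), of 0 "\<lambda>_. 0"] P.smult_zero_left[OF lin_closed[OF J(2)]] by simp
   then show ?case by (metis lin_def P.M.finsum_empty)
  next
   case (insert s S'')
   then obtain b e where be: "lin a S'' = lin b J" "s = lin e J" using mem by blast
   have "lin a (insert s S'') = a s \<odot>\<^bsub>P\<^esub> s \<oplus>\<^bsub>P\<^esub> lin a S''"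
    using insert S' by (intro lin_insert) auto
   also have "\<dots> = lin (\<lambda>j. a s * e j + b j) J"
    using be J(2) by (simp add: lin_add lin_smult)
   finally show ?case by blast
  qed
  then show ?thesis using S'(1,3) unfolding spans_def by (metis order_refl)
 qed
 have "?Q ((\<lambda>s. s \<ominus>\<^bsub>P\<^esub> sc (pr s)) ` S)"
 proof (intro conjI)
  let ?N = "(\<lambda>s. s \<ominus>\<^bsub>P\<^esub> sc (pr s)) ` S"
  show fin: "finite ?N" using S(1) by simp
  show nil: "?N \<subseteq> nil"
   using S(2) by (auto simp: nil_def a_minus_def pr_add pr_neg)
  have sub: "?N \<subseteq> carrier P" using nil nil_carrier by blast
  show "spans (insert \<one>\<^bsub>P\<^esub> ?N)"
  proof (rule span_mem[OF _ _ _ S])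
   fix s assume s: "s : S"
   let ?n = "s \<ominus>\<^bsub>P\<^esub> sc (pr s)"
   have n: "?n : ?N" using s by (rule imageI)
   then have n: "?n : ?N" "?n : carrier P" using sub by (simp_all only: subsetD)
   \<comment> \<open>These coefficients express \<open>s = sc (pr s) + (s - sc (pr s))\<close>; they
     do not collide, because 1 is not in \<open>nil\<close>.\<close>
   define a where "a j = (if j = \<one>\<^bsub>P\<^esub> then pr s else if j = ?n then 1 else 0)" for j
   have "?n : nil" by (rule subsetD[OF nil n(1)])
   then have ne: "?n \<noteq> \<one>\<^bsub>P\<^esub>" using one_notin by metis
   have "lin a (?N - {?n}) = lin (\<lambda>j. 0 * a j) (?N - {?n})"
    by (rule lin_cong) (use sub nil one_notin in \<open>auto simp: a_def\<close>)
   also have "\<dots> = \<zero>\<^bsub>P\<^esub>"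
    using lin_smult[of "?N - {?n}" 0 a] P.smult_zero_left[OF lin_closed, of "?N - {?n}" a] sub by simp blast
   finally have 0: "lin a (?N - {?n}) = \<zero>\<^bsub>P\<^esub>" .
   have "lin a (insert ?n (?N - {?n})) = a ?n \<odot>\<^bsub>P\<^esub> ?n \<oplus>\<^bsub>P\<^esub> lin a (?N - {?n})"
    by (rule lin_insert) (use sub n fin in auto)
   then have 1: "lin a ?N = ?n"
    using 0 n ne P.smult_one[of ?n] by (simp add: a_def insert_absorb)
   have "lin a (insert \<one>\<^bsub>P\<^esub> ?N) = a \<one>\<^bsub>P\<^esub> \<odot>\<^bsub>P\<^esub> \<one>\<^bsub>P\<^esub> \<oplus>\<^bsub>P\<^esub> lin a ?N"
    by (rule lin_insert) (use sub fin nil one_notin in auto)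
   also have "\<dots> = sc (pr s) \<oplus>\<^bsub>P\<^esub> ?n" by (simp add: 1) (simp add: a_def sc_def)
   also have "\<dots> = s"
    using s S(2) by (simp add: a_minus_def P.M.a_lcomm P.M.r_neg subset_iff)
   finally show "\<exists>a. s = lin a (insert \<one>\<^bsub>P\<^esub> ?N)" by metis
  qed (use fin sub in auto)
 qed
 from ex_has_least_nat[where P = ?Q, OF this, of card]
 obtain N where least: "?Q N \<and> (\<forall>N'. ?Q N' \<longrightarrow> card N \<le> card N')" ..
 have N: "?Q N" by (rule conjunct1[OF least])
 have min: "card N \<le> card N'" if "?Q N'" for N' by (rule mp[OF spec[OF conjunct2[OF least]] that])
 define J where "J = insert \<one>\<^bsub>P\<^esub> N"
 have J: "finite J" "J \<subseteq> carrier P" "\<one>\<^bsub>P\<^esub> : J" "J - {\<one>\<^bsub>P\<^esub>} \<subseteq> nil" "spans J"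
  using N nil_carrier by (auto simp: J_def)
 \<comment> \<open>Under \<open>pr\<close> the relation loses all members of \<open>N\<close>, so
   the coefficient of 1 is zero. A nonzero coefficient at some \<open>j\<close> in \<open>N\<close>
   would express \<open>j\<close> by the remaining elements and contradict the minimality of
   \<open>N\<close>.\<close>
 have indep: "a j = 0" if a: "lin a J = \<zero>\<^bsub>P\<^esub>" and j: "j : J" for a j
 proof -
  have "finite N" "N \<subseteq> nil" using N by blast+
  then have "pr (lin a N) = 0"
  proof (induction N)
   case empty
   then show ?case by (simp add: lin_def pr_zero)
  next
   case (insert x N')
   have sub: "N' \<subseteq> carrier P" and x: "x : carrier P" "pr x = 0" and N': "N' \<subseteq> nil"
    using insert.prems by (simp_all add: nil_def subset_iff)
   have "lin a (insert x N') = a x \<odot>\<^bsub>P\<^esub> x \<oplus>\<^bsub>P\<^esub> lin a N'"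
    by (rule lin_insert[OF sub x(1) insert.hyps])
   then show ?case
    using insert.IH[OF N'] x lin_closed[OF sub] by (simp add: pr_add pr_smult real_smult_closed)
  qed
  moreover have lJ: "lin a J = a \<one>\<^bsub>P\<^esub> \<odot>\<^bsub>P\<^esub> \<one>\<^bsub>P\<^esub> \<oplus>\<^bsub>P\<^esub> lin a N"
   unfolding J_def by (rule lin_insert) (use N nil_carrier one_notin in auto)
  moreover have NP: "N \<subseteq> carrier P" using N nil_carrier by blast
  ultimately have a1: "a \<one>\<^bsub>P\<^esub> = 0"
   using a pr_zero lin_closed[OF NP, of a] real_smult_closed
   by (simp add: pr_add pr_smult pr_one)
  show ?thesis
  proof (rule ccontr)
   assume aj: "a j \<noteq> 0"
   then have jN: "j : N" and jP: "j : carrier P" using j a1 NP by (auto simp: J_def)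
   let ?J' = "insert \<one>\<^bsub>P\<^esub> (N - {j})"
   have j_notin: "j \<notin> ?J'" using jN N one_notin by auto
   have J': "?J' \<subseteq> carrier P" "finite ?J'" using NP N by auto
   have "J = insert j ?J'" using jN by (auto simp: J_def)
   then have "a j \<odot>\<^bsub>P\<^esub> j \<oplus>\<^bsub>P\<^esub> lin a ?J' = \<zero>\<^bsub>P\<^esub>"
    using a lin_insert[OF J'(1) jP J'(2) j_notin, of a] by simp
   moreover have "lin (\<lambda>i. (-1) * a i) ?J' \<oplus>\<^bsub>P\<^esub> lin a ?J' = lin (\<lambda>i. 0 * a i) ?J'"
    by (simp add: lin_add[OF J'(1), symmetric])
   moreover have "lin (\<lambda>i. 0 * a i) ?J' = \<zero>\<^bsub>P\<^esub>"
    unfolding lin_smult[OF J'(1)] using P.smult_zero_left[OF lin_closed[OF J'(1)]] by simp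
   ultimately have "a j \<odot>\<^bsub>P\<^esub> j = lin (\<lambda>i. (-1) * a i) ?J'"
    using jP lin_closed[OF J'(1)] real_smult_closed by (metis P.M.add.right_cancel)
   then have "inverse (a j) \<odot>\<^bsub>P\<^esub> (a j \<odot>\<^bsub>P\<^esub> j) = lin (\<lambda>i. inverse (a j) * ((-1) * a i)) ?J'"
    by (simp only: lin_smult[OF J'(1)])
   then have "j = lin (\<lambda>i. inverse (a j) * ((-1) * a i)) ?J'"
    using aj jP P.smult_assoc[of "inverse (a j)" "a j" j] P.smult_one[of j] by simp
   then have "\<exists>b. i = lin b ?J'" if "i : J" for i
   proof (cases "i = j")
    case False
    then have i: "i : ?J'" using that by (auto simp: J_def)
    then have iP: "i : carrier P" using J' by blast
    let ?b = "\<lambda>k. if k = i then 1 else (0::real)"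
    have "lin ?b (?J' - {i}) = lin (\<lambda>k. 0 * ?b k) (?J' - {i})"
     by (rule lin_cong) (use J' in auto)
    also have "\<dots> = \<zero>\<^bsub>P\<^esub>"
     using lin_smult[of "?J' - {i}" 0 ?b] P.smult_zero_left[OF lin_closed, of "?J' - {i}" ?b] J'(1) by auto
    finally have "lin ?b (insert i (?J' - {i})) = i"
     using lin_insert[of "?J' - {i}" i ?b] J' iP P.smult_one[of i] by auto
    then show ?thesis using i by (metis insert_Diff)
   qed blast
   then have "spans ?J'" by (rule span_mem[OF J'(2,1) _ J(1,2,5)])
   then have "?Q (N - {j})" using N by auto
   then have "card N \<le> card (N - {j})" by (rule min)
   then show False using jN N by (metis card_Diff1_less linorder_not_le)
  qed
 qed
 have uniq: "a j = b j" if "lin a J = lin b J" "j : J" for a b j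
 proof -
  have "lin (\<lambda>i. a i + (-1) * b i) J = lin b J \<oplus>\<^bsub>P\<^esub> lin (\<lambda>i. (-1) * b i) J"
   using that(1) by (simp only: lin_add[OF J(2)])
  also have "\<dots> = lin (\<lambda>i. 0 * b i) J"
   by (simp add: lin_add[OF J(2), symmetric])
  also have "\<dots> = \<zero>\<^bsub>P\<^esub>"
   unfolding lin_smult[OF J(2)] using P.smult_zero_left[OF lin_closed[OF J(2)]] by simp
  finally show ?thesis using indep[of "\<lambda>i. a i + (-1) * b i" j] that(2) by simp
 qed
 have "\<forall>x\<in>carrier P. \<exists>a. x = lin a J" using J(5) by (simp add: spans_def)
 then obtain e where e: "\<And>x. x : carrier P ==> x = lin (e x) J" by metis
 show ?thesis
 proof (rule that[of J "\<lambda>j x. e x j"])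
  fix j assume j: "j : J"
  show "functional (\<lambda>x. e x j)"
   unfolding functional_def
  proof (intro conjI ballI allI)
   fix x y assume xy: "x : carrier P" "y : carrier P"
   then have "lin (e (x \<oplus>\<^bsub>P\<^esub> y)) J = lin (\<lambda>i. e x i + e y i) J"
    using e by (metis lin_add[OF J(2)] P.M.a_closed)
   then show "e (x \<oplus>\<^bsub>P\<^esub> y) j = e x j + e y j" using uniq j by blast
  next
   fix r x assume x: "x : carrier P"
   then have "lin (e (r \<odot>\<^bsub>P\<^esub> x)) J = lin (\<lambda>i. r * e x i) J"
    using e by (metis lin_smult[OF J(2)] real_smult_closed)
   then show "e (r \<odot>\<^bsub>P\<^esub> x) j = r * e x j" using uniq j by blast
  qed
 next
  fix i j assume ij: "i : J" "j : J"
  let ?b = "\<lambda>k. if k = j then 1 else (0::real)"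
  have jP: "j : carrier P" using ij J by blast
  have "lin ?b (J - {j}) = lin (\<lambda>k. 0 * ?b k) (J - {j})"
   by (rule lin_cong) (use J in auto)
  also have "\<dots> = \<zero>\<^bsub>P\<^esub>"
   using lin_smult[of "J - {j}" 0 ?b] P.smult_zero_left[OF lin_closed, of "J - {j}" ?b] J(2) by auto
  finally have "lin ?b (insert j (J - {j})) = j"
   using lin_insert[of "J - {j}" j ?b] J jP P.smult_one[of j] by auto
  then have "lin (e j) J = lin ?b J" using e[OF jP] ij by (metis insert_Diff)
  then show "e j i = (if i = j then 1 else 0)" using uniq ij by blast
 next
  show "x = (\<Oplus>\<^bsub>P\<^esub>j\<in>J. e x j \<odot>\<^bsub>P\<^esub> j)" if "x : carrier P" for x
   using e[OF that] by (simp add: lin_def)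
 qed (use J in auto)
qed

end

lemma addmap_pointwise_minus:
 assumes "addmap G H h" "addmap G H k" "abelian_group H"
 shows "addmap G H (\<lambda>x. h x \<ominus>\<^bsub>H\<^esub> k x)"
proof -
 interpret H: abelian_group H by fact
 show ?thesis
  using assms by (auto simp: addmap_def Pi_iff H.a_ac a_minus_def H.minus_add)
qed

section \<open>Extension of scalars of the body\<close>

context algebra_over begin

lemma smult_B_closed: "b : carrier B ==> r \<odot>\<^bsub>B\<^esub> b : carrier B"
 by (rule br_surj) (auto simp: smult_B br_closed A.smult_closed)

lemma smult_B_add:
 assumes "b : carrier B" "b' : carrier B"
 shows "r \<odot>\<^bsub>B\<^esub> (b \<oplus>\<^bsub>B\<^esub> b') = r \<odot>\<^bsub>B\<^esub> b \<oplus>\<^bsub>B\<^esub> r \<odot>\<^bsub>B\<^esub> b'"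
proof -
 obtain f g where fg: "f : carrier A" "b = br f" "g : carrier A" "b' = br g"
  using assms br_surj by metis
 show ?thesis
  unfolding fg(2,4) using fg(1,3)
  by (simp add: smult_B A.smult_r_distr addmap_add[OF br_additive, symmetric] A.smult_closed)
qed

lemma smult_B_add_left: "b : carrier B ==> (r + s) \<odot>\<^bsub>B\<^esub> b = r \<odot>\<^bsub>B\<^esub> b \<oplus>\<^bsub>B\<^esub> s \<odot>\<^bsub>B\<^esub> b"
 by (rule br_surj)
  (auto simp: smult_B sc_add A.smult_l_distr addmap_add[OF br_additive] A.smult_closed)

lemma smult_B_assoc: "b : carrier B ==> (r * s) \<odot>\<^bsub>B\<^esub> b = r \<odot>\<^bsub>B\<^esub> (s \<odot>\<^bsub>B\<^esub> b)"
 by (rule br_surj) (auto simp: smult_B sc_mult A.smult_assoc A.smult_closed)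

lemma smult_B_one: "b : carrier B ==> 1 \<odot>\<^bsub>B\<^esub> b = b"
 by (rule br_surj) (auto simp: smult_B A.smult_one)

lemma smult_B_zero: "b : carrier B ==> 0 \<odot>\<^bsub>B\<^esub> b = \<zero>\<^bsub>B\<^esub>"
 by (rule br_surj)
  (auto simp: smult_B A.smult_zero_left addmap_zero[OF br_additive A.abg BG.abg])

lemma additive_smult_B: "addmap B B (\<lambda>b. r \<odot>\<^bsub>B\<^esub> b)"
 by (intro addmapI) (simp_all add: smult_B_closed smult_B_add)

lemma smult_B_grade:
 assumes "b : grade B i" shows "r \<odot>\<^bsub>B\<^esub> b : grade B i"
proof -
 obtain f where f: "f : grade A i" "b = br f" using grade_B_lift[OF assms] .
 have "sc r \<odot>\<^bsub>A\<^esub> f : grade A i" using A.grade_smult[OF sc_even f(1), of r] by (simp only: add_0_left)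
 then show ?thesis using f AG.grade_carrier by (simp add: smult_B br_grade)
qed

lemma hcomp_smult_B: "b : carrier B ==> hcomp B i (r \<odot>\<^bsub>B\<^esub> b) = r \<odot>\<^bsub>B\<^esub> hcomp B i b"
 by (rule BG.hcomp_commute[OF BG.graded_group_axioms additive_smult_B smult_B_grade])

lemma mult_B_closed: "[|b : carrier B; b' : carrier B|] ==> b \<otimes>\<^bsub>B\<^esub> b' : carrier B"
 by (metis br_surj tensor_prod_body br_closed A.A.m_closed)

lemma additive_mult_B_left:
 assumes "b' : carrier B" shows "addmap B B (\<lambda>b. b \<otimes>\<^bsub>B\<^esub> b')"
proof (rule addmapI)
 fix b c assume bc: "b : carrier B" "c : carrier B"
 obtain f g h where *: "f : carrier A" "b = br f" "g : carrier A" "c = br g" "h : carrier A" "b' = br h"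
  using bc assms br_surj by metis
 show "(b \<oplus>\<^bsub>B\<^esub> c) \<otimes>\<^bsub>B\<^esub> b' = b \<otimes>\<^bsub>B\<^esub> b' \<oplus>\<^bsub>B\<^esub> c \<otimes>\<^bsub>B\<^esub> b'"
  unfolding *(2,4,6) using *(1,3,5)
  by (simp add: addmap_add[OF br_additive, symmetric] tensor_prod_body A.A.l_distr)
qed (use assms mult_B_closed in blast)

lemma additive_mult_B_right:
 assumes "b' : carrier B" shows "addmap B B (\<lambda>b. b' \<otimes>\<^bsub>B\<^esub> b)"
proof (rule addmapI)
 fix b c assume bc: "b : carrier B" "c : carrier B"
 obtain f g h where *: "f : carrier A" "b = br f" "g : carrier A" "c = br g" "h : carrier A" "b' = br h"
  using bc assms br_surj by metis
 show "b' \<otimes>\<^bsub>B\<^esub> (b \<oplus>\<^bsub>B\<^esub> c) = b' \<otimes>\<^bsub>B\<^esub> b \<oplus>\<^bsub>B\<^esub> b' \<otimes>\<^bsub>B\<^esub> c"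
  unfolding *(2,4,6) using *(1,3,5)
  by (simp add: addmap_add[OF br_additive, symmetric] tensor_prod_body A.A.r_distr)
qed (use assms mult_B_closed in blast)

lemma mult_B_smult:
 assumes "b : carrier B" "c : carrier B"
 shows "(r \<odot>\<^bsub>B\<^esub> b) \<otimes>\<^bsub>B\<^esub> c = r \<odot>\<^bsub>B\<^esub> (b \<otimes>\<^bsub>B\<^esub> c)" "b \<otimes>\<^bsub>B\<^esub> (r \<odot>\<^bsub>B\<^esub> c) = r \<odot>\<^bsub>B\<^esub> (b \<otimes>\<^bsub>B\<^esub> c)"
proof -
 obtain f g where *: "f : carrier A" "b = br f" "g : carrier A" "c = br g"
  using assms br_surj by metis
 show "(r \<odot>\<^bsub>B\<^esub> b) \<otimes>\<^bsub>B\<^esub> c = r \<odot>\<^bsub>B\<^esub> (b \<otimes>\<^bsub>B\<^esub> c)"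
  unfolding *(2,4) using *(1,3) by (simp add: smult_B tensor_prod_body A.smult_closed A.smult_mult_l)
 show "b \<otimes>\<^bsub>B\<^esub> (r \<odot>\<^bsub>B\<^esub> c) = r \<odot>\<^bsub>B\<^esub> (b \<otimes>\<^bsub>B\<^esub> c)"
  unfolding *(2,4) using *(1,3)
  by (simp add: smult_B tensor_prod_body A.smult_closed A.smult_mult_r_even[OF sc_even])
qed

end

text \<open>The data on \<open>M\<close> that make \<open>(c \<otimes> d) (a \<otimes> x)\<close>,
  equal to \<open>c a \<otimes> d x\<close> up to the Koszul sign, well defined on
  \<open>P \<otimes> M\<close>. There are two uses: \<open>M = B\<close> gives the multiplication of
  \<open>P \<otimes> B\<close>, and \<open>M = RE\<close>, the body of a module seen over the reals,
  gives the action on the extended body.\<close>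

locale body_module = algebra_over P pr A
 for P :: "(real, 'p) gmodule" and pr and A :: "('p, 'a) gmodule" +
 fixes M :: "(real, 'm) gmodule" and \<nu> :: "(real, 'a) tensor \<Rightarrow> 'm \<Rightarrow> 'm"
  and act :: "'s \<Rightarrow> ('p, 'm) tensor \<Rightarrow> ('p, 'm) tensor"
 assumes abelian_M: "abelian_group M"
  and smult_M: "addmap M M (\<lambda>x. r \<odot>\<^bsub>M\<^esub> x)"
  and \<nu>_left: "x : carrier M ==> addmap B M (\<lambda>b. \<nu> b x)"
  and \<nu>_right: "b : carrier B ==> addmap M M (\<nu> b)"
  and \<nu>_smult: "[|b : carrier B; x : carrier M|] ==> \<nu> (r \<odot>\<^bsub>B\<^esub> b) x = r \<odot>\<^bsub>M\<^esub> \<nu> b x"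
   "[|b : carrier B; x : carrier M|] ==> \<nu> b (r \<odot>\<^bsub>M\<^esub> x) = r \<odot>\<^bsub>M\<^esub> \<nu> b x"
begin

sublocale MG: abelian_group M by (rule abelian_M)

sublocale PM: tensor_pair real_alg P M
 by (rule tensor_pair.intro)
  (use P.abg abelian_M PG.grade_subset real_smult_closed addmap_closed[OF smult_M] in auto)

lemma pure_real_smult:
 assumes "p : carrier P" "x : carrier M"
 shows "pure_tensor real_alg P M (r \<odot>\<^bsub>P\<^esub> p) x = pure_tensor real_alg P M p (r \<odot>\<^bsub>M\<^esub> x)"
proof -
 have *: "pure_tensor real_alg P M (r \<odot>\<^bsub>P\<^esub> q) x = pure_tensor real_alg P M q (r \<odot>\<^bsub>M\<^esub> x)"
  if "q : grade P i" for q i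
  using PM.pure_smult[OF that, of r 0 x] assms(2) by (simp add: koszul_def)
 note c = PG.hcomp_closed[OF assms(1), of 0] PG.hcomp_closed[OF assms(1), of 1]
 have "r \<odot>\<^bsub>P\<^esub> p = r \<odot>\<^bsub>P\<^esub> hcomp P 0 p \<oplus>\<^bsub>P\<^esub> r \<odot>\<^bsub>P\<^esub> hcomp P 1 p"
  using P.smult_r_distr[OF _ c, of r] PG.hcomp_sum[OF assms(1)] by simp
 then have "pure_tensor real_alg P M (r \<odot>\<^bsub>P\<^esub> p) x =
   pure_tensor real_alg P M (hcomp P 0 p \<oplus>\<^bsub>P\<^esub> hcomp P 1 p) (r \<odot>\<^bsub>M\<^esub> x)"
  using c assms(2) real_smult_closed addmap_closed[OF smult_M]
  by (simp add: PM.pure_add_left[where act = act] *[OF PG.hcomp_props(1)[OF assms(1)]])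
 then show ?thesis using PG.hcomp_sum[OF assms(1)] by simp
qed

lemma balanced_PM:
 assumes "abelian_group G" "\<And>x. x : carrier M ==> addmap P G (\<lambda>p. \<beta> p x)"
  "\<And>p. p : carrier P ==> addmap M G (\<beta> p)"
  "\<And>r p x. [|p : carrier P; x : carrier M|] ==> \<beta> (r \<odot>\<^bsub>P\<^esub> p) x = \<beta> p (r \<odot>\<^bsub>M\<^esub> x)"
 shows "balanced real_alg P M G \<beta>"
 by (rule balanced_realI[OF P.abg abelian_M assms(1)])
  (use assms PG.grade_subset P.smult_zero_left in auto)

abbreviation PM where "PM \<equiv> tensor real_alg P M act"
abbreviation pm where "pm \<equiv> pure_tensor real_alg P M"

text \<open>The product of \<open>c \<otimes> d\<close> with \<open>a \<otimes> x\<close>: as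
  \<open>d\<close> moves past \<open>a\<close>, only the odd part of \<open>d\<close> and the odd
  part of \<open>a\<close> exchange a sign.\<close>

definition twisted :: "'p \<Rightarrow> (real, 'a) tensor \<Rightarrow> 'p \<Rightarrow> 'm \<Rightarrow> ('p, 'm) tensor" where
 "twisted c d a x =
  pm (c \<otimes>\<^bsub>P\<^esub> hcomp P 0 a) (\<nu> (hcomp B 0 d) x \<oplus>\<^bsub>M\<^esub> \<nu> (hcomp B 1 d) x) \<oplus>\<^bsub>PM\<^esub>
  pm (c \<otimes>\<^bsub>P\<^esub> hcomp P 1 a) (\<nu> (hcomp B 0 d) x \<ominus>\<^bsub>M\<^esub> \<nu> (hcomp B 1 d) x)"

lemma \<nu>_closed: "[|b : carrier B; x : carrier M|] ==> \<nu> b x : carrier M"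
 by (rule addmap_closed[OF \<nu>_right])

lemma additive_mult_P_left: "q : carrier P ==> addmap P P (\<lambda>p. p \<otimes>\<^bsub>P\<^esub> q)"
 by (intro addmapI) (simp_all add: P.A.l_distr)

lemma additive_mult_P_right: "q : carrier P ==> addmap P P (\<lambda>p. q \<otimes>\<^bsub>P\<^esub> p)"
 by (intro addmapI) (simp_all add: P.A.r_distr)

lemma hcomp_smult_P: "p : carrier P ==> hcomp P i (r \<odot>\<^bsub>P\<^esub> p) = r \<odot>\<^bsub>P\<^esub> hcomp P i p"
proof (rule PG.hcomp_commute[OF PG.graded_group_axioms])
 show "addmap P P (\<lambda>p. r \<odot>\<^bsub>P\<^esub> p)" using P.additive_smult[of r] by simp
 show "r \<odot>\<^bsub>P\<^esub> x : grade P i" if "x : grade P i" for i x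
  using P.grade_smult[of r 0 x i] that by (simp only: add_0_left) simp
qed

lemma mult_P_smult:
 assumes "p : carrier P" "q : carrier P"
 shows "(r \<odot>\<^bsub>P\<^esub> p) \<otimes>\<^bsub>P\<^esub> q = r \<odot>\<^bsub>P\<^esub> (p \<otimes>\<^bsub>P\<^esub> q)" "p \<otimes>\<^bsub>P\<^esub> (r \<odot>\<^bsub>P\<^esub> q) = r \<odot>\<^bsub>P\<^esub> (p \<otimes>\<^bsub>P\<^esub> q)"
 using P.smult_mult_l[of r p q] P.smult_mult_r_even[of r p q] assms by simp_all

lemma twisted_sum:
 assumes "c : carrier P" "d : carrier B" "a : carrier P" "x : carrier M"
 shows "(\<Sum>i\<in>UNIV. \<Sum>j\<in>UNIV. frag_cmul (koszul_int j i)
   (frag_of (c \<otimes>\<^bsub>P\<^esub> hcomp P i a, \<nu> (hcomp B j d) x))) : carrier (tensor_free P M)"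
  and "tensor_class real_alg P M (\<Sum>i\<in>UNIV. \<Sum>j\<in>UNIV. frag_cmul (koszul_int j i)
   (frag_of (c \<otimes>\<^bsub>P\<^esub> hcomp P i a, \<nu> (hcomp B j d) x))) = twisted c d a x"
 unfolding twisted_def
 by (rule PM.tensor_class_koszul_sum[of "\<lambda>i. c \<otimes>\<^bsub>P\<^esub> hcomp P i a" "\<lambda>j. \<nu> (hcomp B j d) x"];
   use assms PG.hcomp_closed BG.hcomp_closed \<nu>_closed in simp)+

lemma balanced_twisted_right:
 assumes c: "c : carrier P" and d: "d : carrier B"
 shows "balanced real_alg P M PM (twisted c d)"
proof (rule balanced_PM[OF PM.abelian_group_tensor])
 note d' = BG.hcomp_closed[OF d]
 show "addmap P PM (\<lambda>a. twisted c d a x)" if x: "x : carrier M" for x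
  unfolding twisted_def
  by (intro addmap_pointwise_add PM.abelian_group_tensor
    addmap_comp[OF addmap_comp[OF PG.additive_hcomp additive_mult_P_right[OF c]] PM.additive_pure_left])
   (use x d' \<nu>_closed in auto)
 show "addmap M PM (twisted c d a)" if a: "a : carrier P" for a
  unfolding twisted_def
  by (intro addmap_pointwise_add PM.abelian_group_tensor
    addmap_comp[OF addmap_pointwise_add[OF \<nu>_right[OF d'] \<nu>_right[OF d'] abelian_M] PM.additive_pure_right]
    addmap_comp[OF addmap_pointwise_minus[OF \<nu>_right[OF d'] \<nu>_right[OF d'] abelian_M] PM.additive_pure_right])
   (use a c PG.hcomp_closed in auto)
 show "twisted c d (r \<odot>\<^bsub>P\<^esub> a) x = twisted c d a (r \<odot>\<^bsub>M\<^esub> x)" if a: "a : carrier P" and x: "x : carrier M" for r a x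
 proof -
  have "\<nu> (hcomp B 0 d) (r \<odot>\<^bsub>M\<^esub> x) \<oplus>\<^bsub>M\<^esub> \<nu> (hcomp B 1 d) (r \<odot>\<^bsub>M\<^esub> x) =
    r \<odot>\<^bsub>M\<^esub> (\<nu> (hcomp B 0 d) x \<oplus>\<^bsub>M\<^esub> \<nu> (hcomp B 1 d) x)"
   "\<nu> (hcomp B 0 d) (r \<odot>\<^bsub>M\<^esub> x) \<ominus>\<^bsub>M\<^esub> \<nu> (hcomp B 1 d) (r \<odot>\<^bsub>M\<^esub> x) =
    r \<odot>\<^bsub>M\<^esub> (\<nu> (hcomp B 0 d) x \<ominus>\<^bsub>M\<^esub> \<nu> (hcomp B 1 d) x)"
   using d' x \<nu>_closed
   by (simp_all add: \<nu>_smult addmap_add[OF smult_M] addmap_minus[OF smult_M abelian_M abelian_M])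
  then show ?thesis
   unfolding twisted_def using a x c d' PG.hcomp_closed[OF a] \<nu>_closed
   by (simp add: hcomp_smult_P mult_P_smult pure_real_smult)
 qed
qed

lemma balanced_twisted_left:
 assumes a: "a : carrier P" and x: "x : carrier M"
 shows "balanced real_alg P B PM (\<lambda>c d. twisted c d a x)"
proof (rule balanced_realI[OF P.abg BG.abg PM.abelian_group_tensor])
 note a' = PG.hcomp_closed[OF a]
 have add: "addmap B M (\<lambda>d. \<nu> (hcomp B i d) x)" for i
  by (rule addmap_comp[OF BG.additive_hcomp \<nu>_left[OF x]])
 show "addmap P PM (\<lambda>c. twisted c d a x)" if d: "d : carrier B" for d
  unfolding twisted_def
  by (intro addmap_pointwise_add PM.abelian_group_tensor
    addmap_comp[OF additive_mult_P_left[OF a'] PM.additive_pure_left])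
   (use x BG.hcomp_closed[OF d] \<nu>_closed in auto)
 show "addmap B PM (\<lambda>d. twisted c d a x)" if c: "c : carrier P" for c
  unfolding twisted_def
  by (intro addmap_pointwise_add PM.abelian_group_tensor
    addmap_comp[OF addmap_pointwise_add[OF add add abelian_M] PM.additive_pure_right]
    addmap_comp[OF addmap_pointwise_minus[OF add add abelian_M] PM.additive_pure_right])
   (use c a' in auto)
 show "twisted (r \<odot>\<^bsub>P\<^esub> c) d a x = twisted c (r \<odot>\<^bsub>B\<^esub> d) a x" if c: "c : carrier P" and d: "d : carrier B" for r c d
 proof -
  note d' = BG.hcomp_closed[OF d]
  have "r \<odot>\<^bsub>M\<^esub> \<nu> (hcomp B 0 d) x \<oplus>\<^bsub>M\<^esub> r \<odot>\<^bsub>M\<^esub> \<nu> (hcomp B 1 d) x =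
    r \<odot>\<^bsub>M\<^esub> (\<nu> (hcomp B 0 d) x \<oplus>\<^bsub>M\<^esub> \<nu> (hcomp B 1 d) x)"
   "r \<odot>\<^bsub>M\<^esub> \<nu> (hcomp B 0 d) x \<ominus>\<^bsub>M\<^esub> r \<odot>\<^bsub>M\<^esub> \<nu> (hcomp B 1 d) x =
    r \<odot>\<^bsub>M\<^esub> (\<nu> (hcomp B 0 d) x \<ominus>\<^bsub>M\<^esub> \<nu> (hcomp B 1 d) x)"
   using d' x \<nu>_closed
   by (simp_all add: addmap_add[OF smult_M] addmap_minus[OF smult_M abelian_M abelian_M])
  then show ?thesis
   unfolding twisted_def using x c d d' a' \<nu>_closed
   by (simp add: hcomp_smult_B mult_P_smult pure_real_smult \<nu>_smult)
 qed
qed (use PG.grade_subset P.smult_zero_left in auto)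

end

text \<open>The first use of \<open>body_module\<close>: \<open>B\<close> acting on itself by
  multiplication.\<close>

sublocale algebra_over \<subseteq> ext: body_module P pr A "B" "(\<otimes>\<^bsub>B\<^esub>)" "\<lambda>s. tensor_map real_alg P B ((\<otimes>\<^bsub>P\<^esub>) s) id"
 by (intro body_module.intro body_module_axioms.intro algebra_over_axioms)
  (rule BG.abg additive_smult_B additive_mult_B_left additive_mult_B_right mult_B_smult
   | assumption)+

context body_module begin

lemma tensor_prod_twisted:
 shows "Y : carrier PM ==> addmap (tensor real_alg P B act') PM
   (\<lambda>X. tensor_prod real_alg P M B (\<otimes>\<^bsub>P\<^esub>) \<nu> X Y)"
  and "X : carrier (tensor real_alg P B act') ==>
   addmap PM PM (tensor_prod real_alg P M B (\<otimes>\<^bsub>P\<^esub>) \<nu> X)"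
  and "[|c : carrier P; d : carrier B; a : carrier P; x : carrier M|] ==>
   tensor_prod real_alg P M B (\<otimes>\<^bsub>P\<^esub>) \<nu> (pure_tensor real_alg P B c d) (pm a x) = twisted c d a x"
proof -
 note ev = PM.tensor_prod_eval[OF ext.PM.tensor_pair_axioms, where K = twisted and act = act and
   \<mu> = "(\<otimes>\<^bsub>P\<^esub>)" and \<nu> = \<nu>, OF conjI[OF twisted_sum] balanced_twisted_right balanced_twisted_left]
 show "addmap (tensor real_alg P B act') PM (\<lambda>X. tensor_prod real_alg P M B (\<otimes>\<^bsub>P\<^esub>) \<nu> X Y)"
  if "Y : carrier PM" by (rule ev(1)) (assumption | rule that)+
 show "addmap PM PM (tensor_prod real_alg P M B (\<otimes>\<^bsub>P\<^esub>) \<nu> X)"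
  if "X : carrier (tensor real_alg P B act')" by (rule ev(2)) (assumption | rule that)+
 show "tensor_prod real_alg P M B (\<otimes>\<^bsub>P\<^esub>) \<nu> (pure_tensor real_alg P B c d) (pm a x) = twisted c d a x"
  if "c : carrier P" "d : carrier B" "a : carrier P" "x : carrier M"
  by (rule ev(3)) (assumption | rule that)+
qed

end

text \<open>With \<open>N = nil\<close> this is the subgroup \<open>nil M\<close> of finite sums
  \<open>\<Sum> n x\<close>. With the products of \<open>l\<close> elements of \<open>nil\<close> in
  place of \<open>N\<close> it is the \<open>l\<close>-th step of a filtration that ends at
  zero.\<close>

inductive_set nspan :: "'p set \<Rightarrow> ('a, 'm) ring_scheme \<Rightarrow> ('p \<Rightarrow> 'a \<Rightarrow> 'a) \<Rightarrow> 'a set"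
 for N M act where
 zero: "\<zero>\<^bsub>M\<^esub> : nspan N M act"
| step: "[|y : nspan N M act; n : N; x : carrier M|] ==> y \<oplus>\<^bsub>M\<^esub> act n x : nspan N M act"

lemma nspan_closed:
 assumes "abelian_group M" "\<And>n x. [|n : N; x : carrier M|] ==> act n x : carrier M" "x : nspan N M act"
 shows "x : carrier M"
 using assms(3) by induction (use abelian_groupE[OF assms(1)] assms(2) in auto)

lemma nspan_add:
 assumes "abelian_group M" "\<And>n x. [|n : N; x : carrier M|] ==> act n x : carrier M"
  "x : nspan N M act" "y : nspan N M act"
 shows "x \<oplus>\<^bsub>M\<^esub> y : nspan N M act"
proof -
 interpret M: abelian_group M by fact
 have x: "x : carrier M" using nspan_closed[OF assms(1,2,3)] .
 show ?thesis
  using assms(4)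
 proof induction
  case zero
  then show ?case using x assms(3) by simp
 next
  case (step y n z)
  have y: "y : carrier M" using nspan_closed[OF assms(1,2) step(1)] .
  have "x \<oplus>\<^bsub>M\<^esub> (y \<oplus>\<^bsub>M\<^esub> act n z) = (x \<oplus>\<^bsub>M\<^esub> y) \<oplus>\<^bsub>M\<^esub> act n z"
   using x y assms(2)[OF step(2,3)] by (simp add: M.a_assoc)
  then show ?case using nspan.step[OF step(4,2,3)] by simp
 qed
qed

lemma nspan_act:
 assumes "abelian_group M" "\<And>n x. [|n : N; x : carrier M|] ==> act n x : carrier M" "n : N" "x : carrier M"
 shows "act n x : nspan N M act"
proof -
 interpret M: abelian_group M by fact
 show ?thesis using nspan.step[OF nspan.zero assms(3,4), of act] assms(2)[OF assms(3,4)] by simp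
qed

text \<open>The unit of \<open>P\<close> is even, so that there is no odd part for \<open>d\<close>
  to exchange a sign with.\<close>

lemma (in body_module) twisted_one:
 assumes "c : carrier P" "d : carrier B" "x : carrier M"
 shows "twisted c d \<one>\<^bsub>P\<^esub> x = pm c (\<nu> d x)"
proof -
 have "hcomp P 0 \<one>\<^bsub>P\<^esub> = \<one>\<^bsub>P\<^esub>" "hcomp P 1 \<one>\<^bsub>P\<^esub> = \<zero>\<^bsub>P\<^esub>"
  using PG.hcomp_grade_same[OF P.A.one_even] PG.hcomp_grade_other[of "\<one>\<^bsub>P\<^esub>" 1] P.A.one_even by simp_all
 moreover have "\<nu> (hcomp B 0 d) x \<oplus>\<^bsub>M\<^esub> \<nu> (hcomp B 1 d) x = \<nu> d x"
  using addmap_add[OF \<nu>_left[OF assms(3)] BG.hcomp_closed[OF assms(2)] BG.hcomp_closed[OF assms(2)], of 0 1]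
   BG.hcomp_sum[OF assms(2)] by simp
 moreover have "\<nu> (hcomp B i d) x : carrier M" for i
  using \<nu>_closed BG.hcomp_closed[OF assms(2)] assms(3) by blast
 ultimately show ?thesis
  unfolding twisted_def
  using assms \<nu>_closed[OF assms(2,3)] PM.pure_zero_left[where act = act]
   PM.pure_closed[where act = act] abelian_monoid.r_zero[OF abelian_group.axioms(1)[OF PM.abelian_group_tensor[of act]]]
  by simp
qed

context algebra_over begin

abbreviation PB where "PB \<equiv> left_tensor real_alg P B (\<otimes>\<^bsub>P\<^esub>)"
abbreviation pb where "pb \<equiv> pure_tensor real_alg P B"

sublocale extg: graded_pair real_alg P B
proof (intro graded_pair.intro graded_pair_axioms.intro ext.PM.tensor_pair_axioms
  PG.graded_group_axioms BG.graded_group_axioms)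
 show "r \<odot>\<^bsub>P\<^esub> a : grade P (i + j)" if "r : grade real_alg j" "a : grade P i" for r j a i
  unfolding add.commute[of i j] by (rule P.grade_smult[OF that])
 show "r \<odot>\<^bsub>B\<^esub> b : grade B (i + j)" if "r : grade real_alg j" "b : grade B i" for r j b i
 proof (cases "j = 0")
  case True
  then show ?thesis using smult_B_grade[OF that(2), of r] by (simp only: add_0_right)
 next
  case False
  then have "r = 0" using that(1) by simp
  then show ?thesis using smult_B_zero[OF BG.grade_carrier[OF that(2)]] BG.grade_zero by (simp only:)
 qed
qed (simp add: smult_B_add)

sublocale PBG: graded_group PB
 unfolding left_tensor_def[of real_alg] by (rule extg.graded_group_tensor)

lemma pb_closed: "[|p : carrier P; b : carrier B|] ==> pb p b : carrier PB"
 unfolding left_tensor_def[of real_alg] by (rule ext.PM.pure_closed)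

lemma PB_induct [consumes 1, case_names pure add]:
 assumes "X : carrier PB" "\<And>p b. [|p : carrier P; b : carrier B|] ==> Q (pb p b)"
  "\<And>X Y. [|X : carrier PB; Y : carrier PB; Q X; Q Y|] ==> Q (X \<oplus>\<^bsub>PB\<^esub> Y)"
 shows "Q X"
 using assms unfolding left_tensor_def[of real_alg] by (rule ext.PM.tensor_induct)

lemma additive_pb_left: "b : carrier B ==> addmap P PB (\<lambda>p. pb p b)"
 unfolding left_tensor_def[of real_alg] by (rule ext.PM.additive_pure_left)

lemma additive_pb_right: "p : carrier P ==> addmap B PB (pb p)"
 unfolding left_tensor_def[of real_alg] by (rule ext.PM.additive_pure_right)

lemma pb_real_smult: "[|p : carrier P; b : carrier B|] ==> pb (r \<odot>\<^bsub>P\<^esub> p) b = pb p (r \<odot>\<^bsub>B\<^esub> b)"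
 by (rule ext.pure_real_smult)

lemma pb_mult:
 assumes "b : carrier B" "b' : carrier B"
 shows "pb \<one>\<^bsub>P\<^esub> b \<otimes>\<^bsub>PB\<^esub> pb \<one>\<^bsub>P\<^esub> b' = pb \<one>\<^bsub>P\<^esub> (b \<otimes>\<^bsub>B\<^esub> b')"
 using ext.tensor_prod_twisted(3)[of "\<one>\<^bsub>P\<^esub>" b "\<one>\<^bsub>P\<^esub>" b'] ext.twisted_one[of "\<one>\<^bsub>P\<^esub>" b b'] assms
 by (simp add: left_tensor_def[of real_alg] tensor_def[of real_alg])

lemma PB_act:
 assumes "p : carrier P"
 shows "addmap PB PB (\<lambda>X. p \<odot>\<^bsub>PB\<^esub> X)"
  and "[|q : carrier P; b : carrier B|] ==> p \<odot>\<^bsub>PB\<^esub> pb q b = pb (p \<otimes>\<^bsub>P\<^esub> q) b"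
proof -
 have act: "(\<odot>\<^bsub>PB\<^esub>) p = tensor_map real_alg P B ((\<otimes>\<^bsub>P\<^esub>) p) id"
  by (simp add: left_tensor_def[of real_alg] tensor_def[of real_alg])
 have bal: "balanced real_alg P B PB (\<lambda>q b. pb (p \<otimes>\<^bsub>P\<^esub> q) (id b))"
 proof (rule ext.balanced_PM)
  show "addmap P PB (\<lambda>q. pb (p \<otimes>\<^bsub>P\<^esub> q) (id b))" if "b : carrier B" for b
   using addmap_comp[OF ext.additive_mult_P_right[OF assms] additive_pb_left[OF that]] by simp
  show "addmap B PB (\<lambda>b. pb (p \<otimes>\<^bsub>P\<^esub> q) (id b))" if "q : carrier P" for q
   using additive_pb_right[of "p \<otimes>\<^bsub>P\<^esub> q"] assms that by simp
  show "pb (p \<otimes>\<^bsub>P\<^esub> (r \<odot>\<^bsub>P\<^esub> q)) (id b) = pb (p \<otimes>\<^bsub>P\<^esub> q) (id (r \<odot>\<^bsub>B\<^esub> b))"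
   if "q : carrier P" "b : carrier B" for r q b
   using that assms by (simp add: ext.mult_P_smult pb_real_smult)
 qed (rule PBG.abg)
 note ev = ext.PM.tensor_map_eval[OF ext.PM.tensor_pair_axioms _ _ bal[unfolded left_tensor_def[of real_alg]]]
 show "addmap PB PB (\<lambda>X. p \<odot>\<^bsub>PB\<^esub> X)"
  unfolding act unfolding left_tensor_def[of real_alg]
  by (rule ev(1)) (use assms in simp_all)
 show "p \<odot>\<^bsub>PB\<^esub> pb q b = pb (p \<otimes>\<^bsub>P\<^esub> q) b" if "q : carrier P" "b : carrier B"
 proof -
  have "tensor_map real_alg P B ((\<otimes>\<^bsub>P\<^esub>) p) id (pb q b) = pb (p \<otimes>\<^bsub>P\<^esub> q) (id b)"
   by (rule ev(2)[OF _ _ that]) (use assms in simp_all)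
  then show ?thesis unfolding act by (simp only: id_apply)
 qed
qed

text \<open>Applies a linear form to the left factor of \<open>P \<otimes> B\<close>. With
  \<open>pr\<close> it yields the projection to the body, with the dual functionals of a basis it
  reads off coefficients.\<close>

lemma functional_lift:
 assumes "functional c"
 obtains \<theta> where "addmap PB B \<theta>" "\<And>p b. [|p : carrier P; b : carrier B|] ==> \<theta> (pb p b) = c p \<odot>\<^bsub>B\<^esub> b"
proof -
 have "balanced real_alg P B B (\<lambda>p b. c p \<odot>\<^bsub>B\<^esub> b)"
 proof (rule ext.balanced_PM[OF BG.abg])
  show "addmap P B (\<lambda>p. c p \<odot>\<^bsub>B\<^esub> b)" if "b : carrier B" for b
   using assms that by (intro addmapI) (simp_all add: functional_def smult_B_closed smult_B_add_left)
  show "addmap B B (\<lambda>b. c p \<odot>\<^bsub>B\<^esub> b)" for p by (rule additive_smult_B)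
  show "c (r \<odot>\<^bsub>P\<^esub> p) \<odot>\<^bsub>B\<^esub> b = c p \<odot>\<^bsub>B\<^esub> (r \<odot>\<^bsub>B\<^esub> b)" if "p : carrier P" "b : carrier B" for r p b
   using assms that by (simp add: functional_def smult_B_assoc[symmetric] mult.commute)
 qed
 then obtain \<theta> where "addmap ext.PM B \<theta>"
  "\<And>p b. [|p : carrier P; b : carrier B|] ==> \<theta> (pb p b) = c p \<odot>\<^bsub>B\<^esub> b"
  by (rule ext.PM.tensor_lift[OF BG.abg]) (rule that)
 then show ?thesis by (intro that[of \<theta>]) (simp_all add: left_tensor_def[of real_alg])
qed

lemma tensor_pair_PB: "tensor_pair P (real_over pr) PB"
 by (rule tensor_pair.intro)
  (use abelian_group_real_over PBG.abg PG.grade_carrier addmap_closed[OF PB_act(1)] in auto)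

end

section \<open>The endomorphism \<open>\<tau>\<close> defined by an identification with the extended
  body\<close>

locale identified = algebra_over P pr A
 for P :: "(real, 'p) gmodule" and pr and A :: "('p, 'a) gmodule" +
 fixes \<kappa> :: "'a \<Rightarrow> ('p, (real, 'a) tensor) tensor"
 assumes \<kappa>_hom: "algebra_hom P A PB \<kappa>"
  and \<kappa>_bij: "bij_betw \<kappa> (carrier A) (carrier PB)"
  and \<kappa>_body: "\<And>f. f : carrier B ==>
   tensor_map P (real_over pr) PB id \<kappa> f = pure_tensor P (real_over pr) PB 1 (pb \<one>\<^bsub>P\<^esub> f)"
begin

lemma additive_\<kappa>: "addmap A PB \<kappa>"
 using \<kappa>_hom by (simp add: algebra_hom_def module_hom_def addmap_def)

lemma \<kappa>_smult: "[|p : carrier P; f : carrier A|] ==> \<kappa> (p \<odot>\<^bsub>A\<^esub> f) = p \<odot>\<^bsub>PB\<^esub> \<kappa> f"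
 using \<kappa>_hom by (simp add: algebra_hom_def module_hom_def)

lemma \<kappa>_mult: "[|f : carrier A; g : carrier A|] ==> \<kappa> (f \<otimes>\<^bsub>A\<^esub> g) = \<kappa> f \<otimes>\<^bsub>PB\<^esub> \<kappa> g"
 using \<kappa>_hom by (simp add: algebra_hom_def ring_hom_mult)

lemma \<kappa>_grade: "f : grade A i ==> \<kappa> f : grade PB i"
proof -
 assume "f : grade A i"
 moreover have "\<kappa> ` grade A i \<subseteq> grade PB i" using \<kappa>_hom by (simp add: algebra_hom_def module_hom_def)
 ultimately show "\<kappa> f : grade PB i" by (rule subsetD[OF _ imageI, rotated])
qed

lemma \<kappa>_closed: "f : carrier A ==> \<kappa> f : carrier PB"
 by (rule addmap_closed[OF additive_\<kappa>])

lemma \<kappa>_inj: "[|\<kappa> f = \<kappa> g; f : carrier A; g : carrier A|] ==> f = g"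
 using \<kappa>_bij by (auto simp: bij_betw_def dest: inj_onD)

text \<open>Under \<open>\<kappa>\<close> the projection \<open>br\<close> corresponds to
  \<open>p \<otimes> b\<close> going to \<open>pr p b\<close>. The assumption
  \<open>\<kappa>_body\<close> says so only after tensoring with the reals over \<open>P\<close>;
  the map \<open>\<delta>\<close> on that tensor product, which sends \<open>r \<otimes> X\<close>
  to \<open>r \<epsilon> X\<close>, brings the equation back to \<open>B\<close>.\<close>

lemma counit:
 obtains \<epsilon> where "addmap PB B \<epsilon>" "\<And>p b. [|p : carrier P; b : carrier B|] ==> \<epsilon> (pb p b) = pr p \<odot>\<^bsub>B\<^esub> b"
  "\<And>f. f : carrier A ==> \<epsilon> (\<kappa> f) = br f"
proof -
 obtain \<epsilon> where \<epsilon>: "addmap PB B \<epsilon>"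
  "\<And>p b. [|p : carrier P; b : carrier B|] ==> \<epsilon> (pb p b) = pr p \<odot>\<^bsub>B\<^esub> b"
  by (rule functional_lift[OF functional_pr]) (rule that)
 interpret R: tensor_pair P "real_over pr" PB by (rule tensor_pair_PB)
 \<comment> \<open>This compatibility of \<open>\<epsilon>\<close> with \<open>pr\<close> is what
   makes the map defining \<open>\<delta>\<close> balanced.\<close>
 have \<epsilon>_smult: "\<epsilon> (p \<odot>\<^bsub>PB\<^esub> X) = pr p \<odot>\<^bsub>B\<^esub> \<epsilon> X" if "X : carrier PB" "p : carrier P" for X p
  using that(1)
 proof (induction rule: PB_induct)
  case (pure q b)
  then show ?case using that(2) by (simp add: PB_act \<epsilon> pr_mult smult_B_assoc)
 next
  case (add X Y)
  then show ?case
   using that(2) addmap_closed[OF PB_act(1)[OF that(2)]] addmap_closed[OF \<epsilon>(1)]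
   by (simp add: addmap_add[OF PB_act(1)] addmap_add[OF \<epsilon>(1)] smult_B_add)
 qed
 have "balanced P (real_over pr) PB B (\<lambda>r X. r \<odot>\<^bsub>B\<^esub> \<epsilon> X)"
  unfolding balanced_def
 proof (intro conjI ballI allI impI)
  show "addmap (real_over pr) B (\<lambda>r. r \<odot>\<^bsub>B\<^esub> \<epsilon> X)" if "X : carrier PB" for X
   using addmap_closed[OF \<epsilon>(1) that] by (simp add: addmap_def smult_B_closed smult_B_add_left)
  show "addmap PB B (\<lambda>X. r \<odot>\<^bsub>B\<^esub> \<epsilon> X)" for r by (rule addmap_comp[OF \<epsilon>(1) additive_smult_B])
  fix i j r p X assume *: "r : grade (real_over pr) i \<and> p : grade P j \<and> X : carrier PB"
  then have "koszul (real_over pr) i j (p \<odot>\<^bsub>real_over pr\<^esub> r) = r * pr p"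
   by (auto simp: koszul_def split: if_splits)
  then show "koszul (real_over pr) i j (p \<odot>\<^bsub>real_over pr\<^esub> r) \<odot>\<^bsub>B\<^esub> \<epsilon> X = r \<odot>\<^bsub>B\<^esub> \<epsilon> (p \<odot>\<^bsub>PB\<^esub> X)"
   using * PG.grade_carrier[of p j] addmap_closed[OF \<epsilon>(1)] by (simp add: \<epsilon>_smult smult_B_assoc)
 qed
 then obtain \<delta> where \<delta>: "\<And>r X. [|r : carrier (real_over pr); X : carrier PB|] ==>
   \<delta> (pure_tensor P (real_over pr) PB r X) = r \<odot>\<^bsub>B\<^esub> \<epsilon> X"
  by (rule R.tensor_lift[OF BG.abg]) (rule that)
 have "\<epsilon> (\<kappa> f) = br f" if f: "f : carrier A" for f
 proof -
  let ?T = "tensor P (real_over pr) PB (\<lambda>_::unit. id)"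
  have "balanced P (real_over pr) A ?T (\<lambda>c d. pure_tensor P (real_over pr) PB (id c) (\<kappa> d))"
   unfolding balanced_def
  proof (intro conjI ballI allI impI)
   show "addmap (real_over pr) ?T (\<lambda>r. pure_tensor P (real_over pr) PB (id r) (\<kappa> d))"
    if "d : carrier A" for d using R.additive_pure_left[OF \<kappa>_closed[OF that]] by simp
   show "addmap A ?T (\<lambda>d. pure_tensor P (real_over pr) PB (id r) (\<kappa> d))" for r
    by (rule addmap_comp[OF additive_\<kappa> R.additive_pure_right]) simp
   fix i j r p d assume *: "r : grade (real_over pr) i \<and> p : grade P j \<and> d : carrier A"
   then have "p : carrier P" using PG.grade_carrier by blast
   then show "pure_tensor P (real_over pr) PB (id (koszul (real_over pr) i j (p \<odot>\<^bsub>real_over pr\<^esub> r))) (\<kappa> d) =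
     pure_tensor P (real_over pr) PB (id r) (\<kappa> (p \<odot>\<^bsub>A\<^esub> d))"
    using R.pure_smult[of r i p j "\<kappa> d"] * \<kappa>_closed \<kappa>_smult by (simp only: id_apply)
  qed
  from R.tensor_map_eval(2)[where g = id and h = \<kappa>, OF body.tensor_pair_axioms _ \<kappa>_closed this, of 1 f]
  have "pure_tensor P (real_over pr) PB 1 (\<kappa> f) = pure_tensor P (real_over pr) PB 1 (pb \<one>\<^bsub>P\<^esub> (br f))"
   using \<kappa>_body[OF br_closed[OF f]] f by simp
  then have "1 \<odot>\<^bsub>B\<^esub> \<epsilon> (\<kappa> f) = 1 \<odot>\<^bsub>B\<^esub> \<epsilon> (pb \<one>\<^bsub>P\<^esub> (br f))"
   using \<delta>[of 1 "\<kappa> f"] \<delta>[of 1 "pb \<one>\<^bsub>P\<^esub> (br f)"] \<kappa>_closed[OF f] pb_closed br_closed[OF f] by simp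
  then show ?thesis
   using \<epsilon>(2)[of "\<one>\<^bsub>P\<^esub>" "br f"] br_closed[OF f] addmap_closed[OF \<epsilon>(1) \<kappa>_closed[OF f]]
   by (simp add: smult_B_one pr_one)
 qed
 then show ?thesis using that \<epsilon> by blast
qed

definition \<sigma> where "\<sigma> b = inv_into (carrier A) \<kappa> (pb \<one>\<^bsub>P\<^esub> b)"

lemma \<sigma>_closed: "b : carrier B ==> \<sigma> b : carrier A"
 and \<kappa>_\<sigma>: "b : carrier B ==> \<kappa> (\<sigma> b) = pb \<one>\<^bsub>P\<^esub> b"
proof -
 assume "b : carrier B"
 then have "pb \<one>\<^bsub>P\<^esub> b : \<kappa> ` carrier A" using \<kappa>_bij pb_closed by (simp add: bij_betw_def)
 then show "\<sigma> b : carrier A" "\<kappa> (\<sigma> b) = pb \<one>\<^bsub>P\<^esub> b"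
  unfolding \<sigma>_def by (simp_all only: inv_into_into f_inv_into_f)
qed

lemma \<sigma>_eqI: "[|\<kappa> f = pb \<one>\<^bsub>P\<^esub> b; f : carrier A; b : carrier B|] ==> \<sigma> b = f"
 using \<kappa>_inj \<kappa>_\<sigma> \<sigma>_closed by metis

text \<open>\<open>\<epsilon>\<close> takes \<open>\<kappa> (\<sigma> b) = 1 \<otimes> b\<close> to
  \<open>b\<close>, and \<open>\<epsilon>\<close> after \<open>\<kappa>\<close> is
  \<open>br\<close>.\<close>

lemma br_\<sigma>: "b : carrier B ==> br (\<sigma> b) = b"
proof -
 assume b: "b : carrier B"
 obtain \<epsilon> where "\<And>p b. [|p : carrier P; b : carrier B|] ==> \<epsilon> (pb p b) = pr p \<odot>\<^bsub>B\<^esub> b"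
  "\<And>f. f : carrier A ==> \<epsilon> (\<kappa> f) = br f" using counit by metis
 then show ?thesis
  using \<kappa>_\<sigma>[OF b] \<sigma>_closed[OF b] b by (metis P.A.one_closed pr_one smult_B_one)
qed

lemma additive_\<sigma>: "addmap B A \<sigma>"
 by (rule addmapI, rule \<sigma>_closed, assumption, rule \<sigma>_eqI)
  (simp_all add: \<sigma>_closed \<kappa>_\<sigma> addmap_add[OF additive_\<kappa>] addmap_add[OF additive_pb_right])

lemma \<sigma>_mult: "[|b : carrier B; c : carrier B|] ==> \<sigma> (b \<otimes>\<^bsub>B\<^esub> c) = \<sigma> b \<otimes>\<^bsub>A\<^esub> \<sigma> c"
 by (rule \<sigma>_eqI) (simp_all add: \<sigma>_closed \<kappa>_\<sigma> \<kappa>_mult pb_mult mult_B_closed)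

lemma \<sigma>_one: "\<sigma> \<one>\<^bsub>B\<^esub> = \<one>\<^bsub>A\<^esub>"
proof (rule \<sigma>_eqI)
 have "\<kappa> \<one>\<^bsub>A\<^esub> = \<one>\<^bsub>PB\<^esub>" using \<kappa>_hom by (simp add: algebra_hom_def ring_hom_one)
 then show "\<kappa> \<one>\<^bsub>A\<^esub> = pb \<one>\<^bsub>P\<^esub> \<one>\<^bsub>B\<^esub>" by (simp add: left_tensor_def[of real_alg] tensor_def[of real_alg])
 show "\<one>\<^bsub>B\<^esub> : carrier B" unfolding one_B by (simp add: br_closed)
qed simp

lemma \<sigma>_smult: "b : carrier B ==> \<sigma> (r \<odot>\<^bsub>B\<^esub> b) = sc r \<odot>\<^bsub>A\<^esub> \<sigma> b"
 by (rule \<sigma>_eqI)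
  (simp_all add: \<sigma>_closed \<kappa>_\<sigma> \<kappa>_smult PB_act A.smult_closed smult_B_closed pb_real_smult[symmetric] smult_sc)

text \<open>\<open>\<kappa>\<close> commutes with \<open>hcomp\<close> and is injective, so a
  preimage of an element of degree \<open>i\<close> equals its own component of degree
  \<open>i\<close>.\<close>

lemma \<sigma>_grade:
 assumes b: "b : grade B i" shows "\<sigma> b : grade A i"
proof -
 have bc: "b : carrier B" using b by (rule BG.grade_carrier)
 have "pb \<one>\<^bsub>P\<^esub> b : grade PB i"
  unfolding left_tensor_def[of real_alg] using ext.PM.pure_grade[OF P.A.one_even b] by (simp only: add_0_left)
 then have "hcomp PB i (\<kappa> (\<sigma> b)) = \<kappa> (\<sigma> b)" using \<kappa>_\<sigma>[OF bc] PBG.hcomp_grade_same by simp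
 moreover have "hcomp PB i (\<kappa> (\<sigma> b)) = \<kappa> (hcomp A i (\<sigma> b))"
  by (rule AG.hcomp_commute[OF PBG.graded_group_axioms additive_\<kappa> \<kappa>_grade \<sigma>_closed[OF bc]])
 ultimately have "\<sigma> b = hcomp A i (\<sigma> b)"
  using \<kappa>_inj[of "\<sigma> b" "hcomp A i (\<sigma> b)"] \<sigma>_closed[OF bc] AG.hcomp_closed by simp
 then show ?thesis using AG.hcomp_props(1)[OF \<sigma>_closed[OF bc], of i] by simp
qed

lemma \<kappa>_smult_\<sigma>: "[|p : carrier P; b : carrier B|] ==> \<kappa> (p \<odot>\<^bsub>A\<^esub> \<sigma> b) = pb p b"
 by (simp add: \<kappa>_smult \<sigma>_closed \<kappa>_\<sigma> PB_act)

definition \<tau> where "\<tau> f = \<sigma> (br f)"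

lemma \<tau>_closed: "f : carrier A ==> \<tau> f : carrier A"
 by (simp add: \<tau>_def \<sigma>_closed br_closed)

lemma additive_\<tau>: "addmap A A \<tau>"
 unfolding \<tau>_def by (rule addmap_comp[OF br_additive additive_\<sigma>])

lemma \<tau>_mult: "[|f : carrier A; g : carrier A|] ==> \<tau> (f \<otimes>\<^bsub>A\<^esub> g) = \<tau> f \<otimes>\<^bsub>A\<^esub> \<tau> g"
 by (simp add: \<tau>_def tensor_prod_body[symmetric] \<sigma>_mult br_closed)

lemma \<tau>_one: "\<tau> \<one>\<^bsub>A\<^esub> = \<one>\<^bsub>A\<^esub>"
 using \<sigma>_one by (simp add: \<tau>_def one_B)

lemma \<tau>_grade: "f : grade A i ==> \<tau> f : grade A i"
 by (simp add: \<tau>_def \<sigma>_grade br_grade)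

lemma br_\<tau>: "f : carrier A ==> br (\<tau> f) = br f"
 by (simp add: \<tau>_def br_\<sigma> br_closed)

lemma \<tau>_\<tau>: "f : carrier A ==> \<tau> (\<tau> f) = \<tau> f"
 using br_\<tau> by (simp add: \<tau>_def)

lemma \<tau>_smult: "[|p : carrier P; f : carrier A|] ==> \<tau> (p \<odot>\<^bsub>A\<^esub> f) = sc (pr p) \<odot>\<^bsub>A\<^esub> \<tau> f"
 using smult_B[of f "pr p"] by (simp add: \<tau>_def br_smult[of p f] \<sigma>_smult[symmetric] br_closed)

text \<open>Transported along \<open>\<kappa>\<close> from the induction over pure tensors:
  \<open>p \<otimes> b\<close> corresponds to \<open>p \<tau> g\<close> for any \<open>g\<close>
  with \<open>br g = b\<close>.\<close>

lemma A_induct [consumes 1, case_names pure add]: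
 assumes f: "f : carrier A"
  and pure: "\<And>p g. [|p : carrier P; g : carrier A|] ==> Q (p \<odot>\<^bsub>A\<^esub> \<tau> g)"
  and add: "\<And>f g. [|f : carrier A; g : carrier A; Q f; Q g|] ==> Q (f \<oplus>\<^bsub>A\<^esub> g)"
 shows "Q f"
proof -
 have "\<forall>f\<in>carrier A. \<kappa> f = X \<longrightarrow> Q f" if "X : carrier PB" for X
  using that
 proof (induction rule: PB_induct)
  case (pure p b)
  obtain g where g: "g : carrier A" "b = br g" using pure(2) by (rule br_surj)
  have "f = p \<odot>\<^bsub>A\<^esub> \<tau> g" if "f : carrier A" "\<kappa> f = pb p b" for f
   using \<kappa>_inj[OF _ that(1)] \<kappa>_smult_\<sigma>[OF pure] that(2) pure \<sigma>_closed A.smult_closed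
   unfolding \<tau>_def g(2)[symmetric] by simp
  then show ?case using assms(2)[OF pure(1) g(1)] by blast
 next
  case (add X Y)
  obtain f g where fg: "f : carrier A" "\<kappa> f = X" "g : carrier A" "\<kappa> g = Y"
   using add(1,2) \<kappa>_bij unfolding bij_betw_def by (metis imageE)
  then have "Q (f \<oplus>\<^bsub>A\<^esub> g)" using add assms(3) by simp
  moreover have "h = f \<oplus>\<^bsub>A\<^esub> g" if "h : carrier A" "\<kappa> h = X \<oplus>\<^bsub>PB\<^esub> Y" for h
   using \<kappa>_inj[of h "f \<oplus>\<^bsub>A\<^esub> g"] that fg by (simp add: addmap_add[OF additive_\<kappa>])
  ultimately show ?case by blast
 qed
 then show ?thesis using f \<kappa>_closed by blast
qed

text \<open>On a generator \<open>p \<tau> g\<close> the effect of \<open>\<tau>\<close> is to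
  replace \<open>p\<close> by \<open>sc (pr p)\<close>, and \<open>p - sc (pr p)\<close> lies in
  \<open>nil\<close>.\<close>

lemma minus_\<tau>_nspan: "f : carrier A ==> f \<ominus>\<^bsub>A\<^esub> \<tau> f : nspan nil A (\<odot>\<^bsub>A\<^esub>)"
proof (induction rule: A_induct)
 case (pure p g)
 obtain n where n: "n : nil" "p = sc (pr p) \<oplus>\<^bsub>P\<^esub> n" using split_nil[OF pure(1)] .
 have c: "sc (pr p) \<odot>\<^bsub>A\<^esub> \<tau> g : carrier A" "n \<odot>\<^bsub>A\<^esub> \<tau> g : carrier A"
  using pure n nil_carrier A.smult_closed \<tau>_closed by simp_all
 have "p \<odot>\<^bsub>A\<^esub> \<tau> g = sc (pr p) \<odot>\<^bsub>A\<^esub> \<tau> g \<oplus>\<^bsub>A\<^esub> n \<odot>\<^bsub>A\<^esub> \<tau> g"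
  using A.smult_l_distr[of "sc (pr p)" n "\<tau> g"] n pure nil_carrier \<tau>_closed by simp
 moreover have "\<tau> (p \<odot>\<^bsub>A\<^esub> \<tau> g) = sc (pr p) \<odot>\<^bsub>A\<^esub> \<tau> g"
  using pure by (simp add: \<tau>_smult \<tau>_closed \<tau>_\<tau>)
 ultimately have "p \<odot>\<^bsub>A\<^esub> \<tau> g \<ominus>\<^bsub>A\<^esub> \<tau> (p \<odot>\<^bsub>A\<^esub> \<tau> g) =
   (sc (pr p) \<odot>\<^bsub>A\<^esub> \<tau> g \<oplus>\<^bsub>A\<^esub> n \<odot>\<^bsub>A\<^esub> \<tau> g) \<ominus>\<^bsub>A\<^esub> sc (pr p) \<odot>\<^bsub>A\<^esub> \<tau> g" by (simp only:)
 also have "\<dots> = n \<odot>\<^bsub>A\<^esub> \<tau> g"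
  using c by (simp add: a_minus_def A.M.a_comm[of "sc (pr p) \<odot>\<^bsub>A\<^esub> \<tau> g"] A.M.a_assoc A.M.r_neg)
 finally show ?case
  using nspan_act[OF A.abg, of nil "(\<odot>\<^bsub>A\<^esub>)" n "\<tau> g"] A.smult_closed nil_carrier n(1) \<tau>_closed[OF pure(2)]
  by simp
next
 case (add f g)
 have "(f \<oplus>\<^bsub>A\<^esub> g) \<ominus>\<^bsub>A\<^esub> \<tau> (f \<oplus>\<^bsub>A\<^esub> g) = (f \<ominus>\<^bsub>A\<^esub> \<tau> f) \<oplus>\<^bsub>A\<^esub> (g \<ominus>\<^bsub>A\<^esub> \<tau> g)"
  using add(1,2) \<tau>_closed
  by (simp add: addmap_add[OF additive_\<tau>] a_minus_def A.M.minus_add A.M.a_ac)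
 then show ?case
  using nspan_add[OF A.abg _ add(3,4)] A.smult_closed nil_carrier by simp
qed

text \<open>\<open>\<kappa>\<close> turns the sum into \<open>\<Sum> j \<otimes> br (g j)\<close> in
  \<open>P \<otimes> B\<close>, from which \<open>functional_lift\<close> with \<open>c i\<close>
  extracts \<open>br (g i)\<close>.\<close>

lemma \<tau>_indep:
 assumes J: "finite J" "J \<subseteq> carrier P"
  and c: "\<And>j. j : J ==> functional (c j)" "\<And>i j. [|i : J; j : J|] ==> c i j = (if i = j then 1 else 0)"
  and g: "g : J \<rightarrow> carrier A" and sum: "(\<Oplus>\<^bsub>A\<^esub>j\<in>J. j \<odot>\<^bsub>A\<^esub> \<tau> (g j)) = \<zero>\<^bsub>A\<^esub>" and i: "i : J"
 shows "\<tau> (g i) = \<zero>\<^bsub>A\<^esub>"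
proof -
 obtain \<theta> where \<theta>: "addmap PB B \<theta>" "\<And>p b. [|p : carrier P; b : carrier B|] ==> \<theta> (pb p b) = c i p \<odot>\<^bsub>B\<^esub> b"
  by (rule functional_lift[OF c(1)[OF i]]) (rule that)
 note comp = addmap_comp[OF additive_\<kappa> \<theta>(1)]
 have gj: "g j : carrier A" "j : carrier P" if "j : J" for j using g J(2) that by auto
 have "\<zero>\<^bsub>B\<^esub> = \<theta> (\<kappa> (\<Oplus>\<^bsub>A\<^esub>j\<in>J. j \<odot>\<^bsub>A\<^esub> \<tau> (g j)))"
  unfolding sum using addmap_zero[OF comp A.abg BG.abg] by simp
 also have "\<dots> = (\<Oplus>\<^bsub>B\<^esub>j\<in>J. \<theta> (\<kappa> (j \<odot>\<^bsub>A\<^esub> \<tau> (g j))))"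
  by (rule addmap_finsum[OF comp A.abg BG.abg])
   (use gj A.smult_closed \<tau>_closed in auto)
 also have "\<dots> = (\<Oplus>\<^bsub>B\<^esub>j\<in>J. if i = j then br (g j) else \<zero>\<^bsub>B\<^esub>)"
 proof (rule BG.M.finsum_cong')
  fix j assume j: "j : J"
  have "\<theta> (\<kappa> (j \<odot>\<^bsub>A\<^esub> \<tau> (g j))) = c i j \<odot>\<^bsub>B\<^esub> br (g j)"
   unfolding \<tau>_def using \<kappa>_smult_\<sigma> \<theta>(2) gj[OF j] br_closed by simp
  then show "\<theta> (\<kappa> (j \<odot>\<^bsub>A\<^esub> \<tau> (g j))) = (if i = j then br (g j) else \<zero>\<^bsub>B\<^esub>)"
   using c(2)[OF i j] gj[OF j] br_closed smult_B_one smult_B_zero by simp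
 qed (use gj br_closed in auto)
 also have "\<dots> = br (g i)"
  by (rule BG.M.finsum_singleton[OF i J(1)]) (use gj br_closed in auto)
 finally have "br (g i) = \<zero>\<^bsub>B\<^esub>" by simp
 then show ?thesis
  unfolding \<tau>_def using addmap_zero[OF additive_\<sigma> BG.abg A.abg] by simp
qed

end

section \<open>Semilinear splittings\<close>

lemma nspan_finsum:
 assumes "abelian_group M" "\<And>n x. [|n : N; x : carrier M|] ==> act n x : carrier M"
  "\<And>i. i : I ==> f i : nspan N M act"
 shows "(\<Oplus>\<^bsub>M\<^esub>i\<in>I. f i) : nspan N M act"
proof -
 interpret M: abelian_group M by fact
 show ?thesis
  using assms(3)
 proof (induction I rule: infinite_finite_induct)
  case (insert i I)
  have fc: "f j : carrier M" if "j : insert i I" for j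
   by (rule nspan_closed[OF assms(1,2) insert.prems[OF that]])
  have "(\<Oplus>\<^bsub>M\<^esub>i\<in>insert i I. f i) = f i \<oplus>\<^bsub>M\<^esub> (\<Oplus>\<^bsub>M\<^esub>i\<in>I. f i)"
   by (rule M.finsum_insert) (use insert fc in auto)
  moreover have "f i : nspan N M act" "(\<Oplus>\<^bsub>M\<^esub>i\<in>I. f i) : nspan N M act"
   using insert by auto
  ultimately show ?case using nspan_add[OF assms(1,2)] by simp
 qed (use nspan.zero[of M N act] in auto)
qed

lemma nspan_image:
 assumes ab: "abelian_group M" "abelian_group M'"
  and act: "\<And>n x. [|n : N; x : carrier M|] ==> act n x : carrier M"
   "\<And>n x. [|n : N'; x : carrier M'|] ==> act' n x : carrier M'"
  and h: "addmap M M' h"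
  and step: "\<And>n x. [|n : N; x : carrier M|] ==> h (act n x) : nspan N' M' act'"
  and x: "x : nspan N M act"
 shows "h x : nspan N' M' act'"
 using x
proof induction
 case zero
 then show ?case using addmap_zero[OF h ab] nspan.zero by simp
next
 case (step y n z)
 have "h (y \<oplus>\<^bsub>M\<^esub> act n z) = h y \<oplus>\<^bsub>M'\<^esub> h (act n z)"
  by (rule addmap_add[OF h nspan_closed[OF ab(1) act(1) step(1)] act(1)[OF step(2,3)]])
 then show ?case using nspan_add[OF ab(2) act(2) step(4) assms(6)[OF step(2,3)]] by simp
qed

lemma nspan_neg:
 assumes "abelian_group M" "\<And>n. n : N ==> addmap M M (act n)" "x : nspan N M act"
 shows "\<ominus>\<^bsub>M\<^esub> x : nspan N M act"
proof (rule nspan_image[OF assms(1,1) _ _ _ _ assms(3)])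
 interpret M: abelian_group M by fact
 show "addmap M M (a_inv M)" by (rule addmapI) (simp_all add: M.minus_add)
 show "\<ominus>\<^bsub>M\<^esub> act n x : nspan N M act" if "n : N" "x : carrier M" for n x
  using nspan_act[OF assms(1) _ that(1), of act "\<ominus>\<^bsub>M\<^esub> x"] that
   addmap_neg[OF assms(2)[OF that(1)] assms(1,1) that(2)] addmap_closed[OF assms(2)]
  by (simp only: M.a_inv_closed)
qed (rule addmap_closed[OF assms(2)], assumption+)+

locale identified_module = identified P pr A \<kappa> + E: supermodule A E
 for P :: "(real, 'p) gmodule" and pr and A :: "('p, 'a) gmodule" and \<kappa> and E :: "('a, 'e) gmodule"
begin

sublocale EG: graded_group E by (rule E.graded_group)

text \<open>\<open>E\<close> is a module over \<open>A\<close> only; \<open>P\<close> acts on it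
  through the structure map \<open>\<iota>\<close> of the algebra \<open>A\<close>.\<close>

definition \<iota> where "\<iota> p = p \<odot>\<^bsub>A\<^esub> \<one>\<^bsub>A\<^esub>"
definition pact where "pact p e = \<iota> p \<odot>\<^bsub>E\<^esub> e"

lemma \<iota>_closed: "p : carrier P ==> \<iota> p : carrier A"
 by (simp add: \<iota>_def A.smult_closed)

lemma \<iota>_mult: "[|p : carrier P; q : carrier P|] ==> \<iota> (p \<otimes>\<^bsub>P\<^esub> q) = \<iota> p \<otimes>\<^bsub>A\<^esub> \<iota> q"
 by (simp add: \<iota>_def A.smult_assoc A.smult_closed smult_conv_mult[symmetric])

lemma \<iota>_one: "\<iota> \<one>\<^bsub>P\<^esub> = \<one>\<^bsub>A\<^esub>"
 by (simp add: \<iota>_def A.smult_one)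

lemma \<iota>_grade: "p : grade P i ==> \<iota> p : grade A i"
 unfolding \<iota>_def using A.grade_smult[OF _ A.A.one_even, of p i] by (simp only: add_0_right)

lemma additive_\<iota>: "addmap P A \<iota>"
 unfolding \<iota>_def by (rule A.additive_smult_left) simp

lemma \<iota>_smult: "[|p : carrier P; f : carrier A|] ==> p \<odot>\<^bsub>A\<^esub> f = \<iota> p \<otimes>\<^bsub>A\<^esub> f"
 unfolding \<iota>_def by (rule smult_conv_mult)

lemma \<tau>_\<iota>: "p : carrier P ==> \<tau> (\<iota> p) = \<iota> (sc (pr p))"
 by (simp add: \<iota>_def \<tau>_smult \<tau>_one)

lemma pact_closed: "[|p : carrier P; e : carrier E|] ==> pact p e : carrier E"
 by (simp add: pact_def \<iota>_closed E.smult_closed)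

lemma pact_nil: "[|n : nil; e : carrier E|] ==> pact n e : carrier E"
 using pact_closed nil_carrier by blast

lemma additive_pact: "p : carrier P ==> addmap E E (pact p)"
 unfolding pact_def by (rule E.additive_smult) (rule \<iota>_closed)

lemma additive_pact_left: "e : carrier E ==> addmap P E (\<lambda>p. pact p e)"
 unfolding pact_def by (rule addmap_comp[OF additive_\<iota> E.additive_smult_left])

lemma pact_mult: "[|p : carrier P; q : carrier P; e : carrier E|] ==> pact (p \<otimes>\<^bsub>P\<^esub> q) e = pact p (pact q e)"
 by (simp add: pact_def \<iota>_mult E.smult_assoc \<iota>_closed)

lemma pact_one: "e : carrier E ==> pact \<one>\<^bsub>P\<^esub> e = e"
 by (simp add: pact_def \<iota>_one E.smult_one)

lemma pact_zero: "e : carrier E ==> pact \<zero>\<^bsub>P\<^esub> e = \<zero>\<^bsub>E\<^esub>"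
 by (rule addmap_zero[OF additive_pact_left P.abg E.abg])

lemma smult_pact:
 assumes "p : grade P i" "f : grade A j" "e : carrier E"
 shows "f \<odot>\<^bsub>E\<^esub> pact p e = pact p (koszul E i j (f \<odot>\<^bsub>E\<^esub> e))"
proof -
 have c: "p : carrier P" "f : carrier A" using assms PG.grade_carrier AG.grade_carrier by blast+
 have "f \<otimes>\<^bsub>A\<^esub> \<iota> p = koszul A j i (\<iota> p \<otimes>\<^bsub>A\<^esub> f)"
  by (rule A.A.supercommutative[OF assms(2) \<iota>_grade[OF assms(1)]])
 note comm = this
 note assoc = E.smult_assoc[of f "\<iota> p" e] E.smult_assoc[of "\<iota> p" f e]
 show ?thesis
 proof (cases "i = 1 \<and> j = 1")
  case True
  then have "f \<otimes>\<^bsub>A\<^esub> \<iota> p = \<ominus>\<^bsub>A\<^esub> (\<iota> p \<otimes>\<^bsub>A\<^esub> f)" and k: "koszul E i j (f \<odot>\<^bsub>E\<^esub> e) = \<ominus>\<^bsub>E\<^esub> (f \<odot>\<^bsub>E\<^esub> e)"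
   using comm by (auto simp: koszul_def)
  then show ?thesis
   unfolding pact_def k using c assms(3) \<iota>_closed[OF c(1)] assoc
   by (simp add: E.smult_neg_left E.smult_neg_right E.smult_closed)
 next
  case False
  then have "f \<otimes>\<^bsub>A\<^esub> \<iota> p = \<iota> p \<otimes>\<^bsub>A\<^esub> f" and k: "koszul E i j (f \<odot>\<^bsub>E\<^esub> e) = f \<odot>\<^bsub>E\<^esub> e"
   using comm by (auto simp: koszul_def)
  then show ?thesis
   unfolding pact_def k using c assms(3) \<iota>_closed[OF c(1)] assoc by simp
 qed
qed

text \<open>The homogeneous parts of \<open>f\<close> pass those of \<open>n\<close> up to sign, and
  the parts of \<open>n\<close> remain in \<open>nil\<close> by \<open>nil_hcomp\<close>.\<close>

lemma nspan_smult:
 assumes f: "f : carrier A" and x: "x : nspan nil E pact"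
 shows "f \<odot>\<^bsub>E\<^esub> x : nspan nil E pact"
proof (rule nspan_image[OF E.abg E.abg _ _ E.additive_smult[OF f] _ x])
 fix n e assume n: "n : nil" and e: "e : carrier E"
 have hom: "g \<odot>\<^bsub>E\<^esub> pact q e : nspan nil E pact" if "q : nil" "q : grade P i" "g : grade A j" for g q i j
  unfolding smult_pact[OF that(2,3) e]
  by (rule nspan_act[OF E.abg pact_nil that(1)])
   (use that(3) AG.grade_carrier e E.smult_closed in \<open>auto simp: koszul_def\<close>)
 note np = nil_carrier[OF n]
 note c = AG.hcomp_closed[OF f] PG.hcomp_closed[OF np]
 have t: "hcomp A j f \<odot>\<^bsub>E\<^esub> pact (hcomp P i n) e : nspan nil E pact" for i j
  by (rule hom[OF nil_hcomp[OF n] PG.hcomp_props(1)[OF np] AG.hcomp_props(1)[OF f]])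
 have pe: "pact (hcomp P i n) e : carrier E" for i using pact_closed c(2) e by blast
 have "pact n e = pact (hcomp P 0 n) e \<oplus>\<^bsub>E\<^esub> pact (hcomp P 1 n) e"
  using addmap_add[OF additive_pact_left[OF e] c(2) c(2), of 0 1] PG.hcomp_sum[OF np] by simp
 then have "f \<odot>\<^bsub>E\<^esub> pact n e = (hcomp A 0 f \<oplus>\<^bsub>A\<^esub> hcomp A 1 f) \<odot>\<^bsub>E\<^esub> (pact (hcomp P 0 n) e \<oplus>\<^bsub>E\<^esub> pact (hcomp P 1 n) e)"
  using AG.hcomp_sum[OF f] by simp
 also have "\<dots> = (hcomp A 0 f \<odot>\<^bsub>E\<^esub> pact (hcomp P 0 n) e \<oplus>\<^bsub>E\<^esub> hcomp A 0 f \<odot>\<^bsub>E\<^esub> pact (hcomp P 1 n) e) \<oplus>\<^bsub>E\<^esub>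
   (hcomp A 1 f \<odot>\<^bsub>E\<^esub> pact (hcomp P 0 n) e \<oplus>\<^bsub>E\<^esub> hcomp A 1 f \<odot>\<^bsub>E\<^esub> pact (hcomp P 1 n) e)"
  using c pe E.smult_closed by (subst E.smult_l_distr) (simp_all add: E.smult_r_distr)
 also have "\<dots> : nspan nil E pact"
  by (intro nspan_add[OF E.abg pact_nil] t)
 finally show "f \<odot>\<^bsub>E\<^esub> pact n e : nspan nil E pact" .
qed (rule pact_nil, assumption+)+

text \<open>These products generate the subgroups \<open>filt l\<close>, which start with all of
  \<open>E\<close> and reach zero for some \<open>l\<close> because \<open>nil\<close> is
  nilpotent.\<close>

definition prods where "prods l = {foldr (\<otimes>\<^bsub>P\<^esub>) ns \<one>\<^bsub>P\<^esub> | ns. length ns = l \<and> set ns \<subseteq> nil}"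

lemma foldr_closed: "set ns \<subseteq> carrier P ==> q : carrier P ==> foldr (\<otimes>\<^bsub>P\<^esub>) ns q : carrier P"
 by (induction ns) auto

lemma foldr_append: "set ns \<subseteq> carrier P ==> q : carrier P ==>
  foldr (\<otimes>\<^bsub>P\<^esub>) ns q = foldr (\<otimes>\<^bsub>P\<^esub>) ns \<one>\<^bsub>P\<^esub> \<otimes>\<^bsub>P\<^esub> q"
 by (induction ns) (auto simp: P.A.m_assoc foldr_closed)

lemma prods_carrier: "q : prods l ==> q : carrier P"
 using foldr_closed nil_carrier by (auto simp: prods_def subset_iff)

lemma prods_Suc: "[|q : prods l; n : nil|] ==> q \<otimes>\<^bsub>P\<^esub> n : prods (Suc l)"
proof -
 assume q: "q : prods l" and n: "n : nil"
 obtain ns where ns: "q = foldr (\<otimes>\<^bsub>P\<^esub>) ns \<one>\<^bsub>P\<^esub>" "length ns = l" "set ns \<subseteq> nil"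
  using q by (auto simp: prods_def)
 have "foldr (\<otimes>\<^bsub>P\<^esub>) (ns @ [n]) \<one>\<^bsub>P\<^esub> = q \<otimes>\<^bsub>P\<^esub> n"
  using foldr_append[of ns n] ns nil_carrier n by auto
 moreover have "length (ns @ [n]) = Suc l" "set (ns @ [n]) \<subseteq> nil" using ns n by auto
 ultimately show ?thesis
  unfolding prods_def by (intro CollectI exI[of _ "ns @ [n]"] conjI) (simp_all only: refl)
qed

abbreviation filt where "filt l \<equiv> nspan (prods l) E pact"

lemma pact_prods: "[|q : prods l; e : carrier E|] ==> pact q e : carrier E"
 using pact_closed prods_carrier by blast

lemma filt_Suc:
 assumes q: "q : prods l" and x: "x : nspan nil E pact"
 shows "pact q x : filt (Suc l)"
proof (rule nspan_image[OF E.abg E.abg pact_nil pact_prods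
   additive_pact[OF prods_carrier[OF q]] _ x])
 fix n e assume n: "n : nil" and e: "e : carrier E"
 have "pact q (pact n e) = pact (q \<otimes>\<^bsub>P\<^esub> n) e"
  using pact_mult[OF prods_carrier[OF q] nil_carrier[OF n] e] by simp
 also have "\<dots> : filt (Suc l)"
  by (rule nspan_act[OF E.abg pact_prods prods_Suc[OF q n] e])
 finally show "pact q (pact n e) : filt (Suc l)" .
qed

lemma filt_0: "e : carrier E ==> e : filt 0"
proof -
 assume e: "e : carrier E"
 have "\<one>\<^bsub>P\<^esub> : prods 0" by (simp add: prods_def)
 from nspan_act[where act = pact and N = "prods 0", OF E.abg pact_prods this e] show ?thesis by (simp add: pact_one e)
qed

lemma filt_zero: "\<exists>k. \<forall>e\<in>filt k. e = \<zero>\<^bsub>E\<^esub>"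
proof -
 obtain k where k: "\<And>xs. length xs = k \<and> set xs \<subseteq> nil ==> foldr (\<otimes>\<^bsub>P\<^esub>) xs \<one>\<^bsub>P\<^esub> = \<zero>\<^bsub>P\<^esub>"
  using nilpotent by metis
 have "e = \<zero>\<^bsub>E\<^esub>" if "e : filt k" for e
  using that by induction (use k pact_zero in \<open>auto simp: prods_def\<close>)
 then show ?thesis by blast
qed

text \<open>\<open>\<Phi> - id\<close> takes each step of the filtration into the next. If
  \<open>\<Phi> e = 0\<close>, then \<open>e\<close> is the negative of its own image under
  \<open>\<Phi> - id\<close> and so lies in every step, hence in the one that is zero.\<close>

lemma unipotent_injective:
 assumes \<Phi>: "addmap E E \<Phi>" "\<And>p e. [|p : carrier P; e : carrier E|] ==> \<Phi> (pact p e) = pact p (\<Phi> e)"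
  and near: "\<And>e. e : carrier E ==> \<Phi> e \<ominus>\<^bsub>E\<^esub> e : nspan nil E pact"
  and e: "e : carrier E" "\<Phi> e = \<zero>\<^bsub>E\<^esub>"
 shows "e = \<zero>\<^bsub>E\<^esub>"
proof -
 have \<Delta>: "addmap E E (\<lambda>e. \<Phi> e \<ominus>\<^bsub>E\<^esub> e)"
  by (rule addmap_pointwise_minus[OF \<Phi>(1) addmap_id E.abg])
 have step: "\<Phi> x \<ominus>\<^bsub>E\<^esub> x : filt (Suc l)" if "x : filt l" for x l
 proof (rule nspan_image[OF E.abg E.abg pact_prods pact_prods \<Delta> _ that])
  fix q x assume q: "q : prods l" and x: "x : carrier E"
  have "\<Phi> (pact q x) \<ominus>\<^bsub>E\<^esub> pact q x = pact q (\<Phi> x \<ominus>\<^bsub>E\<^esub> x)"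
   using \<Phi>(2)[OF prods_carrier[OF q] x] addmap_closed[OF \<Phi>(1) x] x
    addmap_minus[OF additive_pact[OF prods_carrier[OF q]] E.abg E.abg]
   by simp
  then show "\<Phi> (pact q x) \<ominus>\<^bsub>E\<^esub> pact q x : filt (Suc l)" using filt_Suc[OF q near[OF x]] by simp
 qed
 have "e : filt l" for l
 proof (induction l)
  case (Suc l)
  have "\<ominus>\<^bsub>E\<^esub> e : filt (Suc l)" using step[OF Suc] e by (simp add: a_minus_def)
  from nspan_neg[OF E.abg additive_pact[OF prods_carrier] this]
  show ?case using e(1) by simp
 qed (rule filt_0[OF e(1)])
 then show ?thesis using filt_zero by blast
qed

end

locale splitting = identified_module P pr A \<kappa> E
 for P :: "(real, 'p) gmodule" and pr and A :: "('p, 'a) gmodule" and \<kappa> and E :: "('a, 'e) gmodule" +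
 fixes S :: "'e \<Rightarrow> 'e"
 assumes additive_S: "addmap E E S"
  and S_smult: "[|f : carrier A; e : carrier E|] ==> S (f \<odot>\<^bsub>E\<^esub> e) = \<tau> f \<odot>\<^bsub>E\<^esub> S e"
  and S_near: "e : carrier E ==> e \<ominus>\<^bsub>E\<^esub> S e : nspan nil E pact"
begin

lemma S_closed: "e : carrier E ==> S e : carrier E"
 by (rule addmap_closed[OF additive_S])

lemma S_pact: "[|p : carrier P; e : carrier E|] ==> S (pact p e) = pact (sc (pr p)) (S e)"
 unfolding pact_def by (simp add: S_smult \<iota>_closed \<tau>_\<iota>)

lemma S_pact_nil: "[|n : nil; e : carrier E|] ==> S (pact n e) = \<zero>\<^bsub>E\<^esub>"
 using S_pact[of n e] nil_carrier[of n] pact_zero S_closed by (simp add: nil_def)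

lemma S_nspan: "x : nspan nil E pact ==> S x = \<zero>\<^bsub>E\<^esub>"
proof (induction rule: nspan.induct)
 case zero
 show ?case by (rule addmap_zero[OF additive_S E.abg E.abg])
next
 case (step y n x)
 have "y : carrier E" by (rule nspan_closed[OF E.abg pact_nil step(1)])
 then show ?case
  using step pact_nil by (simp add: addmap_add[OF additive_S] S_pact_nil)
qed

text \<open>\<open>e - S e\<close> lies in \<open>nil E\<close>, where \<open>S\<close> vanishes
  because \<open>\<tau>\<close> sends \<open>\<iota> n\<close> to zero for \<open>n\<close> in
  \<open>nil\<close>.\<close>

lemma S_S: "e : carrier E ==> S (S e) = S e"
proof -
 assume e: "e : carrier E"
 have "S e \<ominus>\<^bsub>E\<^esub> S (S e) = \<zero>\<^bsub>E\<^esub>"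
  using S_nspan[OF S_near[OF e]] addmap_minus[OF additive_S E.abg E.abg e S_closed[OF e]]
  by simp
 then show ?thesis
  using E.M.minus_equality[of "S e" "\<ominus>\<^bsub>E\<^esub> S (S e)"] S_closed e by (simp add: a_minus_def)
qed

text \<open>Descending induction along the filtration: in \<open>q x = q (S x) + q (x - S x)\<close>
  the first term is expanded through the basis and the second lies one step deeper.\<close>

lemma decomposition_exists:
 assumes J: "finite J" "J \<subseteq> carrier P" and c: "\<And>x. x : carrier P ==> x = (\<Oplus>\<^bsub>P\<^esub>j\<in>J. c j x \<odot>\<^bsub>P\<^esub> j)"
  and e: "e : carrier E"
 shows "\<exists>y\<in>J \<rightarrow> carrier E. e = (\<Oplus>\<^bsub>E\<^esub>j\<in>J. pact j (S (y j)))"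
proof -
 define H where "H = {(\<Oplus>\<^bsub>E\<^esub>j\<in>J. pact j (S (y j))) | y. y : J \<rightarrow> carrier E}"
 have term_closed: "pact j (S x) : carrier E" if "j : J" "x : carrier E" for j x
  using that J pact_closed S_closed by blast
 have H_add: "x \<oplus>\<^bsub>E\<^esub> x' : H" if x: "x : H" and x': "x' : H" for x x'
 proof -
  obtain y y' where y: "y : J \<rightarrow> carrier E" "x = (\<Oplus>\<^bsub>E\<^esub>j\<in>J. pact j (S (y j)))"
   "y' : J \<rightarrow> carrier E" "x' = (\<Oplus>\<^bsub>E\<^esub>j\<in>J. pact j (S (y' j)))"
   using x x' unfolding H_def by blast
  have "x \<oplus>\<^bsub>E\<^esub> x' = (\<Oplus>\<^bsub>E\<^esub>j\<in>J. pact j (S (y j)) \<oplus>\<^bsub>E\<^esub> pact j (S (y' j)))"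
   unfolding y(2,4) by (rule E.M.finsum_addf[symmetric]) (use y term_closed in auto)
  also have "\<dots> = (\<Oplus>\<^bsub>E\<^esub>j\<in>J. pact j (S (y j \<oplus>\<^bsub>E\<^esub> y' j)))"
  proof (rule E.M.finsum_cong')
   fix j assume j: "j : J"
   then have yc: "y j : carrier E" "y' j : carrier E" using y(1,3) by auto
   then show "pact j (S (y j)) \<oplus>\<^bsub>E\<^esub> pact j (S (y' j)) = pact j (S (y j \<oplus>\<^bsub>E\<^esub> y' j))"
    using addmap_add[OF addmap_comp[OF additive_S additive_pact], of j "y j" "y' j"] j J by auto
  qed (use y term_closed in \<open>auto simp: Pi_iff\<close>)
  finally show ?thesis
   unfolding H_def
   by (intro CollectI exI[of _ "\<lambda>j. y j \<oplus>\<^bsub>E\<^esub> y' j"] conjI) (use y in \<open>auto simp: Pi_iff\<close>)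
 qed
 \<comment> \<open>\<open>p\<close> is expanded in the basis, and its real coefficients are absorbed
   into the argument of \<open>S\<close>, which is linear over the reals.\<close>
 have H_pact: "pact p (S x) : H" if p: "p : carrier P" and x: "x : carrier E" for p x
 proof -
  have jx: "pact (c j p \<odot>\<^bsub>P\<^esub> j) (S x) = pact j (S (pact (sc (c j p)) x))" if "j : J" for j
  proof -
   have jP: "j : carrier P" using that J by blast
   have "c j p \<odot>\<^bsub>P\<^esub> j = j \<otimes>\<^bsub>P\<^esub> sc (c j p)"
    using ext.mult_P_smult(2)[OF jP P.A.one_closed, of "c j p"] jP by (simp add: sc_def)
   then show ?thesis using jP x S_closed by (simp add: pact_mult S_pact)
  qed
  have "pact p (S x) = pact (\<Oplus>\<^bsub>P\<^esub>j\<in>J. c j p \<odot>\<^bsub>P\<^esub> j) (S x)" using c[OF p] by simp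
  also have "\<dots> = (\<Oplus>\<^bsub>E\<^esub>j\<in>J. pact (c j p \<odot>\<^bsub>P\<^esub> j) (S x))"
   by (rule addmap_finsum[OF additive_pact_left P.abg E.abg])
    (use x S_closed J real_smult_closed in auto)
  also have "\<dots> = (\<Oplus>\<^bsub>E\<^esub>j\<in>J. pact j (S (pact (sc (c j p)) x)))"
   by (rule E.M.finsum_cong') (use jx x term_closed pact_closed in auto)
  finally show ?thesis
   unfolding H_def
   by (intro CollectI exI[of _ "\<lambda>j. pact (sc (c j p)) x"] conjI) (use x pact_closed in simp_all)
 qed
 have H_zero: "\<zero>\<^bsub>E\<^esub> : H"
  using H_pact[of "\<zero>\<^bsub>P\<^esub>" "\<zero>\<^bsub>E\<^esub>"] pact_zero[OF S_closed[of "\<zero>\<^bsub>E\<^esub>"]] by simp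
 obtain k where k: "\<forall>e\<in>filt k. e = \<zero>\<^bsub>E\<^esub>" using filt_zero by blast
 \<comment> \<open>\<open>d\<close> counts upwards while the step \<open>k - d\<close> comes down
   from the zero step \<open>filt k\<close>. Once \<open>d\<close> has reached \<open>k\<close>, the
   truncated difference stays at 0 and nothing is left to show.\<close>
 have "filt (k - d) \<subseteq> H" for d
 proof (induction d)
  case 0
  then show ?case using k H_zero by auto
 next
  case (Suc d)
  show ?case
  proof (cases "k \<le> d")
   case True
   then show ?thesis using Suc by simp
  next
   case False
   define l where "l = k - Suc d"
   have IH: "filt (Suc l) \<subseteq> H" using Suc False by (simp add: l_def Suc_diff_Suc)
   have "x : H" if "x : filt l" for x
    using that
   proof induction
    case zero
    show ?case by (rule H_zero)
   next
    case (step y q x)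
    have q: "q : carrier P" using prods_carrier[OF step(2)] .
    have "pact q x = pact q (S x) \<oplus>\<^bsub>E\<^esub> pact q (x \<ominus>\<^bsub>E\<^esub> S x)"
    proof -
     have "x = S x \<oplus>\<^bsub>E\<^esub> (x \<ominus>\<^bsub>E\<^esub> S x)"
      using step(3) S_closed by (simp add: a_minus_def E.M.a_lcomm E.M.r_neg)
     then show ?thesis
      using addmap_add[OF additive_pact[OF q], of "S x" "x \<ominus>\<^bsub>E\<^esub> S x"] step(3) S_closed by simp
    qed
    moreover have "pact q (x \<ominus>\<^bsub>E\<^esub> S x) : H" using filt_Suc[OF step(2) S_near[OF step(3)]] IH by blast
    ultimately have "pact q x : H" using H_add[OF H_pact[OF q step(3)]] by simp
    then show ?case using H_add[OF step(4)] by simp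
   qed
   then show ?thesis unfolding l_def by blast
  qed
 qed
 from this[of k] have "filt 0 \<subseteq> H" by simp
 then have "e : H" using filt_0[OF e] by blast
 then show ?thesis unfolding H_def by blast
qed

end

section \<open>Free modules\<close>

locale free_identified = identified_module P pr A \<kappa> E
 for P :: "(real, 'p) gmodule" and pr and A :: "('p, 'a) gmodule" and \<kappa> and E :: "('a, 'e) gmodule" +
 fixes p q :: nat and \<psi> :: "'e \<Rightarrow> nat \<Rightarrow> 'a"
 assumes \<psi>_hom: "module_hom A E (free_module p q A) \<psi>"
  and \<psi>_bij: "bij_betw \<psi> (carrier E) (carrier (free_module p q A))"
begin

lemma \<psi>_PiE: "e : carrier E ==> \<psi> e : {..<p + q} \<rightarrow>\<^sub>E carrier A"
 using \<psi>_hom by (auto simp: module_hom_def free_module_def)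

lemma coord_closed: "[|e : carrier E; k < p + q|] ==> \<psi> e k : carrier A"
 using PiE_mem[OF \<psi>_PiE] by simp

lemma coord_add: "[|e : carrier E; e' : carrier E; k < p + q|] ==> \<psi> (e \<oplus>\<^bsub>E\<^esub> e') k = \<psi> e k \<oplus>\<^bsub>A\<^esub> \<psi> e' k"
 using \<psi>_hom by (simp add: module_hom_def free_module_def)

lemma additive_coord: "k < p + q ==> addmap E A (\<lambda>e. \<psi> e k)"
 by (intro addmapI coord_closed coord_add)

lemma coord_smult: "[|f : carrier A; e : carrier E; k < p + q|] ==> \<psi> (f \<odot>\<^bsub>E\<^esub> e) k = f \<otimes>\<^bsub>A\<^esub> \<psi> e k"
 using \<psi>_hom by (simp add: module_hom_def free_module_def)

lemma coord_grade:
 assumes "e : grade E i" "k < p + q"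
 shows "\<psi> e k : grade A (if k < p then i else i + 1)"
proof -
 have "\<psi> ` grade E i \<subseteq> grade (free_module p q A) i" using \<psi>_hom by (simp add: module_hom_def)
 then have "\<psi> e : grade (free_module p q A) i" using assms(1) by (rule subsetD[OF _ imageI])
 then have "\<psi> e : (\<Pi>\<^sub>E k\<in>{..<p + q}. grade A (if k < p then i else i + 1))"
  by (simp only: free_module_def gmodule.simps)
 from PiE_mem[OF this, of k] show ?thesis using assms(2) by simp
qed

lemma coord_eqI:
 assumes "e : carrier E" "e' : carrier E" "\<And>k. k < p + q ==> \<psi> e k = \<psi> e' k"
 shows "e = e'"
proof -
 have "\<psi> e = \<psi> e'"
  by (rule PiE_ext[OF \<psi>_PiE[OF assms(1)] \<psi>_PiE[OF assms(2)]]) (simp add: assms(3))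
 then show ?thesis using \<psi>_bij assms(1,2) by (auto simp: bij_betw_def dest: inj_onD)
qed

text \<open>The frame of \<open>E\<close> given by \<open>\<psi>\<close>. For \<open>k\<close>
  beyond the rank it is the preimage of zero, so that closure can be stated for all
  \<open>k\<close>.\<close>

definition \<epsilon> where "\<epsilon> k = inv_into (carrier E) \<psi> (\<lambda>l\<in>{..<p + q}. if l = k then \<one>\<^bsub>A\<^esub> else \<zero>\<^bsub>A\<^esub>)"

lemma \<epsilon>_closed: "\<epsilon> k : carrier E"
 and coord_\<epsilon>: "l < p + q ==> \<psi> (\<epsilon> k) l = (if l = k then \<one>\<^bsub>A\<^esub> else \<zero>\<^bsub>A\<^esub>)"
proof -
 have "(\<lambda>l\<in>{..<p + q}. if l = k then \<one>\<^bsub>A\<^esub> else \<zero>\<^bsub>A\<^esub>) : carrier (free_module p q A)"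
  by (auto simp: free_module_def)
 then have m: "(\<lambda>l\<in>{..<p + q}. if l = k then \<one>\<^bsub>A\<^esub> else \<zero>\<^bsub>A\<^esub>) : \<psi> ` carrier E"
  using \<psi>_bij by (simp add: bij_betw_def)
 show "\<epsilon> k : carrier E" unfolding \<epsilon>_def by (rule inv_into_into[OF m])
 show "\<psi> (\<epsilon> k) l = (if l = k then \<one>\<^bsub>A\<^esub> else \<zero>\<^bsub>A\<^esub>)" if "l < p + q"
  unfolding \<epsilon>_def f_inv_into_f[OF m] using that by simp
qed

definition comb where "comb v = (\<Oplus>\<^bsub>E\<^esub>k\<in>{..<p + q}. v k \<odot>\<^bsub>E\<^esub> \<epsilon> k)"

lemma comb_closed: "(\<And>k. k < p + q ==> v k : carrier A) ==> comb v : carrier E"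
 unfolding comb_def by (intro E.M.finsum_closed) (simp add: Pi_iff E.smult_closed \<epsilon>_closed)

lemma coord_comb:
 assumes v: "\<And>k. k < p + q ==> v k : carrier A" and l: "l < p + q"
 shows "\<psi> (comb v) l = v l"
proof -
 have "\<psi> (comb v) l = (\<Oplus>\<^bsub>A\<^esub>k\<in>{..<p + q}. \<psi> (v k \<odot>\<^bsub>E\<^esub> \<epsilon> k) l)"
  unfolding comb_def
  by (rule addmap_finsum[OF additive_coord[OF l] E.abg A.abg])
   (use v E.smult_closed \<epsilon>_closed in auto)
 also have "\<dots> = (\<Oplus>\<^bsub>A\<^esub>k\<in>{..<p + q}. if l = k then v k else \<zero>\<^bsub>A\<^esub>)"
  by (rule A.M.finsum_cong') (use v l coord_smult \<epsilon>_closed coord_\<epsilon> in auto)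
 also have "\<dots> = v l"
  by (rule A.M.finsum_singleton) (use v l in auto)
 finally show ?thesis .
qed

lemma comb_coord: "e : carrier E ==> comb (\<psi> e) = e"
 by (rule coord_eqI) (simp_all add: comb_closed coord_closed coord_comb)

definition S0 where "S0 e = comb (\<lambda>k. \<tau> (\<psi> e k))"

lemma S0_closed: "e : carrier E ==> S0 e : carrier E"
 unfolding S0_def by (intro comb_closed \<tau>_closed coord_closed)

lemma coord_S0: "[|e : carrier E; k < p + q|] ==> \<psi> (S0 e) k = \<tau> (\<psi> e k)"
 unfolding S0_def by (rule coord_comb) (simp_all add: \<tau>_closed coord_closed)

lemma comb_smult_nspan:
 assumes "f : nspan nil A (\<odot>\<^bsub>A\<^esub>)" "e : carrier E"
 shows "f \<odot>\<^bsub>E\<^esub> e : nspan nil E pact"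
proof (rule nspan_image[OF A.abg E.abg _ pact_nil
   E.additive_smult_left[OF assms(2)] _ assms(1)])
 fix n g assume n: "n : nil" and g: "g : carrier A"
 have "(n \<odot>\<^bsub>A\<^esub> g) \<odot>\<^bsub>E\<^esub> e = pact n (g \<odot>\<^bsub>E\<^esub> e)"
  unfolding pact_def using nil_carrier[OF n] g assms(2) by (simp add: \<iota>_smult E.smult_assoc \<iota>_closed)
 then show "(n \<odot>\<^bsub>A\<^esub> g) \<odot>\<^bsub>E\<^esub> e : nspan nil E pact"
  using nspan_act[where act = pact, OF E.abg pact_nil n E.smult_closed[OF g assms(2)]] by simp
qed (rule A.smult_closed[OF nil_carrier], assumption+)

lemma splitting_S0: "splitting P pr A \<kappa> E S0"
proof (intro splitting.intro splitting_axioms.intro identified_module_axioms)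
 show "addmap E E S0"
 proof (rule addmapI)
  fix e e' assume e: "e : carrier E" "e' : carrier E"
  show "S0 (e \<oplus>\<^bsub>E\<^esub> e') = S0 e \<oplus>\<^bsub>E\<^esub> S0 e'"
   by (rule coord_eqI)
    (use e in \<open>simp_all add: S0_closed coord_S0 coord_add coord_closed addmap_add[OF additive_\<tau>]\<close>)
 qed (rule S0_closed)
 show "S0 (f \<odot>\<^bsub>E\<^esub> e) = \<tau> f \<odot>\<^bsub>E\<^esub> S0 e" if "f : carrier A" "e : carrier E" for f e
  by (rule coord_eqI)
   (use that in \<open>simp_all add: S0_closed E.smult_closed \<tau>_closed coord_S0 coord_smult coord_closed \<tau>_mult\<close>)
 show "e \<ominus>\<^bsub>E\<^esub> S0 e : nspan nil E pact" if e: "e : carrier E" for e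
 proof -
  have c: "\<psi> e k \<ominus>\<^bsub>A\<^esub> \<tau> (\<psi> e k) : carrier A" if "k < p + q" for k
   using coord_closed[OF e that] \<tau>_closed by simp
  have "e \<ominus>\<^bsub>E\<^esub> S0 e = comb (\<lambda>k. \<psi> e k \<ominus>\<^bsub>A\<^esub> \<tau> (\<psi> e k))"
   by (rule coord_eqI)
    (use e c in \<open>simp_all add: S0_closed comb_closed coord_comb coord_S0
     addmap_minus[OF additive_coord E.abg A.abg]\<close>)
  also have "\<dots> : nspan nil E pact"
   unfolding comb_def
   by (rule nspan_finsum[OF E.abg pact_nil comb_smult_nspan[OF minus_\<tau>_nspan \<epsilon>_closed]])
    (simp_all add: coord_closed e)
  finally show ?thesis .
 qed
qed

text \<open>\<open>\<psi>\<close> is given as mapping grades into grades, and the way back needs an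
  argument: the component of \<open>S0 e\<close> of the wrong parity has coordinates of the wrong
  parity, while the coordinates of \<open>S0 e\<close> itself have the right one, so the former are
  all zero.\<close>

lemma S0_grade:
 assumes e: "e : grade E i" shows "S0 e : grade E i"
proof -
 have ec: "e : carrier E" using e by (rule EG.grade_carrier)
 let ?x = "hcomp E (i + 1) (S0 e)"
 note x = EG.hcomp_closed[OF S0_closed[OF ec]]
 have zero: "\<psi> ?x k = \<zero>\<^bsub>A\<^esub>" if k: "k < p + q" for k
 proof -
  let ?d = "if k < p then i else i + 1"
  have 1: "\<psi> ?x k : grade A (?d + 1)"
   using coord_grade[OF EG.hcomp_props(1)[OF S0_closed[OF ec], of "i + 1"] k] by (cases "k < p") (simp_all only: if_True if_False)
  have "S0 e = hcomp E i (S0 e) \<oplus>\<^bsub>E\<^esub> ?x" by (rule EG.hcomp_props(2)[OF S0_closed[OF ec]])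
  then have "\<tau> (\<psi> e k) = \<psi> (hcomp E i (S0 e)) k \<oplus>\<^bsub>A\<^esub> \<psi> ?x k"
   using coord_add[OF x x k] coord_S0[OF ec k] by metis
  moreover have "\<tau> (\<psi> e k) : grade A ?d" by (rule \<tau>_grade[OF coord_grade[OF e k]])
  moreover have "\<psi> (hcomp E i (S0 e)) k : grade A ?d"
   by (rule coord_grade[OF EG.hcomp_props(1)[OF S0_closed[OF ec]] k])
  ultimately show ?thesis
   using AG.grade_decomp_unique[OF _ 1 _ AG.grade_zero, of "\<psi> (hcomp E i (S0 e)) k" "\<tau> (\<psi> e k)"]
    AG.grade_carrier A.M.r_zero by metis
 qed
 have "\<psi> \<zero>\<^bsub>E\<^esub> k = \<zero>\<^bsub>A\<^esub>" if "k < p + q" for k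
  by (rule addmap_zero[OF additive_coord[OF that] E.abg A.abg])
 then have "?x = \<zero>\<^bsub>E\<^esub>"
  using zero by (intro coord_eqI x) simp_all
 then have "S0 e = hcomp E i (S0 e)"
  using EG.hcomp_props(2)[OF S0_closed[OF ec], of i] x[of i] by simp
 then show ?thesis using EG.hcomp_props(1)[OF S0_closed[OF ec], of i] by simp
qed

end

locale free_splitting = free_identified P pr A \<kappa> E p q \<psi> + splitting P pr A \<kappa> E S
 for P :: "(real, 'p) gmodule" and pr and A :: "('p, 'a) gmodule" and \<kappa> and E :: "('a, 'e) gmodule"
  and p q \<psi> S
begin

text \<open>The \<open>A\<close>-linear map that moves each frame element
  \<open>\<epsilon> k\<close> to \<open>S (\<epsilon> k)\<close>. It is the unipotent factor in
  \<open>S = \<Phi>\<close> after \<open>S0\<close>.\<close>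

definition \<Phi> where "\<Phi> e = (\<Oplus>\<^bsub>E\<^esub>k\<in>{..<p + q}. \<psi> e k \<odot>\<^bsub>E\<^esub> S (\<epsilon> k))"

lemma term_closed: "[|e : carrier E; k < p + q|] ==> \<psi> e k \<odot>\<^bsub>E\<^esub> S (\<epsilon> k) : carrier E"
 by (simp add: E.smult_closed coord_closed S_closed \<epsilon>_closed)

lemma \<Phi>_closed: "e : carrier E ==> \<Phi> e : carrier E"
 unfolding \<Phi>_def by (intro E.M.finsum_closed) (simp add: Pi_iff term_closed)

lemma additive_\<Phi>: "addmap E E \<Phi>"
proof (rule addmapI)
 fix e e' assume e: "e : carrier E" "e' : carrier E"
 have "\<Phi> (e \<oplus>\<^bsub>E\<^esub> e') = (\<Oplus>\<^bsub>E\<^esub>k\<in>{..<p + q}. \<psi> e k \<odot>\<^bsub>E\<^esub> S (\<epsilon> k) \<oplus>\<^bsub>E\<^esub> \<psi> e' k \<odot>\<^bsub>E\<^esub> S (\<epsilon> k))"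
  unfolding \<Phi>_def
  by (rule E.M.finsum_cong')
   (use e in \<open>auto simp: term_closed coord_add E.smult_l_distr coord_closed S_closed \<epsilon>_closed\<close>)
 also have "\<dots> = \<Phi> e \<oplus>\<^bsub>E\<^esub> \<Phi> e'"
  unfolding \<Phi>_def by (rule E.M.finsum_addf) (use e term_closed in auto)
 finally show "\<Phi> (e \<oplus>\<^bsub>E\<^esub> e') = \<Phi> e \<oplus>\<^bsub>E\<^esub> \<Phi> e'" .
qed (rule \<Phi>_closed)

lemma \<Phi>_smult:
 assumes "f : carrier A" "e : carrier E" shows "\<Phi> (f \<odot>\<^bsub>E\<^esub> e) = f \<odot>\<^bsub>E\<^esub> \<Phi> e"
proof -
 have "f \<odot>\<^bsub>E\<^esub> \<Phi> e = (\<Oplus>\<^bsub>E\<^esub>k\<in>{..<p + q}. f \<odot>\<^bsub>E\<^esub> (\<psi> e k \<odot>\<^bsub>E\<^esub> S (\<epsilon> k)))"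
  unfolding \<Phi>_def
  by (rule addmap_finsum[OF E.additive_smult[OF assms(1)] E.abg E.abg])
   (use assms term_closed in auto)
 also have "\<dots> = \<Phi> (f \<odot>\<^bsub>E\<^esub> e)"
  unfolding \<Phi>_def
  by (rule E.M.finsum_cong')
   (use assms in \<open>auto simp: term_closed E.smult_closed coord_smult E.smult_assoc coord_closed S_closed \<epsilon>_closed\<close>)
 finally show ?thesis by simp
qed

text \<open>Each \<open>S (\<epsilon> k) - \<epsilon> k\<close> lies in \<open>nil E\<close>, which
  is stable under the coordinates as coefficients by \<open>nspan_smult\<close>.\<close>

lemma \<Phi>_near:
 assumes e: "e : carrier E" shows "\<Phi> e \<ominus>\<^bsub>E\<^esub> e : nspan nil E pact"
proof -
 have D: "S (\<epsilon> k) \<ominus>\<^bsub>E\<^esub> \<epsilon> k : nspan nil E pact" for k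
 proof -
  have "\<ominus>\<^bsub>E\<^esub> (\<epsilon> k \<ominus>\<^bsub>E\<^esub> S (\<epsilon> k)) : nspan nil E pact"
   by (rule nspan_neg[OF E.abg additive_pact[OF nil_carrier] S_near[OF \<epsilon>_closed]])
  then show ?thesis
   using \<epsilon>_closed S_closed by (simp add: a_minus_def E.M.minus_add E.M.a_comm)
 qed
 have Dc: "S (\<epsilon> k) \<ominus>\<^bsub>E\<^esub> \<epsilon> k : carrier E" for k using \<epsilon>_closed S_closed by simp
 have "\<Phi> e = (\<Oplus>\<^bsub>E\<^esub>k\<in>{..<p + q}. \<psi> e k \<odot>\<^bsub>E\<^esub> (S (\<epsilon> k) \<ominus>\<^bsub>E\<^esub> \<epsilon> k) \<oplus>\<^bsub>E\<^esub> \<psi> e k \<odot>\<^bsub>E\<^esub> \<epsilon> k)"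
  unfolding \<Phi>_def
 proof (rule E.M.finsum_cong')
  fix k assume "k : {..<p + q}"
  then have k: "\<psi> e k : carrier A" using coord_closed[OF e] by simp
  have "S (\<epsilon> k) = (S (\<epsilon> k) \<ominus>\<^bsub>E\<^esub> \<epsilon> k) \<oplus>\<^bsub>E\<^esub> \<epsilon> k"
   using \<epsilon>_closed S_closed by (simp add: a_minus_def E.M.a_assoc E.M.l_neg)
  then show "\<psi> e k \<odot>\<^bsub>E\<^esub> S (\<epsilon> k) = \<psi> e k \<odot>\<^bsub>E\<^esub> (S (\<epsilon> k) \<ominus>\<^bsub>E\<^esub> \<epsilon> k) \<oplus>\<^bsub>E\<^esub> \<psi> e k \<odot>\<^bsub>E\<^esub> \<epsilon> k"
   using E.smult_r_distr[OF k Dc \<epsilon>_closed, of k k] by simp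
 qed (use coord_closed[OF e] E.smult_closed Dc \<epsilon>_closed in auto)
 also have "\<dots> = (\<Oplus>\<^bsub>E\<^esub>k\<in>{..<p + q}. \<psi> e k \<odot>\<^bsub>E\<^esub> (S (\<epsilon> k) \<ominus>\<^bsub>E\<^esub> \<epsilon> k)) \<oplus>\<^bsub>E\<^esub> comb (\<psi> e)"
  unfolding comb_def
  by (rule E.M.finsum_addf) (use coord_closed[OF e] E.smult_closed Dc \<epsilon>_closed in auto)
 finally have eq: "\<Phi> e = (\<Oplus>\<^bsub>E\<^esub>k\<in>{..<p + q}. \<psi> e k \<odot>\<^bsub>E\<^esub> (S (\<epsilon> k) \<ominus>\<^bsub>E\<^esub> \<epsilon> k)) \<oplus>\<^bsub>E\<^esub> e"
  unfolding comb_coord[OF e] .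
 have mem: "(\<Oplus>\<^bsub>E\<^esub>k\<in>{..<p + q}. \<psi> e k \<odot>\<^bsub>E\<^esub> (S (\<epsilon> k) \<ominus>\<^bsub>E\<^esub> \<epsilon> k)) : nspan nil E pact"
  by (rule nspan_finsum[OF E.abg pact_nil nspan_smult[OF _ D]]) (use coord_closed[OF e] in simp_all)
 have "\<Phi> e \<ominus>\<^bsub>E\<^esub> e = (\<Oplus>\<^bsub>E\<^esub>k\<in>{..<p + q}. \<psi> e k \<odot>\<^bsub>E\<^esub> (S (\<epsilon> k) \<ominus>\<^bsub>E\<^esub> \<epsilon> k))"
  unfolding eq using nspan_closed[OF E.abg pact_nil mem] e
  by (simp add: a_minus_def E.M.a_assoc E.M.r_neg)
 then show ?thesis using mem by simp
qed

lemma S_conv_\<Phi>: assumes e: "e : carrier E" shows "S e = \<Phi> (S0 e)"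
proof -
 have "S e = S (comb (\<psi> e))" by (simp add: comb_coord e)
 also have "\<dots> = (\<Oplus>\<^bsub>E\<^esub>k\<in>{..<p + q}. S (\<psi> e k \<odot>\<^bsub>E\<^esub> \<epsilon> k))"
  unfolding comb_def
  by (rule addmap_finsum[OF additive_S E.abg E.abg])
   (use coord_closed[OF e] E.smult_closed \<epsilon>_closed in auto)
 also have "\<dots> = \<Phi> (S0 e)"
  unfolding \<Phi>_def
  by (rule E.M.finsum_cong')
   (use e in \<open>auto simp: coord_S0 S_smult coord_closed \<epsilon>_closed \<tau>_closed S_closed E.smult_closed\<close>)
 finally show ?thesis .
qed

text \<open>The relation is the image under \<open>\<Phi>\<close> of the same sum formed with
  \<open>S0\<close>. By \<open>unipotent_injective\<close> that sum is zero as well, and read in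
  coordinates it is a relation to which \<open>\<tau>_indep\<close> applies.\<close>

lemma decomposition_unique:
 assumes J: "finite J" "J \<subseteq> carrier P"
  and c: "\<And>j. j : J ==> functional (c j)" "\<And>i j. [|i : J; j : J|] ==> c i j = (if i = j then 1 else 0)"
  and y: "y : J \<rightarrow> carrier E" and sum: "(\<Oplus>\<^bsub>E\<^esub>j\<in>J. pact j (S (y j))) = \<zero>\<^bsub>E\<^esub>" and i: "i : J"
 shows "S (y i) = \<zero>\<^bsub>E\<^esub>"
proof -
 have yj: "y j : carrier E" "j : carrier P" if "j : J" for j using y J that by auto
 let ?e = "\<Oplus>\<^bsub>E\<^esub>j\<in>J. pact j (S0 (y j))"
 have tc: "pact j (S0 (y j)) : carrier E" if "j : J" for j using yj[OF that] by (simp add: pact_closed S0_closed)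
 have ec: "?e : carrier E" using tc by (intro E.M.finsum_closed) auto
 have \<Phi>_pact: "\<Phi> (pact p e) = pact p (\<Phi> e)" if "p : carrier P" "e : carrier E" for p e
  unfolding pact_def using that by (simp add: \<Phi>_smult \<iota>_closed)
 have "\<Phi> ?e = (\<Oplus>\<^bsub>E\<^esub>j\<in>J. \<Phi> (pact j (S0 (y j))))"
  by (rule addmap_finsum[OF additive_\<Phi> E.abg E.abg]) (use tc in auto)
 also have "\<dots> = (\<Oplus>\<^bsub>E\<^esub>j\<in>J. pact j (S (y j)))"
  by (rule E.M.finsum_cong') (use yj in \<open>auto simp: \<Phi>_pact S0_closed S_conv_\<Phi> pact_closed \<Phi>_closed\<close>)
 finally have \<Phi>0: "\<Phi> ?e = \<zero>\<^bsub>E\<^esub>" using sum by simp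
 have e0: "?e = \<zero>\<^bsub>E\<^esub>" by (rule unipotent_injective[OF additive_\<Phi> \<Phi>_pact \<Phi>_near ec \<Phi>0])
 have "\<tau> (\<psi> (y i) k) = \<zero>\<^bsub>A\<^esub>" if k: "k < p + q" for k
 proof (rule \<tau>_indep[OF J c _ _ i])
  show "(\<lambda>j. \<psi> (y j) k) : J \<rightarrow> carrier A" using yj coord_closed k by auto
  have "(\<Oplus>\<^bsub>A\<^esub>j\<in>J. j \<odot>\<^bsub>A\<^esub> \<tau> (\<psi> (y j) k)) = (\<Oplus>\<^bsub>A\<^esub>j\<in>J. \<psi> (pact j (S0 (y j))) k)"
   by (rule A.M.finsum_cong')
    (use yj k in \<open>auto simp: pact_def coord_smult \<iota>_closed S0_closed coord_S0 \<iota>_smult \<tau>_closed coord_closed\<close>)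
  also have "\<dots> = \<psi> ?e k"
   by (rule addmap_finsum[OF additive_coord[OF k] E.abg A.abg, symmetric])
    (use tc in auto)
  also have "\<dots> = \<zero>\<^bsub>A\<^esub>"
   unfolding e0 by (rule addmap_zero[OF additive_coord[OF k] E.abg A.abg])
  finally show "(\<Oplus>\<^bsub>A\<^esub>j\<in>J. j \<odot>\<^bsub>A\<^esub> \<tau> (\<psi> (y j) k)) = \<zero>\<^bsub>A\<^esub>" .
 qed
 then have "\<psi> (S0 (y i)) k = \<psi> \<zero>\<^bsub>E\<^esub> k" if "k < p + q" for k
  using coord_S0[OF yj(1)[OF i] that] that
   addmap_zero[OF additive_coord[OF that] E.abg A.abg] by simp
 then have "S0 (y i) = \<zero>\<^bsub>E\<^esub>" by (intro coord_eqI S0_closed yj i) simp_all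
 then show ?thesis
  using S_conv_\<Phi>[OF yj(1)[OF i]] addmap_zero[OF additive_\<Phi> E.abg E.abg] by simp
qed

end

section \<open>Naturality\<close>

text \<open>The restriction map of the structure sheaf between two open sets. The assumption
  \<open>natural\<close> is the compatibility of \<open>\<kappa>\<close> with restriction, its right
  side being the restriction map of the extended body.\<close>

locale identified_hom = D: identified P pr A \<kappa> + C: identified P pr A' \<kappa>'
 for P :: "(real, 'p) gmodule" and pr and A :: "('p, 'a) gmodule" and \<kappa> and A' :: "('p, 'b) gmodule" and \<kappa>' +
 fixes h :: "'a \<Rightarrow> 'b"
 assumes hom: "algebra_hom P A A' h"
  and natural: "f : carrier A ==>
   \<kappa>' (h f) = tensor_map real_alg P C.B id (tensor_map P (real_over pr) A' id h) (\<kappa> f)"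
begin

lemma additive_h: "addmap A A' h"
 using hom by (simp add: algebra_hom_def module_hom_def addmap_def)

lemma h_smult: "[|p : carrier P; f : carrier A|] ==> h (p \<odot>\<^bsub>A\<^esub> f) = p \<odot>\<^bsub>A'\<^esub> h f"
 using hom by (simp add: algebra_hom_def module_hom_def)

lemma h_mult: "[|f : carrier A; g : carrier A|] ==> h (f \<otimes>\<^bsub>A\<^esub> g) = h f \<otimes>\<^bsub>A'\<^esub> h g"
 using hom by (simp add: algebra_hom_def ring_hom_mult)

lemma h_one: "h \<one>\<^bsub>A\<^esub> = \<one>\<^bsub>A'\<^esub>"
 using hom by (simp add: algebra_hom_def ring_hom_one)

lemma h_closed: "f : carrier A ==> h f : carrier A'"
 by (rule addmap_closed[OF additive_h])

abbreviation hB where "hB \<equiv> tensor_map P (real_over pr) A' id h"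

lemma additive_hB: "addmap D.B C.B hB"
 and hB_br: "f : carrier A ==> hB (D.br f) = C.br (h f)"
proof -
 let ?act = "\<lambda>s. tensor_map P (real_over pr) A' ((*) s) id"
 have bal: "balanced P (real_over pr) A (tensor P (real_over pr) A' ?act)
  (\<lambda>c d. pure_tensor P (real_over pr) A' (id c) (h d))"
  unfolding balanced_def
 proof (intro conjI ballI allI impI)
  show "addmap (real_over pr) (tensor P (real_over pr) A' ?act)
    (\<lambda>c. pure_tensor P (real_over pr) A' (id c) (h d))" if "d : carrier A" for d
   using C.body.additive_pure_left[OF h_closed[OF that]] by simp
  show "addmap A (tensor P (real_over pr) A' ?act)
    (\<lambda>d. pure_tensor P (real_over pr) A' (id c) (h d))" for c
   by (rule addmap_comp[OF additive_h C.body.additive_pure_right]) simp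
  fix i j c r d assume *: "c : grade (real_over pr) i \<and> r : grade P j \<and> d : carrier A"
  then have r: "r : carrier P" using D.PG.grade_carrier by blast
  show "pure_tensor P (real_over pr) A' (id (koszul (real_over pr) i j (r \<odot>\<^bsub>real_over pr\<^esub> c))) (h d) =
    pure_tensor P (real_over pr) A' (id c) (h (r \<odot>\<^bsub>A\<^esub> d))"
   using C.body.pure_smult[of c i r j "h d"] * h_closed h_smult[OF r] by (simp only: id_apply)
 qed
 note ev = C.body.tensor_map_eval[where g = id and h = h, OF D.body.tensor_pair_axioms _ h_closed bal]
 show "addmap D.B C.B hB" unfolding left_tensor_def by (rule ev(1)) simp_all
 show "hB (D.br f) = C.br (h f)" if "f : carrier A"
  using ev(2)[OF _ _ _ that, of 1] by simp
qed

lemma hB_smult: "b : carrier D.B ==> hB (r \<odot>\<^bsub>D.B\<^esub> b) = r \<odot>\<^bsub>C.B\<^esub> hB b"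
proof -
 assume "b : carrier D.B"
 then obtain f where f: "f : carrier A" "b = D.br f" by (rule D.br_surj)
 show ?thesis
  unfolding f(2) using f(1) by (simp add: D.smult_B C.smult_B hB_br h_closed D.A.smult_closed h_smult)
qed

lemma extension_pb:
 assumes "p : carrier P" "b : carrier D.B"
 shows "tensor_map real_alg P C.B id hB (D.pb p b) = C.pb p (hB b)"
proof -
 note c = addmap_closed[OF additive_hB]
 have "balanced real_alg P D.B C.PB (\<lambda>p b. C.pb (id p) (hB b))"
 proof (rule D.ext.balanced_PM[OF C.PBG.abg])
  show "addmap P C.PB (\<lambda>p. C.pb (id p) (hB b))" if "b : carrier D.B" for b
   using C.additive_pb_left[OF c[OF that]] by simp
  show "addmap D.B C.PB (\<lambda>b. C.pb (id p) (hB b))" if "p : carrier P" for p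
   using addmap_comp[OF additive_hB C.additive_pb_right[OF that]] by simp
  show "C.pb (id (r \<odot>\<^bsub>P\<^esub> p)) (hB b) = C.pb (id p) (hB (r \<odot>\<^bsub>D.B\<^esub> b))"
   if "p : carrier P" "b : carrier D.B" for r p b
   using that c by (simp add: C.pb_real_smult hB_smult)
 qed
 note ev = C.ext.PM.tensor_map_eval(2)[where g = id and h = hB,
   OF D.ext.PM.tensor_pair_axioms _ c this[unfolded left_tensor_def[of real_alg]]]
 show ?thesis using ev[OF _ _ assms] by simp
qed

text \<open>\<open>\<tau> f\<close> is determined by
  \<open>\<kappa> (\<tau> f) = 1 \<otimes> br f\<close>, and the maps induced by \<open>h\<close>
  preserve this equation.\<close>

lemma \<tau>_natural: "f : carrier A ==> C.\<tau> (h f) = h (D.\<tau> f)"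
proof -
 assume f: "f : carrier A"
 have "\<kappa>' (h (D.\<tau> f)) = tensor_map real_alg P C.B id hB (D.pb \<one>\<^bsub>P\<^esub> (D.br f))"
  using natural[OF D.\<tau>_closed[OF f]] D.\<kappa>_\<sigma>[OF D.br_closed[OF f]] by (simp add: D.\<tau>_def)
 also have "\<dots> = C.pb \<one>\<^bsub>P\<^esub> (C.br (h f))"
  using extension_pb[OF D.P.A.one_closed D.br_closed[OF f]] hB_br[OF f] by simp
 finally show ?thesis
  unfolding C.\<tau>_def by (rule C.\<sigma>_eqI) (simp_all add: h_closed D.\<tau>_closed f C.br_closed)
qed

end

section \<open>The body of a module and its extension of scalars\<close>

lemma abelian_group_cong:
 assumes "abelian_group G" "carrier H = carrier G" "add H = add G" "\<zero>\<^bsub>H\<^esub> = \<zero>\<^bsub>G\<^esub>"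
 shows "abelian_group H"
proof -
 interpret G: abelian_group G by fact
 show ?thesis
 proof (rule abelian_groupI)
  show "\<exists>y\<in>carrier H. y \<oplus>\<^bsub>H\<^esub> x = \<zero>\<^bsub>H\<^esub>" if "x : carrier H" for x
   unfolding assms(2-4) by (rule bexI[of _ "\<ominus>\<^bsub>G\<^esub> x"]) (use that assms(2) G.l_neg in simp_all)
 qed (simp_all only: assms(2-4) G.a_closed G.zero_closed G.a_assoc G.l_zero, rule G.a_comm)
qed

lemma addmap_cong_groups:
 assumes "addmap G H h" "carrier G' = carrier G" "add G' = add G" "carrier H' = carrier H" "add H' = add H"
 shows "addmap G' H' h"
 using assms by (simp add: addmap_def)

lemma (in graded_group) addmaps_eq:
 assumes "addmap M G h" "addmap M G k" "\<And>i x. x : grade M i ==> h x = k x" "x : carrier M"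
 shows "h x = k x"
proof -
 note c = hcomp_closed[OF assms(4), of 0] hcomp_closed[OF assms(4), of 1]
 have "h (hcomp M 0 x \<oplus>\<^bsub>M\<^esub> hcomp M 1 x) = k (hcomp M 0 x \<oplus>\<^bsub>M\<^esub> hcomp M 1 x)"
  using assms(3)[OF hcomp_props(1)[OF assms(4)]]
  by (simp only: addmap_add[OF assms(1) c] addmap_add[OF assms(2) c])
 then show ?thesis by (simp only: hcomp_sum[OF assms(4)])
qed

context algebra_over begin

lemma mult_B_assoc:
 assumes "a : carrier B" "b : carrier B" "c : carrier B"
 shows "(a \<otimes>\<^bsub>B\<^esub> b) \<otimes>\<^bsub>B\<^esub> c = a \<otimes>\<^bsub>B\<^esub> (b \<otimes>\<^bsub>B\<^esub> c)"
proof -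
 obtain f where f: "f : carrier A" "a = br f" using assms(1) by (rule br_surj)
 obtain g where g: "g : carrier A" "b = br g" using assms(2) by (rule br_surj)
 obtain h where h: "h : carrier A" "c = br h" using assms(3) by (rule br_surj)
 show ?thesis
  unfolding f(2) g(2) h(2) using f(1) g(1) h(1) by (simp add: tensor_prod_body A.A.m_assoc)
qed

text \<open>\<open>B\<close> as a module over \<open>A\<close> by way of \<open>br\<close>: the
  value of \<open>body_over\<close> at a single open set.\<close>

definition BO :: "('a, (real, 'a) tensor) gmodule" where
 "BO = \<lparr>carrier = carrier B, monoid.mult = monoid.mult B, one = one B, ring.zero = ring.zero B, add = add B,
  smult = (\<lambda>f b. br f \<otimes>\<^bsub>B\<^esub> b), grade = grade B\<rparr>"

lemma BO_simps [simp]: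
 "carrier BO = carrier B" "add BO = add B" "\<zero>\<^bsub>BO\<^esub> = \<zero>\<^bsub>B\<^esub>" "\<one>\<^bsub>BO\<^esub> = \<one>\<^bsub>B\<^esub>" "grade BO = grade B"
 "f \<odot>\<^bsub>BO\<^esub> b = br f \<otimes>\<^bsub>B\<^esub> b"
 by (simp_all add: BO_def)

lemma abelian_group_BO: "abelian_group BO"
 by (rule abelian_group_cong[OF BG.abg]) simp_all

lemma neg_BO: "b : carrier B ==> \<ominus>\<^bsub>BO\<^esub> b = \<ominus>\<^bsub>B\<^esub> b"
 by (rule abelian_group.minus_equality[OF abelian_group_BO]) (simp_all add: BG.M.l_neg)

text \<open>By supercommutativity the left action together with its Koszul sign is plain right
  multiplication by \<open>br r\<close>. The sign thereby disappears from the tensor relations over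
  \<open>BO\<close>.\<close>

lemma koszul_BO:
 assumes "x : grade B i" "r : grade A j"
 shows "koszul BO i j (r \<odot>\<^bsub>BO\<^esub> x) = x \<otimes>\<^bsub>B\<^esub> br r"
proof -
 obtain g where g: "g : grade A i" "x = br g" using assms(1) by (rule grade_B_lift)
 note c = AG.grade_carrier[OF g(1)] AG.grade_carrier[OF assms(2)]
 have "x \<otimes>\<^bsub>B\<^esub> br r = br (koszul A i j (r \<otimes>\<^bsub>A\<^esub> g))"
  unfolding g(2) tensor_prod_body[OF c] A.A.supercommutative[OF g(1) assms(2)] ..
 also have "\<dots> = koszul BO i j (br (r \<otimes>\<^bsub>A\<^esub> g))"
  unfolding koszul_def using c
  by (simp add: neg_BO br_closed addmap_neg[OF br_additive A.abg BG.abg])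
 also have "br (r \<otimes>\<^bsub>A\<^esub> g) = r \<odot>\<^bsub>BO\<^esub> x"
  by (simp only: BO_simps g(2) tensor_prod_body[OF c(2,1)])
 finally show ?thesis by (rule sym)
qed

lemma one_B_closed: "\<one>\<^bsub>B\<^esub> : carrier B"
 unfolding one_B by (simp add: br_closed)

lemma one_B_mult: "b : carrier B ==> \<one>\<^bsub>B\<^esub> \<otimes>\<^bsub>B\<^esub> b = b"
proof -
 assume "b : carrier B"
 then obtain f where f: "f : carrier A" "b = br f" by (rule br_surj)
 show ?thesis unfolding one_B f(2) using f(1) by (simp add: tensor_prod_body)
qed

lemma one_B_even: "\<one>\<^bsub>B\<^esub> : grade B 0"
 unfolding one_B by (rule br_grade[OF A.A.one_even])

end

context identified_module begin

abbreviation EB where "EB \<equiv> left_tensor A BO E (\<otimes>\<^bsub>B\<^esub>)"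
abbreviation pe where "pe \<equiv> pure_tensor A BO E"
abbreviation er where "er \<equiv> pe \<one>\<^bsub>B\<^esub>"

sublocale Eb: tensor_pair A BO E
proof (rule tensor_pair.intro[OF abelian_group_BO E.abg])
 show "grade BO i \<subseteq> carrier BO" for i using BG.grade_subset by simp
 show "r \<odot>\<^bsub>BO\<^esub> a : carrier BO" if "r : grade A j" "a : carrier BO" for r j a
  using that AG.grade_carrier[OF that(1)] by (simp add: mult_B_closed br_closed)
 show "r \<odot>\<^bsub>E\<^esub> b : carrier E" if "r : grade A j" "b : carrier E" for r j b
  using that AG.grade_carrier[OF that(1)] by (simp add: E.smult_closed)
qed

lemma abelian_group_EB: "abelian_group EB"
 unfolding left_tensor_def[of A] by (rule Eb.abelian_group_tensor)

sublocale EBG: abelian_group EB by (rule abelian_group_EB)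

lemma additive_pe_left: "e : carrier E ==> addmap B EB (\<lambda>b. pe b e)"
 unfolding left_tensor_def[of A]
 by (rule addmap_cong_groups[OF Eb.additive_pure_left]) simp_all

lemma additive_pe_right: "b : carrier B ==> addmap E EB (pe b)"
 unfolding left_tensor_def[of A] by (rule Eb.additive_pure_right) simp

text \<open>For homogeneous \<open>b\<close> and \<open>f\<close> this is a tensor relation;
  additivity, first in \<open>b\<close> and then in \<open>f\<close>, gives the general
  case.\<close>

lemma pe_smult:
 assumes "b : carrier B" "f : carrier A" "e : carrier E"
 shows "pe (b \<otimes>\<^bsub>B\<^esub> br f) e = pe b (f \<odot>\<^bsub>E\<^esub> e)"
proof -
 have 1: "pe (b \<otimes>\<^bsub>B\<^esub> br f) e = pe b (f \<odot>\<^bsub>E\<^esub> e)" if "f : grade A j" "b : carrier B" for f j b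
  using _ _ _ that(2)
 proof (rule BG.addmaps_eq)
  note f = AG.grade_carrier[OF that(1)]
  show "addmap B EB (\<lambda>b. pe (b \<otimes>\<^bsub>B\<^esub> br f) e)"
   by (rule addmap_comp[OF additive_mult_B_left additive_pe_left]) (use f br_closed assms in simp_all)
  show "addmap B EB (\<lambda>b. pe b (f \<odot>\<^bsub>E\<^esub> e))"
   by (rule additive_pe_left) (use f assms E.smult_closed in simp)
  show "pe (b \<otimes>\<^bsub>B\<^esub> br f) e = pe b (f \<odot>\<^bsub>E\<^esub> e)" if b: "b : grade B i" for i b
   using Eb.pure_smult[of b i f j e] koszul_BO[OF b \<open>f : grade A j\<close>] b \<open>f : grade A j\<close> assms(3)
   by (simp only: BO_simps)
 qed
 show ?thesis
  using _ _ _ assms(2)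
 proof (rule AG.addmaps_eq)
  show "addmap A EB (\<lambda>f. pe (b \<otimes>\<^bsub>B\<^esub> br f) e)"
   by (rule addmap_comp[OF addmap_comp[OF br_additive additive_mult_B_right] additive_pe_left])
    (use assms in simp_all)
  show "addmap A EB (\<lambda>f. pe b (f \<odot>\<^bsub>E\<^esub> e))"
   by (rule addmap_comp[OF E.additive_smult_left additive_pe_right]) (use assms in simp_all)
 qed (rule 1[OF _ assms(1)])
qed

lemma additive_er: "addmap E EB er"
 by (rule additive_pe_right[OF one_B_closed])

lemma er_closed: "e : carrier E ==> er e : carrier EB"
 by (rule addmap_closed[OF additive_er])

lemma pe_br: "[|f : carrier A; e : carrier E|] ==> pe (br f) e = er (f \<odot>\<^bsub>E\<^esub> e)"
 using pe_smult[OF one_B_closed, of f e] one_B_mult[OF br_closed, of f] by simp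

lemma EB_induct [consumes 1, case_names pure add]:
 assumes "X : carrier EB" "\<And>b e. [|b : carrier B; e : carrier E|] ==> Q (pe b e)"
  "\<And>X Y. [|X : carrier EB; Y : carrier EB; Q X; Q Y|] ==> Q (X \<oplus>\<^bsub>EB\<^esub> Y)"
 shows "Q X"
 using assms unfolding left_tensor_def[of A] by (intro Eb.tensor_induct[of X _ Q]) simp_all

text \<open>The left factor \<open>br f\<close> of a pure tensor can be absorbed into
  \<open>e\<close>, just as in \<open>br_surj\<close>. Identities in \<open>EB\<close> are thus
  tested on elements \<open>er e\<close>.\<close>

lemma er_surj:
 assumes "X : carrier EB" obtains e where "e : carrier E" "X = er e"
proof -
 have "\<exists>e\<in>carrier E. X = er e"
  using assms
 proof (induction rule: EB_induct)
  case (pure b e)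
  obtain f where f: "f : carrier A" "b = br f" using pure(1) by (rule br_surj)
  show ?case
   by (rule bexI[of _ "f \<odot>\<^bsub>E\<^esub> e"]) (use f pure pe_br E.smult_closed in simp_all)
 next
  case (add X Y)
  from add(3) obtain e where e: "e : carrier E" "X = er e" by (rule bexE)
  from add(4) obtain e' where e': "e' : carrier E" "Y = er e'" by (rule bexE)
  show ?case
   by (rule bexI[of _ "e \<oplus>\<^bsub>E\<^esub> e'"]) (use e e' addmap_add[OF additive_er] in simp_all)
 qed
 then show ?thesis by (rule bexE) (rule that)
qed

lemma er_pact_nil: "[|n : nil; e : carrier E|] ==> er (pact n e) = \<zero>\<^bsub>EB\<^esub>"
 using pe_br[of "\<iota> n" e] br_nil[of n "\<one>\<^bsub>A\<^esub>"] \<iota>_closed[of n] nil_carrier[of n]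
  addmap_zero[OF additive_pe_left BG.abg abelian_group_EB, of e]
 by (simp add: pact_def \<iota>_def)

lemma er_nspan: "x : nspan nil E pact ==> er x = \<zero>\<^bsub>EB\<^esub>"
proof (induction rule: nspan.induct)
 case zero
 show ?case by (rule addmap_zero[OF additive_er E.abg abelian_group_EB])
next
 case (step y n x)
 have y: "y : carrier E" by (rule nspan_closed[OF E.abg pact_nil step(1)])
 show ?case
  using addmap_add[OF additive_er y pact_nil[OF step(2,3)]] step(4) er_pact_nil[OF step(2,3)] by simp
qed

lemma er_grade: "e : grade E k ==> er e : grade EB k"
proof -
 assume e: "e : grade E k"
 have "\<one>\<^bsub>B\<^esub> : grade BO 0" unfolding BO_simps by (rule one_B_even)
 from Eb.pure_grade[OF this e, unfolded add_0_left]
 show ?thesis unfolding left_tensor_def[of A] .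
qed

lemma grade_EB_lift:
 assumes "X : grade EB k" obtains e where "e : grade E k" "X = er e"
proof -
 have "X : carrier (tensor A BO E (\<lambda>s. tensor_map A BO E ((\<otimes>\<^bsub>B\<^esub>) s) id)) \<and> (\<exists>e\<in>grade E k. X = er e)"
  using EG.grade_subset assms unfolding left_tensor_def[of A]
 proof (induction rule: Eb.grade_tensor_induct)
  case (pure b e i j)
  then have "b : grade B i" by simp
  then obtain f where f: "f : grade A i" "b = br f" by (rule grade_B_lift)
  show ?case
  proof (rule bexI)
   show "pe b e = er (f \<odot>\<^bsub>E\<^esub> e)"
    unfolding f(2) by (rule pe_br[OF AG.grade_carrier[OF f(1)] EG.grade_carrier[OF pure(2)]])
   show "f \<odot>\<^bsub>E\<^esub> e : grade E k" unfolding pure(3)[symmetric] by (rule E.grade_smult[OF f(1) pure(2)])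
  qed
 next
  case zero
  show ?case
   by (rule bexI[OF _ EG.grade_zero])
    (rule addmap_zero[OF additive_er E.abg abelian_group_EB, unfolded left_tensor_def[of A], symmetric])
 next
  case (add X Y)
  from add(3) obtain e where e: "e : grade E k" "X = er e" by (rule bexE)
  from add(4) obtain e' where e': "e' : grade E k" "Y = er e'" by (rule bexE)
  show ?case
   unfolding e(2) e'(2)
   by (rule bexI[OF _ EG.grade_add[OF e(1) e'(1)]])
    (rule addmap_add[OF additive_er EG.grade_carrier EG.grade_carrier, unfolded left_tensor_def[of A], OF e(1) e'(1), symmetric])
 next
  case (neg X)
  from neg(2) obtain e where e: "e : grade E k" "X = er e" by (rule bexE)
  show ?case
   unfolding e(2)
   by (rule bexI[OF _ EG.grade_neg[OF e(1)]])
    (rule addmap_neg[OF additive_er E.abg abelian_group_EB EG.grade_carrier, unfolded left_tensor_def[of A], OF e(1), symmetric])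
 qed
 then show ?thesis by (elim conjE bexE) (rule that)
qed

lemma EB_act:
 assumes b: "b : carrier B"
 shows "addmap EB EB (\<lambda>X. b \<odot>\<^bsub>EB\<^esub> X)"
  and "[|x : carrier B; e : carrier E|] ==> b \<odot>\<^bsub>EB\<^esub> pe x e = pe (b \<otimes>\<^bsub>B\<^esub> x) e"
proof -
 have act: "(\<odot>\<^bsub>EB\<^esub>) b = tensor_map A BO E ((\<otimes>\<^bsub>B\<^esub>) b) id"
  by (simp add: left_tensor_def[of A] tensor_def[of A])
 have bal: "balanced A BO E EB (\<lambda>x e. pe (b \<otimes>\<^bsub>B\<^esub> x) (id e))"
  unfolding balanced_def
 proof (intro conjI ballI allI impI)
  show "addmap BO EB (\<lambda>x. pe (b \<otimes>\<^bsub>B\<^esub> x) (id e))" if "e : carrier E" for e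
   using addmap_cong_groups[OF addmap_comp[OF additive_mult_B_right[OF b] additive_pe_left[OF that]], of BO EB]
   by simp
  show "addmap E EB (\<lambda>e. pe (b \<otimes>\<^bsub>B\<^esub> x) (id e))" if "x : carrier BO" for x
   using additive_pe_right[OF mult_B_closed[OF b, of x]] that by simp
  fix i j x r e assume *: "x : grade BO i \<and> r : grade A j \<and> e : carrier E"
  then have x: "x : grade B i" and r: "r : grade A j" and e: "e : carrier E" by simp_all
  note c = BG.grade_carrier[OF x] AG.grade_carrier[OF r]
  show "pe (b \<otimes>\<^bsub>B\<^esub> koszul BO i j (r \<odot>\<^bsub>BO\<^esub> x)) (id e) = pe (b \<otimes>\<^bsub>B\<^esub> x) (id (r \<odot>\<^bsub>E\<^esub> e))"
   unfolding koszul_BO[OF x r] mult_B_assoc[OF b c(1) br_closed[OF c(2)], symmetric] id_apply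
   by (rule pe_smult[OF mult_B_closed[OF b c(1)] c(2) e])
 qed
 note ev = Eb.tensor_map_eval[where g = "(\<otimes>\<^bsub>B\<^esub>) b" and h = id,
   OF Eb.tensor_pair_axioms _ _ bal[unfolded left_tensor_def[of A]]]
 show "addmap EB EB (\<lambda>X. b \<odot>\<^bsub>EB\<^esub> X)"
  unfolding act unfolding left_tensor_def[of A]
  by (rule ev(1)) (use b mult_B_closed in simp_all)
 show "b \<odot>\<^bsub>EB\<^esub> pe x e = pe (b \<otimes>\<^bsub>B\<^esub> x) e" if "x : carrier B" "e : carrier E"
 proof -
  have "tensor_map A BO E ((\<otimes>\<^bsub>B\<^esub>) b) id (pe x e) = pe (b \<otimes>\<^bsub>B\<^esub> x) (id e)"
   by (rule ev(2)) (use b mult_B_closed that in simp_all)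
  then show ?thesis unfolding act by (simp only: id_apply)
 qed
qed

lemma EB_act_er: "[|f : carrier A; e : carrier E|] ==> br f \<odot>\<^bsub>EB\<^esub> er e = er (f \<odot>\<^bsub>E\<^esub> e)"
proof -
 assume f: "f : carrier A" and e: "e : carrier E"
 have "br f \<otimes>\<^bsub>B\<^esub> \<one>\<^bsub>B\<^esub> = br f" unfolding one_B using f by (simp add: tensor_prod_body)
 then show ?thesis using EB_act(2)[OF br_closed[OF f] one_B_closed e] pe_br[OF f e] by simp
qed

abbreviation RE where "RE \<equiv> restrict_to_real B EB"

lemma RE_simps [simp]:
 "carrier RE = carrier EB" "add RE = add EB" "\<zero>\<^bsub>RE\<^esub> = \<zero>\<^bsub>EB\<^esub>" "grade RE = grade EB"
 by (simp_all add: restrict_to_real_def)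

lemma RE_smult: "e : carrier E ==> r \<odot>\<^bsub>RE\<^esub> er e = er (pact (sc r) e)"
proof -
 assume e: "e : carrier E"
 have "r \<odot>\<^bsub>B\<^esub> \<one>\<^bsub>B\<^esub> = br (\<iota> (sc r))" unfolding one_B \<iota>_def by (simp add: smult_B)
 then have "r \<odot>\<^bsub>RE\<^esub> er e = br (\<iota> (sc r)) \<odot>\<^bsub>EB\<^esub> er e" by (simp add: restrict_to_real_def)
 then show ?thesis unfolding pact_def using EB_act_er[OF \<iota>_closed e] by simp
qed

text \<open>The action of \<open>P \<otimes> B\<close> in \<open>extend_bundle\<close>. It turns
  into an action of \<open>A\<close> only in \<open>XE\<close>, through
  \<open>\<kappa>\<close>.\<close>

definition ext_act where
 "ext_act = tensor_prod real_alg P RE B (\<otimes>\<^bsub>P\<^esub>) (smult EB)"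


text \<open>The second use of \<open>body_module\<close>. The laws are tested on \<open>br f\<close>
  and \<open>er e\<close>, which exhaust \<open>B\<close> and \<open>EB\<close>; there they become
  laws of the module \<open>E\<close> over \<open>A\<close>.\<close>

sublocale Xb: body_module P pr A RE "smult EB" ext_act
proof (intro body_module.intro body_module_axioms.intro algebra_over_axioms)
 show "abelian_group RE" by (rule abelian_group_cong[OF abelian_group_EB]) simp_all
 have one: "r \<odot>\<^bsub>B\<^esub> \<one>\<^bsub>B\<^esub> : carrier B" for r by (rule smult_B_closed[OF one_B_closed])
 have "(\<lambda>x. r \<odot>\<^bsub>RE\<^esub> x) = (\<lambda>x. (r \<odot>\<^bsub>B\<^esub> \<one>\<^bsub>B\<^esub>) \<odot>\<^bsub>EB\<^esub> x)" for r by (simp add: restrict_to_real_def)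
 then show "addmap RE RE (\<lambda>x. r \<odot>\<^bsub>RE\<^esub> x)" for r
  using addmap_cong_groups[OF EB_act(1)[OF one], of RE RE r] by simp
 show "addmap B RE (\<lambda>b. b \<odot>\<^bsub>EB\<^esub> x)" if x: "x : carrier RE" for x
 proof (rule addmapI)
  show "b \<odot>\<^bsub>EB\<^esub> x : carrier RE" if "b : carrier B" for b
   using addmap_closed[OF EB_act(1)[OF that], of x] x by simp
  fix b c assume "b : carrier B" "c : carrier B"
  obtain f where f: "f : carrier A" "b = br f" using \<open>b : carrier B\<close> by (rule br_surj)
  obtain g where g: "g : carrier A" "c = br g" using \<open>c : carrier B\<close> by (rule br_surj)
  have "x : carrier EB" using x by simp
  then obtain e where e: "e : carrier E" "x = er e" by (rule er_surj)
  have "(b \<oplus>\<^bsub>B\<^esub> c) = br (f \<oplus>\<^bsub>A\<^esub> g)" unfolding f(2) g(2) by (rule addmap_add[OF br_additive f(1) g(1), symmetric])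
  then show "(b \<oplus>\<^bsub>B\<^esub> c) \<odot>\<^bsub>EB\<^esub> x = b \<odot>\<^bsub>EB\<^esub> x \<oplus>\<^bsub>RE\<^esub> c \<odot>\<^bsub>EB\<^esub> x"
   using f g e
   by (simp add: EB_act_er E.smult_l_distr addmap_add[OF additive_er] E.smult_closed)
 qed
 show "addmap RE RE (\<lambda>x. b \<odot>\<^bsub>EB\<^esub> x)" if "b : carrier B" for b
  by (rule addmap_cong_groups[OF EB_act(1)[OF that]]) simp_all
 fix b x r assume b: "b : carrier B" and x: "x : carrier RE"
 obtain f where f: "f : carrier A" "b = br f" using b by (rule br_surj)
 have "x : carrier EB" using x by simp
 then obtain e where e: "e : carrier E" "x = er e" by (rule er_surj)
 have sm: "sc r \<odot>\<^bsub>A\<^esub> f = \<iota> (sc r) \<otimes>\<^bsub>A\<^esub> f" by (rule \<iota>_smult[OF sc_closed f(1)])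
 have comm: "f \<otimes>\<^bsub>A\<^esub> \<iota> (sc r) = \<iota> (sc r) \<otimes>\<^bsub>A\<^esub> f"
  using A.smult_mult_r_even[OF sc_even f(1) A.A.one_closed, of r] f(1) sm by (simp add: \<iota>_def)
 show "(r \<odot>\<^bsub>B\<^esub> b) \<odot>\<^bsub>EB\<^esub> x = r \<odot>\<^bsub>RE\<^esub> (b \<odot>\<^bsub>EB\<^esub> x)"
  unfolding f(2) e(2) smult_B[OF f(1)] EB_act_er[OF f(1) e(1)] RE_smult[OF E.smult_closed[OF f(1) e(1)]]
   EB_act_er[OF A.smult_closed[OF sc_closed f(1)] e(1)] pact_def
  by (simp only: sm E.smult_assoc[OF \<iota>_closed[OF sc_closed] f(1) e(1)])
 show "b \<odot>\<^bsub>EB\<^esub> (r \<odot>\<^bsub>RE\<^esub> x) = r \<odot>\<^bsub>RE\<^esub> (b \<odot>\<^bsub>EB\<^esub> x)"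
  unfolding f(2) e(2) EB_act_er[OF f(1) e(1)] RE_smult[OF E.smult_closed[OF f(1) e(1)]] RE_smult[OF e(1)]
   EB_act_er[OF f(1) pact_closed[OF sc_closed e(1)]] pact_def
  by (simp only: EB_act_er[OF f(1) E.smult_closed[OF \<iota>_closed[OF sc_closed] e(1)]]
    E.smult_assoc[OF f(1) \<iota>_closed[OF sc_closed] e(1), symmetric] comm
    E.smult_assoc[OF \<iota>_closed[OF sc_closed] f(1) e(1)])
qed

abbreviation XM where "XM \<equiv> tensor real_alg P RE ext_act"
abbreviation px where "px \<equiv> pure_tensor real_alg P RE"

text \<open>The left action of \<open>A\<close> on \<open>E\<close>, written in the shape of
  \<open>twisted\<close> so that \<open>\<phi>_ext_act\<close> can compare it with the action on the
  extended body.\<close>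

lemma smult_pact_split:
 assumes "f : carrier A" "a : carrier P" "x : carrier E"
 shows "f \<odot>\<^bsub>E\<^esub> pact a x = pact (hcomp P 0 a) (f \<odot>\<^bsub>E\<^esub> x) \<oplus>\<^bsub>E\<^esub>
  pact (hcomp P 1 a) (hcomp A 0 f \<odot>\<^bsub>E\<^esub> x \<ominus>\<^bsub>E\<^esub> hcomp A 1 f \<odot>\<^bsub>E\<^esub> x)"
proof -
 note f' = AG.hcomp_closed[OF assms(1)] and a' = PG.hcomp_closed[OF assms(2)]
 note hf = AG.hcomp_props(1)[OF assms(1)] and ha = PG.hcomp_props(1)[OF assms(2)]
 have px: "pact (hcomp P i a) x : carrier E" for i using pact_closed[OF a' assms(3)] .
 have fx: "hcomp A j f \<odot>\<^bsub>E\<^esub> x : carrier E" for j using E.smult_closed[OF f' assms(3)] .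
 have "pact a x = pact (hcomp P 0 a) x \<oplus>\<^bsub>E\<^esub> pact (hcomp P 1 a) x"
  using addmap_add[OF additive_pact_left[OF assms(3)] a' a', of 0 1] PG.hcomp_sum[OF assms(2)] by simp
 then have 1: "f \<odot>\<^bsub>E\<^esub> pact a x = f \<odot>\<^bsub>E\<^esub> pact (hcomp P 0 a) x \<oplus>\<^bsub>E\<^esub> f \<odot>\<^bsub>E\<^esub> pact (hcomp P 1 a) x"
  using E.smult_r_distr[OF assms(1) px px, of 0 1] by simp
 have 2: "f \<odot>\<^bsub>E\<^esub> y = hcomp A 0 f \<odot>\<^bsub>E\<^esub> y \<oplus>\<^bsub>E\<^esub> hcomp A 1 f \<odot>\<^bsub>E\<^esub> y" if "y : carrier E" for y
  using E.smult_l_distr[OF f' f' that, of 0 1] AG.hcomp_sum[OF assms(1)] by simp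
 have 3: "f \<odot>\<^bsub>E\<^esub> pact (hcomp P 0 a) x = pact (hcomp P 0 a) (f \<odot>\<^bsub>E\<^esub> x)"
  unfolding 2[OF px] 2[OF assms(3)] smult_pact[OF ha hf assms(3)]
  using addmap_add[OF additive_pact[OF a'] fx fx] by (simp add: koszul_def)
 have 4: "f \<odot>\<^bsub>E\<^esub> pact (hcomp P 1 a) x =
   pact (hcomp P 1 a) (hcomp A 0 f \<odot>\<^bsub>E\<^esub> x \<ominus>\<^bsub>E\<^esub> hcomp A 1 f \<odot>\<^bsub>E\<^esub> x)"
  unfolding 2[OF px] smult_pact[OF ha hf assms(3)]
  using addmap_add[OF additive_pact[OF a'] fx E.M.a_inv_closed[OF fx]] by (simp add: koszul_def a_minus_def)
 show ?thesis unfolding 1 3 4 ..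
qed

end

text \<open>Uniqueness of coefficients is the assumption \<open>S_indep\<close> here because it is
  proved in a frame, and an open set need not have one; over a general open set it has to come from
  a cover.\<close>

locale body_splitting = splitting P pr A \<kappa> E S
 for P :: "(real, 'p) gmodule" and pr and A :: "('p, 'a) gmodule" and \<kappa> and E :: "('a, 'e) gmodule" and S +
 assumes S_grade: "e : grade E k ==> S e : grade E k"
  and S_indep: "[|finite J; J \<subseteq> carrier P; \<And>j. j : J ==> functional (c j);
   \<And>i j. [|i : J; j : J|] ==> c i j = (if i = j then 1 else 0);
   y : J \<rightarrow> carrier E; (\<Oplus>\<^bsub>E\<^esub>j\<in>J. pact j (S (y j))) = \<zero>\<^bsub>E\<^esub>; i : J|] ==> S (y i) = \<zero>\<^bsub>E\<^esub>"
begin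

text \<open>\<open>er\<close> vanishes on \<open>nil E\<close>, where \<open>e - S e\<close> lies.
  This is what makes the body of \<open>\<phi>\<close> the identity.\<close>

lemma er_S: "e : carrier E ==> er (S e) = er e"
proof -
 assume e: "e : carrier E"
 have "er e = er (S e \<oplus>\<^bsub>E\<^esub> (e \<ominus>\<^bsub>E\<^esub> S e))"
  using e S_closed by (simp add: a_minus_def E.M.a_lcomm E.M.r_neg)
 also have "\<dots> = er (S e) \<oplus>\<^bsub>EB\<^esub> er (e \<ominus>\<^bsub>E\<^esub> S e)"
  using e S_closed by (intro addmap_add[OF additive_er]) simp_all
 also have "\<dots> = er (S e)"
  using er_nspan[OF S_near[OF e]] er_closed[OF S_closed[OF e]] by simp
 finally show ?thesis by (rule sym)
qed

text \<open>Two lifts in succession: \<open>b \<otimes> e\<close> goes to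
  \<open>\<sigma> b S e\<close>, and then \<open>p \<otimes> x\<close> to the product of
  \<open>p\<close> with \<open>s x\<close>. The first is balanced because
  \<open>S (r e) = \<tau> r S e\<close> and \<open>\<sigma>\<close> takes the product of
  \<open>b\<close> and \<open>br r\<close> to that of \<open>\<sigma> b\<close> and
  \<open>\<tau> r\<close>.\<close>

lemma \<phi>_exists: "\<exists>\<theta>. addmap XM E \<theta> \<and> (\<forall>p\<in>carrier P. \<forall>e\<in>carrier E. \<theta> (px p (er e)) = pact p (S e))"
proof -
 have "balanced A BO E E (\<lambda>b e. \<sigma> b \<odot>\<^bsub>E\<^esub> S e)"
  unfolding balanced_def
 proof (intro conjI ballI allI impI)
  show "addmap BO E (\<lambda>b. \<sigma> b \<odot>\<^bsub>E\<^esub> S e)" if "e : carrier E" for e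
   by (rule addmap_cong_groups[OF addmap_comp[OF additive_\<sigma> E.additive_smult_left[OF S_closed[OF that]]]]) simp_all
  show "addmap E E (\<lambda>e. \<sigma> b \<odot>\<^bsub>E\<^esub> S e)" if "b : carrier BO" for b
   by (rule addmap_comp[OF additive_S E.additive_smult]) (use that \<sigma>_closed in simp)
  fix i j b r e assume *: "b : grade BO i \<and> r : grade A j \<and> e : carrier E"
  then have b: "b : grade B i" and r: "r : grade A j" and e: "e : carrier E" by simp_all
  note c = BG.grade_carrier[OF b] AG.grade_carrier[OF r]
  show "\<sigma> (koszul BO i j (r \<odot>\<^bsub>BO\<^esub> b)) \<odot>\<^bsub>E\<^esub> S e = \<sigma> b \<odot>\<^bsub>E\<^esub> S (r \<odot>\<^bsub>E\<^esub> e)"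
   unfolding koszul_BO[OF b r] \<sigma>_mult[OF c(1) br_closed[OF c(2)]] S_smult[OF c(2) e] \<tau>_def[symmetric]
   by (rule E.smult_assoc[OF \<sigma>_closed[OF c(1)] \<tau>_closed[OF c(2)] S_closed[OF e]])
 qed
 then obtain s where s': "addmap (tensor A BO E (\<lambda>s. tensor_map A BO E ((\<otimes>\<^bsub>B\<^esub>) s) id)) E s"
  and s'': "\<And>b e. [|b : carrier BO; e : carrier E|] ==> s (pe b e) = \<sigma> b \<odot>\<^bsub>E\<^esub> S e"
  by (rule Eb.tensor_lift[OF E.abg]) (rule that)
 note s = s'[folded left_tensor_def[of A]] s''
 have s_er: "s (er e) = S e" if "e : carrier E" for e
  using s(2)[of "\<one>\<^bsub>B\<^esub>" e] that one_B_closed \<sigma>_one E.smult_one[OF S_closed[OF that]] by simp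
 have s_closed: "s x : carrier E" if "x : carrier EB" for x by (rule addmap_closed[OF s(1) that])
 have "balanced real_alg P RE E (\<lambda>p x. pact p (s x))"
 proof (rule Xb.balanced_PM[OF E.abg])
  show "addmap P E (\<lambda>p. pact p (s x))" if "x : carrier RE" for x
   by (rule additive_pact_left) (use that s_closed in simp)
  show "addmap RE E (\<lambda>x. pact p (s x))" if "p : carrier P" for p
   by (rule addmap_cong_groups[OF addmap_comp[OF s(1) additive_pact[OF that]]]) simp_all
  fix r p x assume p: "p : carrier P" and "x : carrier RE"
  then have "x : carrier EB" by simp
  then obtain e where e: "e : carrier E" "x = er e" by (rule er_surj)
  have "r \<odot>\<^bsub>P\<^esub> p = p \<otimes>\<^bsub>P\<^esub> sc r"
   using ext.mult_P_smult(2)[OF p P.A.one_closed, of r] p by (simp add: sc_def)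
  then show "pact (r \<odot>\<^bsub>P\<^esub> p) (s x) = pact p (s (r \<odot>\<^bsub>RE\<^esub> x))"
   unfolding e(2) RE_smult[OF e(1)] using e(1) p
   by (simp add: s_er pact_closed S_pact pact_mult S_closed)
 qed
 then obtain \<theta> where \<theta>: "addmap XM E \<theta>"
  "\<And>p x. [|p : carrier P; x : carrier RE|] ==> \<theta> (px p x) = pact p (s x)"
  by (rule Xb.PM.tensor_lift[OF E.abg]) (rule that)
 show ?thesis
  by (intro exI[of _ \<theta>] conjI \<theta>(1) ballI) (simp add: \<theta>(2) er_closed s_er)
qed

definition \<phi> where
 "\<phi> = (SOME \<theta>. addmap XM E \<theta> \<and> (\<forall>p\<in>carrier P. \<forall>e\<in>carrier E. \<theta> (px p (er e)) = pact p (S e)))"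

lemma additive_\<phi>: "addmap XM E \<phi>"
 and \<phi>_px: "[|p : carrier P; e : carrier E|] ==> \<phi> (px p (er e)) = pact p (S e)"
 using someI_ex[OF \<phi>_exists, folded \<phi>_def] by simp_all

lemma XM_abelian: "abelian_group XM"
 by (rule Xb.PM.abelian_group_tensor)

lemma px_closed: "[|p : carrier P; x : carrier EB|] ==> px p x : carrier XM"
 by (rule Xb.PM.pure_closed) simp_all

lemma XM_induct [consumes 1, case_names pure add]:
 assumes "X : carrier XM" "\<And>p e. [|p : carrier P; e : carrier E|] ==> Q (px p (er e))"
  "\<And>X Y. [|X : carrier XM; Y : carrier XM; Q X; Q Y|] ==> Q (X \<oplus>\<^bsub>XM\<^esub> Y)"
 shows "Q X"
 using assms(1)
proof (induction rule: Xb.PM.tensor_induct)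
 case (pure p x)
 then have "x : carrier EB" by simp
 then obtain e where e: "e : carrier E" "x = er e" by (rule er_surj)
 show ?case unfolding e(2) by (rule assms(2)[OF pure(1) e(1)])
qed (rule assms(3))

lemma \<phi>_closed: "X : carrier XM ==> \<phi> X : carrier E"
 by (rule addmap_closed[OF additive_\<phi>])

lemma XM_basis_expansion:
 assumes J: "finite J" "J \<subseteq> carrier P" and c: "\<And>x. x : carrier P ==> x = (\<Oplus>\<^bsub>P\<^esub>j\<in>J. c j x \<odot>\<^bsub>P\<^esub> j)"
  and X: "X : carrier XM"
 shows "\<exists>y\<in>J \<rightarrow> carrier E. X = (\<Oplus>\<^bsub>XM\<^esub>j\<in>J. px j (er (y j)))"
proof -
 interpret XM: abelian_group XM by (rule XM_abelian)
 have tc: "px j (er x) : carrier XM" if "j : J" "x : carrier E" for j x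
  using that J px_closed er_closed by blast
 show ?thesis
  using X
 proof (induction rule: XM_induct)
  case (pure p e)
  have erc: "er e : carrier RE" using er_closed[OF pure(2)] by simp
  have jx: "px (c j p \<odot>\<^bsub>P\<^esub> j) (er e) = px j (er (pact (sc (c j p)) e))" if "j : J" for j
   using Xb.pure_real_smult[OF _ erc, of j "c j p"] RE_smult[OF pure(2)] that J by auto
  have "px p (er e) = px (\<Oplus>\<^bsub>P\<^esub>j\<in>J. c j p \<odot>\<^bsub>P\<^esub> j) (er e)" using c[OF pure(1)] by simp
  also have "\<dots> = (\<Oplus>\<^bsub>XM\<^esub>j\<in>J. px (c j p \<odot>\<^bsub>P\<^esub> j) (er e))"
   by (rule addmap_finsum[OF Xb.PM.additive_pure_left[OF erc] P.abg XM_abelian])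
    (use J real_smult_closed in auto)
  also have "\<dots> = (\<Oplus>\<^bsub>XM\<^esub>j\<in>J. px j (er (pact (sc (c j p)) e)))"
   by (rule XM.finsum_cong') (simp_all add: Pi_iff jx tc pact_closed pure)
  finally show ?case
   by (intro bexI[of _ "\<lambda>j. pact (sc (c j p)) e"]) (simp_all add: pact_closed pure)
 next
  case (add X Y)
  from add(3) obtain y where y: "y : J \<rightarrow> carrier E" "X = (\<Oplus>\<^bsub>XM\<^esub>j\<in>J. px j (er (y j)))" by (rule bexE)
  from add(4) obtain y' where y': "y' : J \<rightarrow> carrier E" "Y = (\<Oplus>\<^bsub>XM\<^esub>j\<in>J. px j (er (y' j)))" by (rule bexE)
  have yc: "y j : carrier E" "y' j : carrier E" if "j : J" for j using y y' that by auto
  have "X \<oplus>\<^bsub>XM\<^esub> Y = (\<Oplus>\<^bsub>XM\<^esub>j\<in>J. px j (er (y j)) \<oplus>\<^bsub>XM\<^esub> px j (er (y' j)))"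
   unfolding y(2) y'(2) by (rule XM.finsum_addf[symmetric]) (simp_all add: Pi_iff tc yc)
  also have "\<dots> = (\<Oplus>\<^bsub>XM\<^esub>j\<in>J. px j (er (y j \<oplus>\<^bsub>E\<^esub> y' j)))"
  proof (rule XM.finsum_cong')
   fix j assume j: "j : J"
   then have jP: "j : carrier P" using J by blast
   show "px j (er (y j)) \<oplus>\<^bsub>XM\<^esub> px j (er (y' j)) = px j (er (y j \<oplus>\<^bsub>E\<^esub> y' j))"
    unfolding addmap_add[OF additive_er yc[OF j]]
    using addmap_add[OF Xb.PM.additive_pure_right[OF jP], of "er (y j)" "er (y' j)" ext_act] er_closed yc[OF j]
    by simp
  qed (simp_all add: Pi_iff tc yc)
  finally show ?case by (intro bexI[of _ "\<lambda>j. y j \<oplus>\<^bsub>E\<^esub> y' j"]) (simp_all add: Pi_iff yc)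
 qed
qed

text \<open>Surjectivity is \<open>decomposition_exists\<close>. For injectivity, an element of the
  kernel is written as \<open>\<Sum> j \<otimes> er (y j)\<close>; its image
  \<open>\<Sum> j S (y j)\<close> is zero, so every \<open>S (y j)\<close> is zero by
  \<open>S_indep\<close>, and \<open>er (y j) = er (S (y j))\<close> shows that each term
  vanishes.\<close>

lemma \<phi>_bij: "bij_betw \<phi> (carrier XM) (carrier E)"
proof -
 interpret XM: abelian_group XM by (rule XM_abelian)
 obtain J c where J: "finite J" "J \<subseteq> carrier P" and "\<one>\<^bsub>P\<^esub> : J" "J - {\<one>\<^bsub>P\<^esub>} \<subseteq> nil"
  and c: "\<And>j. j : J ==> functional (c j)" "\<And>i j. [|i : J; j : J|] ==> c i j = (if i = j then 1 else 0)"
   "\<And>x. x : carrier P ==> x = (\<Oplus>\<^bsub>P\<^esub>j\<in>J. c j x \<odot>\<^bsub>P\<^esub> j)"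
  using basis by blast
 have tc: "px j (er x) : carrier XM" if "j : J" "x : carrier E" for j x
  using that J px_closed er_closed by blast
 have \<phi>_sum: "\<phi> (\<Oplus>\<^bsub>XM\<^esub>j\<in>J. px j (er (y j))) = (\<Oplus>\<^bsub>E\<^esub>j\<in>J. pact j (S (y j)))" if y: "y : J \<rightarrow> carrier E" for y
 proof -
  have yc: "y j : carrier E" "j : carrier P" if "j : J" for j using y J that by auto
  have "\<phi> (\<Oplus>\<^bsub>XM\<^esub>j\<in>J. px j (er (y j))) = (\<Oplus>\<^bsub>E\<^esub>j\<in>J. \<phi> (px j (er (y j))))"
   by (rule addmap_finsum[OF additive_\<phi> XM_abelian E.abg]) (simp add: Pi_iff tc yc)
  also have "\<dots> = (\<Oplus>\<^bsub>E\<^esub>j\<in>J. pact j (S (y j)))"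
   by (rule E.M.finsum_cong') (simp_all add: Pi_iff \<phi>_px yc pact_closed S_closed)
  finally show ?thesis .
 qed
 have ker: "X = \<zero>\<^bsub>XM\<^esub>" if X: "X : carrier XM" "\<phi> X = \<zero>\<^bsub>E\<^esub>" for X
 proof -
  obtain y where y: "y : J \<rightarrow> carrier E" "X = (\<Oplus>\<^bsub>XM\<^esub>j\<in>J. px j (er (y j)))"
   using XM_basis_expansion[OF J c(3) X(1)] by (rule bexE)
  have "px j (er (y j)) = \<zero>\<^bsub>XM\<^esub>" if j: "j : J" for j
  proof -
   have yc: "y j : carrier E" "j : carrier P" using y J j by auto
   have "S (y j) = \<zero>\<^bsub>E\<^esub>"
    by (rule S_indep[OF J c(1,2) y(1) _ j]) (use X(2) y(2) \<phi>_sum[OF y(1)] in simp_all)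
   then have "er (y j) = \<zero>\<^bsub>RE\<^esub>"
    using er_S[OF yc(1)] addmap_zero[OF additive_er E.abg abelian_group_EB] by simp
   then show ?thesis using Xb.PM.pure_zero_right[OF yc(2)] by simp
  qed
  then have "X = (\<Oplus>\<^bsub>XM\<^esub>j\<in>J. \<zero>\<^bsub>XM\<^esub>)" unfolding y(2) by (intro XM.finsum_cong') simp_all
  then show ?thesis by simp
 qed
 have "inj_on \<phi> (carrier XM)"
 proof (rule inj_onI)
  fix X Y assume XY: "X : carrier XM" "Y : carrier XM" "\<phi> X = \<phi> Y"
  then have "\<phi> (X \<ominus>\<^bsub>XM\<^esub> Y) = \<zero>\<^bsub>E\<^esub>"
   using addmap_minus[OF additive_\<phi> XM_abelian E.abg XY(1,2)] \<phi>_closed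
   by (simp add: a_minus_def E.M.r_neg)
  then have "X \<ominus>\<^bsub>XM\<^esub> Y = \<zero>\<^bsub>XM\<^esub>" using ker XY by simp
  then have "\<ominus>\<^bsub>XM\<^esub> (\<ominus>\<^bsub>XM\<^esub> Y) = X"
   using XY by (intro XM.minus_equality) (simp_all add: a_minus_def)
  then show "X = Y" using XY by simp
 qed
 moreover have "carrier E \<subseteq> \<phi> ` carrier XM"
 proof
  fix e assume "e : carrier E"
  then obtain y where y: "y : J \<rightarrow> carrier E" "e = (\<Oplus>\<^bsub>E\<^esub>j\<in>J. pact j (S (y j)))"
   using decomposition_exists[OF J c(3)] by blast
  have "(\<Oplus>\<^bsub>XM\<^esub>j\<in>J. px j (er (y j))) : carrier XM" using y tc by (intro XM.finsum_closed) auto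
  then show "e : \<phi> ` carrier XM" unfolding y(2) \<phi>_sum[OF y(1), symmetric] by (rule imageI)
 qed
 ultimately show ?thesis using \<phi>_closed by (auto simp: bij_betw_def)
qed

text \<open>Tested on the generators \<open>p \<tau> g\<close> of \<open>A\<close> and
  \<open>a \<otimes> er e\<close> of the extended body. Since \<open>\<kappa>\<close> takes
  \<open>p \<tau> g\<close> to \<open>p \<otimes> br g\<close>, the left side is a
  \<open>twisted\<close> product, and \<open>smult_pact_split\<close> gives the right side the same
  form.\<close>

lemma \<phi>_ext_act:
 assumes f: "f : carrier A" and X: "X : carrier XM"
 shows "ext_act (\<kappa> f) X : carrier XM \<and> \<phi> (ext_act (\<kappa> f) X) = f \<odot>\<^bsub>E\<^esub> \<phi> X"
proof -
 note tp = Xb.tensor_prod_twisted[folded ext_act_def]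
 have PBc: "\<kappa> f : carrier ext.PM" if "f : carrier A" for f
  using \<kappa>_closed[OF that] by (simp only: left_tensor_def[of real_alg])
 have closed: "ext_act (\<kappa> f) X : carrier XM" if "f : carrier A" "X : carrier XM" for f X
  by (rule addmap_closed[OF tp(2)[OF PBc[OF that(1)]] that(2)])
 have pure_eq: "\<phi> (ext_act (\<kappa> (p \<odot>\<^bsub>A\<^esub> \<tau> g)) (px a (er e))) = (p \<odot>\<^bsub>A\<^esub> \<tau> g) \<odot>\<^bsub>E\<^esub> pact a (S e)"
  if p: "p : carrier P" and g: "g : carrier A" and a: "a : carrier P" and e: "e : carrier E" for p g a e
 proof -
  note a' = PG.hcomp_closed[OF a] and g' = AG.hcomp_closed[OF g]
  have hc: "hcomp B i (br g) = br (hcomp A i g)" for i by (rule hcomp_br[OF g])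
  have ge: "hcomp A i g \<odot>\<^bsub>E\<^esub> e : carrier E" for i by (rule E.smult_closed[OF g' e])
  have sum: "br (hcomp A 0 g) \<odot>\<^bsub>EB\<^esub> er e \<oplus>\<^bsub>RE\<^esub> br (hcomp A 1 g) \<odot>\<^bsub>EB\<^esub> er e = er (g \<odot>\<^bsub>E\<^esub> e)"
   unfolding EB_act_er[OF g' e] using addmap_add[OF additive_er ge ge, of 0 1]
    E.smult_l_distr[OF g' g' e, of 0 1] AG.hcomp_sum[OF g] by simp
  have neg: "\<ominus>\<^bsub>RE\<^esub> x = \<ominus>\<^bsub>EB\<^esub> x" if "x : carrier EB" for x
   by (rule Xb.MG.minus_equality) (use that EBG.l_neg in simp_all)
  have diff: "br (hcomp A 0 g) \<odot>\<^bsub>EB\<^esub> er e \<ominus>\<^bsub>RE\<^esub> br (hcomp A 1 g) \<odot>\<^bsub>EB\<^esub> er e =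
    er (hcomp A 0 g \<odot>\<^bsub>E\<^esub> e \<ominus>\<^bsub>E\<^esub> hcomp A 1 g \<odot>\<^bsub>E\<^esub> e)"
   unfolding EB_act_er[OF g' e]
   using addmap_minus[OF additive_er E.abg abelian_group_EB ge ge, of 0 1] neg[OF er_closed[OF ge]]
   by (simp add: a_minus_def)
  have "ext_act (\<kappa> (p \<odot>\<^bsub>A\<^esub> \<tau> g)) (px a (er e)) = Xb.twisted p (br g) a (er e)"
   unfolding \<tau>_def \<kappa>_smult_\<sigma>[OF p br_closed[OF g]] by (rule tp(3)) (use p g a e br_closed er_closed in simp_all)
  also have "\<dots> = px (p \<otimes>\<^bsub>P\<^esub> hcomp P 0 a) (er (g \<odot>\<^bsub>E\<^esub> e)) \<oplus>\<^bsub>XM\<^esub>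
    px (p \<otimes>\<^bsub>P\<^esub> hcomp P 1 a) (er (hcomp A 0 g \<odot>\<^bsub>E\<^esub> e \<ominus>\<^bsub>E\<^esub> hcomp A 1 g \<odot>\<^bsub>E\<^esub> e))"
   unfolding Xb.twisted_def hc sum diff ..
  finally have 1: "\<phi> (ext_act (\<kappa> (p \<odot>\<^bsub>A\<^esub> \<tau> g)) (px a (er e))) =
    pact (p \<otimes>\<^bsub>P\<^esub> hcomp P 0 a) (S (g \<odot>\<^bsub>E\<^esub> e)) \<oplus>\<^bsub>E\<^esub>
    pact (p \<otimes>\<^bsub>P\<^esub> hcomp P 1 a) (S (hcomp A 0 g \<odot>\<^bsub>E\<^esub> e \<ominus>\<^bsub>E\<^esub> hcomp A 1 g \<odot>\<^bsub>E\<^esub> e))"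
   using p a' ge E.smult_closed[OF g e] px_closed er_closed
   by (simp add: addmap_add[OF additive_\<phi>] \<phi>_px)
  have h\<tau>: "hcomp A i (\<tau> g) = \<tau> (hcomp A i g)" for i
   by (rule AG.hcomp_commute[OF AG.graded_group_axioms additive_\<tau> \<tau>_grade g])
  have 2: "S (hcomp A 0 g \<odot>\<^bsub>E\<^esub> e \<ominus>\<^bsub>E\<^esub> hcomp A 1 g \<odot>\<^bsub>E\<^esub> e) =
    hcomp A 0 (\<tau> g) \<odot>\<^bsub>E\<^esub> S e \<ominus>\<^bsub>E\<^esub> hcomp A 1 (\<tau> g) \<odot>\<^bsub>E\<^esub> S e"
   unfolding h\<tau> addmap_minus[OF additive_S E.abg E.abg ge ge] S_smult[OF g' e] ..
  have \<tau>e: "hcomp A i (\<tau> g) \<odot>\<^bsub>E\<^esub> S e : carrier E" for i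
   by (rule E.smult_closed[OF AG.hcomp_closed[OF \<tau>_closed[OF g]] S_closed[OF e]])
  have \<tau>e': "\<tau> g \<odot>\<^bsub>E\<^esub> S e : carrier E" by (rule E.smult_closed[OF \<tau>_closed[OF g] S_closed[OF e]])
  have "(p \<odot>\<^bsub>A\<^esub> \<tau> g) \<odot>\<^bsub>E\<^esub> pact a (S e) = pact p (\<tau> g \<odot>\<^bsub>E\<^esub> pact a (S e))"
   unfolding pact_def[of p] \<iota>_smult[OF p \<tau>_closed[OF g]]
   by (rule E.smult_assoc[OF \<iota>_closed[OF p] \<tau>_closed[OF g] pact_closed[OF a S_closed[OF e]]])
  also have "\<dots> = pact (p \<otimes>\<^bsub>P\<^esub> hcomp P 0 a) (\<tau> g \<odot>\<^bsub>E\<^esub> S e) \<oplus>\<^bsub>E\<^esub>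
    pact (p \<otimes>\<^bsub>P\<^esub> hcomp P 1 a) (hcomp A 0 (\<tau> g) \<odot>\<^bsub>E\<^esub> S e \<ominus>\<^bsub>E\<^esub> hcomp A 1 (\<tau> g) \<odot>\<^bsub>E\<^esub> S e)"
   unfolding smult_pact_split[OF \<tau>_closed[OF g] a S_closed[OF e]]
   using addmap_add[OF additive_pact[OF p] pact_closed[OF a' \<tau>e'] pact_closed[OF a' E.M.minus_closed[OF \<tau>e \<tau>e]]]
    pact_mult[OF p a'] \<tau>e \<tau>e' by simp
  finally show ?thesis unfolding 1 2 S_smult[OF g e] by (rule sym)
 qed
 have "\<phi> (ext_act (\<kappa> f) X) = f \<odot>\<^bsub>E\<^esub> \<phi> X"
  using f
 proof (induction rule: A_induct)
  case (pure p g)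
  then have fA: "p \<odot>\<^bsub>A\<^esub> \<tau> g : carrier A" by (simp add: A.smult_closed \<tau>_closed)
  show ?case
   using X
  proof (induction rule: XM_induct)
   case (pure a e)
   then show ?case using pure_eq[OF \<open>p : carrier P\<close> \<open>g : carrier A\<close> pure] by (simp add: \<phi>_px)
  next
   case (add X Y)
   show ?case
    unfolding addmap_add[OF tp(2)[OF PBc[OF fA]] add(1,2)]
     addmap_add[OF additive_\<phi> closed[OF fA add(1)] closed[OF fA add(2)]]
     addmap_add[OF additive_\<phi> add(1,2)] add(3,4)
    by (rule E.smult_r_distr[OF fA \<phi>_closed[OF add(1)] \<phi>_closed[OF add(2)], symmetric])
  qed
 next
  case (add f g)
  have "ext_act (\<kappa> (f \<oplus>\<^bsub>A\<^esub> g)) X = ext_act (\<kappa> f) X \<oplus>\<^bsub>XM\<^esub> ext_act (\<kappa> g) X"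
   unfolding addmap_add[OF additive_\<kappa> add(1,2)]
   using addmap_add[OF tp(1)[OF X, of "\<lambda>s. tensor_map real_alg P B ((\<otimes>\<^bsub>P\<^esub>) s) id"] PBc[OF add(1)] PBc[OF add(2)]]
   by (simp only: left_tensor_def[of real_alg])
  then show ?case
   using addmap_add[OF additive_\<phi> closed[OF add(1) X] closed[OF add(2) X]] add(3,4)
    E.smult_l_distr[OF add(1,2) \<phi>_closed[OF X]] by simp
 qed
 then show ?thesis using closed[OF f X] by blast
qed

lemma pact_grade: "[|p : grade P i; e : grade E j|] ==> pact p e : grade E (i + j)"
 unfolding pact_def by (rule E.grade_smult[OF \<iota>_grade])

lemma grade_EB_subset: "grade EB i \<subseteq> carrier EB"
 using grade_EB_lift EG.grade_carrier er_closed by (metis subsetI)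

lemma \<phi>_grade: "X : grade XM k ==> X : carrier XM \<and> \<phi> X : grade E k"
proof -
 assume X: "X : grade XM k"
 have gB: "\<And>i. grade RE i \<subseteq> carrier RE" using grade_EB_subset by simp
 show ?thesis
  using gB X
 proof (induction rule: Xb.PM.grade_tensor_induct)
  case (pure p x i j)
  then have "x : grade EB j" by simp
  then obtain e where e: "e : grade E j" "x = er e" by (rule grade_EB_lift)
  have "\<phi> (px p x) = pact p (S e)"
   unfolding e(2) by (rule \<phi>_px[OF PG.grade_carrier[OF pure(1)] EG.grade_carrier[OF e(1)]])
  then show ?case using pact_grade[OF pure(1) S_grade[OF e(1)]] pure(3) by simp
 next
  case zero
  show ?case using addmap_zero[OF additive_\<phi> XM_abelian E.abg] EG.grade_zero by simp
 next
  case (add X Y)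
  then show ?case using addmap_add[OF additive_\<phi> add(1,2)] EG.grade_add by simp
 next
  case (neg X)
  then show ?case
   using addmap_neg[OF additive_\<phi> XM_abelian E.abg neg(1)] EG.grade_neg by simp
 qed
qed

text \<open>The grades of \<open>XM\<close> are not yet known to decompose it, so a preimage of
  \<open>e\<close> cannot simply be replaced by its component of degree \<open>k\<close>. Instead,
  induction on \<open>X\<close> constructs for every \<open>X\<close> and \<open>i\<close> an
  element of degree \<open>i\<close> that is mapped to the component of degree \<open>i\<close> of
  \<open>\<phi> X\<close>.\<close>

lemma \<phi>_grade_image: "\<phi> ` grade XM k = grade E k"
proof
 show "\<phi> ` grade XM k \<subseteq> grade E k" using \<phi>_grade by blast
 show "grade E k \<subseteq> \<phi> ` grade XM k"
 proof
  fix e assume e: "e : grade E k"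
  have ec: "e : carrier E" using e by (rule EG.grade_carrier)
  have hom: "\<exists>Y\<in>grade XM i. \<phi> Y = hcomp E i (\<phi> X)" if "X : carrier XM" for X i
   using that
  proof (induction rule: XM_induct)
   case (pure p x)
   have gsub: "additive_subgroup (grade XM i) XM"
    by (rule Xb.PM.additive_subgroup_grade_tensor) (use grade_EB_subset in simp)
   note p' = PG.hcomp_closed[OF pure(1)] and x' = EG.hcomp_closed[OF pure(2)]
   \<comment> \<open>The part of degree \<open>i\<close> of \<open>p \<otimes> er x\<close>, split
     by the degree \<open>l\<close> of the left factor; modulo 2,
     \<open>l + (i + l) = i\<close>.\<close>
   let ?t = "\<lambda>l. px (hcomp P l p) (er (hcomp E (i + l) x))"
   have ll: "l + (i + l) = i" for l :: bit using bit_cases[of l] bit_cases[of i] by auto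
   have t: "?t l : grade XM i" for l
    using Xb.PM.pure_grade[OF PG.hcomp_props(1)[OF pure(1)], of "er (hcomp E (i + l) x)" "i + l" l ext_act]
     er_grade[OF EG.hcomp_props(1)[OF pure(2)]] by (simp only: RE_simps ll)
   have tc: "?t l : carrier XM" for l by (rule px_closed[OF p' er_closed[OF x']])
   have \<phi>t: "\<phi> (?t l) = pact (hcomp P l p) (S (hcomp E (i + l) x))" for l by (rule \<phi>_px[OF p' x'])
   have Sx: "S (hcomp E j x) = hcomp E j (S x)" for j
    by (rule EG.hcomp_commute[OF EG.graded_group_axioms additive_S S_grade pure(2), symmetric])
   have hp: "hcomp E i (pact (hcomp P l p) (S x)) = pact (hcomp P l p) (hcomp E (i + l) (S x))" for l
   proof (rule EG.hcomp_eqI)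
    show "pact (hcomp P l p) (hcomp E (i + l) (S x)) : grade E i"
     using pact_grade[OF PG.hcomp_props(1)[OF pure(1), of l] EG.hcomp_props(1)[OF S_closed[OF pure(2)], of "i + l"]]
     by (simp only: ll)
    have "l + (i + l + 1) = i + 1" using bit_cases[of l] bit_cases[of i] by auto
    then show "pact (hcomp P l p) (hcomp E (i + l + 1) (S x)) : grade E (i + 1)"
     using pact_grade[OF PG.hcomp_props(1)[OF pure(1), of l] EG.hcomp_props(1)[OF S_closed[OF pure(2)], of "i + l + 1"]]
     by (simp only:)
    show "pact (hcomp P l p) (S x) = pact (hcomp P l p) (hcomp E (i + l) (S x)) \<oplus>\<^bsub>E\<^esub>
      pact (hcomp P l p) (hcomp E (i + l + 1) (S x))"
     using addmap_add[OF additive_pact[OF p'] EG.hcomp_closed EG.hcomp_closed, OF S_closed[OF pure(2)] S_closed[OF pure(2)], of l "i + l" "i + l + 1"]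
      EG.hcomp_props(2)[OF S_closed[OF pure(2)], of "i + l"] by simp
   qed
   show ?case
   proof (rule bexI)
    show "?t 0 \<oplus>\<^bsub>XM\<^esub> ?t 1 : grade XM i" by (rule additive_subgroup.a_closed[OF gsub t t])
    have "hcomp E i (\<phi> (px p (er x))) = hcomp E i (pact (hcomp P 0 p) (S x) \<oplus>\<^bsub>E\<^esub> pact (hcomp P 1 p) (S x))"
     unfolding \<phi>_px[OF pure]
     using addmap_add[OF additive_pact_left[OF S_closed[OF pure(2)]] p' p', of 0 1] PG.hcomp_sum[OF pure(1)] by simp
    also have "\<dots> = \<phi> (?t 0) \<oplus>\<^bsub>E\<^esub> \<phi> (?t 1)"
     unfolding \<phi>t Sx hp[symmetric] by (rule EG.hcomp_add[OF pact_closed[OF p' S_closed[OF pure(2)]] pact_closed[OF p' S_closed[OF pure(2)]]])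
    also have "\<dots> = \<phi> (?t 0 \<oplus>\<^bsub>XM\<^esub> ?t 1)" by (rule addmap_add[OF additive_\<phi> tc tc, symmetric])
    finally show "\<phi> (?t 0 \<oplus>\<^bsub>XM\<^esub> ?t 1) = hcomp E i (\<phi> (px p (er x)))" by (rule sym)
   qed
  next
   case (add X Y)
   have gsub: "additive_subgroup (grade XM i) XM"
    by (rule Xb.PM.additive_subgroup_grade_tensor) (use grade_EB_subset in simp)
   from add(3) obtain X' where X': "X' : grade XM i" "\<phi> X' = hcomp E i (\<phi> X)" by (rule bexE)
   from add(4) obtain Y' where Y': "Y' : grade XM i" "\<phi> Y' = hcomp E i (\<phi> Y)" by (rule bexE)
   have c: "X' : carrier XM" "Y' : carrier XM" using \<phi>_grade X'(1) Y'(1) by blast+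
   show ?case
   proof (rule bexI)
    show "X' \<oplus>\<^bsub>XM\<^esub> Y' : grade XM i" by (rule additive_subgroup.a_closed[OF gsub X'(1) Y'(1)])
    show "\<phi> (X' \<oplus>\<^bsub>XM\<^esub> Y') = hcomp E i (\<phi> (X \<oplus>\<^bsub>XM\<^esub> Y))"
     unfolding addmap_add[OF additive_\<phi> c] addmap_add[OF additive_\<phi> add(1,2)] X'(2) Y'(2)
     by (rule EG.hcomp_add[OF \<phi>_closed[OF add(1)] \<phi>_closed[OF add(2)], symmetric])
   qed
  qed
  obtain X where X: "X : carrier XM" "e = \<phi> X"
   using \<phi>_bij ec unfolding bij_betw_def by blast
  from hom[OF X(1), of k] obtain Y where Y: "Y : grade XM k" "\<phi> Y = hcomp E k (\<phi> X)" by (rule bexE)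
  have "\<phi> Y = e" unfolding Y(2) X(2)[symmetric] by (rule EG.hcomp_grade_same[OF e])
  then show "e : \<phi> ` grade XM k" using Y(1) by (metis imageI)
 qed
qed

end

text \<open>Laws and uniqueness of decompositions can be checked after the injective map
  \<open>\<phi>\<close>. The equality in \<open>gr\<close> lifts the homogeneous components of
  \<open>\<phi> x\<close> back to \<open>X\<close>.\<close>

lemma supermodule_transport:
 assumes E: "supermodule A E" and X: "abelian_group X"
  and \<phi>: "addmap X E \<phi>" "bij_betw \<phi> (carrier X) (carrier E)"
  and sm: "\<And>f x. [|f : carrier A; x : carrier X|] ==> f \<odot>\<^bsub>X\<^esub> x : carrier X \<and> \<phi> (f \<odot>\<^bsub>X\<^esub> x) = f \<odot>\<^bsub>E\<^esub> \<phi> x"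
  and gr: "\<And>k. grade X k \<subseteq> carrier X" "\<And>k. \<phi> ` grade X k = grade E k"
 shows "supermodule A X"
proof -
 interpret E: supermodule A E by fact
 interpret X: abelian_group X by fact
 interpret EG: graded_group E by (rule E.graded_group)
 have inj: "x = y" if "\<phi> x = \<phi> y" "x : carrier X" "y : carrier X" for x y
  using that \<phi>(2) by (metis bij_betw_def inj_onD)
 note \<phi>c = addmap_closed[OF \<phi>(1)] and \<phi>add = addmap_add[OF \<phi>(1)]
 note smc = conjunct1[OF sm] and sme = conjunct2[OF sm]
 have grI: "x : grade X k" if x: "x : carrier X" "\<phi> x : grade E k" for x k
 proof -
  have "\<phi> x : \<phi> ` grade X k" unfolding gr(2) by (rule x(2))
  then obtain x' where x': "\<phi> x = \<phi> x'" "x' : grade X k" by (rule imageE)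
  have "x = x'" by (rule inj[OF x'(1) x(1) subsetD[OF gr(1) x'(2)]])
  then show ?thesis using x'(2) by (simp only:)
 qed
 have grD: "\<phi> x : grade E k" if "x : grade X k" for x k
  unfolding gr(2)[symmetric] by (rule imageI[OF that])
 have grc: "x : carrier X" if "x : grade X k" for x k by (rule subsetD[OF gr(1) that])
 have sub: "additive_subgroup (grade X k) X" for k
 proof (rule additive_subgroup_of_closed[OF X gr(1)])
  show "\<zero>\<^bsub>X\<^esub> : grade X k"
   by (rule grI) (simp_all add: addmap_zero[OF \<phi>(1) X E.abg] EG.grade_zero)
  show "x \<oplus>\<^bsub>X\<^esub> y : grade X k" if "x : grade X k" "y : grade X k" for x y
   by (rule grI) (simp_all add: \<phi>add grc[OF that(1)] grc[OF that(2)] EG.grade_add grD[OF that(1)] grD[OF that(2)])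
  show "\<ominus>\<^bsub>X\<^esub> x : grade X k" if "x : grade X k" for x
   by (rule grI) (simp_all add: addmap_neg[OF \<phi>(1) X E.abg] grc[OF that] EG.grade_neg grD[OF that])
 qed
 have ex: "\<exists>y. fst y : grade X 0 \<and> snd y : grade X 1 \<and> x = fst y \<oplus>\<^bsub>X\<^esub> snd y" if x: "x : carrier X" for x
 proof -
  have "\<exists>y\<in>grade X i. \<phi> y = hcomp E i (\<phi> x)" for i
  proof -
   have "hcomp E i (\<phi> x) : \<phi> ` grade X i" unfolding gr(2) by (rule EG.hcomp_props(1)[OF \<phi>c[OF x]])
   then obtain y where "hcomp E i (\<phi> x) = \<phi> y" "y : grade X i" by (rule imageE)
   then show ?thesis by (intro bexI[of _ y]) simp_all
  qed
  note e = this
  from e[of 0] obtain y where y: "y : grade X 0" "\<phi> y = hcomp E 0 (\<phi> x)" by (rule bexE)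
  from e[of 1] obtain z where z: "z : grade X 1" "\<phi> z = hcomp E 1 (\<phi> x)" by (rule bexE)
  have "x = y \<oplus>\<^bsub>X\<^esub> z"
   by (rule inj) (simp_all add: \<phi>add grc[OF y(1)] grc[OF z(1)] x y(2) z(2) EG.hcomp_sum[OF \<phi>c[OF x]])
  then show ?thesis using y(1) z(1) by (intro exI[of _ "(y, z)"]) simp
 qed
 have uniq: "y = y'"
  if "fst y : grade X 0 \<and> snd y : grade X 1 \<and> x = fst y \<oplus>\<^bsub>X\<^esub> snd y"
   "fst y' : grade X 0 \<and> snd y' : grade X 1 \<and> x = fst y' \<oplus>\<^bsub>X\<^esub> snd y'" for x y y'
 proof -
  have g: "fst y : grade X 0" "snd y : grade X 1" "fst y' : grade X 0" "snd y' : grade X 1"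
   and eq: "fst y \<oplus>\<^bsub>X\<^esub> snd y = fst y' \<oplus>\<^bsub>X\<^esub> snd y'" using that by simp_all
  note c = grc[OF g(1)] grc[OF g(2)] grc[OF g(3)] grc[OF g(4)]
  have "\<phi> (fst y) \<oplus>\<^bsub>E\<^esub> \<phi> (snd y) = \<phi> (fst y') \<oplus>\<^bsub>E\<^esub> \<phi> (snd y')"
   using arg_cong[OF eq, of \<phi>] by (simp only: \<phi>add[OF c(1,2)] \<phi>add[OF c(3,4)])
  from EG.grade_decomp_unique[OF _ _ _ _ this, of 0]
  have "\<phi> (fst y) = \<phi> (fst y') \<and> \<phi> (snd y) = \<phi> (snd y')"
   using grD[OF g(1)] grD[OF g(2)] grD[OF g(3)] grD[OF g(4)] by (simp only: add_0_left simp_thms)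
  then have "fst y = fst y'" "snd y = snd y'" using inj c by simp_all
  then show ?thesis by (rule prod_eqI)
 qed
 have graded: "graded X"
  unfolding graded_def
 proof (intro conjI allI ballI)
  show "additive_subgroup (grade X i) X" for i by (rule sub)
  fix x assume "x : carrier X"
  from ex[OF this] obtain y where y: "fst y : grade X 0 \<and> snd y : grade X 1 \<and> x = fst y \<oplus>\<^bsub>X\<^esub> snd y" by (rule exE)
  show "\<exists>!y. fst y : grade X 0 \<and> snd y : grade X 1 \<and> x = fst y \<oplus>\<^bsub>X\<^esub> snd y"
   by (rule ex1I, rule y, rule uniq, assumption, rule y)
 qed
 show ?thesis
 proof (intro supermodule.intro supermodule_axioms.intro E.R.superring_axioms X graded)
  fix r s x y
  show "r : carrier A ==> x : carrier X ==> r \<odot>\<^bsub>X\<^esub> x : carrier X" by (rule smc)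
  show "(r \<oplus>\<^bsub>A\<^esub> s) \<odot>\<^bsub>X\<^esub> x = r \<odot>\<^bsub>X\<^esub> x \<oplus>\<^bsub>X\<^esub> s \<odot>\<^bsub>X\<^esub> x"
   if "r : carrier A" "s : carrier A" "x : carrier X"
   by (rule inj) (simp_all add: that smc sme \<phi>add \<phi>c E.smult_l_distr)
  show "r \<odot>\<^bsub>X\<^esub> (x \<oplus>\<^bsub>X\<^esub> y) = r \<odot>\<^bsub>X\<^esub> x \<oplus>\<^bsub>X\<^esub> r \<odot>\<^bsub>X\<^esub> y"
   if "r : carrier A" "x : carrier X" "y : carrier X"
   by (rule inj) (simp_all add: that smc sme \<phi>add \<phi>c E.smult_r_distr)
  show "(r \<otimes>\<^bsub>A\<^esub> s) \<odot>\<^bsub>X\<^esub> x = r \<odot>\<^bsub>X\<^esub> (s \<odot>\<^bsub>X\<^esub> x)"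
   if "r : carrier A" "s : carrier A" "x : carrier X"
   by (rule inj) (simp_all add: that smc sme \<phi>c E.smult_assoc)
  show "\<one>\<^bsub>A\<^esub> \<odot>\<^bsub>X\<^esub> x = x" if "x : carrier X"
   by (rule inj) (simp_all add: that smc sme \<phi>c E.smult_one)
  show "r \<odot>\<^bsub>X\<^esub> x : grade X (i + j)" if "r : grade A i" "x : grade X j" for i j
  proof (rule grI)
   interpret AG: graded_group A by (rule E.R.graded_group)
   note c = AG.grade_carrier[OF that(1)] grc[OF that(2)]
   show "r \<odot>\<^bsub>X\<^esub> x : carrier X" by (rule smc[OF c])
   show "\<phi> (r \<odot>\<^bsub>X\<^esub> x) : grade E (i + j)"
    unfolding sme[OF c] by (rule E.grade_smult[OF that(1) grD[OF that(2)]])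
  qed
 qed
qed

context identified_module begin

text \<open>The sections of \<open>extended_body\<close> over one open set, with scalars pulled back
  along \<open>\<kappa>\<close>.\<close>

definition XE :: "('a, ('p, ((real, 'a) tensor, 'e) tensor) tensor) gmodule" where
 "XE = \<lparr>carrier = carrier XM, monoid.mult = monoid.mult XM, one = one XM, ring.zero = ring.zero XM, add = add XM,
  smult = (\<lambda>a. ext_act (\<kappa> a)), grade = grade XM\<rparr>"

lemma XE_simps [simp]:
 "carrier XE = carrier XM" "add XE = add XM" "\<zero>\<^bsub>XE\<^esub> = \<zero>\<^bsub>XM\<^esub>" "grade XE = grade XM"
 "f \<odot>\<^bsub>XE\<^esub> X = ext_act (\<kappa> f) X"
 by (simp_all add: XE_def)

lemma abelian_group_XE: "abelian_group XE"
 by (rule abelian_group_cong[OF Xb.PM.abelian_group_tensor[where act = ext_act]]) (rule XE_simps)+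

end

context body_splitting begin

lemma additive_\<phi>_XE: "addmap XE E \<phi>"
 by (rule addmap_cong_groups[OF additive_\<phi>]) simp_all

lemma supermodule_XE: "supermodule A XE"
proof (rule supermodule_transport[OF E.supermodule_axioms abelian_group_XE additive_\<phi>_XE])
 show "bij_betw \<phi> (carrier XE) (carrier E)" unfolding XE_simps by (rule \<phi>_bij)
 show "f \<odot>\<^bsub>XE\<^esub> x : carrier XE \<and> \<phi> (f \<odot>\<^bsub>XE\<^esub> x) = f \<odot>\<^bsub>E\<^esub> \<phi> x" if "f : carrier A" "x : carrier XE" for f x
  unfolding XE_simps by (rule \<phi>_ext_act[OF that(1) that(2)[unfolded XE_simps]])
 show "grade XE k \<subseteq> carrier XE" for k unfolding XE_simps using \<phi>_grade by (rule_tac subsetI) (rule conjunct1)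
 show "\<phi> ` grade XE k = grade E k" for k unfolding XE_simps by (rule \<phi>_grade_image)
qed

text \<open>\<open>id \<otimes> \<phi>\<close> takes \<open>1 \<otimes> (1 \<otimes> er e)\<close>
  to \<open>1 \<otimes> S e\<close>, that is to \<open>er (S e) = er e\<close>. Over one open set
  this is the condition that the body of \<open>\<phi>\<close> be the identity.\<close>

lemma body_\<phi>:
 assumes x: "x : carrier EB"
 shows "tensor_map A BO E id \<phi> (pure_tensor A BO XE \<one>\<^bsub>B\<^esub> (px \<one>\<^bsub>P\<^esub> x)) = x"
proof -
 interpret X: supermodule A XE by (rule supermodule_XE)
 have tp: "tensor_pair A BO XE"
  by (rule tensor_pair.intro[OF abelian_group_BO abelian_group_XE Eb.grade_left])
   (rule Eb.smult_left, assumption+, rule X.smult_closed, rule AG.grade_carrier, assumption+)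
 note \<phi>c = addmap_closed[OF additive_\<phi>_XE]
 have bal: "balanced A BO XE EB (\<lambda>b X. pe (id b) (\<phi> X))"
  unfolding balanced_def
 proof (intro conjI ballI allI impI)
  show "addmap BO EB (\<lambda>b. pe (id b) (\<phi> X))" if "X : carrier XE" for X
   unfolding id_apply
   by (rule addmap_cong_groups[OF additive_pe_left[OF \<phi>c[OF that]]]) simp_all
  show "addmap XE EB (\<lambda>X. pe (id b) (\<phi> X))" if "b : carrier BO" for b
   unfolding id_apply
   by (rule addmap_comp[OF additive_\<phi>_XE additive_pe_right[OF that[unfolded BO_simps]]])
  fix i j b r X assume *: "b : grade BO i \<and> r : grade A j \<and> X : carrier XE"
  have b: "b : grade B i" using * by simp
  have r: "r : grade A j" and X: "X : carrier XE" using * by blast+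
  have X': "X : carrier XM" using X by (simp only: XE_simps)
  note c = BG.grade_carrier[OF b] AG.grade_carrier[OF r]
  show "pe (id (koszul BO i j (r \<odot>\<^bsub>BO\<^esub> b))) (\<phi> X) = pe (id b) (\<phi> (r \<odot>\<^bsub>XE\<^esub> X))"
   unfolding id_apply koszul_BO[OF b r] XE_simps conjunct2[OF \<phi>_ext_act[OF c(2) X']]
   by (rule pe_smult[OF c \<phi>c[OF X]])
 qed
 obtain e where e: "e : carrier E" "x = er e" using x by (rule er_surj)
 have X: "px \<one>\<^bsub>P\<^esub> x : carrier XE" unfolding XE_simps by (rule px_closed[OF P.A.one_closed x])
 have "tensor_map A BO E id \<phi> (pure_tensor A BO XE \<one>\<^bsub>B\<^esub> (px \<one>\<^bsub>P\<^esub> x)) = pe (id \<one>\<^bsub>B\<^esub>) (\<phi> (px \<one>\<^bsub>P\<^esub> x))"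
  by (rule Eb.tensor_map_eval(2)[where g = id and h = \<phi>, OF tp _ \<phi>c bal[unfolded left_tensor_def[of A]] _ X])
   (simp_all add: one_B_closed)
 also have "\<dots> = x"
  unfolding e(2) id_apply \<phi>_px[OF P.A.one_closed e(1)] pact_one[OF S_closed[OF e(1)]] by (rule er_S[OF e(1)])
 finally show ?thesis .
qed

end

section \<open>Compatibility with restriction maps\<close>

locale identified_module_hom = identified_hom P pr A \<kappa> A' \<kappa>' h +
  D: identified_module P pr A \<kappa> E + C: identified_module P pr A' \<kappa>' E'
 for P :: "(real, 'p) gmodule" and pr and A :: "('p, 'a) gmodule" and \<kappa> and A' :: "('p, 'b) gmodule" and \<kappa>'
  and h :: "'a \<Rightarrow> 'b" and E :: "('a, 'e) gmodule" and E' :: "('b, 'f) gmodule" +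
 fixes k :: "'e \<Rightarrow> 'f"
 assumes additive_k: "addmap E E' k"
  and k_smult: "[|f : carrier A; e : carrier E|] ==> k (f \<odot>\<^bsub>E\<^esub> e) = h f \<odot>\<^bsub>E'\<^esub> k e"
begin

lemma k_closed: "e : carrier E ==> k e : carrier E'"
 by (rule addmap_closed[OF additive_k])

lemma h_\<iota>: "p : carrier P ==> h (D.\<iota> p) = C.\<iota> p"
 by (simp add: D.\<iota>_def C.\<iota>_def h_smult h_one)

lemma k_pact: "[|p : carrier P; e : carrier E|] ==> k (D.pact p e) = C.pact p (k e)"
 by (simp add: D.pact_def C.pact_def k_smult D.\<iota>_closed h_\<iota>)

lemma hB_closed: "b : carrier D.B ==> hB b : carrier C.B"
 by (rule addmap_closed[OF additive_hB])

lemma hB_mult_br: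
 assumes "b : carrier D.B" "f : carrier A"
 shows "hB (b \<otimes>\<^bsub>D.B\<^esub> D.br f) = hB b \<otimes>\<^bsub>C.B\<^esub> C.br (h f)"
proof -
 obtain g where g: "g : carrier A" "b = D.br g" using assms(1) by (rule D.br_surj)
 show ?thesis
  unfolding g(2) D.tensor_prod_body[OF g(1) assms(2)] hB_br[OF g(1)]
   hB_br[OF D.A.A.m_closed[OF g(1) assms(2)]] h_mult[OF g(1) assms(2)]
  by (rule C.tensor_prod_body[OF h_closed[OF g(1)] h_closed[OF assms(2)], symmetric])
qed

lemma hB_one: "hB \<one>\<^bsub>D.B\<^esub> = \<one>\<^bsub>C.B\<^esub>"
 unfolding D.one_B C.one_B hB_br[OF D.A.A.one_closed] h_one ..

abbreviation kB where "kB \<equiv> tensor_map A' C.BO E' hB k"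

text \<open>\<open>hB\<close>, \<open>kB\<close> and, further below, \<open>kX\<close> are the
  restriction maps of the body, of \<open>bundle_body\<close> and of \<open>extended_body\<close>;
  on pure tensors they reduce to \<open>h\<close> and \<open>k\<close>.\<close>

lemma additive_kB: "addmap D.EB C.EB kB"
 and kB_pe: "[|b : carrier D.B; e : carrier E|] ==> kB (D.pe b e) = C.pe (hB b) (k e)"
proof -
 have bal: "balanced A D.BO E C.EB (\<lambda>b e. C.pe (hB b) (k e))"
  unfolding balanced_def
 proof (intro conjI ballI allI impI)
  show "addmap D.BO C.EB (\<lambda>b. C.pe (hB b) (k e))" if "e : carrier E" for e
   by (rule addmap_cong_groups[OF addmap_comp[OF additive_hB C.additive_pe_left[OF k_closed[OF that]]]]) simp_all
  show "addmap E C.EB (\<lambda>e. C.pe (hB b) (k e))" if "b : carrier D.BO" for b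
   by (rule addmap_comp[OF additive_k C.additive_pe_right[OF hB_closed[OF that[unfolded D.BO_simps]]]])
  fix i j b r e assume *: "b : grade D.BO i \<and> r : grade A j \<and> e : carrier E"
  have b: "b : grade D.B i" using * by simp
  have r: "r : grade A j" and e: "e : carrier E" using * by blast+
  note c = D.BG.grade_carrier[OF b] D.AG.grade_carrier[OF r]
  show "C.pe (hB (koszul D.BO i j (r \<odot>\<^bsub>D.BO\<^esub> b))) (k e) = C.pe (hB b) (k (r \<odot>\<^bsub>E\<^esub> e))"
   unfolding D.koszul_BO[OF b r] hB_mult_br[OF c] k_smult[OF c(2) e]
   by (rule C.pe_smult[OF hB_closed[OF c(1)] h_closed[OF c(2)] k_closed[OF e]])
 qed
 have hb: "hB b : carrier C.BO" if "b : carrier D.BO" for b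
  unfolding C.BO_simps by (rule hB_closed[OF that[unfolded D.BO_simps]])
 note ev = C.Eb.tensor_map_eval[where g = hB and h = k, OF D.Eb.tensor_pair_axioms hb k_closed
   bal[unfolded left_tensor_def[of A']]]
 show "addmap D.EB C.EB kB"
  unfolding left_tensor_def[of A] left_tensor_def[of A'] by (rule ev(1))
 show "kB (D.pe b e) = C.pe (hB b) (k e)" if "b : carrier D.B" "e : carrier E"
  by (rule ev(2)) (use that in simp_all)
qed

lemma kB_er: "e : carrier E ==> kB (D.er e) = C.er (k e)"
 using kB_pe[OF D.one_B_closed] by (simp only: hB_one)

abbreviation kX where "kX \<equiv> tensor_map real_alg P C.RE id kB"

lemma additive_kX: "addmap D.XM C.XM kX"
 and kX_px: "[|p : carrier P; x : carrier D.EB|] ==> kX (D.px p x) = C.px p (kB x)"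
proof -
 note kBc = addmap_closed[OF additive_kB]
 have kBR: "kB x : carrier C.RE" if "x : carrier D.RE" for x
  unfolding C.RE_simps by (rule kBc[OF that[unfolded D.RE_simps]])
 have bal: "balanced real_alg P D.RE C.XM (\<lambda>p x. C.px (id p) (kB x))"
 proof (rule D.Xb.balanced_PM[OF C.Xb.PM.abelian_group_tensor])
  show "addmap P C.XM (\<lambda>p. C.px (id p) (kB x))" if "x : carrier D.RE" for x
   using C.Xb.PM.additive_pure_left[OF kBR[OF that]] by (simp only: id_apply)
  show "addmap D.RE C.XM (\<lambda>x. C.px (id p) (kB x))" if "p : carrier P" for p
  proof -
   have "addmap D.RE C.RE kB" by (rule addmap_cong_groups[OF additive_kB]) simp_all
   from addmap_comp[OF this C.Xb.PM.additive_pure_right[OF that]]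
   show ?thesis by (simp only: id_apply)
  qed
  fix r p x assume p: "p : carrier P" and x: "x : carrier D.RE"
  have "x : carrier D.EB" using x by (simp only: D.RE_simps)
  then obtain e where e: "e : carrier E" "x = D.er e" by (rule D.er_surj)
  have "C.px (r \<odot>\<^bsub>P\<^esub> p) (kB x) = C.px p (kB (r \<odot>\<^bsub>D.RE\<^esub> x))"
   unfolding C.Xb.pure_real_smult[OF p kBR[OF x]] unfolding e(2)
    D.RE_smult[OF e(1)] kB_er[OF e(1)] kB_er[OF D.pact_closed[OF D.sc_closed e(1)]]
    C.RE_smult[OF k_closed[OF e(1)]] k_pact[OF D.sc_closed e(1)] ..
  then show "C.px (id (r \<odot>\<^bsub>P\<^esub> p)) (kB x) = C.px (id p) (kB (r \<odot>\<^bsub>D.RE\<^esub> x))"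
   by (simp only: id_apply)
 qed
 note ev = C.Xb.PM.tensor_map_eval[where g = id and h = kB, OF D.Xb.PM.tensor_pair_axioms _ kBR bal]
 show "addmap D.XM C.XM kX" by (rule ev(1)) (simp only: id_apply)
 show "kX (D.px p x) = C.px p (kB x)" if "p : carrier P" "x : carrier D.EB"
  using ev(2)[OF _ _ that(1), of x] that(2) by (simp only: id_apply D.RE_simps)
qed

end

locale body_splitting_hom = identified_module_hom P pr A \<kappa> A' \<kappa>' h E E' k +
  D: body_splitting P pr A \<kappa> E S + C: body_splitting P pr A' \<kappa>' E' S'
 for P :: "(real, 'p) gmodule" and pr and A :: "('p, 'a) gmodule" and \<kappa> and A' :: "('p, 'b) gmodule" and \<kappa>'
  and h :: "'a \<Rightarrow> 'b" and E :: "('a, 'e) gmodule" and E' :: "('b, 'f) gmodule" and k S S' +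
 assumes S_natural: "e : carrier E ==> S' (k e) = k (S e)"
begin

lemma \<phi>_natural: "X : carrier D.XM ==> C.\<phi> (kX X) = k (D.\<phi> X)"
proof (induction rule: D.XM_induct)
 case (pure p e)
 show ?case
  unfolding kX_px[OF pure(1) D.er_closed[OF pure(2)]] kB_er[OF pure(2)] C.\<phi>_px[OF pure(1) k_closed[OF pure(2)]]
   D.\<phi>_px[OF pure] S_natural[OF pure(2)] k_pact[OF pure(1) D.S_closed[OF pure(2)]] ..
next
 case (add X Y)
 show ?case
  unfolding addmap_add[OF additive_kX add(1,2)] addmap_add[OF D.additive_\<phi> add(1,2)]
   addmap_add[OF C.additive_\<phi> addmap_closed[OF additive_kX add(1)] addmap_closed[OF additive_kX add(2)]]
   addmap_add[OF additive_k D.\<phi>_closed[OF add(1)] D.\<phi>_closed[OF add(2)]] add(3,4) ..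
qed

end

section \<open>Sheaves\<close>

lemma sheaf_res_closed:
 "[|sheaf T F; openin T U; openin T V; V \<subseteq> U; x : carrier (sec F U)|] ==> res F U V x : carrier (sec F V)"
 by (auto simp: sheaf_def)

lemma sheaf_res_id: "[|sheaf T F; openin T U; x : carrier (sec F U)|] ==> res F U U x = x"
 by (auto simp: sheaf_def)

lemma sheaf_res_res:
 assumes "sheaf T F" "openin T U" "openin T V" "openin T W" "W \<subseteq> V" "V \<subseteq> U" "x : carrier (sec F U)"
 shows "res F V W (res F U V x) = res F U W x"
proof -
 have "\<forall>U V W. openin T U \<and> openin T V \<and> openin T W \<and> W \<subseteq> V \<and> V \<subseteq> U \<longrightarrow>
    (\<forall>x\<in>carrier (sec F U). res F V W (res F U V x) = res F U W x)"
  using assms(1) unfolding sheaf_def by (elim conjE)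
 then show ?thesis using assms(2-) by blast
qed

lemma sheaf_family:
 assumes "sheaf T F" "\<And>V. V : \<U> ==> openin T V" "\<And>V. V : \<U> ==> s V : carrier (sec F V)"
  and "\<And>V W. [|V : \<U>; W : \<U>|] ==> res F V (V \<inter> W) (s V) = res F W (V \<inter> W) (s W)"
 shows "\<exists>!x. x : carrier (sec F (\<Union>\<U>)) \<and> (\<forall>V\<in>\<U>. res F (\<Union>\<U>) V x = s V)"
proof -
 have "\<forall>\<U>. (\<forall>V\<in>\<U>. openin T V) \<longrightarrow>
    (\<forall>s. (\<forall>V\<in>\<U>. s V : carrier (sec F V)) \<and>
      (\<forall>V\<in>\<U>. \<forall>W\<in>\<U>. res F V (V \<inter> W) (s V) = res F W (V \<inter> W) (s W)) \<longrightarrow>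
      (\<exists>!x. x : carrier (sec F (\<Union>\<U>)) \<and> (\<forall>V\<in>\<U>. res F (\<Union>\<U>) V x = s V)))"
  using assms(1) unfolding sheaf_def by (elim conjE)
 from this[rule_format, of \<U> s] show ?thesis using assms(2-) by blast
qed

text \<open>The sheaf axiom speaks of sets of open sets, whereas covers are used here as indexed
  families. An index is chosen for each member of the cover; compatibility makes sections with the
  same domain equal, so the choice does not matter.\<close>

lemma sheaf_glue:
 assumes F: "sheaf T F" and U: "\<And>i. i : I ==> openin T (U i)" "W = (\<Union>i\<in>I. U i)"
  and s: "\<And>i. i : I ==> s i : carrier (sec F (U i))"
  and compat: "\<And>i j. [|i : I; j : I|] ==> res F (U i) (U i \<inter> U j) (s i) = res F (U j) (U i \<inter> U j) (s j)"
 shows "\<exists>x\<in>carrier (sec F W). \<forall>i\<in>I. res F W (U i) x = s i"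
proof -
 define j where "j V = (SOME i. i : I \<and> U i = V)" for V
 have j: "j V : I" "U (j V) = V" if "V : U ` I" for V
  using someI_ex[of "\<lambda>i. i : I \<and> U i = V"] that unfolding j_def by blast+
 have "\<exists>!x. x : carrier (sec F (\<Union>(U ` I))) \<and> (\<forall>V\<in>U ` I. res F (\<Union>(U ` I)) V x = s (j V))"
 proof (rule sheaf_family[OF F])
  fix V V' assume V: "V : U ` I"
  show "openin T V" using U(1) V by blast
  show "s (j V) : carrier (sec F V)" using s[OF j(1)[OF V]] j(2)[OF V] by simp
  show "res F V (V \<inter> V') (s (j V)) = res F V' (V \<inter> V') (s (j V'))" if V': "V' : U ` I"
   using compat[OF j(1)[OF V] j(1)[OF V']] unfolding j(2)[OF V] j(2)[OF V'] .
 qed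
 then obtain x where x: "x : carrier (sec F (\<Union>(U ` I)))" "\<forall>V\<in>U ` I. res F (\<Union>(U ` I)) V x = s (j V)" by blast
 have "res F W (U i) x = s i" if i: "i : I" for i
 proof -
  have ji: "j (U i) : I" "U (j (U i)) = U i" using j[of "U i"] i by blast+
  \<comment> \<open>The index chosen for \<open>U i\<close> need not be \<open>i\<close>; over their
    common domain the compatibility condition compares the two sections themselves.\<close>
  have "s (j (U i)) = s i"
   using compat[OF ji(1) i] sheaf_res_id[OF F U(1)[OF i]] s[OF ji(1)] s[OF i] unfolding ji(2) by simp
  then show ?thesis using x(2) i unfolding U(2) by auto
 qed
 then show ?thesis using x(1) unfolding U(2) by blast
qed

lemma sheaf_eqI:
 assumes F: "sheaf T F" and U: "\<And>i. i : I ==> openin T (U i)" "W = (\<Union>i\<in>I. U i)"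
  and xy: "x : carrier (sec F W)" "y : carrier (sec F W)" "\<And>i. i : I ==> res F W (U i) x = res F W (U i) y"
 shows "x = y"
proof -
 have W: "openin T W" unfolding U(2) using U(1) by blast
 have sub: "V \<subseteq> W" "openin T V" if "V : U ` I" for V using that U by blast+
 have "\<exists>!z. z : carrier (sec F (\<Union>(U ` I))) \<and> (\<forall>V\<in>U ` I. res F (\<Union>(U ` I)) V z = res F W V x)"
 proof (rule sheaf_family[OF F])
  fix V V' assume V: "V : U ` I"
  show "openin T V" "res F W V x : carrier (sec F V)"
   using sub[OF V] by (auto intro: sheaf_res_closed[OF F W] xy)
  show "res F V (V \<inter> V') (res F W V x) = res F V' (V \<inter> V') (res F W V' x)" if V': "V' : U ` I"
   using sub[OF V] sub[OF V'] xy(1) by (simp add: sheaf_res_res[OF F W] openin_Int)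
 qed
 then obtain z where z: "\<And>y. [|y : carrier (sec F W); \<forall>V\<in>U ` I. res F W V y = res F W V x|] ==> y = z"
  unfolding U(2)[symmetric] by (elim ex1E) (rule that, simp only: simp_thms)
 have "x = z" by (rule z[OF xy(1)]) simp
 moreover have "y = z" by (rule z[OF xy(2)]) (simp add: xy(3))
 ultimately show ?thesis by simp
qed

text \<open>This is how tensor products that are formed section by section acquire the gluing
  property: along bijections that commute with restriction.\<close>

lemma sheaf_transport:
 assumes F: "sheaf T F"
  and \<psi>: "\<And>U. openin T U ==> bij_betw (\<psi> U) (carrier (sec X U)) (carrier (sec F U))"
  and res: "\<And>U V x. [|openin T U; openin T V; V \<subseteq> U; x : carrier (sec X U)|] ==>
   res X U V x : carrier (sec X V) \<and> \<psi> V (res X U V x) = res F U V (\<psi> U x)"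
 shows "sheaf T X"
proof -
 have \<psi>c: "\<psi> U x : carrier (sec F U)" if "openin T U" "x : carrier (sec X U)" for U x
  using \<psi>[OF that(1)] that(2) by (auto simp: bij_betw_def)
 have inj: "x = y" if "openin T U" "\<psi> U x = \<psi> U y" "x : carrier (sec X U)" "y : carrier (sec X U)" for U x y
  using \<psi>[OF that(1)] that(2-) by (metis bij_betw_def inj_onD)
 note rc = conjunct1[OF res] and re = conjunct2[OF res]
 show ?thesis
  unfolding sheaf_def
 proof (intro conjI allI impI ballI)
  show "res X U V : carrier (sec X U) \<rightarrow> carrier (sec X V)" if "openin T U \<and> openin T V \<and> V \<subseteq> U" for U V
   using rc that by blast
  show "res X U U x = x" if "openin T U" "x : carrier (sec X U)" for U x
   by (rule inj[OF that(1) _ rc[OF that(1,1) order_refl that(2)] that(2)])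
    (simp add: re[OF that(1,1) order_refl that(2)] sheaf_res_id[OF F that(1) \<psi>c[OF that]])
  show "res X V W (res X U V x) = res X U W x"
   if *: "openin T U \<and> openin T V \<and> openin T W \<and> W \<subseteq> V \<and> V \<subseteq> U" and x: "x : carrier (sec X U)" for U V W x
  proof -
   have o: "openin T U" "openin T V" "openin T W" "W \<subseteq> V" "V \<subseteq> U" "W \<subseteq> U" using * by auto
   show ?thesis
    by (rule inj[OF o(3) _ rc[OF o(2,3,4) rc[OF o(1,2,5) x]] rc[OF o(1,3,6) x]])
     (simp add: re[OF o(2,3,4) rc[OF o(1,2,5) x]] re[OF o(1,2,5) x] re[OF o(1,3,6) x]
      sheaf_res_res[OF F o(1-5) \<psi>c[OF o(1) x]])
  qed
  fix \<U> s assume \<U>: "\<forall>V\<in>\<U>. openin T V"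
   and s: "(\<forall>V\<in>\<U>. s V : carrier (sec X V)) \<and> (\<forall>V\<in>\<U>. \<forall>W\<in>\<U>. res X V (V \<inter> W) (s V) = res X W (V \<inter> W) (s W))"
  have o: "openin T (\<Union>\<U>)" using \<U> by blast
  have oV: "openin T V" and sc: "s V : carrier (sec X V)" and sub: "V \<subseteq> \<Union>\<U>" if "V : \<U>" for V
   using \<U> s that by auto
  have "\<exists>!x. x : carrier (sec F (\<Union>\<U>)) \<and> (\<forall>V\<in>\<U>. res F (\<Union>\<U>) V x = \<psi> V (s V))"
  proof (rule sheaf_family[OF F oV])
   show "\<psi> V (s V) : carrier (sec F V)" if "V : \<U>" for V by (rule \<psi>c[OF oV[OF that] sc[OF that]])
   fix V W assume V: "V : \<U>" and W: "W : \<U>"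
   note oVW = openin_Int[OF oV[OF V] oV[OF W]]
   have "res X V (V \<inter> W) (s V) = res X W (V \<inter> W) (s W)" using s V W by blast
   then show "res F V (V \<inter> W) (\<psi> V (s V)) = res F W (V \<inter> W) (\<psi> W (s W))"
    by (simp only: re[OF oV[OF V] oVW Int_lower1 sc[OF V], symmetric] re[OF oV[OF W] oVW Int_lower2 sc[OF W], symmetric])
  qed
  then obtain x where x: "x : carrier (sec F (\<Union>\<U>))" "\<And>V. V : \<U> ==> res F (\<Union>\<U>) V x = \<psi> V (s V)"
   and u: "\<And>y. y : carrier (sec F (\<Union>\<U>)) \<and> (\<forall>V\<in>\<U>. res F (\<Union>\<U>) V y = \<psi> V (s V)) ==> y = x"
   by (elim ex1E) metis
  have "x : \<psi> (\<Union>\<U>) ` carrier (sec X (\<Union>\<U>))" using \<psi>[OF o] x(1) by (simp add: bij_betw_def)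
  then obtain y where y: "x = \<psi> (\<Union>\<U>) y" "y : carrier (sec X (\<Union>\<U>))" by (rule imageE)
  show "\<exists>!x. x : carrier (sec X (\<Union>\<U>)) \<and> (\<forall>V\<in>\<U>. res X (\<Union>\<U>) V x = s V)"
  proof (rule ex1I[of _ y])
   have "res X (\<Union>\<U>) V y = s V" if V: "V : \<U>" for V
    by (rule inj[OF oV[OF V] _ rc[OF o oV[OF V] sub[OF V] y(2)] sc[OF V]])
     (simp add: re[OF o oV[OF V] sub[OF V] y(2)] y(1)[symmetric] x(2)[OF V])
   then show "y : carrier (sec X (\<Union>\<U>)) \<and> (\<forall>V\<in>\<U>. res X (\<Union>\<U>) V y = s V)" using y(2) by blast
   fix z assume z: "z : carrier (sec X (\<Union>\<U>)) \<and> (\<forall>V\<in>\<U>. res X (\<Union>\<U>) V z = s V)"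
   have "\<psi> (\<Union>\<U>) z = x"
   proof (rule u, intro conjI ballI)
    show "\<psi> (\<Union>\<U>) z : carrier (sec F (\<Union>\<U>))" using \<psi>c[OF o] z by blast
    show "res F (\<Union>\<U>) V (\<psi> (\<Union>\<U>) z) = \<psi> V (s V)" if V: "V : \<U>" for V
     using re[OF o oV[OF V] sub[OF V], of z] z V by simp
   qed
   then show "z = y" using inj[OF o, of z y] z y by simp
  qed
 qed
qed

lemma (in superring) even_commute:
 assumes "g : grade R 0" "f : carrier R"
 shows "f \<otimes> g = g \<otimes> f"
proof -
 interpret G: graded_group R by (rule graded_group)
 have c: "g : carrier R" "\<And>i. hcomp R i f : carrier R" using assms G.grade_carrier G.hcomp_closed by blast+
 have "hcomp R i f \<otimes> g = g \<otimes> hcomp R i f" for i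
  using supercommutative[OF G.hcomp_props(1)[OF assms(2), of i] assms(1)] by (simp add: koszul_def)
 then have "(hcomp R 0 f \<oplus> hcomp R 1 f) \<otimes> g = g \<otimes> (hcomp R 0 f \<oplus> hcomp R 1 f)"
  using c by (simp add: l_distr r_distr)
 then show ?thesis using G.hcomp_sum[OF assms(2)] by simp
qed

section \<open>Restriction in the structure sheaf and in a module over it\<close>

locale sheaf_pair =
 fixes T :: "'x topology" and P :: "('k, 'p) gmodule" and \<O> :: "('x, 'p, 'o) gsheaf"
  and E :: "('x, 'o, 'e) gsheaf"
 assumes algebra_sheaf: "algebra_sheaf T P \<O>" and module_sheaf: "module_sheaf T \<O> E"
begin

abbreviation ME where "ME U \<equiv> carrier (sec E U)"
abbreviation MO where "MO U \<equiv> carrier (sec \<O> U)"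


abbreviation "\<Omega> \<equiv> topspace T"

lemma sheaf_O: "sheaf T \<O>" using algebra_sheaf by (simp add: algebra_sheaf_def)
lemma sheaf_E: "sheaf T E" using module_sheaf by (simp add: module_sheaf_def)

lemma superalgebra_O: "openin T U ==> superalgebra P (sec \<O> U)"
 using algebra_sheaf by (simp add: algebra_sheaf_def)
lemma supermodule_E: "openin T U ==> supermodule (sec \<O> U) (sec E U)"
 using module_sheaf by (simp add: module_sheaf_def)
lemma superring_O: "openin T U ==> superring (sec \<O> U)"
 using superalgebra_O by (simp add: superalgebra_def)
lemma graded_O: "openin T U ==> graded_group (sec \<O> U)"
 by (rule superring.graded_group[OF superring_O])
lemma graded_E: "openin T U ==> graded_group (sec E U)"
 by (rule supermodule.graded_group[OF supermodule_E])
lemma abelian_O: "openin T U ==> abelian_group (sec \<O> U)"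
 using graded_O by (simp add: graded_group_def)
lemma abelian_E: "openin T U ==> abelian_group (sec E U)"
 using graded_E by (simp add: graded_group_def)

lemma hom_O: "[|openin T U; openin T V; V \<subseteq> U|] ==> algebra_hom P (sec \<O> U) (sec \<O> V) (res \<O> U V)"
 using algebra_sheaf by (simp add: algebra_sheaf_def)

lemma additive_res_O: "[|openin T U; openin T V; V \<subseteq> U|] ==> addmap (sec \<O> U) (sec \<O> V) (res \<O> U V)"
 using hom_O by (simp add: algebra_hom_def module_hom_def addmap_def)

lemma additive_res_E: "[|openin T U; openin T V; V \<subseteq> U|] ==> addmap (sec E U) (sec E V) (res E U V)"
 using module_sheaf sheaf_res_closed[OF sheaf_E] by (simp add: module_sheaf_def addmap_def Pi_iff)

lemma res_O_closed: "[|openin T U; openin T V; V \<subseteq> U; f : MO U|] ==> res \<O> U V f : MO V"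
 by (rule sheaf_res_closed[OF sheaf_O])

lemma res_E_closed: "[|openin T U; openin T V; V \<subseteq> U; e : ME U|] ==> res E U V e : ME V"
 by (rule sheaf_res_closed[OF sheaf_E])

lemma res_O_zero: "[|openin T U; openin T V; V \<subseteq> U|] ==> res \<O> U V \<zero>\<^bsub>sec \<O> U\<^esub> = \<zero>\<^bsub>sec \<O> V\<^esub>"
 by (rule addmap_zero[OF additive_res_O abelian_O abelian_O])

lemma res_E_zero: "[|openin T U; openin T V; V \<subseteq> U|] ==> res E U V \<zero>\<^bsub>sec E U\<^esub> = \<zero>\<^bsub>sec E V\<^esub>"
 by (rule addmap_zero[OF additive_res_E abelian_E abelian_E])

lemma res_O_one: "[|openin T U; openin T V; V \<subseteq> U|] ==> res \<O> U V \<one>\<^bsub>sec \<O> U\<^esub> = \<one>\<^bsub>sec \<O> V\<^esub>"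
 using hom_O by (simp add: algebra_hom_def ring_hom_one)

lemma res_O_mult: "[|openin T U; openin T V; V \<subseteq> U; f : MO U; g : MO U|] ==>
  res \<O> U V (f \<otimes>\<^bsub>sec \<O> U\<^esub> g) = res \<O> U V f \<otimes>\<^bsub>sec \<O> V\<^esub> res \<O> U V g"
 using hom_O by (simp add: algebra_hom_def ring_hom_mult)

lemma res_O_grade: "[|openin T U; openin T V; V \<subseteq> U; f : grade (sec \<O> U) i|] ==> res \<O> U V f : grade (sec \<O> V) i"
 using hom_O[of U V] by (simp add: algebra_hom_def module_hom_def image_subset_iff)

lemma res_E_smult: "[|openin T U; openin T V; V \<subseteq> U; f : MO U; e : ME U|] ==>
  res E U V (f \<odot>\<^bsub>sec E U\<^esub> e) = res \<O> U V f \<odot>\<^bsub>sec E V\<^esub> res E U V e"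
 using module_sheaf by (simp add: module_sheaf_def)

lemma res_E_grade: "[|openin T U; openin T V; V \<subseteq> U; e : grade (sec E U) i|] ==> res E U V e : grade (sec E V) i"
 using module_sheaf by (simp add: module_sheaf_def image_subset_iff)

lemma res_O_res: "[|openin T U; openin T V; openin T W; W \<subseteq> V; V \<subseteq> U; f : MO U|] ==>
  res \<O> V W (res \<O> U V f) = res \<O> U W f"
 by (rule sheaf_res_res[OF sheaf_O])

lemma res_E_res: "[|openin T U; openin T V; openin T W; W \<subseteq> V; V \<subseteq> U; e : ME U|] ==>
  res E V W (res E U V e) = res E U W e"
 by (rule sheaf_res_res[OF sheaf_E])

lemma smult_closed_E: "[|openin T U; f : MO U; e : ME U|] ==> f \<odot>\<^bsub>sec E U\<^esub> e : ME U"
 by (rule supermodule.smult_closed[OF supermodule_E])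

text \<open>The component of degree \<open>k\<close> agrees with \<open>e\<close> on every member of
  the cover, hence on \<open>W\<close>.\<close>

lemma grade_E_local:
 assumes U: "\<And>i. i : I ==> openin T (U i)" "W = (\<Union>i\<in>I. U i)"
  and e: "e : ME W" "\<And>i. i : I ==> res E W (U i) e : grade (sec E (U i)) k"
 shows "e : grade (sec E W) k"
proof -
 have W: "openin T W" unfolding U(2) using U(1) by blast
 have sub: "U i \<subseteq> W" if "i : I" for i using that U(2) by blast
 interpret W: graded_group "sec E W" by (rule graded_E[OF W])
 have "hcomp (sec E W) k e = e"
 proof (rule sheaf_eqI[OF sheaf_E U W.hcomp_closed[OF e(1)] e(1)])
  fix i assume i: "i : I"
  interpret V: graded_group "sec E (U i)" by (rule graded_E[OF U(1)[OF i]])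
  have "hcomp (sec E (U i)) k (res E W (U i) e) = res E W (U i) (hcomp (sec E W) k e)"
   by (rule W.hcomp_commute[OF V.graded_group_axioms additive_res_E[OF W U(1)[OF i] sub[OF i]] res_E_grade[OF W U(1)[OF i] sub[OF i]] e(1)])
  then show "res E W (U i) (hcomp (sec E W) k e) = res E W (U i) e"
   using V.hcomp_grade_same[OF e(2)[OF i]] by simp
 qed
 then show ?thesis using W.hcomp_props(1)[OF e(1), of k] by simp
qed

end

section \<open>Extension by zero\<close>

text \<open>\<open>g\<close> is to be supported in \<open>C\<close>. As sections of
  \<open>\<O>\<close> are not functions of points, this is expressed by restriction to the open
  complement of \<open>C\<close>.\<close>

locale cutoff = sheaf_pair T P \<O> E
 for T :: "'x topology" and P :: "('k, 'p) gmodule" and \<O> :: "('x, 'p, 'o) gsheaf" and E :: "('x, 'o, 'e) gsheaf" +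
 fixes g :: 'o and U C
 assumes U: "openin T U" and C: "closedin T C" "C \<subseteq> U"
  and g: "g : grade (sec \<O> (topspace T)) 0"
  and g_zero: "res \<O> (topspace T) (topspace T - C) g = \<zero>\<^bsub>sec \<O> (topspace T - C)\<^esub>"
begin

lemma open_Int: "openin T W ==> openin T (W \<inter> U)"
 by (rule openin_Int[OF _ U])
lemma open_diff: "openin T W ==> openin T (W - C)"
 by (rule openin_diff[OF _ C(1)])

abbreviation gr where "gr W \<equiv> res \<O> \<Omega> W g"

lemma gr_even: "openin T W ==> gr W : grade (sec \<O> W) 0"
 by (rule res_O_grade[OF openin_topspace _ openin_subset g])

lemma g_closed: "g : MO \<Omega>"
 by (rule graded_group.grade_carrier[OF graded_O[OF openin_topspace] g])

lemma gr_closed: "openin T W ==> gr W : MO W"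
 by (rule res_O_closed[OF openin_topspace _ openin_subset g_closed])

lemma gr_res: "[|openin T W; openin T W'; W' \<subseteq> W|] ==> res \<O> W W' (gr W) = gr W'"
 by (rule res_O_res[OF openin_topspace _ _ _ openin_subset g_closed])

lemma gr_zero: assumes W: "openin T W" "W \<inter> C = {}" shows "gr W = \<zero>\<^bsub>sec \<O> W\<^esub>"
proof -
 have o: "openin T (\<Omega> - C)" by (rule open_diff[OF openin_topspace])
 have s: "W \<subseteq> \<Omega> - C" using openin_subset[OF W(1)] W(2) by blast
 have "gr W = res \<O> (\<Omega> - C) W (res \<O> \<Omega> (\<Omega> - C) g)"
  by (rule res_O_res[OF openin_topspace o W(1) s Diff_subset g_closed, symmetric])
 then show ?thesis unfolding g_zero using res_O_zero[OF o W(1) s] by simp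
qed

lemma gr_commute: "[|openin T W; f : MO W|] ==> gr W \<otimes>\<^bsub>sec \<O> W\<^esub> f = f \<otimes>\<^bsub>sec \<O> W\<^esub> gr W"
 by (rule superring.even_commute[OF superring_O gr_even, symmetric])

lemma gr_smult_zero: "[|openin T W; W \<inter> C = {}; x : ME W|] ==> gr W \<odot>\<^bsub>sec E W\<^esub> x = \<zero>\<^bsub>sec E W\<^esub>"
 using gr_zero supermodule.smult_zero_left[OF supermodule_E] by simp

lemma cover: "openin T W ==> W = (\<Union>b\<in>{True, False}. if b then W \<inter> U else W - C)"
 using C(2) by auto

lemma cover_eqI:
 assumes "openin T W" "z : ME W" "z' : ME W"
  "res E W (W \<inter> U) z = res E W (W \<inter> U) z'" "res E W (W - C) z = res E W (W - C) z'"
 shows "z = z'"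
 by (rule sheaf_eqI[OF sheaf_E _ cover[OF assms(1)] assms(2,3)])
  (use assms open_Int open_diff in \<open>auto split: if_splits\<close>)

text \<open>The extension by zero of \<open>g x\<close> from \<open>W \<inter> U\<close> to
  \<open>W\<close>. The sets \<open>W \<inter> U\<close> and \<open>W - C\<close> cover
  \<open>W\<close> because \<open>C\<close> lies in \<open>U\<close>, and \<open>g\<close> vanishes
  on their overlap.\<close>

definition zext where "zext W x = (SOME z. z : ME W \<and>
  res E W (W \<inter> U) z = gr (W \<inter> U) \<odot>\<^bsub>sec E (W \<inter> U)\<^esub> x \<and> res E W (W - C) z = \<zero>\<^bsub>sec E (W - C)\<^esub>)"

lemma zext:
 assumes W: "openin T W" and x: "x : ME (W \<inter> U)"
 shows "zext W x : ME W" (is ?A)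
  "res E W (W \<inter> U) (zext W x) = gr (W \<inter> U) \<odot>\<^bsub>sec E (W \<inter> U)\<^esub> x" (is ?B)
  "res E W (W - C) (zext W x) = \<zero>\<^bsub>sec E (W - C)\<^esub>" (is ?C)
proof -
 let ?U = "\<lambda>b. if b then W \<inter> U else W - C"
 let ?x = "gr (W \<inter> U) \<odot>\<^bsub>sec E (W \<inter> U)\<^esub> x"
 let ?s = "\<lambda>b. if b then ?x else \<zero>\<^bsub>sec E (W - C)\<^esub>"
 let ?V = "(W \<inter> U) \<inter> (W - C)"
 note o = open_Int[OF W] open_diff[OF W]
 have oV: "openin T ?V" by (rule openin_Int[OF o])
 have xc: "?x : ME (W \<inter> U)" by (rule smult_closed_E[OF o(1) gr_closed[OF o(1)] x])
 have "res E (W \<inter> U) ?V ?x = gr ?V \<odot>\<^bsub>sec E ?V\<^esub> res E (W \<inter> U) ?V x"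
  using res_E_smult[OF o(1) oV Int_lower1 gr_closed[OF o(1)] x] gr_res[OF o(1) oV Int_lower1] by simp
 also have "\<dots> = \<zero>\<^bsub>sec E ?V\<^esub>"
  by (rule gr_smult_zero[OF oV _ res_E_closed[OF o(1) oV Int_lower1 x]]) blast
 also have "\<dots> = res E (W - C) ?V \<zero>\<^bsub>sec E (W - C)\<^esub>" by (rule res_E_zero[OF o(2) oV Int_lower2, symmetric])
 finally have c: "res E (W \<inter> U) ?V ?x = res E (W - C) ?V \<zero>\<^bsub>sec E (W - C)\<^esub>" .
 have "\<exists>z\<in>ME W. \<forall>b\<in>{True, False}. res E W (?U b) z = ?s b"
 proof (rule sheaf_glue[OF sheaf_E _ cover[OF W]])
  show "openin T (?U b)" for b using o by simp
  show "?s b : ME (?U b)" for b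
   using xc graded_group.grade_carrier[OF graded_E[OF o(2)] graded_group.grade_zero[OF graded_E[OF o(2)]]] by simp
  show "res E (?U b) (?U b \<inter> ?U b') (?s b) = res E (?U b') (?U b \<inter> ?U b') (?s b')" for b b'
   using c c[unfolded Int_commute[of "W \<inter> U" "W - C"]] by (cases b; cases b') simp_all
 qed
 then have "\<exists>z. z : ME W \<and> res E W (W \<inter> U) z = ?x \<and> res E W (W - C) z = \<zero>\<^bsub>sec E (W - C)\<^esub>"
  by auto
 from someI_ex[OF this, folded zext_def] show ?A ?B ?C by blast+
qed

lemma zext_eqI:
 assumes W: "openin T W" and x: "x : ME (W \<inter> U)" and z: "z : ME W"
  "res E W (W \<inter> U) z = gr (W \<inter> U) \<odot>\<^bsub>sec E (W \<inter> U)\<^esub> x" "res E W (W - C) z = \<zero>\<^bsub>sec E (W - C)\<^esub>"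
 shows "zext W x = z"
 by (rule cover_eqI[OF W zext(1)[OF W x] z(1)]) (simp_all add: zext[OF W x] z)

lemma additive_zext:
 assumes W: "openin T W" shows "addmap (sec E (W \<inter> U)) (sec E W) (zext W)"
proof (rule addmapI)
 note o = open_Int[OF W] open_diff[OF W]
 interpret W: abelian_group "sec E W" by (rule abelian_E[OF W])
 interpret V: abelian_group "sec E (W \<inter> U)" by (rule abelian_E[OF o(1)])
 interpret D: abelian_group "sec E (W - C)" by (rule abelian_E[OF o(2)])
 fix x y assume xy: "x : ME (W \<inter> U)" "y : ME (W \<inter> U)"
 note zc = zext(1)[OF W xy(1)] zext(1)[OF W xy(2)]
 show "zext W (x \<oplus>\<^bsub>sec E (W \<inter> U)\<^esub> y) = zext W x \<oplus>\<^bsub>sec E W\<^esub> zext W y"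
  by (rule zext_eqI[OF W V.a_closed[OF xy] W.a_closed[OF zc]])
   (simp_all add: addmap_add[OF additive_res_E[OF W o(1)] zc] addmap_add[OF additive_res_E[OF W o(2)] zc]
    zext[OF W xy(1)] zext[OF W xy(2)] supermodule.smult_r_distr[OF supermodule_E[OF o(1)] gr_closed[OF o(1)] xy])
qed (rule zext(1)[OF W])

text \<open>\<open>g\<close> is even and therefore commutes with \<open>f\<close>.\<close>

lemma zext_smult:
 assumes W: "openin T W" and f: "f : MO W" and x: "x : ME (W \<inter> U)"
 shows "zext W (res \<O> W (W \<inter> U) f \<odot>\<^bsub>sec E (W \<inter> U)\<^esub> x) = f \<odot>\<^bsub>sec E W\<^esub> zext W x"
proof -
 note o = open_Int[OF W] open_diff[OF W]
 interpret V: supermodule "sec \<O> (W \<inter> U)" "sec E (W \<inter> U)" by (rule supermodule_E[OF o(1)])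
 have fV: "res \<O> W (W \<inter> U) f : MO (W \<inter> U)" by (rule res_O_closed[OF W o(1) Int_lower1 f])
 note zc = zext(1)[OF W x]
 show ?thesis
 proof (rule zext_eqI[OF W V.smult_closed[OF fV x] smult_closed_E[OF W f zc]])
  show "res E W (W \<inter> U) (f \<odot>\<^bsub>sec E W\<^esub> zext W x) =
    gr (W \<inter> U) \<odot>\<^bsub>sec E (W \<inter> U)\<^esub> (res \<O> W (W \<inter> U) f \<odot>\<^bsub>sec E (W \<inter> U)\<^esub> x)"
   unfolding res_E_smult[OF W o(1) Int_lower1 f zc] zext(2)[OF W x]
    V.smult_assoc[OF fV gr_closed[OF o(1)] x, symmetric] V.smult_assoc[OF gr_closed[OF o(1)] fV x, symmetric]
    gr_commute[OF o(1) fV] ..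
  show "res E W (W - C) (f \<odot>\<^bsub>sec E W\<^esub> zext W x) = \<zero>\<^bsub>sec E (W - C)\<^esub>"
   unfolding res_E_smult[OF W o(2) Diff_subset f zc] zext(3)[OF W x]
   by (rule supermodule.smult_zero_right[OF supermodule_E[OF o(2)] res_O_closed[OF W o(2) Diff_subset f]])
 qed
qed

lemma zext_grade:
 assumes W: "openin T W" and x: "x : grade (sec E (W \<inter> U)) k"
 shows "zext W x : grade (sec E W) k"
proof -
 note o = open_Int[OF W] open_diff[OF W]
 have xc: "x : ME (W \<inter> U)" by (rule graded_group.grade_carrier[OF graded_E[OF o(1)] x])
 note g = supermodule.grade_smult[OF supermodule_E[OF o(1)] gr_even[OF o(1)] x]
 show ?thesis
 proof (rule grade_E_local[OF _ cover[OF W] zext(1)[OF W xc]])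
  show "openin T (if b then W \<inter> U else W - C)" for b using o by simp
  show "res E W (if b then W \<inter> U else W - C) (zext W x) : grade (sec E (if b then W \<inter> U else W - C)) k" for b
   using g graded_group.grade_zero[OF graded_E[OF o(2)], of k] zext(2,3)[OF W xc]
   by (cases b) (simp_all only: if_True if_False add_0_left)
 qed
qed

lemma zext_res:
 assumes W: "openin T W" and W': "openin T W'" "W' \<subseteq> W" and x: "x : ME (W \<inter> U)"
 shows "res E W W' (zext W x) = zext W' (res E (W \<inter> U) (W' \<inter> U) x)"
proof -
 note o = open_Int[OF W] open_diff[OF W] and o' = open_Int[OF W'(1)] open_diff[OF W'(1)]
 have s: "W' \<inter> U \<subseteq> W \<inter> U" "W' - C \<subseteq> W - C" "W' \<inter> U \<subseteq> W" "W' - C \<subseteq> W" using W'(2) by auto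
 note zc = zext(1)[OF W x]
 show ?thesis
 proof (rule zext_eqI[OF W'(1) res_E_closed[OF o(1) o'(1) s(1) x] res_E_closed[OF W W' zc], symmetric])
  have "res E W' (W' \<inter> U) (res E W W' (zext W x)) = res E (W \<inter> U) (W' \<inter> U) (res E W (W \<inter> U) (zext W x))"
   using res_E_res[OF W W'(1) o'(1) Int_lower1 W'(2) zc] res_E_res[OF W o(1) o'(1) s(1) Int_lower1 zc] by simp
  then show "res E W' (W' \<inter> U) (res E W W' (zext W x)) =
    gr (W' \<inter> U) \<odot>\<^bsub>sec E (W' \<inter> U)\<^esub> res E (W \<inter> U) (W' \<inter> U) x"
   unfolding zext(2)[OF W x] res_E_smult[OF o(1) o'(1) s(1) gr_closed[OF o(1)] x] gr_res[OF o(1) o'(1) s(1)] .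
  have "res E W' (W' - C) (res E W W' (zext W x)) = res E (W - C) (W' - C) (res E W (W - C) (zext W x))"
   using res_E_res[OF W W'(1) o'(2) Diff_subset W'(2) zc] res_E_res[OF W o(2) o'(2) s(2) Diff_subset zc] by simp
  then show "res E W' (W' - C) (res E W W' (zext W x)) = \<zero>\<^bsub>sec E (W' - C)\<^esub>"
   unfolding zext(3)[OF W x] res_E_zero[OF o(2) o'(2) s(2)] .
 qed
qed

lemma zext_restrict:
 assumes W: "openin T W" and e: "e : ME W"
 shows "zext W (res E W (W \<inter> U) e) = gr W \<odot>\<^bsub>sec E W\<^esub> e"
proof -
 note o = open_Int[OF W] open_diff[OF W]
 show ?thesis
 proof (rule zext_eqI[OF W res_E_closed[OF W o(1) Int_lower1 e] smult_closed_E[OF W gr_closed[OF W] e]])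
  show "res E W (W \<inter> U) (gr W \<odot>\<^bsub>sec E W\<^esub> e) = gr (W \<inter> U) \<odot>\<^bsub>sec E (W \<inter> U)\<^esub> res E W (W \<inter> U) e"
   unfolding res_E_smult[OF W o(1) Int_lower1 gr_closed[OF W] e] gr_res[OF W o(1) Int_lower1] ..
  show "res E W (W - C) (gr W \<odot>\<^bsub>sec E W\<^esub> e) = \<zero>\<^bsub>sec E (W - C)\<^esub>"
   unfolding res_E_smult[OF W o(2) Diff_subset gr_closed[OF W] e] gr_res[OF W o(2) Diff_subset]
   by (rule gr_smult_zero[OF o(2) _ res_E_closed[OF W o(2) Diff_subset e]]) blast
 qed
qed

end

section \<open>Gluing semilinear splittings\<close>

locale vector_bundle = sheaf_pair T P \<O> E + small_alg P pr
 for T :: "'x topology" and P :: "(real, 'p) gmodule" and pr and \<O> :: "('x, 'p, 'o) gsheaf"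
  and E :: "('x, 'o, 'e) gsheaf" +
 fixes \<kappa> :: "'x set \<Rightarrow> 'o \<Rightarrow> ('p, (real, 'o) tensor) tensor"
 assumes \<kappa>: "body_identification P pr T \<O> \<kappa>"
begin

lemma identified_module_sec:
 assumes U: "openin T U"
 shows "identified_module P pr (sec \<O> U) (\<kappa> U) (sec E U)"
proof (intro identified_module.intro identified.intro algebra_over.intro small_alg_axioms superalgebra_O[OF U]
  supermodule_E[OF U] identified_axioms.intro)
 note k = \<kappa>[unfolded body_identification_def algebra_sheaf_iso_def extend_alg_def body_def body_map_def gsheaf.simps]
 note k1 = conjunct2[OF conjunct1[OF k], rule_format, OF conjI[OF U openin_subset[OF U]]]
 show "algebra_hom P (sec \<O> U) (left_tensor real_alg P (left_tensor P (real_over pr) (sec \<O> U) (*)) (\<otimes>\<^bsub>P\<^esub>)) (\<kappa> U)"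
  "bij_betw (\<kappa> U) (MO U) (carrier (left_tensor real_alg P (left_tensor P (real_over pr) (sec \<O> U) (*)) (\<otimes>\<^bsub>P\<^esub>)))"
  by (rule conjunct1[OF k1], rule conjunct2[OF k1])
 show "tensor_map P (real_over pr) (left_tensor real_alg P (left_tensor P (real_over pr) (sec \<O> U) (*)) (\<otimes>\<^bsub>P\<^esub>)) id (\<kappa> U) f =
   pure_tensor P (real_over pr) (left_tensor real_alg P (left_tensor P (real_over pr) (sec \<O> U) (*)) (\<otimes>\<^bsub>P\<^esub>)) 1
    (pure_tensor real_alg P (left_tensor P (real_over pr) (sec \<O> U) (*)) \<one>\<^bsub>P\<^esub> f)"
  if "f : carrier (left_tensor P (real_over pr) (sec \<O> U) (*))" for f
  by (rule conjunct2[OF k, rule_format, OF U that])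
qed

lemma identified_sec: "openin T U ==> identified P pr (sec \<O> U) (\<kappa> U)"
 using identified_module_sec by (simp add: identified_module_def)

lemma identified_hom_res:
 assumes "openin T U" "openin T V" "V \<subseteq> U"
 shows "identified_hom P pr (sec \<O> U) (\<kappa> U) (sec \<O> V) (\<kappa> V) (res \<O> U V)"
proof (intro identified_hom.intro identified_sec assms identified_hom_axioms.intro hom_O)
 fix f assume "f : MO U"
 then have "\<kappa> V (res \<O> U V f) = res (extend_alg P (body P pr \<O>)) U V (\<kappa> U f)"
  by (rule conjunct1[OF conjunct1[OF \<kappa>[unfolded body_identification_def algebra_sheaf_iso_def]],
    unfolded commutes_with_res_def, rule_format, OF conjI[OF assms(1) conjI[OF assms(2) conjI[OF assms(3) openin_subset[OF assms(1)]]]]])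
 then show "\<kappa> V (res \<O> U V f) = tensor_map real_alg P (left_tensor P (real_over pr) (sec \<O> V) (*)) id
   (tensor_map P (real_over pr) (sec \<O> V) id (res \<O> U V)) (\<kappa> U f)"
  unfolding extend_alg_def body_def gsheaf.simps .
qed

lemma identified_module_hom_res:
 assumes "openin T U" "openin T V" "V \<subseteq> U"
 shows "identified_module_hom P pr (sec \<O> U) (\<kappa> U) (sec \<O> V) (\<kappa> V) (res \<O> U V) (sec E U) (sec E V) (res E U V)"
 by (intro identified_module_hom.intro identified_hom_res identified_module_sec assms
   identified_module_hom_axioms.intro additive_res_E res_E_smult)

abbreviation tau where "tau U \<equiv> identified.\<tau> P pr (sec \<O> U) (\<kappa> U)"
abbreviation iota where "iota U \<equiv> identified_module.\<iota> (sec \<O> U)"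
abbreviation act where "act U \<equiv> identified_module.pact (sec \<O> U) (sec E U)"
abbreviation nsp where "nsp U \<equiv> nspan nil (sec E U) (act U)"

lemma tau_closed: "[|openin T U; f : MO U|] ==> tau U f : MO U"
 by (rule identified.\<tau>_closed[OF identified_sec])

lemma tau_res: "[|openin T U; openin T V; V \<subseteq> U; f : MO U|] ==> tau V (res \<O> U V f) = res \<O> U V (tau U f)"
 by (rule identified_hom.\<tau>_natural[OF identified_hom_res])

lemma iota_closed: "[|openin T U; r : carrier P|] ==> iota U r : MO U"
 by (rule identified_module.\<iota>_closed[OF identified_module_sec])

lemma iota_res: "[|openin T U; openin T V; V \<subseteq> U; r : carrier P|] ==> res \<O> U V (iota U r) = iota V r"
 by (rule identified_module_hom.h_\<iota>[OF identified_module_hom_res])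

lemma act_def: "openin T U ==> act U r e = iota U r \<odot>\<^bsub>sec E U\<^esub> e"
 by (rule identified_module.pact_def[OF identified_module_sec])

lemma act_closed: "[|openin T U; r : carrier P; e : ME U|] ==> act U r e : ME U"
 by (rule identified_module.pact_closed[OF identified_module_sec])

lemma act_nil: "[|openin T U; r : nil; e : ME U|] ==> act U r e : ME U"
 by (rule act_closed[OF _ nil_carrier])

lemma additive_act: "[|openin T U; r : carrier P|] ==> addmap (sec E U) (sec E U) (act U r)"
 by (rule identified_module.additive_pact[OF identified_module_sec])

lemma act_res: "[|openin T U; openin T V; V \<subseteq> U; r : carrier P; e : ME U|] ==>
  res E U V (act U r e) = act V r (res E U V e)"
 by (rule identified_module_hom.k_pact[OF identified_module_hom_res])

lemma nsp_closed: "[|openin T U; x : nsp U|] ==> x : ME U"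
 by (rule nspan_closed[OF abelian_E act_nil])

lemma nsp_add: "[|openin T U; x : nsp U; y : nsp U|] ==> x \<oplus>\<^bsub>sec E U\<^esub> y : nsp U"
 by (rule nspan_add[OF abelian_E act_nil])

lemma nsp_act: "[|openin T U; r : nil; x : ME U|] ==> act U r x : nsp U"
 using nspan_act[where act = "act U", OF abelian_E act_nil] by blast

lemma nsp_smult: "[|openin T U; f : MO U; x : nsp U|] ==> f \<odot>\<^bsub>sec E U\<^esub> x : nsp U"
 by (rule identified_module.nspan_smult[OF identified_module_sec])

lemma free_identified_sec:
 assumes "module_sheaf_iso T U \<O> E (free_sheaf p q \<O>) \<psi>" "openin T V" "V \<subseteq> U"
 shows "free_identified P pr (sec \<O> V) (\<kappa> V) (sec E V) p q (\<psi> V)"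
 using assms(1) unfolding module_sheaf_iso_def
 by (intro free_identified.intro identified_module_sec free_identified_axioms.intro)
  (use assms(2,3) in \<open>simp_all add: free_sheaf_def\<close>)

abbreviation S0 where "S0 p q \<psi> V \<equiv> free_identified.S0 P pr (sec \<O> V) (\<kappa> V) (sec E V) p q (\<psi> V)"

text \<open>Coordinates commute with restriction because \<open>\<psi>\<close> does, and
  \<open>\<tau>\<close> does by the naturality of \<open>\<kappa>\<close>.\<close>

lemma S0_res:
 assumes \<psi>: "module_sheaf_iso T U \<O> E (free_sheaf p q \<O>) \<psi>"
  and V: "openin T V" "V \<subseteq> U" and W: "openin T W" "W \<subseteq> V" and e: "e : ME V"
 shows "res E V W (S0 p q \<psi> V e) = S0 p q \<psi> W (res E V W e)"
proof -
 have WU: "W \<subseteq> U" using V W by blast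
 interpret V: free_identified P pr "sec \<O> V" "\<kappa> V" "sec E V" p q "\<psi> V" by (rule free_identified_sec[OF \<psi> V])
 interpret W: free_identified P pr "sec \<O> W" "\<kappa> W" "sec E W" p q "\<psi> W" by (rule free_identified_sec[OF \<psi> W(1) WU])
 have c: "\<psi> W (res E V W x) l = res \<O> V W (\<psi> V x l)" if "x : ME V" "l < p + q" for x l
  using \<psi> V W that unfolding module_sheaf_iso_def commutes_with_res_def by (simp add: free_sheaf_def)
 note re = res_E_closed[OF V(1) W e]
 show ?thesis
 proof (rule W.coord_eqI[OF res_E_closed[OF V(1) W V.S0_closed[OF e]] W.S0_closed[OF re]])
  fix l assume l: "l < p + q"
  show "\<psi> W (res E V W (S0 p q \<psi> V e)) l = \<psi> W (S0 p q \<psi> W (res E V W e)) l"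
   unfolding c[OF V.S0_closed[OF e] l] V.coord_S0[OF e l] W.coord_S0[OF re l] c[OF e l]
   by (rule tau_res[OF V(1) W V.coord_closed[OF e l], symmetric])
 qed
qed

end

section \<open>The operator patched together from countably many charts\<close>

locale patched_bundle = vector_bundle T P pr \<O> E \<kappa>
 for T :: "'x topology" and P :: "(real, 'p) gmodule" and pr and \<O> :: "('x, 'p, 'o) gsheaf"
  and E :: "('x, 'o, 'e) gsheaf" and \<kappa> +
 fixes p q :: nat and \<psi> :: "nat \<Rightarrow> 'x set \<Rightarrow> 'e \<Rightarrow> nat \<Rightarrow> 'o" and g :: "nat \<Rightarrow> 'o" and U C V :: "nat \<Rightarrow> 'x set"
 assumes cutoff: "cutoff T P \<O> E (g n) (U n) (C n)"
  and trivial: "module_sheaf_iso T (U n) \<O> E (free_sheaf p q \<O>) (\<psi> n)"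
  and V: "openin T (V n)" "V n \<subseteq> U n" "(\<Union>n. V n) = topspace T"
  and g_one: "res \<O> (topspace T) (V n) (g n) = \<one>\<^bsub>sec \<O> (V n)\<^esub>"
begin

abbreviation gn where "gn n W \<equiv> res \<O> \<Omega> W (g n)"

lemmas gn_even = cutoff.gr_even[OF cutoff]
lemmas gn_closed = cutoff.gr_closed[OF cutoff]
lemmas gn_res = cutoff.gr_res[OF cutoff]
lemmas WU = cutoff.open_Int[OF cutoff]

lemma free_sec: "[|openin T W; W \<subseteq> U n|] ==> free_identified P pr (sec \<O> W) (\<kappa> W) (sec E W) p q (\<psi> n W)"
 by (rule free_identified_sec[OF trivial])

lemma splitting_sec: "[|openin T W; W \<subseteq> U n|] ==> splitting P pr (sec \<O> W) (\<kappa> W) (sec E W) (S0 p q (\<psi> n) W)"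
 by (rule free_identified.splitting_S0[OF free_sec])

definition L where
 "L n W e = cutoff.zext T \<O> E (g n) (U n) (C n) W (S0 p q (\<psi> n) (W \<inter> U n) (res E W (W \<inter> U n) e))"

lemma additive_L: assumes W: "openin T W" shows "addmap (sec E W) (sec E W) (L n W)"
 unfolding L_def
 by (rule addmap_comp[OF addmap_comp[OF additive_res_E[OF W WU[OF W] Int_lower1]
    splitting.additive_S[OF splitting_sec[OF WU[OF W] Int_lower2]]] cutoff.additive_zext[OF cutoff W]])

lemma L_smult:
 assumes W: "openin T W" and f: "f : MO W" and e: "e : ME W"
 shows "L n W (f \<odot>\<^bsub>sec E W\<^esub> e) = tau W f \<odot>\<^bsub>sec E W\<^esub> L n W e"
proof -
 note S = splitting_sec[OF WU[OF W] Int_lower2, of n]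
 note r = WU[OF W, of n] Int_lower1[of W "U n"]
 show ?thesis
  unfolding L_def res_E_smult[OF W r f e] splitting.S_smult[OF S res_O_closed[OF W r f] res_E_closed[OF W r e]] tau_res[OF W r f]
  by (rule cutoff.zext_smult[OF cutoff W tau_closed[OF W f] splitting.S_closed[OF S res_E_closed[OF W r e]]])
qed

lemma L_grade: assumes W: "openin T W" and e: "e : grade (sec E W) k" shows "L n W e : grade (sec E W) k"
 unfolding L_def
 by (rule cutoff.zext_grade[OF cutoff W free_identified.S0_grade[OF free_sec[OF WU[OF W] Int_lower2]
    res_E_grade[OF W WU[OF W] Int_lower1 e]]])

lemma L_res:
 assumes W: "openin T W" and W': "openin T W'" "W' \<subseteq> W" and e: "e : ME W"
 shows "res E W W' (L n W e) = L n W' (res E W W' e)"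
proof -
 have s: "W' \<inter> U n \<subseteq> W \<inter> U n" "W' \<inter> U n \<subseteq> W" using W'(2) by auto
 note o = WU[OF W, of n] WU[OF W'(1), of n]
 note re = res_E_closed[OF W o(1) Int_lower1 e]
 show ?thesis
  unfolding L_def cutoff.zext_res[OF cutoff W W' splitting.S_closed[OF splitting_sec[OF o(1) Int_lower2] re]]
   S0_res[OF trivial o(1) Int_lower2 o(2) s(1) re] res_E_res[OF W o(1) o(2) s(1) Int_lower1 e]
   res_E_res[OF W W'(1) o(2) Int_lower1 W'(2) e] ..
qed

text \<open>The difference is the extension by zero of \<open>e - S0 e\<close> from
  \<open>W \<inter> U n\<close>. A finite sum that represents the latter in \<open>nil E\<close>
  extends term by term, because extension by zero commutes with the scalars from
  \<open>P\<close>.\<close>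

lemma L_near:
 assumes W: "openin T W" and e: "e : ME W"
 shows "gn n W \<odot>\<^bsub>sec E W\<^esub> e \<ominus>\<^bsub>sec E W\<^esub> L n W e : nsp W"
proof -
 note o = WU[OF W, of n]
 note re = res_E_closed[OF W o Int_lower1 e]
 note S = splitting_sec[OF o Int_lower2]
 let ?z = "cutoff.zext T \<O> E (g n) (U n) (C n) W"
 let ?d = "res E W (W \<inter> U n) e \<ominus>\<^bsub>sec E (W \<inter> U n)\<^esub> S0 p q (\<psi> n) (W \<inter> U n) (res E W (W \<inter> U n) e)"
 have "?z ?d : nsp W"
 proof (rule nspan_image[OF abelian_E[OF o] abelian_E[OF W] act_nil[OF o] act_nil[OF W]
    cutoff.additive_zext[OF cutoff W] _ splitting.S_near[OF S re]])
  fix r x assume r: "r : nil" and x: "x : ME (W \<inter> U n)"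
  note rc = nil_carrier[OF r]
  have "?z (act (W \<inter> U n) r x) = act W r (?z x)"
   unfolding act_def[OF o] act_def[OF W] iota_res[OF W o Int_lower1 rc, symmetric]
   by (rule cutoff.zext_smult[OF cutoff W iota_closed[OF W rc] x])
  then show "?z (act (W \<inter> U n) r x) : nsp W"
   using nsp_act[OF W r cutoff.zext(1)[OF cutoff W x]] by simp
 qed
 also have "?z ?d = gn n W \<odot>\<^bsub>sec E W\<^esub> e \<ominus>\<^bsub>sec E W\<^esub> L n W e"
  unfolding L_def addmap_minus[OF cutoff.additive_zext[OF cutoff W] abelian_E[OF o] abelian_E[OF W] re
    splitting.S_closed[OF S re]] cutoff.zext_restrict[OF cutoff W e] ..
 finally show ?thesis .
qed

text \<open>The weight that is left after the first \<open>n\<close> patches. In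
  \<open>approx\<close> patch \<open>n\<close> then receives the share \<open>cut n\<close> times
  \<open>g n\<close>, the factor \<open>g n\<close> being contained in \<open>L n\<close>.\<close>

primrec cut where
 "cut 0 W = \<one>\<^bsub>sec \<O> W\<^esub>"
| "cut (Suc n) W = cut n W \<otimes>\<^bsub>sec \<O> W\<^esub> (\<one>\<^bsub>sec \<O> W\<^esub> \<ominus>\<^bsub>sec \<O> W\<^esub> gn n W)"

primrec approx where
 "approx 0 W e = \<zero>\<^bsub>sec E W\<^esub>"
| "approx (Suc n) W e = approx n W e \<oplus>\<^bsub>sec E W\<^esub> cut n W \<odot>\<^bsub>sec E W\<^esub> L n W e"

lemma cut_even: assumes W: "openin T W" shows "cut n W : grade (sec \<O> W) 0"
proof (induction n)
 interpret R: superring "sec \<O> W" by (rule superring_O[OF W])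
 interpret G: graded_group "sec \<O> W" by (rule graded_O[OF W])
 case 0
 show ?case by (simp add: R.one_even)
next
 interpret R: superring "sec \<O> W" by (rule superring_O[OF W])
 interpret G: graded_group "sec \<O> W" by (rule graded_O[OF W])
 case (Suc n)
 have "\<one>\<^bsub>sec \<O> W\<^esub> \<ominus>\<^bsub>sec \<O> W\<^esub> gn n W : grade (sec \<O> W) 0"
  unfolding a_minus_def by (intro G.grade_add G.grade_neg R.one_even gn_even W)
 from R.grade_mult[OF Suc this] show ?case by (simp only: cut.simps add_0_left)
qed

lemma cut_closed: "openin T W ==> cut n W : MO W"
 by (rule graded_group.grade_carrier[OF graded_O cut_even])

lemma cut_res:
 assumes W: "openin T W" and W': "openin T W'" "W' \<subseteq> W"
 shows "res \<O> W W' (cut n W) = cut n W'"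
proof (induction n)
 case 0
 show ?case by (simp add: res_O_one[OF W W'])
next
 case (Suc n)
 interpret R: superring "sec \<O> W" by (rule superring_O[OF W])
 have c: "\<one>\<^bsub>sec \<O> W\<^esub> \<ominus>\<^bsub>sec \<O> W\<^esub> gn n W : MO W" using gn_closed[OF W] by simp
 show ?case
  unfolding cut.simps res_O_mult[OF W W' cut_closed[OF W] c] Suc
   addmap_minus[OF additive_res_O[OF W W'] abelian_O[OF W] abelian_O[OF W'(1)] R.one_closed gn_closed[OF W]]
   res_O_one[OF W W'] gn_res[OF W W'] ..
qed

text \<open>The factor \<open>1 - g k\<close> is zero on \<open>V k\<close>, and it is the one added
  in passing from \<open>cut k\<close> to \<open>cut (Suc k)\<close>.\<close>

lemma cut_vanish:
 assumes W: "openin T W" "W \<subseteq> V k" and n: "k < n"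
 shows "cut n W = \<zero>\<^bsub>sec \<O> W\<^esub>"
proof -
 interpret R: superring "sec \<O> W" by (rule superring_O[OF W(1)])
 from n have "Suc k \<le> n" by simp
 then show ?thesis
 proof (induction n rule: dec_induct)
  case base
  have "gn k W = res \<O> (V k) W (gn k (V k))" by (rule gn_res[OF V(1) W, symmetric])
  also have "\<dots> = \<one>\<^bsub>sec \<O> W\<^esub>" unfolding g_one by (rule res_O_one[OF V(1) W])
  finally show ?case using cut_closed[OF W(1), of k] by (simp add: a_minus_def R.r_neg)
 next
  case (step n)
  then show ?case using gn_closed[OF W(1)] by simp
 qed
qed

lemma approx_closed: "[|openin T W; e : ME W|] ==> approx n W e : ME W"
proof (induction n)
 case 0
 then show ?case by (simp add: graded_group.grade_carrier[OF graded_E graded_group.grade_zero[OF graded_E]])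
next
 case (Suc n)
 interpret M: abelian_group "sec E W" by (rule abelian_E[OF Suc.prems(1)])
 show ?case
  using Suc by (simp add: smult_closed_E cut_closed addmap_closed[OF additive_L])
qed

lemma additive_approx: assumes W: "openin T W" shows "addmap (sec E W) (sec E W) (approx n W)"
proof (induction n)
 interpret M: supermodule "sec \<O> W" "sec E W" by (rule supermodule_E[OF W])
 case 0
 show ?case by (rule addmapI) simp_all
next
 interpret M: supermodule "sec \<O> W" "sec E W" by (rule supermodule_E[OF W])
 case (Suc n)
 show ?case
  unfolding approx.simps
  by (rule addmap_pointwise_add[OF Suc addmap_comp[OF additive_L[OF W] M.additive_smult[OF cut_closed[OF W]]] abelian_E[OF W]])
qed

text \<open>The weights \<open>cut n\<close> are even and so can be exchanged with
  \<open>tau W f\<close>.\<close>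

lemma approx_smult:
 assumes W: "openin T W" and f: "f : MO W" and e: "e : ME W"
 shows "approx n W (f \<odot>\<^bsub>sec E W\<^esub> e) = tau W f \<odot>\<^bsub>sec E W\<^esub> approx n W e"
proof (induction n)
 interpret M: supermodule "sec \<O> W" "sec E W" by (rule supermodule_E[OF W])
 case 0
 show ?case by (simp add: M.smult_zero_right tau_closed W f)
next
 interpret M: supermodule "sec \<O> W" "sec E W" by (rule supermodule_E[OF W])
 case (Suc n)
 note t = tau_closed[OF W f] and Lc = addmap_closed[OF additive_L[OF W] e, of n] and c = cut_closed[OF W, of n]
 have "cut n W \<odot>\<^bsub>sec E W\<^esub> (tau W f \<odot>\<^bsub>sec E W\<^esub> L n W e) = tau W f \<odot>\<^bsub>sec E W\<^esub> (cut n W \<odot>\<^bsub>sec E W\<^esub> L n W e)"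
  unfolding M.smult_assoc[OF t c Lc, symmetric] M.smult_assoc[OF c t Lc, symmetric]
   superring.even_commute[OF superring_O[OF W] cut_even[OF W] t] ..
 then show ?case
  unfolding approx.simps Suc L_smult[OF W f e]
  using M.smult_r_distr[OF t approx_closed[OF W e, of n] M.smult_closed[OF c Lc]] by simp
qed

lemma approx_grade:
 assumes W: "openin T W" and e: "e : grade (sec E W) k" shows "approx n W e : grade (sec E W) k"
proof (induction n)
 case 0
 show ?case by (simp add: graded_group.grade_zero[OF graded_E[OF W]])
next
 case (Suc n)
 have "cut n W \<odot>\<^bsub>sec E W\<^esub> L n W e : grade (sec E W) k"
  using supermodule.grade_smult[OF supermodule_E[OF W] cut_even[OF W] L_grade[OF W e]] by (simp only: add_0_left)
 from graded_group.grade_add[OF graded_E[OF W] Suc this] show ?case by simp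
qed

lemma approx_res:
 assumes W: "openin T W" and W': "openin T W'" "W' \<subseteq> W" and e: "e : ME W"
 shows "res E W W' (approx n W e) = approx n W' (res E W W' e)"
proof (induction n)
 case 0
 show ?case by (simp add: res_E_zero[OF W W'])
next
 case (Suc n)
 note Lc = addmap_closed[OF additive_L[OF W] e, of n]
 show ?case
  unfolding approx.simps addmap_add[OF additive_res_E[OF W W'] approx_closed[OF W e] smult_closed_E[OF W cut_closed[OF W] Lc]]
   res_E_smult[OF W W' cut_closed[OF W] Lc] Suc cut_res[OF W W'] L_res[OF W W' e] ..
qed

text \<open>A telescoping sum: the difference of \<open>cut n\<close> and \<open>cut (Suc n)\<close>
  is \<open>cut n\<close> times \<open>g n\<close>, and each \<open>g n e - L n e\<close> lies in
  \<open>nil E\<close>. Wherever the remaining weight is zero, this says that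
  \<open>approx n e\<close> equals \<open>e\<close> modulo \<open>nil E\<close>.\<close>

lemma approx_near:
 assumes W: "openin T W" and e: "e : ME W"
 shows "(e \<ominus>\<^bsub>sec E W\<^esub> approx n W e) \<ominus>\<^bsub>sec E W\<^esub> cut n W \<odot>\<^bsub>sec E W\<^esub> e : nsp W"
proof (induction n)
 interpret M: supermodule "sec \<O> W" "sec E W" by (rule supermodule_E[OF W])
 case 0
 have "(e \<ominus>\<^bsub>sec E W\<^esub> \<zero>\<^bsub>sec E W\<^esub>) \<ominus>\<^bsub>sec E W\<^esub> \<one>\<^bsub>sec \<O> W\<^esub> \<odot>\<^bsub>sec E W\<^esub> e = \<zero>\<^bsub>sec E W\<^esub>"
  using e by (simp add: M.smult_one a_minus_def M.M.r_neg
    M.M.minus_equality[OF M.M.l_zero[OF M.M.zero_closed] M.M.zero_closed M.M.zero_closed])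
 then show ?case by (simp add: nspan.zero)
next
 interpret M: supermodule "sec \<O> W" "sec E W" by (rule supermodule_E[OF W])
 case (Suc n)
 note c = cut_closed[OF W, of n] and G = gn_closed[OF W, of n]
 note Tc = approx_closed[OF W e, of n] and Lc = addmap_closed[OF additive_L[OF W] e, of n]
 note ge = M.smult_closed[OF G e]
 note cl = M.smult_closed[OF c e] M.smult_closed[OF c Lc] M.smult_closed[OF c ge]
 have 1: "cut n W \<odot>\<^bsub>sec E W\<^esub> (gn n W \<odot>\<^bsub>sec E W\<^esub> e \<ominus>\<^bsub>sec E W\<^esub> L n W e) =
   cut n W \<odot>\<^bsub>sec E W\<^esub> (gn n W \<odot>\<^bsub>sec E W\<^esub> e) \<ominus>\<^bsub>sec E W\<^esub> cut n W \<odot>\<^bsub>sec E W\<^esub> L n W e"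
  by (rule addmap_minus[OF M.additive_smult[OF c] abelian_E[OF W] abelian_E[OF W] ge Lc])
 have "cut (Suc n) W \<odot>\<^bsub>sec E W\<^esub> e = cut n W \<odot>\<^bsub>sec E W\<^esub> ((\<one>\<^bsub>sec \<O> W\<^esub> \<ominus>\<^bsub>sec \<O> W\<^esub> gn n W) \<odot>\<^bsub>sec E W\<^esub> e)"
  using M.smult_assoc[OF c _ e, of "\<one>\<^bsub>sec \<O> W\<^esub> \<ominus>\<^bsub>sec \<O> W\<^esub> gn n W"] G by simp
 also have "(\<one>\<^bsub>sec \<O> W\<^esub> \<ominus>\<^bsub>sec \<O> W\<^esub> gn n W) \<odot>\<^bsub>sec E W\<^esub> e = e \<ominus>\<^bsub>sec E W\<^esub> gn n W \<odot>\<^bsub>sec E W\<^esub> e"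
  using addmap_minus[OF M.additive_smult_left[OF e] abelian_O[OF W] abelian_E[OF W] M.R.one_closed G] M.smult_one[OF e] by simp
 also have "cut n W \<odot>\<^bsub>sec E W\<^esub> \<dots> = cut n W \<odot>\<^bsub>sec E W\<^esub> e \<ominus>\<^bsub>sec E W\<^esub> cut n W \<odot>\<^bsub>sec E W\<^esub> (gn n W \<odot>\<^bsub>sec E W\<^esub> e)"
  by (rule addmap_minus[OF M.additive_smult[OF c] abelian_E[OF W] abelian_E[OF W] e ge])
 finally have 2: "cut (Suc n) W \<odot>\<^bsub>sec E W\<^esub> e =
   cut n W \<odot>\<^bsub>sec E W\<^esub> e \<ominus>\<^bsub>sec E W\<^esub> cut n W \<odot>\<^bsub>sec E W\<^esub> (gn n W \<odot>\<^bsub>sec E W\<^esub> e)" .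
 have "(e \<ominus>\<^bsub>sec E W\<^esub> approx (Suc n) W e) \<ominus>\<^bsub>sec E W\<^esub> cut (Suc n) W \<odot>\<^bsub>sec E W\<^esub> e =
   ((e \<ominus>\<^bsub>sec E W\<^esub> approx n W e) \<ominus>\<^bsub>sec E W\<^esub> cut n W \<odot>\<^bsub>sec E W\<^esub> e) \<oplus>\<^bsub>sec E W\<^esub>
   cut n W \<odot>\<^bsub>sec E W\<^esub> (gn n W \<odot>\<^bsub>sec E W\<^esub> e \<ominus>\<^bsub>sec E W\<^esub> L n W e)"
  unfolding 1 2 approx.simps using e Tc cl by (simp add: a_minus_def M.M.minus_add M.M.a_ac)
 then show ?case using nsp_add[OF W Suc nsp_smult[OF W c L_near[OF W e]]] by simp
qed

lemma approx_stable:
 assumes W: "openin T W" "W \<subseteq> V k" and e: "e : ME W" and n: "k < n"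
 shows "approx n W e = approx (Suc k) W e"
proof -
 interpret M: supermodule "sec \<O> W" "sec E W" by (rule supermodule_E[OF W(1)])
 from n have "Suc k \<le> n" by simp
 then show ?thesis
 proof (induction n rule: dec_induct)
  case base
  show ?case ..
 next
  case (step n)
  have "cut n W \<odot>\<^bsub>sec E W\<^esub> L n W e = \<zero>\<^bsub>sec E W\<^esub>"
   using cut_vanish[OF W, of n] step(1) M.smult_zero_left addmap_closed[OF additive_L[OF W(1)] e] by simp
  then show ?case using step(3) approx_closed[OF W(1) e] by (simp del: approx.simps add: approx.simps(2)[of n])
 qed
qed

text \<open>On \<open>V k\<close> the partial sums are stationary from stage \<open>Suc k\<close>
  on, the first that contains the term of patch \<open>k\<close> itself. This stage fixes
  \<open>S\<close> there.\<close>

definition S where "S W e = (SOME z. z : ME W \<and>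
  (\<forall>k. res E W (W \<inter> V k) z = approx (Suc k) (W \<inter> V k) (res E W (W \<inter> V k) e)))"

lemma WV: "openin T W ==> openin T (W \<inter> V k)"
 by (rule openin_Int[OF _ V(1)])

lemma V_cover:
 assumes "openin T W" shows "W = (\<Union>k\<in>UNIV. W \<inter> V k)"
proof -
 have "W \<subseteq> (\<Union>n. V n)" unfolding V(3) by (rule openin_subset[OF assms])
 then show ?thesis by blast
qed

lemma cover_eqI_E:
 assumes W: "openin T W" "x : ME W" "y : ME W"
  "\<And>k. res E W (W \<inter> V k) x = res E W (W \<inter> V k) y"
 shows "x = y"
 by (rule sheaf_eqI[OF sheaf_E WV[OF W(1)] V_cover[OF W(1)] W(2,3) W(4)])

lemma S_ex:
 assumes W: "openin T W" and e: "e : ME W"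
 shows "S W e : ME W" (is ?A)
  "res E W (W \<inter> V k) (S W e) = approx (Suc k) (W \<inter> V k) (res E W (W \<inter> V k) e)" (is "?B k")
proof -
 have "\<exists>z\<in>ME W. \<forall>k\<in>UNIV. res E W (W \<inter> V k) z = approx (Suc k) (W \<inter> V k) (res E W (W \<inter> V k) e)"
 proof (rule sheaf_glue[OF sheaf_E WV[OF W] V_cover[OF W]])
  note re = res_E_closed[OF W WV[OF W] Int_lower1 e]
  show "approx (Suc k) (W \<inter> V k) (res E W (W \<inter> V k) e) : ME (W \<inter> V k)" for k
   by (rule approx_closed[OF WV[OF W] re])
  fix k l
  let ?D = "(W \<inter> V k) \<inter> (W \<inter> V l)"
  have D: "openin T ?D" "?D \<subseteq> W" "?D \<subseteq> V k" "?D \<subseteq> V l" using WV[OF W] by auto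
  note rD = res_E_closed[OF W D(1,2) e]
  \<comment> \<open>Both local values are compared with the common later stage
    \<open>Suc (max k l)\<close>.\<close>
  have "approx (Suc k) ?D (res E W ?D e) = approx (Suc (max k l)) ?D (res E W ?D e)"
   by (rule approx_stable[OF D(1,3) rD, symmetric]) simp
  also have "\<dots> = approx (Suc l) ?D (res E W ?D e)"
   by (rule approx_stable[OF D(1,4) rD]) simp
  finally show "res E (W \<inter> V k) ?D (approx (Suc k) (W \<inter> V k) (res E W (W \<inter> V k) e)) =
    res E (W \<inter> V l) ?D (approx (Suc l) (W \<inter> V l) (res E W (W \<inter> V l) e))"
   unfolding approx_res[OF WV[OF W] D(1) Int_lower1 re] approx_res[OF WV[OF W] D(1) Int_lower2 re]
    res_E_res[OF W WV[OF W] D(1) Int_lower1 Int_lower1 e] res_E_res[OF W WV[OF W] D(1) Int_lower2 Int_lower1 e] .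
 qed
 then have "\<exists>z. z : ME W \<and> (\<forall>k. res E W (W \<inter> V k) z = approx (Suc k) (W \<inter> V k) (res E W (W \<inter> V k) e))"
  by blast
 from someI_ex[OF this, folded S_def] show ?A "?B k" by blast+
qed

lemma S_local:
 assumes W: "openin T W" "W \<subseteq> V k" and e: "e : ME W"
 shows "S W e = approx (Suc k) W e"
proof -
 have "W \<inter> V k = W" using W(2) by blast
 then show ?thesis
  using S_ex(2)[OF W(1) e, of k] sheaf_res_id[OF sheaf_E W(1) e] sheaf_res_id[OF sheaf_E W(1) S_ex(1)[OF W(1) e]] by simp
qed

lemma S_res:
 assumes W: "openin T W" and W': "openin T W'" "W' \<subseteq> W" and e: "e : ME W"
 shows "res E W W' (S W e) = S W' (res E W W' e)"
proof (rule cover_eqI_E[OF W'(1) res_E_closed[OF W W' S_ex(1)[OF W e]] S_ex(1)[OF W'(1) res_E_closed[OF W W' e]]])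
 fix k
 have s: "W' \<inter> V k \<subseteq> W \<inter> V k" "W' \<inter> V k \<subseteq> W" using W'(2) by auto
 note o = WV[OF W, of k] WV[OF W'(1), of k]
 have "res E W' (W' \<inter> V k) (res E W W' (S W e)) = res E (W \<inter> V k) (W' \<inter> V k) (res E W (W \<inter> V k) (S W e))"
  unfolding res_E_res[OF W W'(1) o(2) Int_lower1 W'(2) S_ex(1)[OF W e]] res_E_res[OF W o(1,2) s(1) Int_lower1 S_ex(1)[OF W e]] ..
 also have "\<dots> = res E W' (W' \<inter> V k) (S W' (res E W W' e))"
  unfolding S_ex(2)[OF W e] S_ex(2)[OF W'(1) res_E_closed[OF W W' e]]
   approx_res[OF o(1,2) s(1) res_E_closed[OF W o(1) Int_lower1 e]]
   res_E_res[OF W W'(1) o(2) Int_lower1 W'(2) e] res_E_res[OF W o(1,2) s(1) Int_lower1 e] ..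
 finally show "res E W' (W' \<inter> V k) (res E W W' (S W e)) = res E W' (W' \<inter> V k) (S W' (res E W W' e))" .
qed

lemma additive_S: assumes W: "openin T W" shows "addmap (sec E W) (sec E W) (S W)"
proof (rule addmapI)
 interpret M: abelian_group "sec E W" by (rule abelian_E[OF W])
 fix x y assume xy: "x : ME W" "y : ME W"
 show "S W (x \<oplus>\<^bsub>sec E W\<^esub> y) = S W x \<oplus>\<^bsub>sec E W\<^esub> S W y"
 proof (rule cover_eqI_E[OF W S_ex(1)[OF W M.a_closed[OF xy]] M.a_closed[OF S_ex(1)[OF W xy(1)] S_ex(1)[OF W xy(2)]]])
  fix k
  note r = WV[OF W, of k] Int_lower1[of W "V k"]
  note a = additive_res_E[OF W r]
  show "res E W (W \<inter> V k) (S W (x \<oplus>\<^bsub>sec E W\<^esub> y)) = res E W (W \<inter> V k) (S W x \<oplus>\<^bsub>sec E W\<^esub> S W y)"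
   unfolding S_ex(2)[OF W M.a_closed[OF xy]] addmap_add[OF a S_ex(1)[OF W xy(1)] S_ex(1)[OF W xy(2)]]
    S_ex(2)[OF W xy(1)] S_ex(2)[OF W xy(2)] addmap_add[OF a xy]
   by (rule addmap_add[OF additive_approx[OF r(1)] res_E_closed[OF W r xy(1)] res_E_closed[OF W r xy(2)]])
 qed
qed (rule S_ex(1)[OF W])

lemma S_smult:
 assumes W: "openin T W" and f: "f : MO W" and e: "e : ME W"
 shows "S W (f \<odot>\<^bsub>sec E W\<^esub> e) = tau W f \<odot>\<^bsub>sec E W\<^esub> S W e"
proof (rule cover_eqI_E[OF W S_ex(1)[OF W smult_closed_E[OF W f e]] smult_closed_E[OF W tau_closed[OF W f] S_ex(1)[OF W e]]])
 fix k
 note r = WV[OF W, of k] Int_lower1[of W "V k"]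
 show "res E W (W \<inter> V k) (S W (f \<odot>\<^bsub>sec E W\<^esub> e)) = res E W (W \<inter> V k) (tau W f \<odot>\<^bsub>sec E W\<^esub> S W e)"
  unfolding S_ex(2)[OF W smult_closed_E[OF W f e]] res_E_smult[OF W r tau_closed[OF W f] S_ex(1)[OF W e]]
   S_ex(2)[OF W e] res_E_smult[OF W r f e] tau_res[OF W r f, symmetric]
  by (rule approx_smult[OF r(1) res_O_closed[OF W r f] res_E_closed[OF W r e]])
qed

lemma S_grade:
 assumes W: "openin T W" and e: "e : grade (sec E W) k" shows "S W e : grade (sec E W) k"
proof -
 have ec: "e : ME W" by (rule graded_group.grade_carrier[OF graded_E[OF W] e])
 show ?thesis
  by (rule grade_E_local[OF WV[OF W] V_cover[OF W] S_ex(1)[OF W ec]])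
   (simp only: S_ex(2)[OF W ec] approx_grade[OF WV[OF W] res_E_grade[OF W WV[OF W] Int_lower1 e]])
qed

text \<open>Within \<open>V k\<close> the weight \<open>cut (Suc k)\<close> is zero, so that
  \<open>approx_near\<close> becomes the statement that \<open>e - S e\<close> lies in
  \<open>nil E\<close>.\<close>

lemma free_splitting_local:
 assumes W: "openin T W" "W \<subseteq> V k"
 shows "free_splitting P pr (sec \<O> W) (\<kappa> W) (sec E W) p q (\<psi> k W) (S W)"
proof (intro free_splitting.intro splitting.intro splitting_axioms.intro identified_module_sec[OF W(1)]
  free_sec[OF W(1)] additive_S[OF W(1)] S_smult[OF W(1)])
 show "W \<subseteq> U k" using W(2) V(2) by blast
 fix e assume e: "e : ME W"
 interpret M: supermodule "sec \<O> W" "sec E W" by (rule supermodule_E[OF W(1)])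
 show "e \<ominus>\<^bsub>sec E W\<^esub> S W e : nspan nil (sec E W) (act W)"
  using approx_near[OF W(1) e, of "Suc k"] unfolding cut_vanish[OF W lessI] M.smult_zero_left[OF e] S_local[OF W e]
  using e approx_closed[OF W(1) e, of "Suc k"]
  by (simp add: a_minus_def M.M.minus_equality[OF M.M.l_zero[OF M.M.zero_closed] M.M.zero_closed M.M.zero_closed]
    del: approx.simps)
qed

lemma splitting_local: "[|openin T W; W \<subseteq> V k|] ==> splitting P pr (sec \<O> W) (\<kappa> W) (sec E W) (S W)"
 using free_splitting_local by (simp add: free_splitting_def)

lemma act_finsum_res:
 assumes W: "openin T W" and W': "openin T W'" "W' \<subseteq> W" and J: "J \<subseteq> carrier P" and z: "z : J \<rightarrow> ME W"
 shows "res E W W' (\<Oplus>\<^bsub>sec E W\<^esub>j\<in>J. act W j (z j)) = (\<Oplus>\<^bsub>sec E W'\<^esub>j\<in>J. act W' j (res E W W' (z j)))"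
proof -
 interpret M': abelian_group "sec E W'" by (rule abelian_E[OF W'(1)])
 have zj: "z j : ME W" "j : carrier P" if "j : J" for j using z J that by auto
 have "res E W W' (\<Oplus>\<^bsub>sec E W\<^esub>j\<in>J. act W j (z j)) = (\<Oplus>\<^bsub>sec E W'\<^esub>j\<in>J. res E W W' (act W j (z j)))"
  by (rule addmap_finsum[OF additive_res_E[OF W W'] abelian_E[OF W] abelian_E[OF W'(1)]])
   (simp add: Pi_iff act_closed[OF W] zj)
 also have "\<dots> = (\<Oplus>\<^bsub>sec E W'\<^esub>j\<in>J. act W' j (res E W W' (z j)))"
  by (rule M'.finsum_cong') (simp_all add: Pi_iff act_res[OF W W'] act_closed[OF W'(1)] res_E_closed[OF W W'] zj)
 finally show ?thesis .
qed

text \<open>Every \<open>W \<inter> V k\<close> carries a frame, so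
  \<open>decomposition_unique\<close> applies to the restricted relation; a section that vanishes on
  a cover is zero.\<close>

lemma S_indep:
 assumes W: "openin T W" and J: "finite J" "J \<subseteq> carrier P"
  and c: "\<And>j. j : J ==> functional (c j)" "\<And>i j. [|i : J; j : J|] ==> c i j = (if i = j then 1 else 0)"
  and y: "y : J \<rightarrow> ME W" and sum: "(\<Oplus>\<^bsub>sec E W\<^esub>j\<in>J. act W j (S W (y j))) = \<zero>\<^bsub>sec E W\<^esub>" and i: "i : J"
 shows "S W (y i) = \<zero>\<^bsub>sec E W\<^esub>"
proof -
 have yj: "y j : ME W" and jP: "j : carrier P" if "j : J" for j using y J(2) that by auto
 show ?thesis
 proof (rule cover_eqI_E[OF W S_ex(1)[OF W yj[OF i]] graded_group.grade_carrier[OF graded_E[OF W] graded_group.grade_zero[OF graded_E[OF W]]]])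
  fix k
  note r = WV[OF W, of k] Int_lower1[of W "V k"]
  interpret D: abelian_group "sec E (W \<inter> V k)" by (rule abelian_E[OF r(1)])
  have "S (W \<inter> V k) (res E W (W \<inter> V k) (y i)) = \<zero>\<^bsub>sec E (W \<inter> V k)\<^esub>"
  proof (rule free_splitting.decomposition_unique[OF free_splitting_local[OF r(1) Int_lower2] J c _ _ i])
   show "(\<lambda>j. res E W (W \<inter> V k) (y j)) : J \<rightarrow> ME (W \<inter> V k)"
    by (simp add: Pi_iff res_E_closed[OF W r] yj)
   have "(\<Oplus>\<^bsub>sec E (W \<inter> V k)\<^esub>j\<in>J. act (W \<inter> V k) j (S (W \<inter> V k) (res E W (W \<inter> V k) (y j)))) =
     (\<Oplus>\<^bsub>sec E (W \<inter> V k)\<^esub>j\<in>J. act (W \<inter> V k) j (res E W (W \<inter> V k) (S W (y j))))"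
    by (rule D.finsum_cong') (simp_all add: Pi_iff S_res[OF W r yj] act_closed[OF r(1)] S_ex(1)[OF r(1)] res_E_closed[OF W r] yj jP)
   also have "\<dots> = res E W (W \<inter> V k) (\<Oplus>\<^bsub>sec E W\<^esub>j\<in>J. act W j (S W (y j)))"
    by (rule act_finsum_res[OF W r J(2), symmetric]) (simp add: Pi_iff S_ex(1)[OF W] yj)
   also have "\<dots> = \<zero>\<^bsub>sec E (W \<inter> V k)\<^esub>"
    unfolding sum by (rule res_E_zero[OF W r])
   finally show "(\<Oplus>\<^bsub>sec E (W \<inter> V k)\<^esub>j\<in>J. act (W \<inter> V k) j (S (W \<inter> V k) (res E W (W \<inter> V k) (y j)))) = \<zero>\<^bsub>sec E (W \<inter> V k)\<^esub>" .
  qed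
  then show "res E W (W \<inter> V k) (S W (y i)) = res E W (W \<inter> V k) \<zero>\<^bsub>sec E W\<^esub>"
   by (simp only: S_res[OF W r yj[OF i]] res_E_zero[OF W r])
 qed
qed

text \<open>Over each \<open>W \<inter> V k\<close> the section \<open>e\<close> has an expansion
  over the basis. Its coefficients \<open>S (y k j)\<close>, unlike the \<open>y k j\<close>
  themselves, are unique by \<open>S_indep\<close>; hence they agree on overlaps and glue.\<close>

lemma global_decomposition:
 assumes W: "openin T W" and e: "e : ME W" and J: "finite J" "J \<subseteq> carrier P"
  and c: "\<And>j. j : J ==> functional (c j)" "\<And>i j. [|i : J; j : J|] ==> c i j = (if i = j then 1 else 0)"
   "\<And>x. x : carrier P ==> x = (\<Oplus>\<^bsub>P\<^esub>j\<in>J. c j x \<odot>\<^bsub>P\<^esub> j)"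
 shows "\<exists>z\<in>J \<rightarrow> ME W. (\<forall>j\<in>J. S W (z j) = z j) \<and> e = (\<Oplus>\<^bsub>sec E W\<^esub>j\<in>J. act W j (z j))"
proof -
 let ?D = "\<lambda>k. W \<inter> V k"
 note oD = WV[OF W]
 have ex: "\<exists>y\<in>J \<rightarrow> ME (?D k). res E W (?D k) e = (\<Oplus>\<^bsub>sec E (?D k)\<^esub>j\<in>J. act (?D k) j (S (?D k) (y j)))" for k
  by (rule splitting.decomposition_exists[OF splitting_local[OF oD Int_lower2] J c(3) res_E_closed[OF W oD Int_lower1 e]])
 from choice[OF allI[OF ex[unfolded Bex_def]]] obtain y where y': "\<forall>k. y k : J \<rightarrow> ME (?D k) \<and>
  res E W (?D k) e = (\<Oplus>\<^bsub>sec E (?D k)\<^esub>j\<in>J. act (?D k) j (S (?D k) (y k j)))" by (rule exE)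
 note y = conjunct1[OF spec[OF y']] and ey = conjunct2[OF spec[OF y']]
 have yj: "y k j : ME (?D k)" and jP: "j : carrier P" if "j : J" for j k using y[of k] J(2) that by auto
 have compat: "res E (?D k) (?D k \<inter> ?D l) (S (?D k) (y k i)) = res E (?D l) (?D k \<inter> ?D l) (S (?D l) (y l i))"
  if i: "i : J" for k l i
 proof -
  let ?X = "?D k \<inter> ?D l"
  have X: "openin T ?X" by (rule openin_Int[OF oD oD])
  have XV: "?X \<subseteq> V k" by blast
  interpret X: abelian_group "sec E ?X" by (rule abelian_E[OF X])
  define u where "u j = res E (?D k) ?X (y k j)" for j
  define v where "v j = res E (?D l) ?X (y l j)" for j
  have uv: "u j : ME ?X" "v j : ME ?X" if "j : J" for j
   unfolding u_def v_def by (rule res_E_closed[OF oD X Int_lower1 yj[OF that]], rule res_E_closed[OF oD X Int_lower2 yj[OF that]])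
  note Sc = S_ex(1)[OF X uv(1)] S_ex(1)[OF X uv(2)]
  have Sd: "S ?X (u j \<ominus>\<^bsub>sec E ?X\<^esub> v j) = S ?X (u j) \<ominus>\<^bsub>sec E ?X\<^esub> S ?X (v j)" if "j : J" for j
   by (rule addmap_minus[OF additive_S[OF X] abelian_E[OF X] abelian_E[OF X] uv[OF that]])
  have eu: "res E W ?X e = (\<Oplus>\<^bsub>sec E ?X\<^esub>j\<in>J. act ?X j (S ?X (u j)))"
  proof -
   have "res E W ?X e = res E (?D k) ?X (res E W (?D k) e)" by (rule res_E_res[OF W oD X Int_lower1 Int_lower1 e, symmetric])
   also have "\<dots> = (\<Oplus>\<^bsub>sec E ?X\<^esub>j\<in>J. act ?X j (res E (?D k) ?X (S (?D k) (y k j))))"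
    unfolding ey by (rule act_finsum_res[OF oD X Int_lower1 J(2)]) (simp add: Pi_iff S_ex(1)[OF oD] yj)
   also have "\<dots> = (\<Oplus>\<^bsub>sec E ?X\<^esub>j\<in>J. act ?X j (S ?X (u j)))"
    by (rule X.finsum_cong') (simp_all add: Pi_iff S_res[OF oD X Int_lower1 yj] u_def[symmetric] act_closed[OF X] jP Sc)
   finally show ?thesis .
  qed
  have ev: "res E W ?X e = (\<Oplus>\<^bsub>sec E ?X\<^esub>j\<in>J. act ?X j (S ?X (v j)))"
  proof -
   have "res E W ?X e = res E (?D l) ?X (res E W (?D l) e)" by (rule res_E_res[OF W oD X Int_lower2 Int_lower1 e, symmetric])
   also have "\<dots> = (\<Oplus>\<^bsub>sec E ?X\<^esub>j\<in>J. act ?X j (res E (?D l) ?X (S (?D l) (y l j))))"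
    unfolding ey by (rule act_finsum_res[OF oD X Int_lower2 J(2)]) (simp add: Pi_iff S_ex(1)[OF oD] yj)
   also have "\<dots> = (\<Oplus>\<^bsub>sec E ?X\<^esub>j\<in>J. act ?X j (S ?X (v j)))"
    by (rule X.finsum_cong') (simp_all add: Pi_iff S_res[OF oD X Int_lower2 yj] v_def[symmetric] act_closed[OF X] jP Sc)
   finally show ?thesis .
  qed
  have tc: "act ?X j (S ?X (u j)) : ME ?X" "act ?X j (S ?X (v j)) : ME ?X" if "j : J" for j
   by (rule act_closed[OF X jP[OF that] Sc(1)[OF that]], rule act_closed[OF X jP[OF that] Sc(2)[OF that]])
  \<comment> \<open>The two expansions of \<open>e\<close> over the overlap are subtracted, which
    gives a relation for the differences of \<open>u j\<close> and \<open>v j\<close> to which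
    \<open>S_indep\<close> applies.\<close>
  have sum: "(\<Oplus>\<^bsub>sec E ?X\<^esub>j\<in>J. act ?X j (S ?X (u j \<ominus>\<^bsub>sec E ?X\<^esub> v j))) = \<zero>\<^bsub>sec E ?X\<^esub>"
  proof -
   have "(\<Oplus>\<^bsub>sec E ?X\<^esub>j\<in>J. act ?X j (S ?X (u j \<ominus>\<^bsub>sec E ?X\<^esub> v j))) \<oplus>\<^bsub>sec E ?X\<^esub> (\<Oplus>\<^bsub>sec E ?X\<^esub>j\<in>J. act ?X j (S ?X (v j))) =
     (\<Oplus>\<^bsub>sec E ?X\<^esub>j\<in>J. act ?X j (S ?X (u j \<ominus>\<^bsub>sec E ?X\<^esub> v j)) \<oplus>\<^bsub>sec E ?X\<^esub> act ?X j (S ?X (v j)))"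
    by (rule X.finsum_addf[symmetric]) (simp_all add: Pi_iff tc act_closed[OF X] jP S_ex(1)[OF X] uv)
   also have "\<dots> = (\<Oplus>\<^bsub>sec E ?X\<^esub>j\<in>J. act ?X j (S ?X (u j)))"
   proof (rule X.finsum_cong')
    fix j assume j: "j : J"
    note Suv = Sc(1)[OF j] Sc(2)[OF j]
    have "act ?X j (S ?X (u j) \<ominus>\<^bsub>sec E ?X\<^esub> S ?X (v j)) = act ?X j (S ?X (u j)) \<ominus>\<^bsub>sec E ?X\<^esub> act ?X j (S ?X (v j))"
     by (rule addmap_minus[OF additive_act[OF X jP[OF j]] abelian_E[OF X] abelian_E[OF X] Suv])
    then show "act ?X j (S ?X (u j \<ominus>\<^bsub>sec E ?X\<^esub> v j)) \<oplus>\<^bsub>sec E ?X\<^esub> act ?X j (S ?X (v j)) = act ?X j (S ?X (u j))"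
     unfolding Sd[OF j] using tc[OF j] by (simp add: a_minus_def X.a_assoc X.l_neg)
   qed (simp_all add: Pi_iff tc)
   also have "\<dots> = (\<Oplus>\<^bsub>sec E ?X\<^esub>j\<in>J. act ?X j (S ?X (v j)))" using eu ev by simp
   finally have *: "(\<Oplus>\<^bsub>sec E ?X\<^esub>j\<in>J. act ?X j (S ?X (u j \<ominus>\<^bsub>sec E ?X\<^esub> v j))) \<oplus>\<^bsub>sec E ?X\<^esub> (\<Oplus>\<^bsub>sec E ?X\<^esub>j\<in>J. act ?X j (S ?X (v j))) =
     \<zero>\<^bsub>sec E ?X\<^esub> \<oplus>\<^bsub>sec E ?X\<^esub> (\<Oplus>\<^bsub>sec E ?X\<^esub>j\<in>J. act ?X j (S ?X (v j)))"
    using tc by (simp add: X.finsum_closed Pi_iff)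
   have cl: "(\<Oplus>\<^bsub>sec E ?X\<^esub>j\<in>J. act ?X j (S ?X (u j \<ominus>\<^bsub>sec E ?X\<^esub> v j))) : ME ?X"
    "(\<Oplus>\<^bsub>sec E ?X\<^esub>j\<in>J. act ?X j (S ?X (v j))) : ME ?X"
    by (intro X.finsum_closed; simp add: Pi_iff tc act_closed[OF X] jP S_ex(1)[OF X] uv)+
   show ?thesis by (rule iffD1[OF X.add.right_cancel[OF cl(2,1) X.zero_closed] *])
  qed
  have "S ?X (u i \<ominus>\<^bsub>sec E ?X\<^esub> v i) = \<zero>\<^bsub>sec E ?X\<^esub>"
   by (rule S_indep[OF X J c(1,2) _ sum i]) (simp_all add: Pi_iff uv)
  then have "S ?X (u i) = S ?X (v i)"
   unfolding Sd[OF i] using Sc(1)[OF i] Sc(2)[OF i] X.minus_equality[of "S ?X (u i)" "\<ominus>\<^bsub>sec E ?X\<^esub> S ?X (v i)"]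
   by (simp add: a_minus_def)
  then show ?thesis
   unfolding S_res[OF oD X Int_lower1 yj[OF i]] S_res[OF oD X Int_lower2 yj[OF i]] u_def v_def .
 qed
 have glued: "\<exists>z\<in>ME W. \<forall>k\<in>UNIV. res E W (?D k) z = S (?D k) (y k j)" if j: "j : J" for j
  by (rule sheaf_glue[OF sheaf_E oD V_cover[OF W] S_ex(1)[OF oD yj[OF j]] compat[OF j]])
 from bchoice[OF ballI[OF glued[unfolded Bex_def]]] obtain z where z': "\<forall>j\<in>J. z j : ME W \<and>
  (\<forall>k\<in>UNIV. res E W (?D k) (z j) = S (?D k) (y k j))" by (rule exE)
 note z = conjunct1[OF bspec[OF z']] bspec[OF conjunct2[OF bspec[OF z']] UNIV_I]
 \<comment> \<open>Locally \<open>z j\<close> is a value of \<open>S\<close>, which is idempotent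
   there.\<close>
 have "S W (z j) = z j" if j: "j : J" for j
 proof (rule cover_eqI_E[OF W S_ex(1)[OF W z(1)[OF j]] z(1)[OF j]])
  show "res E W (?D k) (S W (z j)) = res E W (?D k) (z j)" for k
   unfolding S_res[OF W oD Int_lower1 z(1)[OF j]] z(2)[OF j] by (rule splitting.S_S[OF splitting_local[OF oD Int_lower2] yj[OF j]])
 qed
 moreover have zP: "z : J \<rightarrow> ME W" using z(1) by auto
 moreover have "e = (\<Oplus>\<^bsub>sec E W\<^esub>j\<in>J. act W j (z j))"
 proof (rule cover_eqI_E[OF W e])
  interpret M: abelian_group "sec E W" by (rule abelian_E[OF W])
  show "(\<Oplus>\<^bsub>sec E W\<^esub>j\<in>J. act W j (z j)) : ME W"
   by (intro M.finsum_closed) (simp add: Pi_iff act_closed[OF W] jP z(1))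
  fix k
  interpret D: abelian_group "sec E (?D k)" by (rule abelian_E[OF oD])
  have "(\<Oplus>\<^bsub>sec E (?D k)\<^esub>j\<in>J. act (?D k) j (res E W (?D k) (z j))) = (\<Oplus>\<^bsub>sec E (?D k)\<^esub>j\<in>J. act (?D k) j (S (?D k) (y k j)))"
   by (rule D.finsum_cong') (simp_all add: Pi_iff z(2) act_closed[OF oD] jP S_ex(1)[OF oD] yj)
  then show "res E W (?D k) e = res E W (?D k) (\<Oplus>\<^bsub>sec E W\<^esub>j\<in>J. act W j (z j))"
   unfolding act_finsum_res[OF W oD Int_lower1 J(2) zP] ey by (rule sym)
 qed
 ultimately show ?thesis by blast
qed

text \<open>Membership in \<open>nil E\<close> does not glue directly, being a statement about
  finite sums. In the global expansion of \<open>e\<close> over the basis, however, all terms except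
  that of 1 lie in \<open>nil E\<close> and are annihilated by \<open>S\<close>, while the
  coefficient of 1 is fixed by \<open>S\<close>. So \<open>S e\<close> is this coefficient and
  \<open>e - S e\<close> is the finite sum of the other terms.\<close>

lemma S_near:
 assumes W: "openin T W" and e: "e : ME W"
 shows "e \<ominus>\<^bsub>sec E W\<^esub> S W e : nsp W"
proof -
 interpret M: abelian_group "sec E W" by (rule abelian_E[OF W])
 obtain J c where J: "finite J" "J \<subseteq> carrier P" and J1: "\<one>\<^bsub>P\<^esub> : J" "J - {\<one>\<^bsub>P\<^esub>} \<subseteq> nil"
  and c: "\<And>j. j : J ==> functional (c j)" "\<And>i j. [|i : J; j : J|] ==> c i j = (if i = j then 1 else 0)"
   "\<And>x. x : carrier P ==> x = (\<Oplus>\<^bsub>P\<^esub>j\<in>J. c j x \<odot>\<^bsub>P\<^esub> j)"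
  using basis by blast
 obtain z where z: "z : J \<rightarrow> ME W" "\<forall>j\<in>J. S W (z j) = z j" "e = (\<Oplus>\<^bsub>sec E W\<^esub>j\<in>J. act W j (z j))"
  using global_decomposition[OF W e J c] by blast
 let ?K = "J - {\<one>\<^bsub>P\<^esub>}"
 have zj: "z j : ME W" if "j : J" for j using z(1) that by auto
 have K: "j : nil" "j : carrier P" "z j : ME W" if "j : ?K" for j using that J(2) J1(2) zj by auto
 have KP: "(\<lambda>j. act W j (z j)) : ?K \<rightarrow> ME W" using act_closed[OF W] K by auto
 define r where "r = (\<Oplus>\<^bsub>sec E W\<^esub>j\<in>?K. act W j (z j))"
 have rn: "r : nsp W"
  unfolding r_def by (rule nspan_finsum[OF abelian_E[OF W] act_nil[OF W] nsp_act[OF W]]) (use K in auto)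
 have rc: "r : ME W" by (rule nsp_closed[OF W rn])
 have "e = (\<Oplus>\<^bsub>sec E W\<^esub>j\<in>insert \<one>\<^bsub>P\<^esub> ?K. act W j (z j))" unfolding z(3) using J1(1) by (simp add: insert_absorb)
 also have "\<dots> = act W \<one>\<^bsub>P\<^esub> (z \<one>\<^bsub>P\<^esub>) \<oplus>\<^bsub>sec E W\<^esub> r"
  unfolding r_def by (rule M.finsum_insert) (use J KP act_closed[OF W] zj J1(1) in auto)
 also have "act W \<one>\<^bsub>P\<^esub> (z \<one>\<^bsub>P\<^esub>) = z \<one>\<^bsub>P\<^esub>"
  by (rule identified_module.pact_one[OF identified_module_sec[OF W] zj[OF J1(1)]])
 finally have er: "e = z \<one>\<^bsub>P\<^esub> \<oplus>\<^bsub>sec E W\<^esub> r" .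
 \<comment> \<open>That \<open>S\<close> is a \<open>splitting\<close> over \<open>W\<close> is
   still being proved, so this is checked on the sets \<open>W \<inter> V k\<close>, where it is
   already known.\<close>
 have "S W (act W n x) = \<zero>\<^bsub>sec E W\<^esub>" if n: "n : nil" and x: "x : ME W" for n x
 proof (rule cover_eqI_E[OF W S_ex(1)[OF W act_nil[OF W n x]] M.zero_closed])
  fix k
  note o = WV[OF W, of k] Int_lower1[of W "V k"]
  show "res E W (W \<inter> V k) (S W (act W n x)) = res E W (W \<inter> V k) \<zero>\<^bsub>sec E W\<^esub>"
   unfolding S_res[OF W o act_nil[OF W n x]] act_res[OF W o nil_carrier[OF n] x] res_E_zero[OF W o]
   by (rule splitting.S_pact_nil[OF splitting_local[OF o(1) Int_lower2] n res_E_closed[OF W o x]])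
 qed
 then have "S W r = (\<Oplus>\<^bsub>sec E W\<^esub>j\<in>?K. \<zero>\<^bsub>sec E W\<^esub>)"
  unfolding r_def addmap_finsum[OF additive_S[OF W] abelian_E[OF W] abelian_E[OF W] KP]
  by (intro M.finsum_cong') (use K in auto)
 then have "S W e = z \<one>\<^bsub>P\<^esub>"
  unfolding er addmap_add[OF additive_S[OF W] zj[OF J1(1)] rc] using z(2) J1(1) zj by simp
 then have "e \<ominus>\<^bsub>sec E W\<^esub> S W e = r"
  unfolding er using zj[OF J1(1)] rc by (simp add: a_minus_def M.a_comm[of "z \<one>\<^bsub>P\<^esub>" r] M.a_assoc M.r_neg)
 then show ?thesis using rn by simp
qed

lemma body_splitting_S:
 assumes W: "openin T W" shows "body_splitting P pr (sec \<O> W) (\<kappa> W) (sec E W) (S W)"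
 by (intro body_splitting.intro splitting.intro splitting_axioms.intro body_splitting_axioms.intro
   identified_module_sec[OF W] additive_S[OF W] S_smult[OF W] S_near[OF W] S_grade[OF W])
  (assumption | rule S_indep[OF W])+

end

section \<open>Transport of the bundle structure\<close>

text \<open>Restriction in \<open>X\<close> preserves the grades because \<open>gr\<close> is an
  equality: the image of the restricted element has the right degree in \<open>E\<close>, hence is
  the image of an element of that degree in \<open>X\<close>, and by injectivity the two elements
  coincide.\<close>

lemma module_sheaf_transport:
 assumes E: "module_sheaf T \<O> E"
  and X: "\<And>U. openin T U ==> supermodule (sec \<O> U) (sec X U)"
  and hom: "\<And>U. openin T U ==> module_hom (sec \<O> U) (sec X U) (sec E U) (\<phi> U)"
  and bij: "\<And>U. openin T U ==> bij_betw (\<phi> U) (carrier (sec X U)) (carrier (sec E U))"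
  and gr: "\<And>U k. openin T U ==> \<phi> U ` grade (sec X U) k = grade (sec E U) k"
  and res: "\<And>U V x. [|openin T U; openin T V; V \<subseteq> U; x : carrier (sec X U)|] ==>
   res X U V x : carrier (sec X V) \<and> \<phi> V (res X U V x) = res E U V (\<phi> U x)"
  and O: "\<And>U V f. [|openin T U; openin T V; V \<subseteq> U; f : carrier (sec \<O> U)|] ==> res \<O> U V f : carrier (sec \<O> V)"
 shows "module_sheaf T \<O> X" and "module_sheaf_iso T (topspace T) \<O> X E \<phi>"
proof -
 have inj: "x = y" if "openin T U" "\<phi> U x = \<phi> U y" "x : carrier (sec X U)" "y : carrier (sec X U)" for U x y
  using bij[OF that(1)] that(2-) by (metis bij_betw_def inj_onD)
 have \<phi>c: "\<phi> U x : carrier (sec E U)" if "openin T U" "x : carrier (sec X U)" for U x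
  using hom[OF that(1)] that(2) by (auto simp: module_hom_def)
 have \<phi>add: "\<phi> U (x \<oplus>\<^bsub>sec X U\<^esub> y) = \<phi> U x \<oplus>\<^bsub>sec E U\<^esub> \<phi> U y"
  if "openin T U" "x : carrier (sec X U)" "y : carrier (sec X U)" for U x y
  using hom[OF that(1)] that(2-) by (simp add: module_hom_def)
 have \<phi>sm: "\<phi> U (f \<odot>\<^bsub>sec X U\<^esub> x) = f \<odot>\<^bsub>sec E U\<^esub> \<phi> U x"
  if "openin T U" "f : carrier (sec \<O> U)" "x : carrier (sec X U)" for U f x
  using hom[OF that(1)] that(2-) by (simp add: module_hom_def)
 note rc = conjunct1[OF res] and re = conjunct2[OF res]
 note gX = graded_group.grade_carrier[OF supermodule.graded_group[OF X]]
 show "module_sheaf T \<O> X"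
  unfolding module_sheaf_def
 proof (intro conjI allI impI ballI)
  show "sheaf T X" by (rule sheaf_transport[OF _ bij res]) (use E in \<open>simp add: module_sheaf_def\<close>)
  show "openin T U ==> supermodule (sec \<O> U) (sec X U)" for U by (rule X)
  fix U V assume "openin T U \<and> openin T V \<and> V \<subseteq> U"
  then have o: "openin T U" "openin T V" "V \<subseteq> U" by auto
  interpret U: supermodule "sec \<O> U" "sec X U" by (rule X[OF o(1)])
  interpret V: supermodule "sec \<O> V" "sec X V" by (rule X[OF o(2)])
  have Eadd: "res E U V (x \<oplus>\<^bsub>sec E U\<^esub> y) = res E U V x \<oplus>\<^bsub>sec E V\<^esub> res E U V y"
   if "x : carrier (sec E U)" "y : carrier (sec E U)" for x y
   using E o that by (simp add: module_sheaf_def)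
  have Esm: "res E U V (f \<odot>\<^bsub>sec E U\<^esub> x) = res \<O> U V f \<odot>\<^bsub>sec E V\<^esub> res E U V x"
   if "f : carrier (sec \<O> U)" "x : carrier (sec E U)" for f x
   using E o that by (simp add: module_sheaf_def)
  have Egr: "res E U V x : grade (sec E V) i" if "x : grade (sec E U) i" for x i
   using E o that by (simp add: module_sheaf_def image_subset_iff)
  show "res X U V (x \<oplus>\<^bsub>sec X U\<^esub> y) = res X U V x \<oplus>\<^bsub>sec X V\<^esub> res X U V y"
   if xy: "x : carrier (sec X U)" "y : carrier (sec X U)" for x y
  proof (rule inj[OF o(2) _ rc[OF o U.M.a_closed[OF xy]] V.M.a_closed[OF rc[OF o xy(1)] rc[OF o xy(2)]]])
   show "\<phi> V (res X U V (x \<oplus>\<^bsub>sec X U\<^esub> y)) = \<phi> V (res X U V x \<oplus>\<^bsub>sec X V\<^esub> res X U V y)"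
    unfolding re[OF o U.M.a_closed[OF xy]] \<phi>add[OF o(1) xy] \<phi>add[OF o(2) rc[OF o xy(1)] rc[OF o xy(2)]]
     re[OF o xy(1)] re[OF o xy(2)] by (rule Eadd[OF \<phi>c[OF o(1) xy(1)] \<phi>c[OF o(1) xy(2)]])
  qed
  show "res X U V (f \<odot>\<^bsub>sec X U\<^esub> x) = res \<O> U V f \<odot>\<^bsub>sec X V\<^esub> res X U V x"
   if f: "f : carrier (sec \<O> U)" and x: "x : carrier (sec X U)" for f x
  proof (rule inj[OF o(2) _ rc[OF o U.smult_closed[OF f x]] V.smult_closed[OF O[OF o f] rc[OF o x]]])
   show "\<phi> V (res X U V (f \<odot>\<^bsub>sec X U\<^esub> x)) = \<phi> V (res \<O> U V f \<odot>\<^bsub>sec X V\<^esub> res X U V x)"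
    unfolding re[OF o U.smult_closed[OF f x]] \<phi>sm[OF o(1) f x] \<phi>sm[OF o(2) O[OF o f] rc[OF o x]] re[OF o x]
    by (rule Esm[OF f \<phi>c[OF o(1) x]])
  qed
  show "res X U V ` grade (sec X U) i \<subseteq> grade (sec X V) i" for i
  proof
   fix y assume "y : res X U V ` grade (sec X U) i"
   then obtain x where x: "y = res X U V x" "x : grade (sec X U) i" by (rule imageE)
   note xc = gX[OF o(1) x(2)]
   have "\<phi> U x : grade (sec E U) i" unfolding gr[OF o(1), symmetric] using x(2) by (rule imageI)
   from Egr[OF this] have "\<phi> V y : \<phi> V ` grade (sec X V) i" unfolding x(1) re[OF o xc] gr[OF o(2)] .
   then obtain z where z: "\<phi> V y = \<phi> V z" "z : grade (sec X V) i" by (rule imageE)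
   have "y = z" by (rule inj[OF o(2) z(1) _ gX[OF o(2) z(2)]]) (simp add: x(1) rc[OF o xc])
   then show "y : grade (sec X V) i" using z(2) by simp
  qed
 qed
 show "module_sheaf_iso T (topspace T) \<O> X E \<phi>"
  unfolding module_sheaf_iso_def commutes_with_res_def using re hom bij by simp
qed

lemma super_vector_bundle_transport:
 assumes E: "super_vector_bundle p q T \<O> E" and X: "module_sheaf T \<O> X"
  and \<phi>: "module_sheaf_iso T (topspace T) \<O> X E \<phi>"
 shows "super_vector_bundle p q T \<O> X"
 unfolding super_vector_bundle_def
proof (intro conjI X ballI)
 fix x assume "x : topspace T"
 then obtain U \<psi> where U: "openin T U" "x : U" and \<psi>: "module_sheaf_iso T U \<O> E (free_sheaf p q \<O>) \<psi>"
  using E unfolding super_vector_bundle_def by blast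
 have \<phi>V: "module_hom (sec \<O> V) (sec X V) (sec E V) (\<phi> V)" "bij_betw (\<phi> V) (carrier (sec X V)) (carrier (sec E V))"
  if "openin T V" for V using \<phi> that openin_subset[OF that] by (simp_all add: module_sheaf_iso_def)
 have \<phi>c: "\<phi> V y : carrier (sec E V)" if "openin T V" "y : carrier (sec X V)" for V y
  using \<phi>V(1)[OF that(1)] that(2) by (auto simp: module_hom_def)
 have \<phi>r: "\<phi> W (res X V W y) = res E V W (\<phi> V y)"
  if "openin T V" "openin T W" "W \<subseteq> V" "y : carrier (sec X V)" for V W y
  using \<phi> that openin_subset[OF that(1)] by (simp add: module_sheaf_iso_def commutes_with_res_def)
 have "module_sheaf_iso T U \<O> X (free_sheaf p q \<O>) (\<lambda>V y. \<psi> V (\<phi> V y))"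
  unfolding module_sheaf_iso_def
 proof (intro conjI allI impI)
  show "commutes_with_res T U X (free_sheaf p q \<O>) (\<lambda>V y. \<psi> V (\<phi> V y))"
   using \<psi> \<phi>r \<phi>c unfolding module_sheaf_iso_def commutes_with_res_def by simp
  fix V assume V: "openin T V \<and> V \<subseteq> U"
  note p = \<phi>V[OF conjunct1[OF V]]
  have s: "module_hom (sec \<O> V) (sec E V) (sec (free_sheaf p q \<O>) V) (\<psi> V)"
   "bij_betw (\<psi> V) (carrier (sec E V)) (carrier (sec (free_sheaf p q \<O>) V))"
   using \<psi> V by (simp_all add: module_sheaf_iso_def)
  show "bij_betw (\<lambda>y. \<psi> V (\<phi> V y)) (carrier (sec X V)) (carrier (sec (free_sheaf p q \<O>) V))"
   using bij_betw_trans[OF p(2) s(2)] by (simp add: comp_def)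
  show "module_hom (sec \<O> V) (sec X V) (sec (free_sheaf p q \<O>) V) (\<lambda>y. \<psi> V (\<phi> V y))"
   unfolding module_hom_def
  proof (intro conjI allI ballI)
   note c = \<phi>c[OF conjunct1[OF V]]
   show "(\<lambda>y. \<psi> V (\<phi> V y)) : carrier (sec X V) \<rightarrow> carrier (sec (free_sheaf p q \<O>) V)"
    using s(1) c by (auto simp: module_hom_def)
   show "\<psi> V (\<phi> V (y \<oplus>\<^bsub>sec X V\<^esub> z)) = \<psi> V (\<phi> V y) \<oplus>\<^bsub>sec (free_sheaf p q \<O>) V\<^esub> \<psi> V (\<phi> V z)"
    if "y : carrier (sec X V)" "z : carrier (sec X V)" for y z
    using p(1) s(1) that c by (simp add: module_hom_def)
   show "\<psi> V (\<phi> V (f \<odot>\<^bsub>sec X V\<^esub> y)) = f \<odot>\<^bsub>sec (free_sheaf p q \<O>) V\<^esub> \<psi> V (\<phi> V y)"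
    if "f : carrier (sec \<O> V)" "y : carrier (sec X V)" for f y
    using p(1) s(1) that c by (simp add: module_hom_def)
   fix i
   have "\<phi> V ` grade (sec X V) i \<subseteq> grade (sec E V) i" "\<psi> V ` grade (sec E V) i \<subseteq> grade (sec (free_sheaf p q \<O>) V) i"
    using p(1) s(1) by (simp_all only: module_hom_def)
   then show "(\<lambda>y. \<psi> V (\<phi> V y)) ` grade (sec X V) i \<subseteq> grade (sec (free_sheaf p q \<O>) V) i" by blast
  qed
 qed
 then show "\<exists>U. openin T U \<and> x : U \<and> (\<exists>\<psi>. module_sheaf_iso T U \<O> X (free_sheaf p q \<O>) \<psi>)" using U by blast
qed

lemma smult_tensor: "smult (tensor R A B act) = act"
 by (simp add: tensor_def)

context vector_bundle begin

abbreviation XB where "XB \<equiv> extended_body P pr \<O> \<kappa> E"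

lemma algebra_over_sec: "openin T U ==> algebra_over P pr (sec \<O> U)"
 using identified_sec by (simp add: identified_def)

lemma body_over_sec: "openin T U ==> body_over P pr \<O> U = algebra_over.BO P pr (sec \<O> U)"
 unfolding algebra_over.BO_def[OF algebra_over_sec] body_over_def body_def Let_def gsheaf.simps ..

text \<open>The bridge between sheaves and the locales for a single open set: both sides unfold to
  the same record.\<close>

lemma sec_XB: "openin T U ==> sec XB U = identified_module.XE P pr (sec \<O> U) (\<kappa> U) (sec E U)"
 unfolding identified_module.XE_def[OF identified_module_sec] identified_module.ext_act_def[OF identified_module_sec]
  body_over_sec[symmetric] extended_body_def pull_scalars_def extend_bundle_def bundle_body_def body_def Let_def
  gsheaf.simps smult_tensor ..

lemma res_XB: "openin T V ==> res XB U V =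
  tensor_map real_alg P (restrict_to_real (left_tensor P (real_over pr) (sec \<O> V) (*))
   (left_tensor (sec \<O> V) (algebra_over.BO P pr (sec \<O> V)) (sec E V)
    (monoid.mult (left_tensor P (real_over pr) (sec \<O> V) (*))))) id
   (tensor_map (sec \<O> V) (algebra_over.BO P pr (sec \<O> V)) (sec E V)
    (tensor_map P (real_over pr) (sec \<O> V) id (res \<O> U V)) (res E U V))"
 unfolding body_over_sec[symmetric] extended_body_def pull_scalars_def extend_bundle_def bundle_body_def body_def
  gsheaf.simps ..

text \<open>Reduces the theorem to a family of splittings over all open sets that commutes with
  restriction; the isomorphism is assembled from the maps \<open>\<phi>\<close> over the single open
  sets.\<close>

lemma rigidity_of_splitting:
 assumes svb: "super_vector_bundle p q T \<O> E"
  and S: "\<And>W. openin T W ==> body_splitting P pr (sec \<O> W) (\<kappa> W) (sec E W) (S W)"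
  and S_res: "\<And>W W' e. [|openin T W; openin T W'; W' \<subseteq> W; e : ME W|] ==>
   res E W W' (S W e) = S W' (res E W W' e)"
 shows "\<exists>\<phi>. svb_iso p q T \<O> XB E \<phi> \<and>
  (\<forall>U. openin T U \<longrightarrow> (\<forall>e\<in>carrier (sec (bundle_body P pr \<O> E) U).
   bundle_body_map P pr \<O> E \<phi> U (body_embed P pr \<O> \<kappa> E U e) = e))"
proof -
 define \<phi> where "\<phi> U = body_splitting.\<phi> P pr (sec \<O> U) (sec E U) (S U)" for U
 have hom: "module_hom (sec \<O> U) (sec XB U) (sec E U) (\<phi> U)"
  and bij: "bij_betw (\<phi> U) (carrier (sec XB U)) (ME U)"
  and gr: "\<phi> U ` grade (sec XB U) k = grade (sec E U) k"
  and sm: "supermodule (sec \<O> U) (sec XB U)" if U: "openin T U" for U k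
 proof -
  interpret U: body_splitting P pr "sec \<O> U" "\<kappa> U" "sec E U" "S U" by (rule S[OF U])
  show "bij_betw (\<phi> U) (carrier (sec XB U)) (ME U)"
   unfolding sec_XB[OF U] \<phi>_def U.XE_simps by (rule U.\<phi>_bij)
  show "\<phi> U ` grade (sec XB U) k = grade (sec E U) k" for k
   unfolding sec_XB[OF U] \<phi>_def U.XE_simps by (rule U.\<phi>_grade_image)
  note gi = this
  show "supermodule (sec \<O> U) (sec XB U)" unfolding sec_XB[OF U] by (rule U.supermodule_XE)
  show "module_hom (sec \<O> U) (sec XB U) (sec E U) (\<phi> U)"
   unfolding module_hom_def
  proof (intro conjI allI ballI)
   show "\<phi> U : carrier (sec XB U) \<rightarrow> ME U"
    unfolding sec_XB[OF U] \<phi>_def by (rule funcsetI) (rule addmap_closed[OF U.additive_\<phi>_XE])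
   show "\<phi> U (x \<oplus>\<^bsub>sec XB U\<^esub> y) = \<phi> U x \<oplus>\<^bsub>sec E U\<^esub> \<phi> U y" if "x : carrier (sec XB U)" "y : carrier (sec XB U)" for x y
    using that unfolding sec_XB[OF U] \<phi>_def by (rule addmap_add[OF U.additive_\<phi>_XE])
   show "\<phi> U (f \<odot>\<^bsub>sec XB U\<^esub> x) = f \<odot>\<^bsub>sec E U\<^esub> \<phi> U x" if "f : MO U" "x : carrier (sec XB U)" for f x
    using that(2) unfolding sec_XB[OF U] \<phi>_def U.XE_simps by (rule conjunct2[OF U.\<phi>_ext_act[OF that(1)]])
   show "\<phi> U ` grade (sec XB U) i \<subseteq> grade (sec E U) i" for i unfolding gi by (rule order_refl)
  qed
 qed
 have res: "res XB U V x : carrier (sec XB V) \<and> \<phi> V (res XB U V x) = res E U V (\<phi> U x)"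
  if o: "openin T U" "openin T V" "V \<subseteq> U" and x: "x : carrier (sec XB U)" for U V x
 proof -
  interpret h: body_splitting_hom P pr "sec \<O> U" "\<kappa> U" "sec \<O> V" "\<kappa> V" "res \<O> U V" "sec E U" "sec E V" "res E U V" "S U" "S V"
   by (intro body_splitting_hom.intro body_splitting_hom_axioms.intro identified_module_hom_res o S S_res[OF o, symmetric])
  have x': "x : carrier h.D.XM" using x unfolding sec_XB[OF o(1)] h.D.XE_simps .
  show ?thesis
   unfolding res_XB[OF o(2)] sec_XB[OF o(2)] h.C.XE_simps \<phi>_def
   by (rule conjI, rule addmap_closed[OF h.additive_kX x'], rule h.\<phi>_natural[OF x'])
 qed
 have ms1: "module_sheaf T \<O> XB"
  by (rule module_sheaf_transport(1)[where \<phi> = \<phi>, OF module_sheaf sm hom bij gr res res_O_closed])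
 have ms2: "module_sheaf_iso T \<Omega> \<O> XB E \<phi>"
  by (rule module_sheaf_transport(2)[where \<phi> = \<phi>, OF module_sheaf sm hom bij gr res res_O_closed])
 have iso: "svb_iso p q T \<O> XB E \<phi>"
  unfolding svb_iso_def
  by (rule conjI[OF super_vector_bundle_transport[OF svb ms1 ms2] conjI[OF svb ms2]])
 have body: "bundle_body_map P pr \<O> E \<phi> U (body_embed P pr \<O> \<kappa> E U e) = e"
  if U: "openin T U" and e: "e : carrier (sec (bundle_body P pr \<O> E) U)" for U e
 proof -
  interpret U: body_splitting P pr "sec \<O> U" "\<kappa> U" "sec E U" "S U" by (rule S[OF U])
  have e': "e : carrier U.EB" using e unfolding bundle_body_def body_def gsheaf.simps body_over_sec[OF U] .
  show ?thesis
   unfolding bundle_body_map_def body_embed_def sec_XB[OF U] body_over_sec[OF U] \<phi>_def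
   unfolding bundle_body_def body_def gsheaf.simps body_over_sec[OF U]
   by (rule U.body_\<phi>[OF e'])
 qed
 show ?thesis
  by (rule exI[of _ \<phi>], rule conjI[OF iso], intro allI impI ballI, rule body)
qed

end

section \<open>Smooth functions and bump functions\<close>

lemma openin_Euclidean_space_subset: "openin (Euclidean_space m) S ==> x : S ==> i \<ge> m ==> x i = 0"
 using openin_subset[of "Euclidean_space m" S] by (auto simp: topspace_Euclidean_space)

lemma continuous_map_Euclidean_coordinate: "continuous_map (Euclidean_space m) euclideanreal (\<lambda>x. x i)"
 unfolding Euclidean_space_def
 by (rule continuous_map_from_subtopology) (rule continuous_map_product_projection, simp)

text \<open>Partial derivatives at a point of an open set thus depend only on the values of the
  function inside this set.\<close>

lemma eventually_update_in_open:
 assumes S: "openin (Euclidean_space m) S" and x: "x : S" and i: "i < m"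
 shows "\<forall>\<^sub>F t in nhds (x i). x(i := t) : S"
proof -
 have "continuous_map euclideanreal euclideanreal (\<lambda>t. (x(i := t)) j)" for j
  by (cases "i = j") simp_all
 then have "continuous_map euclideanreal (Euclidean_space m) (\<lambda>t j. if j < m then (x(i := t)) j else 0)"
  by (simp add: continuous_map_componentwise_Euclidean_space)
 moreover have "(\<lambda>t j. if j < m then (x(i := t)) j else 0) = (\<lambda>t. x(i := t))"
  using openin_Euclidean_space_subset[OF S x] i by (auto simp: fun_eq_iff)
 ultimately have "continuous_map euclideanreal (Euclidean_space m) (\<lambda>t. x(i := t))" by simp
 from openin_continuous_map_preimage[OF this S] have "open {t. x(i := t) : S}" by simp
 then show ?thesis
  unfolding eventually_nhds using x by (intro exI[of _ "{t. x(i := t) : S}"]) simp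
qed

lemma C_k_cong:
 assumes S: "openin (Euclidean_space m) S" and eq: "\<And>x. x : S ==> f x = g x" and f: "C_k m k S f"
 shows "C_k m k S g"
proof (cases k)
 case 0
 then show ?thesis using f eq by (auto intro: continuous_map_eq)
next
 case (Suc k')
 have "\<exists>h. (\<forall>x\<in>S. ((\<lambda>t. g (x(i := t))) has_real_derivative h x) (at (x i))) \<and> C_k m k' S h" if i: "i < m" for i
 proof -
  obtain h where h: "\<forall>x\<in>S. ((\<lambda>t. f (x(i := t))) has_real_derivative h x) (at (x i))" "C_k m k' S h"
   using f Suc i by auto
  have "((\<lambda>t. g (x(i := t))) has_real_derivative h x) (at (x i))" if x: "x : S" for x
  proof -
   have ev: "\<forall>\<^sub>F t in nhds (x i). f (x(i := t)) = g (x(i := t))"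
    using eventually_update_in_open[OF S x i] by eventually_elim (rule eq)
   show ?thesis
    by (rule DERIV_cong_ev[OF refl ev refl, THEN iffD1]) (use h(1) x in blast)
  qed
  then show ?thesis using h(2) by blast
 qed
 moreover have "continuous_map (subtopology (Euclidean_space m) S) euclideanreal g"
  using f Suc eq by (auto intro: continuous_map_eq)
 ultimately show ?thesis using Suc by simp
qed

lemma C_k_continuous: "C_k m k S f ==> continuous_map (subtopology (Euclidean_space m) S) euclideanreal f"
 by (cases k) auto

lemma C_k_subset: "[|C_k m k S f; S' \<subseteq> S|] ==> C_k m k S' f"
proof (induction k arbitrary: f)
 case 0
 then show ?case using continuous_map_from_subtopology_mono by auto
next
 case (Suc k)
 then have "continuous_map (subtopology (Euclidean_space m) S') euclideanreal f"
  using continuous_map_from_subtopology_mono by auto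
 moreover have "\<exists>g. (\<forall>x\<in>S'. ((\<lambda>t. f (x(i := t))) has_real_derivative g x) (at (x i))) \<and> C_k m k S' g"
  if i: "i < m" for i
 proof -
  obtain g where "\<And>x. x : S ==> ((\<lambda>t. f (x(i := t))) has_real_derivative g x) (at (x i))" "C_k m k S g"
   using Suc.prems(1) i by (metis C_k.simps(2))
  then show ?thesis using Suc.IH Suc.prems(2) by blast
 qed
 ultimately show ?case by simp
qed

lemma C_k_mono: "C_k m (Suc k) S f ==> C_k m k S f"
proof (induction k arbitrary: f)
 case (Suc k)
 then show ?case by (subst C_k.simps) (metis C_k.simps(2))
qed simp

lemma C_k_const: "C_k m k S (\<lambda>x. c)"
proof (induction k arbitrary: c)
 case (Suc k)
 have "\<exists>g. (\<forall>x\<in>S. ((\<lambda>t. c) has_real_derivative g x) (at (x i))) \<and> C_k m k S g" for i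
  by (rule exI[of _ "\<lambda>x. 0"]) (auto intro!: derivative_eq_intros Suc)
 then show ?case by simp
qed simp

lemma C_k_add: "[|C_k m k S f; C_k m k S g|] ==> C_k m k S (\<lambda>x. f x + g x)"
proof (induction k arbitrary: f g)
 case 0
 then show ?case by (simp add: continuous_map_add)
next
 case (Suc k)
 have "\<exists>h. (\<forall>x\<in>S. ((\<lambda>t. f (x(i := t)) + g (x(i := t))) has_real_derivative h x) (at (x i))) \<and> C_k m k S h"
  if i: "i < m" for i
 proof -
  obtain f' g' where *: "\<And>x. x : S ==> ((\<lambda>t. f (x(i := t))) has_real_derivative f' x) (at (x i))" "C_k m k S f'"
   "\<And>x. x : S ==> ((\<lambda>t. g (x(i := t))) has_real_derivative g' x) (at (x i))" "C_k m k S g'"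
   using Suc.prems i by (metis C_k.simps(2))
  show ?thesis
   by (rule exI[of _ "\<lambda>x. f' x + g' x"]) (use * Suc.IH in \<open>auto intro!: DERIV_add\<close>)
 qed
 then show ?case using Suc.prems by (simp add: continuous_map_add)
qed

lemma C_k_mult: "[|C_k m k S f; C_k m k S g|] ==> C_k m k S (\<lambda>x. f x * g x)"
proof (induction k arbitrary: f g)
 case 0
 then show ?case by (simp add: continuous_map_real_mult)
next
 case (Suc k)
 have "\<exists>h. (\<forall>x\<in>S. ((\<lambda>t. f (x(i := t)) * g (x(i := t))) has_real_derivative h x) (at (x i))) \<and> C_k m k S h"
  if i: "i < m" for i
 proof -
  obtain f' g' where *: "\<And>x. x : S ==> ((\<lambda>t. f (x(i := t))) has_real_derivative f' x) (at (x i))" "C_k m k S f'"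
   "\<And>x. x : S ==> ((\<lambda>t. g (x(i := t))) has_real_derivative g' x) (at (x i))" "C_k m k S g'"
   using Suc.prems i by (metis C_k.simps(2))
  have "((\<lambda>t. f (x(i := t)) * g (x(i := t))) has_real_derivative f' x * g x + g' x * f x) (at (x i))"
   if "x : S" for x
   using DERIV_mult[OF *(1)[OF that] *(3)[OF that]] by simp
  moreover have "C_k m k S (\<lambda>x. f' x * g x + g' x * f x)"
   by (rule C_k_add[OF Suc.IH[OF *(2) C_k_mono[OF Suc.prems(2)]] Suc.IH[OF *(4) C_k_mono[OF Suc.prems(1)]]])
  ultimately show ?thesis by (intro exI conjI ballI)
 qed
 then show ?case using Suc.prems by (simp add: continuous_map_real_mult)
qed

lemma C_k_inverse:
 assumes "\<And>x. x : S ==> f x \<noteq> 0"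
 shows "C_k m k S f ==> C_k m k S (\<lambda>x. inverse (f x))"
proof (induction k)
 case 0
 then show ?case using assms by (auto intro!: continuous_map_real_inverse)
next
 case (Suc k)
 have IH: "C_k m k S (\<lambda>x. inverse (f x))" using Suc C_k_mono by blast
 have "\<exists>h. (\<forall>x\<in>S. ((\<lambda>t. inverse (f (x(i := t)))) has_real_derivative h x) (at (x i))) \<and> C_k m k S h"
  if i: "i < m" for i
 proof -
  obtain f' where *: "\<And>x. x : S ==> ((\<lambda>t. f (x(i := t))) has_real_derivative f' x) (at (x i))" "C_k m k S f'"
   using Suc.prems i by (metis C_k.simps(2))
  have "((\<lambda>t. inverse (f (x(i := t)))) has_real_derivative -1 * (f' x * (inverse (f x) * inverse (f x)))) (at (x i))"
   if "x : S" for x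
   using DERIV_inverse_fun[OF *(1)[OF that]] assms[OF that] by (simp add: ac_simps)
  moreover have "C_k m k S (\<lambda>x. -1 * (f' x * (inverse (f x) * inverse (f x))))"
   by (rule C_k_mult[OF C_k_const C_k_mult[OF *(2) C_k_mult[OF IH IH]]])
  ultimately show ?thesis by (intro exI conjI ballI)
 qed
 moreover have "continuous_map (subtopology (Euclidean_space m) S) euclideanreal (\<lambda>x. inverse (f x))"
  using C_k_continuous[OF Suc.prems] assms by (auto intro!: continuous_map_real_inverse)
 ultimately show ?case by simp
qed

text \<open>\<open>Q\<close> stands for a class of functions that is closed under derivatives. It
  allows an induction on \<open>k\<close> through the chain rule without a formula for the higher
  derivatives of a composition.\<close>

lemma C_k_compose:
 assumes Q: "\<And>h. Q h ==> \<exists>h'. Q h' \<and> (\<forall>t. (h has_real_derivative h' t) (at t))"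
 shows "[|Q h; C_k m k S f|] ==> C_k m k S (\<lambda>x. h (f x))"
proof (induction k arbitrary: h)
 case (Suc k)
 obtain h' where h': "Q h'" "\<And>t. (h has_real_derivative h' t) (at t)" using Q Suc.prems by blast
 have "\<exists>g. (\<forall>x\<in>S. ((\<lambda>t. h (f (x(i := t)))) has_real_derivative g x) (at (x i))) \<and> C_k m k S g"
  if i: "i < m" for i
 proof -
  obtain f' where *: "\<And>x. x : S ==> ((\<lambda>t. f (x(i := t))) has_real_derivative f' x) (at (x i))" "C_k m k S f'"
   using Suc.prems i by (metis C_k.simps(2))
  have "((\<lambda>t. h (f (x(i := t)))) has_real_derivative h' (f x) * f' x) (at (x i))" if "x : S" for x
   using DERIV_chain2[OF h'(2) *(1)[OF that]] by simp
  moreover have "C_k m k S (\<lambda>x. h' (f x) * f' x)"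
   by (rule C_k_mult[OF Suc.IH[OF h'(1) C_k_mono[OF Suc.prems(2)]] *(2)])
  ultimately show ?thesis by (intro exI conjI ballI)
 qed
 moreover have "continuous_map (subtopology (Euclidean_space m) S) euclideanreal (\<lambda>x. h (f x))"
 proof -
  have "continuous_on UNIV h" using DERIV_isCont[OF h'(2)] by (simp add: continuous_on_eq_continuous_at)
  then show ?thesis
   using continuous_map_compose[OF C_k_continuous[OF Suc.prems(2)], of euclideanreal h] by (simp add: o_def)
 qed
 ultimately show ?case by simp
next
 case 0
 obtain h' where h': "\<And>t. (h has_real_derivative h' t) (at t)" using Q 0 by blast
 have "continuous_on UNIV h" using DERIV_isCont[OF h'] by (simp add: continuous_on_eq_continuous_at)
 then show ?case
  using continuous_map_compose[OF C_k_continuous[OF 0(2)], of euclideanreal h] by (simp add: o_def)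
qed

lemma continuous_map_open_Un:
 assumes "openin X S1" "openin X S2" "continuous_map (subtopology X S1) Y f" "continuous_map (subtopology X S2) Y f"
 shows "continuous_map (subtopology X (S1 \<union> S2)) Y f"
proof (rule pasting_lemma[where I = UNIV and T = "\<lambda>b. if b then S1 else S2" and f = "\<lambda>_. f"])
 show "openin (subtopology X (S1 \<union> S2)) (if b then S1 else S2)" for b
  using assms(1,2) by (auto simp: openin_open_subtopology openin_Un)
 show "continuous_map (subtopology (subtopology X (S1 \<union> S2)) (if b then S1 else S2)) Y f" for b
  using assms(3,4) by (simp add: subtopology_subtopology inf.absorb2 Int_absorb1)
qed (auto split: if_splits)

text \<open>Where the two sets overlap, the partial derivatives agree by uniqueness of derivatives,
  so they paste to one function on the union.\<close>

lemma C_k_Un: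
 assumes S: "openin (Euclidean_space m) S1" "openin (Euclidean_space m) S2"
 shows "[|C_k m k S1 f; C_k m k S2 f|] ==> C_k m k (S1 \<union> S2) f"
proof (induction k arbitrary: f)
 case 0
 then show ?case using continuous_map_open_Un[OF S] by simp
next
 case (Suc k)
 have "\<exists>g. (\<forall>x\<in>S1 \<union> S2. ((\<lambda>t. f (x(i := t))) has_real_derivative g x) (at (x i))) \<and> C_k m k (S1 \<union> S2) g"
  if i: "i < m" for i
 proof -
  obtain g1 g2 where g: "\<And>x. x : S1 ==> ((\<lambda>t. f (x(i := t))) has_real_derivative g1 x) (at (x i))" "C_k m k S1 g1"
   "\<And>x. x : S2 ==> ((\<lambda>t. f (x(i := t))) has_real_derivative g2 x) (at (x i))" "C_k m k S2 g2"
   using Suc.prems i by (metis C_k.simps(2))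
  define g where "g x = (if x : S1 then g1 x else g2 x)" for x
  have "g x = g2 x" if "x : S2" for x
   using g(1,3)[of x] that DERIV_unique by (auto simp: g_def)
  then have "C_k m k S2 g" using C_k_cong[OF S(2) _ g(4)] by simp
  moreover have "C_k m k S1 g" using C_k_cong[OF S(1) _ g(2)] by (simp add: g_def)
  ultimately have "C_k m k (S1 \<union> S2) g" using Suc.IH by blast
  moreover have "((\<lambda>t. f (x(i := t))) has_real_derivative g x) (at (x i))" if "x : S1 \<union> S2" for x
   using g(1,3) that by (auto simp: g_def)
  ultimately show ?thesis by blast
 qed
 moreover have "continuous_map (subtopology (Euclidean_space m) (S1 \<union> S2)) euclideanreal f"
  by (rule continuous_map_open_Un[OF S]) (use Suc.prems C_k_continuous in blast)+
 ultimately show ?case by simp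
qed

lemma smooth_cong: "[|openin (Euclidean_space m) S; \<And>x. x : S ==> f x = g x; smooth m S f|] ==> smooth m S g"
 unfolding smooth_def using C_k_cong by blast

lemma C_k_sum:
 assumes "\<And>i. i : I ==> C_k m k S (f i)"
 shows "C_k m k S (\<lambda>x. \<Sum>i\<in>I. f i x)"
 using assms
 by (induction I rule: infinite_finite_induct) (simp_all add: C_k_const C_k_add)

text \<open>A class that contains the function \<open>exp (- 1 / t)\<close>, extended by zero to
  \<open>t \<le> 0\<close>, and is closed under derivatives: differentiation only brings in powers
  of \<open>1 / t\<close> and linear combinations.\<close>

inductive flat_exp :: "(real \<Rightarrow> real) \<Rightarrow> bool" where
 base: "flat_exp (\<lambda>t. if t > 0 then exp (- inverse t) * inverse t ^ n else 0)"
| add: "[|flat_exp f; flat_exp g|] ==> flat_exp (\<lambda>t. a * f t + b * g t)"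

lemma flat_exp_deriv: "flat_exp h ==> \<exists>h'. flat_exp h' \<and> (\<forall>t. (h has_real_derivative h' t) (at t))"
proof (induction rule: flat_exp.induct)
 case (base n)
 let ?e = "\<lambda>n t::real. if t > 0 then exp (- inverse t) * inverse t ^ n else 0"
 \<comment> \<open>The product rule for \<open>t > 0\<close>: the exponential contributes two
   further powers of \<open>1 / t\<close>, the power contributes one and the factor
   \<open>- n\<close>.\<close>
 let ?h' = "\<lambda>t. 1 * ?e (n + 2) t + (- real n) * ?e (n + 1) t"
 have "(?e n has_real_derivative ?h' t) (at t)" for t
 proof -
  consider "t > 0" | "t < 0" | "t = 0" by linarith
  then show ?thesis
  proof cases
   case 1
   have "((\<lambda>t. exp (- inverse t) * inverse t ^ n) has_real_derivative ?h' t) (at t)"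
   proof -
    have inv: "(inverse has_real_derivative - (inverse t * inverse t)) (at t)"
     using DERIV_inverse[of t] 1 by (simp add: power2_eq_square)
    have "((\<lambda>t. exp (- inverse t)) has_real_derivative exp (- inverse t) * (inverse t * inverse t)) (at t)"
     using DERIV_chain2[OF DERIV_exp DERIV_minus[OF inv]] by simp
    moreover have "((\<lambda>t. inverse t ^ n) has_real_derivative - real n * inverse t ^ (n + 1)) (at t)"
     using DERIV_power[OF inv, of n] by (cases n) (simp_all add: algebra_simps)
    ultimately have "((\<lambda>t. exp (- inverse t) * inverse t ^ n) has_real_derivative
      exp (- inverse t) * (inverse t * inverse t) * inverse t ^ n +
      - real n * inverse t ^ (n + 1) * exp (- inverse t)) (at t)"
     by (rule DERIV_mult)
    then show ?thesis using 1 by (simp add: algebra_simps)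
   qed
   moreover have ev: "\<forall>\<^sub>F s in nhds t. exp (- inverse s) * inverse s ^ n = ?e n s"
    using eventually_nhds_in_open[of "{0<..}" t] 1 by (auto elim: eventually_mono)
   ultimately show ?thesis by (rule DERIV_cong_ev[OF refl _ refl, THEN iffD1, rotated])
  next
   case 2
   have "((\<lambda>t. 0) has_real_derivative ?h' t) (at t)" using 2 by simp
   moreover have "\<forall>\<^sub>F s in nhds t. 0 = ?e n s"
    using eventually_nhds_in_open[of "{..<0}" t] 2 by (auto elim: eventually_mono)
   ultimately show ?thesis by (rule DERIV_cong_ev[OF refl _ refl, THEN iffD1, rotated])
  next
   case 3
   \<comment> \<open>At 0 the difference quotient from the right is
     \<open>x ^ (n + 1) / exp x\<close> for \<open>x = 1 / t\<close>, where \<open>x\<close> tends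
     to infinity.\<close>
   have "((\<lambda>x::real. x ^ (n + 1) / exp x) \<longlongrightarrow> 0) at_top" by (rule tendsto_power_div_exp_0)
   then have "((\<lambda>t::real. inverse t ^ (n + 1) / exp (inverse t)) \<longlongrightarrow> 0) (at_right 0)"
    by (rule filterlim_compose[OF _ filterlim_inverse_at_top_right])
   moreover have "\<forall>\<^sub>F t::real in at_right 0. inverse t ^ (n + 1) / exp (inverse t) = (?e n (0 + t) - ?e n 0) / t"
    using eventually_at_right_less[of "0::real"]
    by eventually_elim (simp add: exp_minus field_simps)
   ultimately have r: "((\<lambda>t. (?e n (0 + t) - ?e n 0) / t) \<longlongrightarrow> 0) (at_right 0)"
    by (rule Lim_transform_eventually)
   have "\<forall>\<^sub>F t::real in at_left 0. 0 = (?e n (0 + t) - ?e n 0) / t"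
    by (auto simp: eventually_at_filter intro!: always_eventually)
   then have l: "((\<lambda>t. (?e n (0 + t) - ?e n 0) / t) \<longlongrightarrow> 0) (at_left 0)"
    by (rule Lim_transform_eventually[OF tendsto_const])
   have "(?e n has_real_derivative 0) (at 0)"
    unfolding DERIV_def using filterlim_at_split l r by blast
   then show ?thesis using 3 by simp
  qed
 qed
 moreover have "flat_exp ?h'" by (intro flat_exp.intros)
 ultimately show ?case by blast
next
 case (add f g a b)
 then obtain f' g' where *: "flat_exp f'" "\<And>t. (f has_real_derivative f' t) (at t)"
  "flat_exp g'" "\<And>t. (g has_real_derivative g' t) (at t)" by blast
 have "flat_exp (\<lambda>t. a * f' t + b * g' t)" using * by (intro flat_exp.intros)
 moreover have "((\<lambda>t. a * f t + b * g t) has_real_derivative a * f' t + b * g' t) (at t)" for t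
  using * by (intro DERIV_add DERIV_cmult)
 ultimately show ?case by blast
qed

definition bump0 :: "real \<Rightarrow> real" where "bump0 t = (if t > 0 then exp (- inverse t) else 0)"

lemma flat_exp_bump0: "flat_exp bump0"
 using flat_exp.base[of 0] by (simp add: bump0_def[abs_def] if_distrib cong: if_cong)

lemma Euclidean_box:
 assumes "openin (Euclidean_space m) W" "a : W"
 obtains e where "e > 0" "\<And>y. [|y : topspace (Euclidean_space m); \<And>i. i < m ==> \<bar>y i - a i\<bar> < e|] ==> y : W"
proof -
 obtain W' where W': "openin (powertop_real UNIV) W'" "W = W' \<inter> {x. \<forall>i\<ge>m. x i = 0}"
  using assms(1) by (auto simp: Euclidean_space_def openin_subtopology)
 then obtain U where U: "\<And>i. open (U i)" "a : Pi\<^sub>E UNIV U" "Pi\<^sub>E UNIV U \<subseteq> W'"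
 proof -
  have "a : W'" using assms(2) W'(2) by blast
  then have "\<exists>U. (\<forall>i\<in>UNIV. openin euclideanreal (U i)) \<and> a : Pi\<^sub>E UNIV U \<and> Pi\<^sub>E UNIV U \<subseteq> W'"
   using W'(1) unfolding openin_product_topology_alt by (elim ballE[of _ _ a]) blast+
  then obtain U where "\<forall>i\<in>UNIV. openin euclideanreal (U i)" "a : Pi\<^sub>E UNIV U" "Pi\<^sub>E UNIV U \<subseteq> W'"
   by (elim exE conjE)
  then show thesis by (intro that[of U]) simp_all
 qed
 have "\<exists>e>0. \<forall>t. \<bar>t - a i\<bar> < e \<longrightarrow> t : U i" for i
  using U(1)[of i] U(2) unfolding open_dist by (auto simp: dist_real_def PiE_iff)
 then obtain e where e: "\<And>i. e i > 0" "\<And>i t. \<bar>t - a i\<bar> < e i ==> t : U i" by metis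
 show ?thesis
 proof (rule that)
  \<comment> \<open>The inserted 1 keeps the minimum defined and positive when
    \<open>m = 0\<close>.\<close>
  let ?e = "Min (insert 1 (e ` {..<m}))"
  show "?e > 0" using e(1) by simp
  fix y assume y: "y : topspace (Euclidean_space m)" "\<And>i. i < m ==> \<bar>y i - a i\<bar> < ?e"
  have "y i : U i" for i
  proof (cases "i < m")
   case True
   then have "?e \<le> e i" by (intro Min_le) auto
   then show ?thesis using e(2)[of "y i" i] y(2)[OF True] by linarith
  next
   case False
   then have "y i = a i" using y(1) assms W'(2) by (simp add: topspace_Euclidean_space)
   then show ?thesis using U(2) by auto
  qed
  then have "y : W'" using U(3) by auto
  then show "y : W" using y(1) W'(2) by (simp add: topspace_Euclidean_space)
 qed
qed

section \<open>Smooth functions and bump functions on a manifold\<close>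

locale manifold =
 fixes m :: nat and T :: "'x topology" and \<A> :: "'x chart set"
 assumes manifold: "smooth_manifold m T \<A>"
begin

lemma chart:
 assumes "(V, c) : \<A>"
 shows "openin T V" "homeomorphic_map (subtopology T V) (subtopology (Euclidean_space m) (c ` V)) c"
  "openin (Euclidean_space m) (c ` V)" "inj_on c V"
proof -
 show V: "openin T V" and h: "homeomorphic_map (subtopology T V) (subtopology (Euclidean_space m) (c ` V)) c"
  and "openin (Euclidean_space m) (c ` V)"
  using manifold assms by (auto simp: smooth_manifold_def)
 show "inj_on c V"
  using homeomorphic_imp_injective_map[OF h] openin_subset[OF V] by (simp add: inf.absorb2)
qed

lemma chart_open:
 assumes "(V, c) : \<A>" "openin T U"
 shows "openin (Euclidean_space m) (c ` (U \<inter> V))"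
proof -
 note ch = chart[OF assms(1)]
 have "openin (subtopology T V) (U \<inter> V)" using assms(2) by (auto simp: openin_subtopology)
 then have "openin (subtopology (Euclidean_space m) (c ` V)) (c ` (U \<inter> V))"
  using homeomorphic_map_openness_eq[OF ch(2)] by blast
 then show ?thesis using ch(3) openin_trans_full by blast
qed

lemma smooth_function_restrict:
 assumes f: "smooth_function m \<A> U f" and "openin T U" "openin T V" "V \<subseteq> U"
 shows "smooth_function m \<A> V (restrict f V)"
 unfolding smooth_function_def
proof (clarify)
 fix W c assume Wc: "(W, c) : \<A>"
 have "smooth m (c ` (U \<inter> W)) (\<lambda>y. f (inv_into W c y))"
  using f Wc by (auto simp: smooth_function_def)
 moreover have "c ` (V \<inter> W) \<subseteq> c ` (U \<inter> W)" using assms by blast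
 ultimately have "smooth m (c ` (V \<inter> W)) (\<lambda>y. f (inv_into W c y))"
  unfolding smooth_def using C_k_subset by blast
 then show "smooth m (c ` (V \<inter> W)) (\<lambda>y. restrict f V (inv_into W c y))"
  by (rule smooth_cong[OF chart_open[OF Wc \<open>openin T V\<close>], rotated])
   (use chart(4)[OF Wc] in auto)
qed

lemma smooth_function_binary:
 assumes "openin T U" "smooth_function m \<A> U f" "smooth_function m \<A> U g"
  and F: "\<And>k S f g. [|C_k m k S f; C_k m k S g|] ==> C_k m k S (\<lambda>x. F (f x) (g x))"
 shows "smooth_function m \<A> U (\<lambda>x\<in>U. F (f x) (g x))"
 unfolding smooth_function_def
proof (clarify)
 fix W c assume Wc: "(W, c) : \<A>"
 have "smooth m (c ` (U \<inter> W)) (\<lambda>y. F (f (inv_into W c y)) (g (inv_into W c y)))"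
  using assms(2,3) Wc F unfolding smooth_function_def smooth_def by blast
 then show "smooth m (c ` (U \<inter> W)) (\<lambda>y. (\<lambda>x\<in>U. F (f x) (g x)) (inv_into W c y))"
  by (rule smooth_cong[OF chart_open[OF Wc \<open>openin T U\<close>], rotated])
   (use chart(4)[OF Wc] in auto)
qed

lemma smooth_function_const: "openin T U ==> smooth_function m \<A> U (\<lambda>x\<in>U. r)"
 unfolding smooth_function_def
proof (clarify)
 fix W c assume "openin T U" and Wc: "(W, c) : \<A>"
 have "smooth m (c ` (U \<inter> W)) (\<lambda>y. r)" by (simp add: smooth_def C_k_const)
 then show "smooth m (c ` (U \<inter> W)) (\<lambda>y. (\<lambda>x\<in>U. r) (inv_into W c y))"
  by (rule smooth_cong[OF chart_open[OF Wc \<open>openin T U\<close>], rotated])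
   (use chart(4)[OF Wc] in auto)
qed

lemma transition_smooth:
 assumes "(U, c) : \<A>" "(V, d) : \<A>" "i < m"
 shows "smooth m (c ` (U \<inter> V)) (\<lambda>y. d (inv_into U c y) i)"
proof -
 have *: "\<forall>(U, c)\<in>\<A>. \<forall>(V, d)\<in>\<A>. \<forall>i<m. smooth m (c ` (U \<inter> V)) (\<lambda>y. d (inv_into U c y) i)"
  using manifold unfolding smooth_manifold_def by (elim conjE)
 from bspec[OF * assms(1)] have "\<forall>(V, d)\<in>\<A>. \<forall>i<m. smooth m (c ` (U \<inter> V)) (\<lambda>y. d (inv_into U c y) i)"
  by simp
 from bspec[OF this assms(2)] show ?thesis using assms(3) by simp
qed

text \<open>In a chart around \<open>x\<close> the function is a quotient of flat exponentials in
  the squared distance \<open>q\<close> from \<open>c x\<close>. The set \<open>C\<close> is the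
  preimage of a closed ball. It is compact by the chart and hence closed in the whole manifold by
  the Hausdorff property, so the complement of \<open>C\<close> is open and the extension by zero is
  smooth.\<close>

lemma bump_function:
 assumes U: "openin T U" and x: "x : U"
 obtains \<rho> V C where "\<rho> : extensional U" "smooth_function m \<A> U \<rho>" "openin T V" "x : V" "V \<subseteq> C"
  "closedin T C" "C \<subseteq> U" "\<And>y. y : V ==> \<rho> y = 1" "\<And>y. y : U - C ==> \<rho> y = 0"
proof -
 have "x : topspace T" using openin_subset[OF U] x by blast
 then obtain V c where Vc: "(V, c) : \<A>" "x : V"
  using manifold unfolding smooth_manifold_def by blast
 note ch = chart[OF Vc(1)]
 have VT: "V \<subseteq> topspace T" using openin_subset[OF ch(1)] .
 define a where "a = c x"
 obtain e where e: "e > 0" "\<And>y. [|y : topspace (Euclidean_space m); \<And>i. i < m ==> \<bar>y i - a i\<bar> < e|] ==> y : c ` (U \<inter> V)"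
  using Euclidean_box[OF chart_open[OF Vc(1) U], of a] x Vc(2) by (auto simp: a_def)
 \<comment> \<open>The outer ball has radius \<open>2 d\<close>, which has to be less than
   \<open>e\<close> for the ball to fit into the box; the inner ball has radius
   \<open>d\<close>.\<close>
 define d where "d = e / 3"
 have d: "d > 0" "2 * d < e" using e(1) by (auto simp: d_def)
 define q where "q y = (\<Sum>i<m. (y i - a i)^2)" for y :: "nat \<Rightarrow> real"
 have q_cont: "continuous_map (Euclidean_space m) euclideanreal q"
  unfolding q_def
  by (intro continuous_map_sum continuous_map_real_pow continuous_map_diff continuous_map_Euclidean_coordinate) auto
 have q_bound: "\<bar>y i - a i\<bar> \<le> 2 * d" if "q y \<le> 4 * d^2" "i < m" for y i
 proof -
  have "(y i - a i)^2 \<le> q y"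
   unfolding q_def using that(2) by (intro member_le_sum) auto
  then have "(y i - a i)^2 \<le> (2 * d)^2" using that(1) by (simp add: power_mult_distrib)
  then show ?thesis using d(1) by (metis abs_le_square_iff abs_of_pos mult_pos_pos zero_less_numeral)
 qed
 define K where "K = {y : topspace (Euclidean_space m). q y \<le> 4 * d^2}"
 have K_sub: "K \<subseteq> c ` (U \<inter> V)"
 proof
  fix y assume "y : K"
  then show "y : c ` (U \<inter> V)"
   using q_bound[of y] d(2) by (intro e(2)) (auto simp: K_def intro: le_less_trans)
 qed
 \<comment> \<open>Compactness of the ball \<open>K\<close>: it is closed and lies in a product of
   compact intervals, with the single point 0 in every coordinate from \<open>m\<close> on.\<close>
 have "compactin (Euclidean_space m) (PiE UNIV (\<lambda>i. if i < m then {a i - 2 * d..a i + 2 * d} else {0}))"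
  unfolding Euclidean_space_def compactin_subtopology compactin_PiE
  by (auto simp: PiE_iff split: if_splits)
 moreover have "K \<subseteq> PiE UNIV (\<lambda>i. if i < m then {a i - 2 * d..a i + 2 * d} else {0})"
  using q_bound by (fastforce simp: K_def topspace_Euclidean_space abs_le_iff)
 moreover have "closedin (Euclidean_space m) K"
  using closedin_continuous_map_preimage[OF q_cont, of "{..4 * d^2}"] by (simp add: K_def)
 ultimately have K: "compactin (Euclidean_space m) K" by (rule closed_compactin)
 define C where "C = {z : V. q (c z) \<le> 4 * d^2}"
 have cV: "c z : topspace (Euclidean_space m)" if "z : V" for z
  using openin_subset[OF ch(3)] that by blast
 have cC: "c ` C = K"
  using K_sub cV by (auto simp: C_def K_def)
 have CU: "C \<subseteq> U"
 proof
  fix z assume z: "z : C"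
  then obtain w where "w : U \<inter> V" "c z = c w" using K_sub cC by blast
  then show "z : U" using inj_onD[OF ch(4)] z by (auto simp: C_def)
 qed
 have "compactin (subtopology (Euclidean_space m) (c ` V)) (c ` C)"
  using K cC K_sub by (auto simp: compactin_subtopology)
 then have "compactin (subtopology T V) C"
  using homeomorphic_map_compactness[OF ch(2), of C] VT by (auto simp: C_def)
 then have "compactin T C" by (simp add: compactin_subtopology)
 moreover have "Hausdorff_space T" using manifold by (simp add: smooth_manifold_def)
 ultimately have C_closed: "closedin T C" using compactin_imp_closedin by blast
 have qc: "continuous_map (subtopology T V) euclideanreal (\<lambda>z. q (c z))"
 proof -
  have "continuous_map (subtopology T V) (Euclidean_space m) c"
   using homeomorphic_imp_continuous_map[OF ch(2)] continuous_map_in_subtopology by blast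
  from continuous_map_compose[OF this q_cont] show ?thesis by (simp add: o_def)
 qed
 define V' where "V' = {z : V. q (c z) < d^2}"
 have "openin (subtopology T V) {z : topspace (subtopology T V). q (c z) : {..<d^2}}"
  by (rule openin_continuous_map_preimage[OF qc]) simp
 moreover have "{z : topspace (subtopology T V). q (c z) : {..<d^2}} = V'"
  using VT by (auto simp: V'_def)
 ultimately have V'_open: "openin T V'" using ch(1) openin_trans_full by metis
 \<comment> \<open>Equal to 1 below \<open>d^2\<close>, where the second summand of the denominator
   is zero, and to 0 beyond \<open>4 d^2\<close>, where the numerator is. Since
   \<open>d^2 < 4 d^2\<close>, the two summands are never zero together.\<close>
 define \<phi> where "\<phi> t = bump0 (4 * d^2 - t) * inverse (bump0 (4 * d^2 - t) + bump0 (t - d^2))" for t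
 have pos: "bump0 (4 * d^2 - t) + bump0 (t - d^2) > 0" for t
 proof -
  have "4 * d^2 - t > 0 \<or> t - d^2 > 0" using d(1) by (smt (verit) zero_less_power)
  moreover have "bump0 s \<ge> 0" "s > 0 ==> bump0 s > 0" for s by (simp_all add: bump0_def)
  ultimately show ?thesis by (metis add_nonneg_pos add_pos_nonneg)
 qed
 have \<phi>1: "\<phi> t = 1" if "t < d^2" for t
  using pos[of t] that by (simp add: \<phi>_def bump0_def)
 have \<phi>0: "\<phi> t = 0" if "t > 4 * d^2" for t
  using that by (simp add: \<phi>_def bump0_def)
 define \<rho> where "\<rho> = (\<lambda>z\<in>U. if z : V then \<phi> (q (c z)) else 0)"
 have \<rho>0: "\<rho> z = 0" if "z : U - C" for z
  using that \<phi>0 by (auto simp: \<rho>_def C_def)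
 have "smooth_function m \<A> U \<rho>"
  unfolding smooth_function_def
 proof (clarify)
  fix W b assume Wb: "(W, b) : \<A>"
  note cw = chart[OF Wb]
  \<comment> \<open>Smoothness is checked on two open sets that cover the image of
    \<open>U \<inter> W\<close>: the part inside the chart \<open>V\<close>, where the formula
    holds, and the part outside \<open>C\<close>, where \<open>\<rho>\<close> is zero.\<close>
  let ?S1 = "b ` ((U \<inter> V) \<inter> W)" and ?S2 = "b ` ((U - C) \<inter> W)"
  have o1: "openin (Euclidean_space m) ?S1"
   by (rule chart_open[OF Wb]) (use U ch(1) in auto)
  have o2: "openin (Euclidean_space m) ?S2"
   by (rule chart_open[OF Wb]) (use U C_closed in \<open>auto intro: openin_diff\<close>)
  have inv: "inv_into W b (b z) = z" if "z : W" for z using cw(4) that by simp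
  have coord: "C_k m k ?S1 (\<lambda>y. c (inv_into W b y) i)" if "i < m" for k i
  proof -
   have "smooth m (b ` (W \<inter> V)) (\<lambda>y. c (inv_into W b y) i)"
    by (rule transition_smooth[OF Wb Vc(1) that])
   then have "C_k m k (b ` (W \<inter> V)) (\<lambda>y. c (inv_into W b y) i)" by (simp add: smooth_def)
   then show ?thesis by (rule C_k_subset) blast
  qed
  have "C_k m k ?S1 (\<lambda>y. \<phi> (q (c (inv_into W b y))))" for k
  proof -
   have "C_k m k ?S1 (\<lambda>y. (c (inv_into W b y) i + - a i) * (c (inv_into W b y) i + - a i))" if "i < m" for i
    using coord[OF that] by (intro C_k_mult C_k_add C_k_const)
   then have "C_k m k ?S1 (\<lambda>y. q (c (inv_into W b y)))"
    unfolding q_def by (intro C_k_sum) (simp add: power2_eq_square)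
   then have Q: "C_k m k ?S1 (\<lambda>y. r * q (c (inv_into W b y)) + s)" for r s
    by (intro C_k_mult C_k_add C_k_const)
   have "C_k m k ?S1 (\<lambda>y. bump0 (r * q (c (inv_into W b y)) + s))" for r s
    by (rule C_k_compose[where Q = flat_exp, OF flat_exp_deriv flat_exp_bump0 Q])
   from this[of "-1" "4 * d^2"] this[of 1 "- (d^2)"]
   have "C_k m k ?S1 (\<lambda>y. bump0 (4 * d^2 - q (c (inv_into W b y))))"
    "C_k m k ?S1 (\<lambda>y. bump0 (q (c (inv_into W b y)) - d^2))" by (simp_all add: algebra_simps)
   then show ?thesis
    unfolding \<phi>_def using pos by (intro C_k_mult C_k_inverse C_k_add) (auto simp: less_imp_neq[symmetric])
  qed
  then have "C_k m k ?S1 (\<lambda>y. \<rho> (inv_into W b y))" for k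
   by (rule C_k_cong[OF o1, rotated]) (auto simp: \<rho>_def inv)
  moreover have "C_k m k ?S2 (\<lambda>y. \<rho> (inv_into W b y))" for k
   by (rule C_k_cong[OF o2 _ C_k_const[of _ _ _ 0]]) (use \<rho>0 in \<open>auto simp: inv\<close>)
  ultimately have "smooth m (?S1 \<union> ?S2) (\<lambda>y. \<rho> (inv_into W b y))"
   unfolding smooth_def using C_k_Un[OF o1 o2] by blast
  moreover have "?S1 \<union> ?S2 = b ` (U \<inter> W)" by (auto simp: C_def)
  ultimately show "smooth m (b ` (U \<inter> W)) (\<lambda>y. \<rho> (inv_into W b y))" by simp
 qed
 moreover have "x : V'" using Vc(2) d(1) by (simp add: V'_def q_def a_def)
 moreover have "V' \<subseteq> C"
 proof
  fix z assume "z : V'"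
  then have "z : V" "q (c z) < d^2" by (simp_all add: V'_def)
  moreover have "d^2 \<le> 4 * d^2" by simp
  ultimately show "z : C" unfolding C_def by (intro CollectI conjI) linarith+
 qed
 moreover have "\<rho> y = 1" if "y : V'" for y
  using that \<phi>1 CU \<open>V' \<subseteq> C\<close> by (auto simp: \<rho>_def V'_def)
 ultimately show ?thesis
  using that[of \<rho> V' C] V'_open C_closed CU \<rho>0 by (auto simp: \<rho>_def)
qed

end

section \<open>Even bump sections of the structure sheaf\<close>

lemma one_tensor: "\<one>\<^bsub>tensor R A B act\<^esub> = pure_tensor R A B \<one>\<^bsub>A\<^esub> \<one>\<^bsub>B\<^esub>"
 by (simp add: tensor_def)

lemma abelian_group_exterior_alg: "abelian_group (exterior_alg n)"
proof (rule abelian_groupI)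
 show "\<exists>y\<in>carrier (exterior_alg n). y \<oplus>\<^bsub>exterior_alg n\<^esub> x = \<zero>\<^bsub>exterior_alg n\<^esub>" if "x : carrier (exterior_alg n)" for x
  by (rule bexI[of _ "\<lambda>I. - x I"]) (use that in \<open>simp_all add: exterior_alg_def\<close>)
qed (simp_all add: exterior_alg_def fun_eq_iff add.assoc)

context small_alg begin

lemma tensor_pair_P:
 assumes "abelian_group M" "\<And>r. addmap M M (\<lambda>x. r \<odot>\<^bsub>M\<^esub> x)"
 shows "tensor_pair real_alg P M"
 by (rule tensor_pair.intro[OF P.abg assms(1) PG.grade_subset])
  (simp add: real_smult_closed, rule addmap_closed[OF assms(2)], assumption)

lemma pure_P_smult:
 assumes M: "abelian_group M" "\<And>r. addmap M M (\<lambda>x. r \<odot>\<^bsub>M\<^esub> x)" and p: "p : carrier P" and x: "x : carrier M"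
 shows "pure_tensor real_alg P M (r \<odot>\<^bsub>P\<^esub> p) x = pure_tensor real_alg P M p (r \<odot>\<^bsub>M\<^esub> x)"
proof -
 interpret PM: tensor_pair real_alg P M by (rule tensor_pair_P[OF M])
 note rx = addmap_closed[OF M(2) x]
 show ?thesis
 proof (rule PG.addmaps_eq[OF _ _ _ p])
  show "addmap P (tensor real_alg P M undefined) (\<lambda>p. pure_tensor real_alg P M (r \<odot>\<^bsub>P\<^esub> p) x)"
   by (rule addmap_comp[OF P.additive_smult PM.additive_pure_left[OF x]]) simp
  show "addmap P (tensor real_alg P M undefined) (\<lambda>p. pure_tensor real_alg P M p (r \<odot>\<^bsub>M\<^esub> x))"
   by (rule PM.additive_pure_left[OF rx])
  fix i q assume "q : grade P i"
  from PM.pure_smult[OF this _ x, of r 0]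
  show "pure_tensor real_alg P M (r \<odot>\<^bsub>P\<^esub> q) x = pure_tensor real_alg P M q (r \<odot>\<^bsub>M\<^esub> x)"
   by (simp add: koszul_def)
 qed
qed

lemma tensor_map_P_pure:
 assumes M: "abelian_group M" "\<And>r. addmap M M (\<lambda>x. r \<odot>\<^bsub>M\<^esub> x)"
  and M': "abelian_group M'" "\<And>r. addmap M' M' (\<lambda>x. r \<odot>\<^bsub>M'\<^esub> x)"
  and k: "addmap M M' k" "\<And>r x. x : carrier M ==> k (r \<odot>\<^bsub>M\<^esub> x) = r \<odot>\<^bsub>M'\<^esub> k x"
  and p: "p : carrier P" and x: "x : carrier M"
 shows "tensor_map real_alg P M' id k (pure_tensor real_alg P M p x) = pure_tensor real_alg P M' p (k x)"
proof -
 interpret PM: tensor_pair real_alg P M by (rule tensor_pair_P[OF M])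
 interpret PM': tensor_pair real_alg P M' by (rule tensor_pair_P[OF M'])
 note kc = addmap_closed[OF k(1)]
 have "balanced real_alg P M (tensor real_alg P M' undefined) (\<lambda>p x. pure_tensor real_alg P M' (id p) (k x))"
 proof (rule balanced_realI[OF P.abg M(1) PM'.abelian_group_tensor _ _ PG.grade_subset])
  show "addmap P (tensor real_alg P M' undefined) (\<lambda>p. pure_tensor real_alg P M' (id p) (k x))" if "x : carrier M" for x
   using PM'.additive_pure_left[OF kc[OF that]] by (simp only: id_apply)
  show "addmap M (tensor real_alg P M' undefined) (\<lambda>x. pure_tensor real_alg P M' (id p) (k x))" if "p : carrier P" for p
   using addmap_comp[OF k(1) PM'.additive_pure_right[OF that]] by (simp only: id_apply)
  show "0 \<odot>\<^bsub>P\<^esub> p = \<zero>\<^bsub>P\<^esub>" if "p : carrier P" for p using P.smult_zero_left[OF that] by simp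
  show "pure_tensor real_alg P M' (id (r \<odot>\<^bsub>P\<^esub> p)) (k x) = pure_tensor real_alg P M' (id p) (k (r \<odot>\<^bsub>M\<^esub> x))"
   if "p : carrier P" "x : carrier M" for r p x
   using pure_P_smult[OF M' that(1) kc[OF that(2)], of r] k(2)[OF that(2), of r] by (simp only: id_apply)
 qed
 note ev = PM'.tensor_map_eval(2)[where g = id and h = k, OF PM.tensor_pair_axioms _ kc this p x]
 show ?thesis using ev by (simp only: id_apply)
qed

end

section \<open>Tensor products of smooth functions with the exterior algebra\<close>

context manifold begin

abbreviation CI where "CI W \<equiv> sec (smooth_sheaf m \<A>) W"

lemma CI_simps:
 "carrier (CI W) = {f : extensional W. smooth_function m \<A> W f}"
 "f \<oplus>\<^bsub>CI W\<^esub> g = (\<lambda>x\<in>W. f x + g x)" "\<zero>\<^bsub>CI W\<^esub> = (\<lambda>x\<in>W. 0)" "\<one>\<^bsub>CI W\<^esub> = (\<lambda>x\<in>W. 1)"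
 "r \<odot>\<^bsub>CI W\<^esub> f = (\<lambda>x\<in>W. r * f x)"
 "grade (CI W) i = (if i = 0 then {f : extensional W. smooth_function m \<A> W f} else {\<lambda>x\<in>W. 0})"
 "res (smooth_sheaf m \<A>) W W' f = restrict f W'"
 by (simp_all add: smooth_sheaf_def)

lemma CI_smult_closed: "[|openin T W; f : carrier (CI W)|] ==> r \<odot>\<^bsub>CI W\<^esub> f : carrier (CI W)"
 unfolding CI_simps using smooth_function_binary[of W f f "\<lambda>a b. r * a"] C_k_mult[OF C_k_const] by auto

lemma CI_add_closed: "[|openin T W; f : carrier (CI W); g : carrier (CI W)|] ==> f \<oplus>\<^bsub>CI W\<^esub> g : carrier (CI W)"
 unfolding CI_simps using smooth_function_binary[of W f g "\<lambda>a b. a + b"] C_k_add by auto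

lemma CI_const_closed: "openin T W ==> (\<lambda>x\<in>W. r) : carrier (CI W)"
 unfolding CI_simps using smooth_function_const by auto

lemma CI_eqI: "[|f : extensional W; g : extensional W; \<And>x. x : W ==> f x = g x|] ==> f = g"
 by (rule extensionalityI)

lemma abelian_group_CI: assumes W: "openin T W" shows "abelian_group (CI W)"
proof (rule abelian_groupI)
 show "\<exists>g\<in>carrier (CI W). g \<oplus>\<^bsub>CI W\<^esub> f = \<zero>\<^bsub>CI W\<^esub>" if f: "f : carrier (CI W)" for f
 proof (rule bexI[OF _ CI_smult_closed[OF W f, of "-1"]])
  show "(-1 \<odot>\<^bsub>CI W\<^esub> f) \<oplus>\<^bsub>CI W\<^esub> f = \<zero>\<^bsub>CI W\<^esub>" unfolding CI_simps by (rule restrict_ext) simp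
 qed
 show "\<zero>\<^bsub>CI W\<^esub> : carrier (CI W)" unfolding CI_simps(3) by (rule CI_const_closed[OF W])
 show "\<zero>\<^bsub>CI W\<^esub> \<oplus>\<^bsub>CI W\<^esub> f = f" if "f : carrier (CI W)" for f
  by (rule CI_eqI[of _ W]) (use that in \<open>simp_all add: CI_simps\<close>)
 show "f \<oplus>\<^bsub>CI W\<^esub> g = g \<oplus>\<^bsub>CI W\<^esub> f" for f g unfolding CI_simps by (rule restrict_ext) simp
 show "(f \<oplus>\<^bsub>CI W\<^esub> g) \<oplus>\<^bsub>CI W\<^esub> h = f \<oplus>\<^bsub>CI W\<^esub> (g \<oplus>\<^bsub>CI W\<^esub> h)" for f g h unfolding CI_simps by (rule restrict_ext) simp
qed (rule CI_add_closed[OF W])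

lemma tensor_pair_CI: assumes W: "openin T W" shows "tensor_pair real_alg (CI W) (exterior_alg n)"
proof (rule tensor_pair.intro[OF abelian_group_CI[OF W] abelian_group_exterior_alg])
 show "grade (CI W) i \<subseteq> carrier (CI W)" for i
  using CI_const_closed[OF W, of 0] by (simp add: CI_simps)
 show "\<And>r j f. [|r : grade real_alg j; f : carrier (CI W)|] ==> r \<odot>\<^bsub>CI W\<^esub> f : carrier (CI W)" by (rule CI_smult_closed[OF W])
 show "\<And>r j f. [|r : grade real_alg j; f : carrier (exterior_alg n)|] ==> r \<odot>\<^bsub>exterior_alg n\<^esub> f : carrier (exterior_alg n)"
  by (simp add: exterior_alg_def)
qed

abbreviation sp where "sp n W \<equiv> pure_tensor real_alg (CI W) (exterior_alg n)"
abbreviation SP where "SP n W \<equiv> sec (split_sheaf m n \<A>) W"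

lemma SP_tensor: "SP n W = tensor real_alg (CI W) (exterior_alg n) (smult (SP n W))"
 "smult (SP n W) = (\<lambda>r. tensor_map real_alg (CI W) (exterior_alg n) (smult (CI W) r) id)"
 by (simp_all add: split_sheaf_def left_tensor_def smult_tensor)

text \<open>Serves twice, for the multiplication by real scalars and for the restriction of sections
  of the split sheaf.\<close>

lemma split_map:
 assumes W: "openin T W" "openin T W'" and g: "addmap (CI W) (CI W') g"
  and gr: "\<And>r f. f : carrier (CI W) ==> g (r \<odot>\<^bsub>CI W\<^esub> f) = r \<odot>\<^bsub>CI W'\<^esub> g f"
 shows "addmap (SP n W) (SP n W') (tensor_map real_alg (CI W') (exterior_alg n) g id)"
  and "[|f : carrier (CI W); v : carrier (exterior_alg n)|] ==>
   tensor_map real_alg (CI W') (exterior_alg n) g id (sp n W f v) = sp n W' (g f) v"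
proof -
 interpret A: tensor_pair real_alg "CI W" "exterior_alg n" by (rule tensor_pair_CI[OF W(1)])
 interpret B: tensor_pair real_alg "CI W'" "exterior_alg n" by (rule tensor_pair_CI[OF W(2)])
 note gc = addmap_closed[OF g]
 have bal: "balanced real_alg (CI W) (exterior_alg n) (tensor real_alg (CI W') (exterior_alg n) (smult (SP n W')))
   (\<lambda>f v. sp n W' (g f) (id v))"
 proof (rule balanced_realI[OF A.abelian_left A.abelian_right B.abelian_group_tensor _ _ A.grade_left])
  show "addmap (CI W) (tensor real_alg (CI W') (exterior_alg n) (smult (SP n W'))) (\<lambda>f. sp n W' (g f) (id v))"
   if "v : carrier (exterior_alg n)" for v
   using addmap_comp[OF g B.additive_pure_left[OF that]] by (simp only: id_apply)
  show "addmap (exterior_alg n) (tensor real_alg (CI W') (exterior_alg n) (smult (SP n W'))) (\<lambda>v. sp n W' (g f) (id v))"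
   if "f : carrier (CI W)" for f
   using B.additive_pure_right[OF gc[OF that]] by (simp only: id_apply)
  show "0 \<odot>\<^bsub>CI W\<^esub> f = \<zero>\<^bsub>CI W\<^esub>" for f unfolding CI_simps by (rule restrict_ext) simp
  show "sp n W' (g (r \<odot>\<^bsub>CI W\<^esub> f)) (id v) = sp n W' (g f) (id (r \<odot>\<^bsub>exterior_alg n\<^esub> v))"
   if f: "f : carrier (CI W)" and v: "v : carrier (exterior_alg n)" for r f v
  proof -
   have "g f : grade (CI W') 0" using gc[OF f] by (simp add: CI_simps)
   from B.pure_smult[OF this _ v, of r 0]
   have "sp n W' (r \<odot>\<^bsub>CI W'\<^esub> g f) v = sp n W' (g f) (r \<odot>\<^bsub>exterior_alg n\<^esub> v)" by (simp add: koszul_def)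
   then show ?thesis by (simp only: id_apply gr[OF f])
  qed
 qed
 note ev = B.tensor_map_eval[where g = g and h = id, OF A.tensor_pair_axioms gc _ bal]
 show "addmap (SP n W) (SP n W') (tensor_map real_alg (CI W') (exterior_alg n) g id)"
  by (subst SP_tensor(1)[of n W], subst SP_tensor(1)[of n W'], rule ev(1)) (simp_all only: id_apply)
 show "tensor_map real_alg (CI W') (exterior_alg n) g id (sp n W f v) = sp n W' (g f) v"
  if "f : carrier (CI W)" "v : carrier (exterior_alg n)"
  using ev(2)[OF _ _ that] by (simp only: id_apply)
qed

lemma CI_smult_comm: "r \<odot>\<^bsub>CI W\<^esub> (s \<odot>\<^bsub>CI W\<^esub> f) = s \<odot>\<^bsub>CI W\<^esub> (r \<odot>\<^bsub>CI W\<^esub> f)"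
 unfolding CI_simps by (rule restrict_ext) simp

lemma additive_CI_smult: assumes W: "openin T W" shows "addmap (CI W) (CI W) (\<lambda>f. r \<odot>\<^bsub>CI W\<^esub> f)"
proof (rule addmapI)
 show "r \<odot>\<^bsub>CI W\<^esub> (f \<oplus>\<^bsub>CI W\<^esub> g) = r \<odot>\<^bsub>CI W\<^esub> f \<oplus>\<^bsub>CI W\<^esub> r \<odot>\<^bsub>CI W\<^esub> g" for f g
  unfolding CI_simps by (rule restrict_ext) (simp add: distrib_left)
qed (rule CI_smult_closed[OF W])

lemma SP_smult:
 assumes W: "openin T W"
 shows "addmap (SP n W) (SP n W) (\<lambda>x. r \<odot>\<^bsub>SP n W\<^esub> x)"
  and "[|f : carrier (CI W); v : carrier (exterior_alg n)|] ==> r \<odot>\<^bsub>SP n W\<^esub> sp n W f v = sp n W (r \<odot>\<^bsub>CI W\<^esub> f) v"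
 unfolding SP_tensor(2)
 by (rule split_map(1)[OF W W additive_CI_smult[OF W] CI_smult_comm],
   rule split_map(2)[OF W W additive_CI_smult[OF W] CI_smult_comm], assumption+)

lemma CI_restrict:
 assumes W: "openin T W" "openin T W'" "W' \<subseteq> W"
 shows "addmap (CI W) (CI W') (\<lambda>f. restrict f W')"
  and "restrict (r \<odot>\<^bsub>CI W\<^esub> f) W' = r \<odot>\<^bsub>CI W'\<^esub> restrict f W'"
proof -
 show "addmap (CI W) (CI W') (\<lambda>f. restrict f W')"
 proof (rule addmapI)
  show "restrict f W' : carrier (CI W')" if "f : carrier (CI W)" for f
   using that smooth_function_restrict[OF _ W] by (simp add: CI_simps)
  show "restrict (f \<oplus>\<^bsub>CI W\<^esub> g) W' = restrict f W' \<oplus>\<^bsub>CI W'\<^esub> restrict g W'" for f g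
   unfolding CI_simps by (rule ext) (use W(3) in \<open>auto simp: restrict_def\<close>)
 qed
 show "restrict (r \<odot>\<^bsub>CI W\<^esub> f) W' = r \<odot>\<^bsub>CI W'\<^esub> restrict f W'"
  unfolding CI_simps by (rule ext) (use W(3) in \<open>auto simp: restrict_def\<close>)
qed

lemma res_SP: "res (split_sheaf m n \<A>) W W' = tensor_map real_alg (CI W') (exterior_alg n) (\<lambda>f. restrict f W') id"
 by (simp add: split_sheaf_def smooth_sheaf_def)

lemma SP_res:
 assumes W: "openin T W" "openin T W'" "W' \<subseteq> W"
 shows "addmap (SP n W) (SP n W') (res (split_sheaf m n \<A>) W W')"
  and "[|f : carrier (CI W); v : carrier (exterior_alg n)|] ==>
   res (split_sheaf m n \<A>) W W' (sp n W f v) = sp n W' (restrict f W') v"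
 unfolding res_SP
 by (rule split_map(1)[OF W(1,2) CI_restrict[OF W]], rule split_map(2)[OF W(1,2) CI_restrict[OF W]], assumption+)

lemma abelian_group_SP: "openin T W ==> abelian_group (SP n W)"
 by (subst SP_tensor(1), rule tensor_pair.abelian_group_tensor[OF tensor_pair_CI])

lemma SP_res_smult:
 assumes W: "openin T W" "openin T W'" "W' \<subseteq> W" and x: "x : carrier (SP n W)"
 shows "res (split_sheaf m n \<A>) W W' (r \<odot>\<^bsub>SP n W\<^esub> x) = r \<odot>\<^bsub>SP n W'\<^esub> res (split_sheaf m n \<A>) W W' x"
proof -
 interpret A: tensor_pair real_alg "CI W" "exterior_alg n" by (rule tensor_pair_CI[OF W(1)])
 have l: "addmap (SP n W) (SP n W') (\<lambda>x. res (split_sheaf m n \<A>) W W' (r \<odot>\<^bsub>SP n W\<^esub> x))"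
  by (rule addmap_comp[OF SP_smult(1)[OF W(1)] SP_res(1)[OF W]])
 have l': "addmap (SP n W) (SP n W') (\<lambda>x. r \<odot>\<^bsub>SP n W'\<^esub> res (split_sheaf m n \<A>) W W' x)"
  by (rule addmap_comp[OF SP_res(1)[OF W] SP_smult(1)[OF W(2)]])
 show ?thesis
 proof (rule A.addmaps_eq[where act = "smult (SP n W)", folded SP_tensor(1)[of n W], OF l l' _ x])
  fix f v assume f: "f : carrier (CI W)" and v: "v : carrier (exterior_alg n)"
  show "res (split_sheaf m n \<A>) W W' (r \<odot>\<^bsub>SP n W\<^esub> sp n W f v) = r \<odot>\<^bsub>SP n W'\<^esub> res (split_sheaf m n \<A>) W W' (sp n W f v)"
   unfolding SP_smult(2)[OF W(1) f v] SP_res(2)[OF W f v] SP_res(2)[OF W CI_smult_closed[OF W(1) f] v]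
    SP_smult(2)[OF W(2) addmap_closed[OF CI_restrict(1)[OF W] f] v] CI_restrict(2)[OF W] ..
 qed
qed

end

lemma module_sheaf_iso_mono: "[|module_sheaf_iso T U \<O> E F \<psi>; U' \<subseteq> U|] ==> module_sheaf_iso T U' \<O> E F \<psi>"
 unfolding module_sheaf_iso_def commutes_with_res_def by (meson subset_trans)

locale supermanifold_bundle = vector_bundle T P pr \<O> E \<kappa> + manifold m T \<A>
 for T :: "'x topology" and P :: "(real, 'p) gmodule" and pr and \<O> :: "('x, 'p, 'o) gsheaf"
  and E :: "('x, 'o, 'e) gsheaf" and \<kappa> and m \<A> +
 fixes n :: nat
 assumes locally_split: "x : topspace T ==> \<exists>U. openin T U \<and> x : U \<and>
  (\<exists>\<psi>. algebra_sheaf_iso T U P \<O> (extend_alg P (split_sheaf m n \<A>)) \<psi>)"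
begin

text \<open>In a local splitting a bump function \<open>\<rho>\<close> gives the section
  \<open>1 \<otimes> (\<rho> \<otimes> 1)\<close>, which is pulled back to \<open>\<O>\<close> over
  \<open>U\<close> and extended by zero outside \<open>C\<close>. Restriction in the splitting acts
  on \<open>\<rho>\<close> alone, which yields the values 1 on \<open>V\<close> and 0 off
  \<open>C\<close>.\<close>

lemma bump_section:
 assumes U0: "openin T U0" "x : U0"
 obtains g U C V where "cutoff T P \<O> E g U C" "U \<subseteq> U0" "openin T V" "x : V" "V \<subseteq> U"
  "res \<O> \<Omega> V g = \<one>\<^bsub>sec \<O> V\<^esub>"
proof -
 have "x : \<Omega>" using openin_subset[OF U0(1)] U0(2) by blast
 from locally_split[OF this] obtain U1 \<psi> where U1: "openin T U1" "x : U1"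
  and \<psi>: "algebra_sheaf_iso T U1 P \<O> (extend_alg P (split_sheaf m n \<A>)) \<psi>" by (elim exE conjE)
 define U where "U = U1 \<inter> U0"
 have U: "openin T U" "x : U" "U \<subseteq> U1" "U \<subseteq> U0" using U0 U1 by (auto simp: U_def)
 obtain \<rho> V C where \<rho>: "\<rho> : extensional U" "smooth_function m \<A> U \<rho>" and V: "openin T V" "x : V" "V \<subseteq> C"
  and C: "closedin T C" "C \<subseteq> U" and \<rho>1: "\<And>y. y : V ==> \<rho> y = 1" and \<rho>0: "\<And>y. y : U - C ==> \<rho> y = 0"
  using bump_function[OF U(1,2)] by metis
 let ?X = "\<lambda>W. tensor real_alg P (SP n W) (\<lambda>s. tensor_map real_alg P (SP n W) ((\<otimes>\<^bsub>P\<^esub>) s) id)"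
 let ?p = "\<lambda>W. pure_tensor real_alg P (SP n W)"
 let ?e = "\<one>\<^bsub>exterior_alg n\<^esub>"
 have ec: "?e : carrier (exterior_alg n)" by (simp add: exterior_alg_def)
 have sX: "sec (extend_alg P (split_sheaf m n \<A>)) W = ?X W" for W
  unfolding extend_alg_def gsheaf.simps left_tensor_def ..
 note tp = tensor_pair_P[OF abelian_group_SP SP_smult(1)]
 have iso: "algebra_hom P (sec \<O> W) (?X W) (\<psi> W)" "bij_betw (\<psi> W) (MO W) (carrier (?X W))"
  if "openin T W" "W \<subseteq> U" for W
 proof -
  have "W \<subseteq> U1" using that(2) U(3) by (rule subset_trans)
  note i = conjunct2[OF \<psi>[unfolded algebra_sheaf_iso_def], rule_format, OF conjI[OF that(1) this], unfolded sX]
  show "algebra_hom P (sec \<O> W) (?X W) (\<psi> W)" "bij_betw (\<psi> W) (MO W) (carrier (?X W))"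
   by (rule conjunct1[OF i], rule conjunct2[OF i])
 qed
 have \<psi>res: "\<psi> W (res \<O> U W a) = tensor_map real_alg P (SP n W) id (res (split_sheaf m n \<A>) U W) (\<psi> U a)"
  if W: "openin T W" "W \<subseteq> U" and a: "a : MO U" for W a
  by (rule conjunct1[OF \<psi>[unfolded algebra_sheaf_iso_def], unfolded commutes_with_res_def extend_alg_def gsheaf.simps,
     rule_format, OF conjI[OF U(1) conjI[OF W(1) conjI[OF W(2) U(3)]]] a])
 have \<rho>c: "\<rho> : carrier (CI U)" using \<rho> by (simp add: CI_simps)
 have spc: "sp n W f ?e : carrier (SP n W)" if "openin T W" "f : carrier (CI W)" for W f
  by (subst SP_tensor(1), rule tensor_pair.pure_closed[OF tensor_pair_CI[OF that(1)] that(2) ec])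
 have "?p U \<one>\<^bsub>P\<^esub> (sp n U \<rho> ?e) : carrier (?X U)"
  by (rule tensor_pair.pure_closed[OF tp[OF U(1) U(1)] P.A.one_closed spc[OF U(1) \<rho>c]])
 then have "?p U \<one>\<^bsub>P\<^esub> (sp n U \<rho> ?e) : \<psi> U ` MO U"
  using iso(2)[OF U(1) order_refl] by (simp only: bij_betw_def)
 then obtain a where a: "?p U \<one>\<^bsub>P\<^esub> (sp n U \<rho> ?e) = \<psi> U a" "a : MO U" by (rule imageE)
 have \<psi>a: "\<psi> W (res \<O> U W a) = ?p W \<one>\<^bsub>P\<^esub> (sp n W (restrict \<rho> W) ?e)" if W: "openin T W" "W \<subseteq> U" for W
 proof -
  have "\<psi> W (res \<O> U W a) =
    tensor_map real_alg P (SP n W) id (res (split_sheaf m n \<A>) U W) (?p U \<one>\<^bsub>P\<^esub> (sp n U \<rho> ?e))"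
   unfolding a(1) by (rule \<psi>res[OF W a(2)])
  also have "\<dots> = ?p W \<one>\<^bsub>P\<^esub> (res (split_sheaf m n \<A>) U W (sp n U \<rho> ?e))"
   by (rule tensor_map_P_pure[OF abelian_group_SP[OF U(1)] SP_smult(1)[OF U(1)] abelian_group_SP[OF W(1)] SP_smult(1)[OF W(1)]
     SP_res(1)[OF U(1) W] SP_res_smult[OF U(1) W] P.A.one_closed spc[OF U(1) \<rho>c]])
  also have "\<dots> = ?p W \<one>\<^bsub>P\<^esub> (sp n W (restrict \<rho> W) ?e)"
   by (rule arg_cong[OF SP_res(2)[OF U(1) W \<rho>c ec]])
  finally show ?thesis .
 qed
 have inj: "y = z" if "openin T W" "W \<subseteq> U" "\<psi> W y = \<psi> W z" "y : MO W" "z : MO W" for W y z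
  by (rule inj_onD[OF bij_betw_imp_inj_on[OF iso(2)[OF that(1,2)]] that(3-)])
 have VU: "V \<subseteq> U" using V(3) C(2) by (rule subset_trans)
 have aV: "res \<O> U V a = \<one>\<^bsub>sec \<O> V\<^esub>"
 proof (rule inj[OF V(1) VU _ res_O_closed[OF U(1) V(1) VU a(2)]])
  interpret OV: superring "sec \<O> V" by (rule superring_O[OF V(1)])
  show "\<one>\<^bsub>sec \<O> V\<^esub> : MO V" by simp
  have r: "restrict \<rho> V = \<one>\<^bsub>CI V\<^esub>" unfolding CI_simps by (rule restrict_ext) (rule \<rho>1)
  have o: "\<one>\<^bsub>SP n V\<^esub> = sp n V \<one>\<^bsub>CI V\<^esub> ?e" by (subst SP_tensor(1), rule one_tensor)
  have "\<psi> V \<one>\<^bsub>sec \<O> V\<^esub> = \<one>\<^bsub>?X V\<^esub>"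
   using iso(1)[OF V(1) VU] unfolding algebra_hom_def by (elim conjE) (rule ring_hom_one)
  then show "\<psi> V (res \<O> U V a) = \<psi> V \<one>\<^bsub>sec \<O> V\<^esub>"
   unfolding \<psi>a[OF V(1) VU] r by (simp only: one_tensor o)
 qed
 let ?D = "\<Omega> - C"
 let ?UD = "U \<inter> ?D"
 have D: "openin T ?D" by (rule openin_diff[OF openin_topspace C(1)])
 have UD: "openin T ?UD" "?UD \<subseteq> U" "?UD \<subseteq> ?D" using openin_Int[OF U(1) D] by auto
 have aD: "res \<O> U ?UD a = \<zero>\<^bsub>sec \<O> ?UD\<^esub>"
 proof (rule inj[OF UD(1,2) _ res_O_closed[OF U(1) UD(1,2) a(2)]])
  show "\<zero>\<^bsub>sec \<O> ?UD\<^esub> : MO ?UD"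
   by (rule graded_group.grade_carrier[OF graded_O[OF UD(1)] graded_group.grade_zero[OF graded_O[OF UD(1)]]])
  have r: "restrict \<rho> ?UD = \<zero>\<^bsub>CI ?UD\<^esub>" unfolding CI_simps by (rule restrict_ext) (rule \<rho>0, blast)
  have z: "sp n ?UD \<zero>\<^bsub>CI ?UD\<^esub> ?e = \<zero>\<^bsub>SP n ?UD\<^esub>"
   by (subst SP_tensor(1), rule tensor_pair.pure_zero_left[OF tensor_pair_CI[OF UD(1)] ec])
  have add: "addmap (sec \<O> ?UD) (?X ?UD) (\<psi> ?UD)"
   using iso(1)[OF UD(1,2)] unfolding algebra_hom_def module_hom_def addmap_def by (elim conjE) (intro conjI)
  have "\<psi> ?UD \<zero>\<^bsub>sec \<O> ?UD\<^esub> = \<zero>\<^bsub>?X ?UD\<^esub>"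
   by (rule addmap_zero[OF add abelian_O[OF UD(1)] tensor_pair.abelian_group_tensor[OF tp[OF UD(1) UD(1)]]])
  also have "\<dots> = ?p ?UD \<one>\<^bsub>P\<^esub> \<zero>\<^bsub>SP n ?UD\<^esub>"
   by (rule tensor_pair.pure_zero_right[OF tp[OF UD(1) UD(1)] P.A.one_closed, symmetric])
  finally show "\<psi> ?UD (res \<O> U ?UD a) = \<psi> ?UD \<zero>\<^bsub>sec \<O> ?UD\<^esub>"
   unfolding \<psi>a[OF UD(1,2)] r z by (rule sym)
 qed
 let ?s = "\<lambda>b. if b then a else \<zero>\<^bsub>sec \<O> ?D\<^esub>"
 let ?U = "\<lambda>b. if b then U else ?D"
 have "\<exists>z\<in>MO \<Omega>. \<forall>b\<in>{True, False}. res \<O> \<Omega> (?U b) z = ?s b"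
 proof (rule sheaf_glue[OF sheaf_O])
  show "openin T (?U b)" for b using U(1) D by simp
  show "\<Omega> = (\<Union>b\<in>{True, False}. ?U b)" using C(2) openin_subset[OF U(1)] by auto
  show "?s b : MO (?U b)" for b
   using a(2) graded_group.grade_carrier[OF graded_O[OF D] graded_group.grade_zero[OF graded_O[OF D]]] by simp
  have e: "res \<O> U ?UD a = res \<O> ?D ?UD \<zero>\<^bsub>sec \<O> ?D\<^esub>" unfolding aD by (rule res_O_zero[OF D UD(1,3), symmetric])
  show "res \<O> (?U b) (?U b \<inter> ?U b') (?s b) = res \<O> (?U b') (?U b \<inter> ?U b') (?s b')" for b b'
   using e e[unfolded Int_commute[of U ?D]] by (cases b; cases b') simp_all
 qed
 then obtain z where z: "z : MO \<Omega>" "res \<O> \<Omega> U z = a" "res \<O> \<Omega> ?D z = \<zero>\<^bsub>sec \<O> ?D\<^esub>" by auto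
 \<comment> \<open>Passing to the even component makes the section even at once and keeps the values
   1 on \<open>V\<close> and 0 off \<open>C\<close>, both of which are even.\<close>
 define g where "g = hcomp (sec \<O> \<Omega>) 0 z"
 interpret G: graded_group "sec \<O> \<Omega>" by (rule graded_O[OF openin_topspace])
 have rg: "res \<O> \<Omega> W g = hcomp (sec \<O> W) 0 (res \<O> \<Omega> W z)" if W: "openin T W" for W
  unfolding g_def
  by (rule G.hcomp_commute[OF graded_O[OF W] additive_res_O[OF openin_topspace W openin_subset[OF W]]
     res_O_grade[OF openin_topspace W openin_subset[OF W]] z(1), symmetric])
 have "res \<O> \<Omega> V z = \<one>\<^bsub>sec \<O> V\<^esub>"
  using res_O_res[OF openin_topspace U(1) V(1) VU openin_subset[OF U(1)] z(1)] unfolding z(2) aV by (rule sym)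
 then have 1: "res \<O> \<Omega> V g = \<one>\<^bsub>sec \<O> V\<^esub>"
  unfolding rg[OF V(1)]
  using graded_group.hcomp_grade_same[OF graded_O[OF V(1)] superring.one_even[OF superring_O[OF V(1)]]] by simp
 have 0: "res \<O> \<Omega> ?D g = \<zero>\<^bsub>sec \<O> ?D\<^esub>"
  unfolding rg[OF D] z(3)
  by (rule graded_group.hcomp_grade_same[OF graded_O[OF D] graded_group.grade_zero[OF graded_O[OF D]]])
 have "cutoff T P \<O> E g U C"
  by (intro cutoff.intro sheaf_pair_axioms cutoff_axioms.intro U(1) C 0)
   (simp add: g_def G.hcomp_props(1)[OF z(1)])
 then show ?thesis by (rule that[OF _ U(4) V(1,2) VU 1])
qed

text \<open>Second countability gives the Lindelof property and so a countable cover by sets on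
  which a bump section is 1; the stages of \<open>approx\<close> require the patches to be indexed
  by natural numbers.\<close>

lemma splitting_exists:
 assumes svb: "super_vector_bundle p q T \<O> E"
 shows "\<exists>S. (\<forall>W. openin T W \<longrightarrow> body_splitting P pr (sec \<O> W) (\<kappa> W) (sec E W) (S W)) \<and>
  (\<forall>W W' e. openin T W \<and> openin T W' \<and> W' \<subseteq> W \<and> e : ME W \<longrightarrow>
   res E W W' (S W e) = S W' (res E W W' e))"
proof (cases "\<Omega> = {}")
 \<comment> \<open>Over the empty manifold there is no patch to enumerate. All section modules are
   trivial there, by the sheaf axiom for the empty cover.\<close>
 case True
 have triv: "x = y" if W: "openin T W" and xy: "x : ME W" "y : ME W" for W x y
  by (rule sheaf_eqI[OF sheaf_E, where I = "{}" and U = "\<lambda>_. W" and W = W]) (use True openin_subset[OF W] xy in auto)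
 have "body_splitting P pr (sec \<O> W) (\<kappa> W) (sec E W) (\<lambda>e. e)" if W: "openin T W" for W
 proof (intro body_splitting.intro splitting.intro splitting_axioms.intro body_splitting_axioms.intro
   identified_module_sec[OF W] addmap_id)
  interpret M: supermodule "sec \<O> W" "sec E W" by (rule supermodule_E[OF W])
  show "f \<odot>\<^bsub>sec E W\<^esub> e = tau W f \<odot>\<^bsub>sec E W\<^esub> e" if "f : MO W" "e : ME W" for f e
   by (rule triv[OF W]) (use that M.smult_closed tau_closed[OF W] in simp_all)
  have "e \<ominus>\<^bsub>sec E W\<^esub> e = \<zero>\<^bsub>sec E W\<^esub>" if "e : ME W" for e
   using that by (simp add: a_minus_def M.M.r_neg)
  then show "e \<ominus>\<^bsub>sec E W\<^esub> e : nsp W" if "e : ME W" for e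
   using that by (simp add: nspan.zero)
  show "y i = \<zero>\<^bsub>sec E W\<^esub>" if "y : J \<rightarrow> ME W" "i : J" for y i and J :: "'p set"
   by (rule triv[OF W]) (use that in auto)
 qed
 then show ?thesis by (intro exI[of _ "\<lambda>W e. e"]) simp
next
 case False
 \<comment> \<open>Bundles the data attached to a point, so that they can be chosen one after
   another as functions of the point.\<close>
 define Q where "Q x \<psi> g U C V \<longleftrightarrow> cutoff T P \<O> E g U C \<and> module_sheaf_iso T U \<O> E (free_sheaf p q \<O>) \<psi> \<and>
  openin T V \<and> V \<subseteq> U \<and> x : V \<and> res \<O> \<Omega> V g = \<one>\<^bsub>sec \<O> V\<^esub>" for x \<psi> g U C V
 have "\<forall>x\<in>\<Omega>. \<exists>\<psi> g U C V. Q x \<psi> g U C V"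
 proof
  fix x assume x: "x : \<Omega>"
  obtain U0 \<psi> where U0: "openin T U0" "x : U0" "module_sheaf_iso T U0 \<O> E (free_sheaf p q \<O>) \<psi>"
   using svb x unfolding super_vector_bundle_def by blast
  obtain g U C V where g: "cutoff T P \<O> E g U C" "U \<subseteq> U0" "openin T V" "x : V" "V \<subseteq> U" "res \<O> \<Omega> V g = \<one>\<^bsub>sec \<O> V\<^esub>"
   using U0(1,2) by (rule bump_section)
  have "Q x \<psi> g U C V"
   unfolding Q_def using g module_sheaf_iso_mono[OF U0(3) g(2)] by (intro conjI)
  then show "\<exists>\<psi> g U C V. Q x \<psi> g U C V" by (intro exI)
 qed
 from bchoice[OF this] obtain \<psi> where "\<forall>x\<in>\<Omega>. \<exists>g U C V. Q x (\<psi> x) g U C V" by (rule exE)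
 from bchoice[OF this] obtain g where "\<forall>x\<in>\<Omega>. \<exists>U C V. Q x (\<psi> x) (g x) U C V" by (rule exE)
 from bchoice[OF this] obtain U where "\<forall>x\<in>\<Omega>. \<exists>C V. Q x (\<psi> x) (g x) (U x) C V" by (rule exE)
 from bchoice[OF this] obtain C where "\<forall>x\<in>\<Omega>. \<exists>V. Q x (\<psi> x) (g x) (U x) (C x) V" by (rule exE)
 from bchoice[OF this] obtain V where Q: "\<forall>x\<in>\<Omega>. Q x (\<psi> x) (g x) (U x) (C x) (V x)" by (rule exE)
 have V: "openin T (V x)" "x : V x" if "x : \<Omega>" for x using bspec[OF Q that] by (simp_all add: Q_def)
 have "Lindelof_space T"
  using manifold by (intro second_countable_imp_Lindelof_space) (simp add: smooth_manifold_def)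
 moreover have "(\<forall>D\<in>V ` \<Omega>. openin T D) \<and> \<Union>(V ` \<Omega>) = \<Omega>" using V openin_subset by fast
 ultimately obtain \<V> where \<V>: "countable \<V>" "\<V> \<subseteq> V ` \<Omega>" "\<Union>\<V> = \<Omega>"
  unfolding Lindelof_space_def by meson
 from \<V>(1,2) obtain K where K: "countable K" "K \<subseteq> \<Omega>" "\<V> = V ` K"
  by (meson countable_subset_image)
 have K0: "K \<noteq> {}" using False unfolding \<V>(3)[symmetric] K(3) by blast
 \<comment> \<open>The enumeration may repeat points, as it must for finite \<open>K\<close>;
   \<open>patched_bundle\<close> allows repeated patches.\<close>
 define x where "x = from_nat_into K"
 have rx: "range x = K" unfolding x_def by (rule range_from_nat_into[OF K0 K(1)])
 have xi: "x i : \<Omega>" for i using rx K(2) by auto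
 note Qi = bspec[OF Q xi, unfolded Q_def]
 have cov: "(\<Union>i. V (x i)) = \<Omega>"
 proof -
  have "(\<Union>i. V (x i)) = \<Union>(V ` range x)" by auto
  then show ?thesis unfolding rx K(3)[symmetric] \<V>(3) .
 qed
 interpret S: patched_bundle T P pr \<O> E \<kappa> p q "\<lambda>i. \<psi> (x i)" "\<lambda>i. g (x i)" "\<lambda>i. U (x i)" "\<lambda>i. C (x i)" "\<lambda>i. V (x i)"
  by (intro patched_bundle.intro vector_bundle_axioms patched_bundle_axioms.intro cov) (use Qi in simp_all)
 show ?thesis
  using S.body_splitting_S S.S_res by (intro exI[of _ S.S]) blast
qed

end

theorem theorem2p4:
  fixes P :: "(real, 'p) gmodule" and pr :: "'p \<Rightarrow> real"
    and T :: "'x topology" and \<A> :: "'x chart set"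
    and \<O> :: "('x, 'p, 'o) gsheaf"
    and \<kappa> :: "'x set \<Rightarrow> 'o \<Rightarrow> ('p, (real, 'o) tensor) tensor"
    and E :: "('x, 'o, 'e) gsheaf"
    and m n p q :: nat
  assumes "small_algebra P pr"
    and "supermanifold P m n T \<A> \<O>"
    and "body_identification P pr T \<O> \<kappa>"
    and "super_vector_bundle p q T \<O> E"
  shows "\<exists>\<phi>. svb_iso p q T \<O> (extended_body P pr \<O> \<kappa> E) E \<phi> \<and>
           (\<forall>U. openin T U \<longrightarrow> (\<forall>e\<in>carrier (sec (bundle_body P pr \<O> E) U).
              bundle_body_map P pr \<O> E \<phi> U (body_embed P pr \<O> \<kappa> E U e) = e))"
proof -
  interpret supermanifold_bundle T P pr \<O> E \<kappa> m \<A> n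
  proof (intro supermanifold_bundle.intro vector_bundle.intro sheaf_pair.intro small_alg.intro manifold.intro
      vector_bundle_axioms.intro supermanifold_bundle_axioms.intro assms(1,3))
    show "algebra_sheaf T P \<O>" "smooth_manifold m T \<A>" using assms(2) by (simp_all add: supermanifold_def)
    show "module_sheaf T \<O> E" using assms(4) by (simp add: super_vector_bundle_def)
    show "\<exists>U. openin T U \<and> x \<in> U \<and> (\<exists>\<psi>. algebra_sheaf_iso T U P \<O> (extend_alg P (split_sheaf m n \<A>)) \<psi>)"
      if "x \<in> topspace T" for x
      using assms(2) that by (simp only: supermanifold_def)
  qed
  from splitting_exists[OF assms(4)] obtain S
    where S: "\<forall>W. openin T W \<longrightarrow> body_splitting P pr (sec \<O> W) (\<kappa> W) (sec E W) (S W)"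
      and S_res: "\<forall>W W' e. openin T W \<and> openin T W' \<and> W' \<subseteq> W \<and> e \<in> carrier (sec E W) \<longrightarrow>
        res E W W' (S W e) = S W' (res E W W' e)"
    by (elim exE conjE)
  show ?thesis
    by (rule rigidity_of_splitting[OF assms(4) S[rule_format] S_res[rule_format, OF conjI[OF _ conjI[OF _ conjI]]]])
qed

end
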